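(* Let $M$ be a connected smooth $n$-manifold with universal cover $\widetilde M$, $\rho\colon\pi_1(M)\to\mathrm{Isom}^+(\mathbb H^{n+1})$ a representation, and $G\colon\widetilde M\to\mathcal G(\mathbb H^{n+1})$ a $\rho$-equivariant Lagrangian ($G^*\Omega=0$) and Riemannian ($G^*\mathbb G$ positive definite) embedding. Then the holonomy $\mathrm{hol}_G\colon\pi_1(M)\to\mathbb R$ of the flat principal $\mathbb R$-bundle $\mathrm p_G$ over $M$ is given by $$\mathrm{hol}_G(\alpha)=\int_\alpha\mu_G\qquad\text{for all }\alpha\in\pi_1(M),$$ where $\mu_G\in H^1_{dR}(M)$ is the Maslov class of $G$.
   Context: Hyperboloid model: $\mathbb R^{n+1,1}$ is $\mathbb R^{n+2}$ with $\langle x,y\rangle=\sum_{i=1}^{n+1}x_iy_i-x_{n+2}y_{n+2}$, and $\mathbb H^{n+1}=\{x:\langle x,x\rangle=-1,\ x_{n+2}>0\}$; $T^1\mathbb H^{n+1}=\{(x,v):x\in\mathbb H^{n+1},\langle x,v\rangle=0,\langle v,v\rangle=1\}\subset\mathbb R^{n+1,1}\times\mathbb R^{n+1,1}$. $\mathcal G(\mathbb H^{n+1})$ is the $2n$-manifold of maximal oriented unparametrized geodesics of $\mathbb H^{n+1}$, and $\mathrm p\colon T^1\mathbb H^{n+1}\to\mathcal G(\mathbb H^{n+1})$ sends $(x,v)$ to the oriented geodesic through $x$ with velocity $v$. It is a principal $\mathbb R$-bundle for the geodesic flow $\varphi_t(x,v)=(\cosh(t)x+\sinh(t)v,\sinh(t)x+\cosh(t)v)$,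 whose infinitesimal generator is $\chi_{(x,v)}=(v,x)$. For $w\in T_x\mathbb H^{n+1}$ with $w\perp v$ put $w^{\mathcal H}=(w,0)$, $w^{\mathcal V}=(0,w)$. Then $T_{(x,v)}T^1\mathbb H^{n+1}=\mathrm{Span}(\chi)\oplus\{w^{\mathcal H}\}\oplus\{w^{\mathcal V}\}$. The para-Sasaki metric $g$ makes these three summands mutually orthogonal, with $g(\chi,\chi)=1$, $g(w_1^{\mathcal H},w_2^{\mathcal H})=\langle w_1,w_2\rangle$, $g(w_1^{\mathcal V},w_2^{\mathcal V})=-\langle w_1,w_2\rangle$. On $\chi^\perp$ let $J(w^{\mathcal H})=w^{\mathcal V}$, $J(w^{\mathcal V})=w^{\mathcal H}$. Since $g$ and $J$ are invariant under $\varphi_t$ and $d\mathrm p\colon\chi^\perp_{(x,v)}\to T_{\mathrm p(x,v)}\mathcal G(\mathbb H^{n+1})$ is an isomorphism, $g|_{\chi^\perp}$ and $J$ descend to a pseudo-Riemannian metric $\mathbb G$ of signature $(n,n)$ and a tensor $\mathbb J$ with $\mathbb J^2=\mathrm{id}$; $\Omega(X,Y)=\mathbb G(X,\mathbb JY)$ is a symplectic form. $\mathrm{Isom}^+(\mathbb H^{n+1})$ acts on all these objects, commuting with $\varphi_t$ and $\mathrm p$. $G$ is $\rho$-equivariant if $G\circ\alpha=\rho(\alpha)\circ G$ for all $\alpha\in\pi_1(M)$ (acting by deck transformations). Holonomy: the connection form $\omega=g(\cdot,\chi)$ on $\mathrm p$ has kernel $\chi^\perp$; sections tangent to its kernel are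 called flat. When $G$ is Lagrangian, the pull-back bundle $\widetilde P=G^*T^1\mathbb H^{n+1}\to\widetilde M$ is flat, hence (as $\widetilde M$ is simply connected) trivial: it has a global flat section, i.e. there is $\zeta\colon\widetilde M\to T^1\mathbb H^{n+1}$ with $\mathrm p\circ\zeta=G$ and $d\zeta$ valued in $\chi^\perp$. Using it, $\widetilde P\cong\widetilde M\times\mathbb R$, $(m,s)\leftrightarrow\varphi_s(\zeta(m))$. The group $\pi_1(M)$ acts on $\widetilde P$ by deck transformations on $\widetilde M$ and via $\rho$ on $T^1\mathbb H^{n+1}$; the quotient is the flat principal $\mathbb R$-bundle $\mathrm p_G\colon P\to M$. The action has the form $\alpha\cdot(m,s)=(\alpha\cdot m,\mathrm{hol}_G(\alpha)+s)$, which defines $\mathrm{hol}_G$; equivalently $\varphi_{\mathrm{hol}_G(\alpha)}\circ\zeta\circ\alpha=\rho(\alpha)\circ\zeta$. Maslov class: let $\mathbb D$ be the Levi-Civita connection of $\mathbb G$, $\overline{\mathrm I}=G^*\mathbb G$, $\overline{\mathrm{II}}(V,W)=(\mathbb D_{G_*V}G_*W)^\perp$ (projection to the $\mathbb G$-normal bundle) and $\overline{\mathrm H}=\frac1n\mathrm{tr}_{\overline{\mathrm I}}\overline{\mathrm{II}}$. The 1-form $V\mapsto\Omega(\overline{\mathrm H},dG(V))$ on $\widetilde M$ is closed and $\pi_1(M)$-invariant, and $\mu_G$ is the class in $H^1_{dR}(M)$ of the induced closed 1-form on $M$. $\int_\alpha$ denotes the integral along the loop in $M$ which is the projection of a path in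 $\widetilde M$ from a point $q$ to $\alpha\cdot q$. *)

theory Defs
  imports "HOL-Analysis.Analysis" "HOL-Algebra.Bij"
begin

section \<open>Smooth manifolds\<close>

primrec Ck_on :: "nat \<Rightarrow> 'a::real_normed_vector set \<Rightarrow> ('a \<Rightarrow> 'b::real_normed_vector) \<Rightarrow> bool" where
  "Ck_on 0 S f = continuous_on S f"
| "Ck_on (Suc k) S f =
     ((\<forall>x\<in>S. f differentiable (at x)) \<and> (\<forall>v. Ck_on k S (\<lambda>x. frechet_derivative f (at x) v)))"

text \<open>Only used for open subsets of finite-dimensional spaces.\<close>

definition smooth_on :: "'a::real_normed_vector set \<Rightarrow> ('a \<Rightarrow> 'b::real_normed_vector) \<Rightarrow> bool" where
  "smooth_on S f \<longleftrightarrow> (\<forall>k. Ck_on k S f)"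

definition smooth_within :: "'a::real_normed_vector set \<Rightarrow> ('a \<Rightarrow> 'b::real_normed_vector) \<Rightarrow> bool" where
  "smooth_within S f \<longleftrightarrow>
     (\<forall>x\<in>S. \<exists>U g. open U \<and> x \<in> U \<and> smooth_on U g \<and> (\<forall>y\<in>S \<inter> U. g y = f y))"

text \<open>A chart is a pair of a domain and a coordinate map.\<close>

type_synonym ('a, 'e) chart = "'a set \<times> ('a \<Rightarrow> 'e)"

definition chart_inv :: "('a, 'e) chart \<Rightarrow> 'e \<Rightarrow> 'a" where
  "chart_inv c = inv_into (fst c) (snd c)"

definition smooth_manifold ::
  "'a topology \<Rightarrow> ('a, 'e::euclidean_space) chart set \<Rightarrow> bool" where
  "smooth_manifold X A \<longleftrightarrow>
     Hausdorff_space X \<and> second_countable X \<and> (\<Union>c\<in>A. fst c) = topspace X \<and>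
     (\<forall>c\<in>A. openin X (fst c) \<and> open (snd c ` fst c) \<and>
        homeomorphic_map (subtopology X (fst c)) (top_of_set (snd c ` fst c)) (snd c)) \<and>
     (\<forall>c\<in>A. \<forall>d\<in>A. smooth_on (snd c ` (fst c \<inter> fst d)) (snd d \<circ> chart_inv c))"

definition std_atlas :: "('e, 'e) chart set" where
  "std_atlas = {(UNIV, id)}"

definition smooth_map ::
  "'a topology \<Rightarrow> ('a, 'e::euclidean_space) chart set \<Rightarrow>
   'b topology \<Rightarrow> ('b, 'f::euclidean_space) chart set \<Rightarrow> ('a \<Rightarrow> 'b) \<Rightarrow> bool" where
  "smooth_map X A Y B f \<longleftrightarrow> continuous_map X Y f \<and>
     (\<forall>c\<in>A. \<forall>d\<in>B. smooth_on (snd c ` {p \<in> fst c. f p \<in> fst d}) (snd d \<circ> f \<circ> chart_inv c))"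

text \<open>
  At each point one chart of the atlas is singled out, and the tangent space at that point is
  identified with the model vector space \<open>'e\<close> by means of it. All tangent vectors, forms and
  metrics below are expressed in this identification, so that a vector field is a function
  \<open>'a \<Rightarrow> 'e\<close> and a 1-form is a function \<open>'a \<Rightarrow> 'e \<Rightarrow> real\<close>. The functions need not depend
  continuously on the point; smoothness is always tested in a chart.
\<close>

definition chart_at :: "('a, 'e) chart set \<Rightarrow> 'a \<Rightarrow> ('a, 'e) chart" where
  "chart_at A p = (SOME c. c \<in> A \<and> p \<in> fst c)"

definition tangent_map ::
  "('a, 'e::euclidean_space) chart set \<Rightarrow> ('b, 'f::euclidean_space) chart set \<Rightarrow>
   ('a \<Rightarrow> 'b) \<Rightarrow> 'a \<Rightarrow> 'e \<Rightarrow> 'f" where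
  "tangent_map A B f p =
     frechet_derivative (snd (chart_at B (f p)) \<circ> f \<circ> chart_inv (chart_at A p))
       (at (snd (chart_at A p) p))"

definition smooth_embedding ::
  "'a topology \<Rightarrow> ('a, 'e::euclidean_space) chart set \<Rightarrow>
   'b topology \<Rightarrow> ('b, 'f::euclidean_space) chart set \<Rightarrow> ('a \<Rightarrow> 'b) \<Rightarrow> bool" where
  "smooth_embedding X A Y B f \<longleftrightarrow>
     smooth_map X A Y B f \<and> (\<forall>p\<in>topspace X. inj (tangent_map A B f p)) \<and> embedding_map X Y f"

text \<open>The vector field on the domain of the chart \<open>c\<close> with constant components \<open>w\<close>.\<close>

definition coord_field ::
  "('a, 'e::euclidean_space) chart set \<Rightarrow> ('a, 'e) chart \<Rightarrow> 'e \<Rightarrow> 'a \<Rightarrow> 'e" where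
  "coord_field A c w p = tangent_map std_atlas A (chart_inv c) (snd c p) w"


section \<open>Differential forms of degree one and de Rham classes\<close>

definition form_coord ::
  "('a, 'e::euclidean_space) chart set \<Rightarrow> ('a, 'e) chart \<Rightarrow> ('a \<Rightarrow> 'e \<Rightarrow> real) \<Rightarrow> 'e \<Rightarrow> 'e \<Rightarrow> real" where
  "form_coord A c \<eta> y w = \<eta> (chart_inv c y) (coord_field A c w (chart_inv c y))"

definition smooth_form ::
  "('a, 'e::euclidean_space) chart set \<Rightarrow> ('a \<Rightarrow> 'e \<Rightarrow> real) \<Rightarrow> bool" where
  "smooth_form A \<eta> \<longleftrightarrow> (\<forall>p. linear (\<eta> p)) \<and>
     (\<forall>c\<in>A. \<forall>w. smooth_on (snd c ` fst c) (\<lambda>y. form_coord A c \<eta> y w))"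

definition closed_form ::
  "('a, 'e::euclidean_space) chart set \<Rightarrow> ('a \<Rightarrow> 'e \<Rightarrow> real) \<Rightarrow> bool" where
  "closed_form A \<eta> \<longleftrightarrow> smooth_form A \<eta> \<and>
     (\<forall>c\<in>A. \<forall>y\<in>snd c ` fst c. \<forall>u w.
        frechet_derivative (\<lambda>y. form_coord A c \<eta> y w) (at y) u =
        frechet_derivative (\<lambda>y. form_coord A c \<eta> y u) (at y) w)"

text \<open>
  Two closed forms are related if they differ by the differential of a smooth function; the
  first de Rham group is the set of equivalence classes.
\<close>

definition cohomologous ::
  "('a::topological_space, 'e::euclidean_space) chart set \<Rightarrow> (('a \<Rightarrow> 'e \<Rightarrow> real) \<times> ('a \<Rightarrow> 'e \<Rightarrow> real)) set" where
  "cohomologous A = {(\<eta>, \<theta>). closed_form A \<eta> \<and> closed_form A \<theta> \<and>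
     (\<exists>f :: 'a \<Rightarrow> real. smooth_map euclidean A euclidean std_atlas f \<and>
        (\<forall>p v. \<theta> p v - \<eta> p v = tangent_map A std_atlas f p v))}"

definition de_Rham_H1 ::
  "('a::topological_space, 'e::euclidean_space) chart set \<Rightarrow> ('a \<Rightarrow> 'e \<Rightarrow> real) set set" where
  "de_Rham_H1 A = Collect (closed_form A) // cohomologous A"

definition de_Rham_class ::
  "('a::topological_space, 'e::euclidean_space) chart set \<Rightarrow> ('a \<Rightarrow> 'e \<Rightarrow> real) \<Rightarrow> ('a \<Rightarrow> 'e \<Rightarrow> real) set" where
  "de_Rham_class A \<eta> = cohomologous A `` {\<eta>}"

lemma de_Rham_class_in_H1: "closed_form A \<eta> \<Longrightarrow> de_Rham_class A \<eta> \<in> de_Rham_H1 A"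
  by (simp add: de_Rham_class_def de_Rham_H1_def quotientI)

definition piecewise_C1_path ::
  "('a::topological_space, 'e::euclidean_space) chart set \<Rightarrow> (real \<Rightarrow> 'a) \<Rightarrow> bool" where
  "piecewise_C1_path A \<gamma> \<longleftrightarrow> path \<gamma> \<and>
     (\<exists>S. finite S \<and> (\<forall>c\<in>A. (snd c \<circ> \<gamma>) C1_differentiable_on ({t\<in>{0..1}. \<gamma> t \<in> fst c} - S)))"

definition velocity :: "('a, 'e::euclidean_space) chart set \<Rightarrow> (real \<Rightarrow> 'a) \<Rightarrow> real \<Rightarrow> 'e" where
  "velocity A \<gamma> t = vector_derivative (snd (chart_at A (\<gamma> t)) \<circ> \<gamma>) (at t)"

definition form_integral ::
  "('a, 'e::euclidean_space) chart set \<Rightarrow> (real \<Rightarrow> 'a) \<Rightarrow> ('a \<Rightarrow> 'e \<Rightarrow> real) \<Rightarrow> real" where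
  "form_integral A \<gamma> \<eta> = integral {0..1} (\<lambda>t. \<eta> (\<gamma> t) (velocity A \<gamma> t))"

text \<open>For a loop \<open>\<gamma>\<close>, all representatives of a class have the same integral.\<close>

definition class_integral ::
  "('a, 'e::euclidean_space) chart set \<Rightarrow> (real \<Rightarrow> 'a) \<Rightarrow> ('a \<Rightarrow> 'e \<Rightarrow> real) set \<Rightarrow> real" where
  "class_integral A \<gamma> K = (THE r. \<forall>\<eta>\<in>K. form_integral A \<gamma> \<eta> = r)"


section \<open>Pseudo-Riemannian geometry\<close>

text \<open>A metric assigns to a point a bilinear form on its tangent space.\<close>

definition metric_coord ::
  "('a, 'e::euclidean_space) chart set \<Rightarrow> ('a, 'e) chart \<Rightarrow> ('a \<Rightarrow> 'e \<Rightarrow> 'e \<Rightarrow> real) \<Rightarrow>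
   'e \<Rightarrow> 'e \<Rightarrow> 'e \<Rightarrow> real" where
  "metric_coord A c h y u w =
     h (chart_inv c y) (coord_field A c u (chart_inv c y)) (coord_field A c w (chart_inv c y))"

text \<open>
  For a metric \<open>h\<close> on an open subset of a vector space, the Levi-Civita connection is
  \<open>D\<^sub>u W = \<partial>\<^sub>u W + \<Gamma> u W\<close>, where \<open>\<Gamma>\<close> is determined by the vanishing of
  the torsion and by the compatibility with \<open>h\<close>.
\<close>

definition levi_civita_symbol ::
  "('e::euclidean_space \<Rightarrow> 'e \<Rightarrow> 'e \<Rightarrow> real) \<Rightarrow> 'e \<Rightarrow> 'e \<Rightarrow> 'e \<Rightarrow> 'e" where
  "levi_civita_symbol h y = (THE \<Gamma>. bilinear \<Gamma> \<and> (\<forall>u w. \<Gamma> u w = \<Gamma> w u) \<and>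
     (\<forall>u w z. frechet_derivative (\<lambda>y. h y w z) (at y) u = h y (\<Gamma> u w) z + h y w (\<Gamma> u z)))"

text \<open>
  The covariant derivative at \<open>p\<close>, in the direction \<open>v\<close>, of a vector field \<open>Y\<close> along
  \<open>f\<close> (so \<open>Y q\<close> is tangent at \<open>f q\<close>), for the Levi-Civita connection of the metric \<open>h\<close>
  on the target. It is computed in the chart that identifies the tangent space at \<open>f p\<close>
  with \<open>'f\<close>.
\<close>

definition cov_deriv ::
  "('a, 'e::euclidean_space) chart set \<Rightarrow> ('b, 'f::euclidean_space) chart set \<Rightarrow>
   ('b \<Rightarrow> 'f \<Rightarrow> 'f \<Rightarrow> real) \<Rightarrow> ('a \<Rightarrow> 'b) \<Rightarrow> ('a \<Rightarrow> 'f) \<Rightarrow> 'a \<Rightarrow> 'e \<Rightarrow> 'f" where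
  "cov_deriv A B h f Y p v =
     (let c = chart_at A p; d = chart_at B (f p) in
        frechet_derivative
          (\<lambda>y. tangent_map B std_atlas (snd d) (f (chart_inv c y)) (Y (chart_inv c y)))
          (at (snd c p)) v
        + levi_civita_symbol (metric_coord B d h) (snd d (f p)) (tangent_map A B f p v) (Y p))"

definition normal_part :: "('f \<Rightarrow> 'f \<Rightarrow> real) \<Rightarrow> 'f::real_vector set \<Rightarrow> 'f \<Rightarrow> 'f" where
  "normal_part b T X = (THE N. X - N \<in> T \<and> (\<forall>Y\<in>T. b N Y = 0))"

definition first_ff ::
  "('a, 'e::euclidean_space) chart set \<Rightarrow> ('b, 'f::euclidean_space) chart set \<Rightarrow>
   ('b \<Rightarrow> 'f \<Rightarrow> 'f \<Rightarrow> real) \<Rightarrow> ('a \<Rightarrow> 'b) \<Rightarrow> 'a \<Rightarrow> 'e \<Rightarrow> 'e \<Rightarrow> real" where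
  "first_ff A B h f p v w = h (f p) (tangent_map A B f p v) (tangent_map A B f p w)"

text \<open>
  The second fundamental form is tensorial; the vector \<open>w\<close> is extended to a field
  with constant components in a chart.
\<close>

definition second_ff ::
  "('a, 'e::euclidean_space) chart set \<Rightarrow> ('b, 'f::euclidean_space) chart set \<Rightarrow>
   ('b \<Rightarrow> 'f \<Rightarrow> 'f \<Rightarrow> real) \<Rightarrow> ('a \<Rightarrow> 'b) \<Rightarrow> 'a \<Rightarrow> 'e \<Rightarrow> 'e \<Rightarrow> 'f" where
  "second_ff A B h f p v w =
     normal_part (h (f p)) (range (tangent_map A B f p))
       (cov_deriv A B h f (\<lambda>q. tangent_map A B f q (coord_field A (chart_at A p) w q)) p v)"

text \<open>The trace \<open>g\<^sup>i\<^sup>j b\<^sub>i\<^sub>j\<close> of a vector-valued bilinear form with respect to a metric.\<close>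

definition metric_trace ::
  "(real^'n \<Rightarrow> real^'n \<Rightarrow> real) \<Rightarrow> (real^'n \<Rightarrow> real^'n \<Rightarrow> 'f::real_vector) \<Rightarrow> 'f" where
  "metric_trace g b =
     (\<Sum>i\<in>UNIV. \<Sum>j\<in>UNIV.
        matrix_inv (\<chi> i j. g (axis i 1) (axis j 1)) $ i $ j *\<^sub>R b (axis i 1) (axis j 1))"

definition mean_curvature ::
  "('a, real^'n) chart set \<Rightarrow> ('b, 'f::euclidean_space) chart set \<Rightarrow>
   ('b \<Rightarrow> 'f \<Rightarrow> 'f \<Rightarrow> real) \<Rightarrow> ('a \<Rightarrow> 'b) \<Rightarrow> 'a \<Rightarrow> 'f" where
  "mean_curvature A B h f p =
     (1 / real CARD('n)) *\<^sub>R metric_trace (first_ff A B h f p) (second_ff A B h f p)"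


section \<open>The hyperboloid model\<close>

text \<open>
  With \<open>n = CARD('n)\<close>, the index type \<open>'n option option\<close> has \<open>n + 2\<close> elements, and \<open>None\<close> is
  the index of the timelike coordinate.
\<close>

type_synonym 'n mink = "real^('n option option)"

definition mink :: "('n::finite) mink \<Rightarrow> 'n mink \<Rightarrow> real" where
  "mink x y = (\<Sum>i\<in>UNIV. x $ Some i * y $ Some i) - x $ None * y $ None"

definition hyp :: "('n::finite) mink set" where
  "hyp = {x. mink x x = -1 \<and> x $ None > 0}"

definition hyp_tangent :: "('n::finite) mink \<Rightarrow> 'n mink set" where
  "hyp_tangent x = {w. mink x w = 0}"

definition hyp_dist :: "('n::finite) mink \<Rightarrow> 'n mink \<Rightarrow> real" where
  "hyp_dist x y = arcosh (- mink x y)"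

definition T1hyp :: "('n::finite mink \<times> 'n mink) set" where
  "T1hyp = {(x, v). x \<in> hyp \<and> mink x v = 0 \<and> mink v v = 1}"

definition flow :: "real \<Rightarrow> ('n::finite) mink \<times> 'n mink \<Rightarrow> 'n mink \<times> 'n mink" where
  "flow t z = (cosh t *\<^sub>R fst z + sinh t *\<^sub>R snd z, sinh t *\<^sub>R fst z + cosh t *\<^sub>R snd z)"

definition hyp_diff :: "('n::finite mink \<Rightarrow> 'n mink) \<Rightarrow> 'n mink \<Rightarrow> 'n mink \<Rightarrow> 'n mink" where
  "hyp_diff f x = frechet_derivative f (at x within hyp)"

text \<open>
  The orientation of \<open>hyp\<close>: a basis \<open>b\<close> of the tangent space at \<open>x\<close> is positive if
  \<open>orient x b > 0\<close>.
\<close>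

definition orient :: "('n::finite) mink \<Rightarrow> ('n option \<Rightarrow> 'n mink) \<Rightarrow> real" where
  "orient x b = det (\<chi> i. case i of None \<Rightarrow> x | Some j \<Rightarrow> b j)"

definition orientation_preserving :: "('n::finite mink \<Rightarrow> 'n mink) \<Rightarrow> bool" where
  "orientation_preserving f \<longleftrightarrow>
     (\<forall>x\<in>hyp. \<forall>b. (\<forall>j. b j \<in> hyp_tangent x) \<and> orient x b > 0 \<longrightarrow>
        orient (f x) (\<lambda>j. hyp_diff f x (b j)) > 0)"

definition isom_plus :: "('n::finite mink \<Rightarrow> 'n mink) monoid" where
  "isom_plus = (BijGroup hyp)\<lparr>carrier :=
     {f \<in> Bij hyp. (\<forall>x\<in>hyp. \<forall>y\<in>hyp. hyp_dist (f x) (f y) = hyp_dist x y) \<and>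
        orientation_preserving f}\<rparr>"

definition T1_act ::
  "('n::finite mink \<Rightarrow> 'n mink) \<Rightarrow> 'n mink \<times> 'n mink \<Rightarrow> 'n mink \<times> 'n mink" where
  "T1_act f z = (f (fst z), hyp_diff f (fst z) (snd z))"


section \<open>The para-Sasaki metric\<close>

definition gen :: "('n::finite) mink \<times> 'n mink \<Rightarrow> 'n mink \<times> 'n mink" where
  "gen z = (snd z, fst z)"

definition hor_lift :: "('n::finite) mink \<Rightarrow> 'n mink \<times> 'n mink" where
  "hor_lift w = (w, 0)"

definition ver_lift :: "('n::finite) mink \<Rightarrow> 'n mink \<times> 'n mink" where
  "ver_lift w = (0, w)"

definition perp :: "('n::finite) mink \<times> 'n mink \<Rightarrow> 'n mink set" where
  "perp z = {w. mink (fst z) w = 0 \<and> mink (snd z) w = 0}"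

definition T1_tangent :: "('n::finite) mink \<times> 'n mink \<Rightarrow> ('n mink \<times> 'n mink) set" where
  "T1_tangent z = {a *\<^sub>R gen z + hor_lift w1 + ver_lift w2 | a w1 w2. w1 \<in> perp z \<and> w2 \<in> perp z}"

text \<open>The components of a tangent vector in the decomposition.\<close>

definition gen_comp :: "('n::finite) mink \<times> 'n mink \<Rightarrow> 'n mink \<times> 'n mink \<Rightarrow> real" where
  "gen_comp z \<xi> = mink (snd z) (fst \<xi>)"

definition hor_comp :: "('n::finite) mink \<times> 'n mink \<Rightarrow> 'n mink \<times> 'n mink \<Rightarrow> 'n mink" where
  "hor_comp z \<xi> = fst \<xi> - gen_comp z \<xi> *\<^sub>R snd z"

definition ver_comp :: "('n::finite) mink \<times> 'n mink \<Rightarrow> 'n mink \<times> 'n mink \<Rightarrow> 'n mink" where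
  "ver_comp z \<xi> = snd \<xi> - gen_comp z \<xi> *\<^sub>R fst z"

lemma decomposition:
  fixes a :: real
  assumes "z \<in> T1hyp" "w1 \<in> perp z" "w2 \<in> perp z"
  defines "\<xi> \<equiv> a *\<^sub>R gen z + hor_lift w1 + ver_lift w2"
  shows "gen_comp z \<xi> = a" "hor_comp z \<xi> = w1" "ver_comp z \<xi> = w2"
proof -
  have "mink (snd z) (a *\<^sub>R snd z + w1) = a * mink (snd z) (snd z) + mink (snd z) w1"
    by (simp add: mink_def algebra_simps sum.distrib sum_distrib_left)
  moreover have "mink (snd z) (snd z) = 1" "mink (snd z) w1 = 0"
    using assms by (auto simp: T1hyp_def perp_def)
  ultimately show *: "gen_comp z \<xi> = a"
    by (simp add: gen_comp_def \<xi>_def gen_def hor_lift_def ver_lift_def)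
  show "hor_comp z \<xi> = w1" "ver_comp z \<xi> = w2"
    unfolding hor_comp_def ver_comp_def *
    by (simp_all add: \<xi>_def gen_def hor_lift_def ver_lift_def)
qed

definition para_sasaki ::
  "('n::finite) mink \<times> 'n mink \<Rightarrow> 'n mink \<times> 'n mink \<Rightarrow> 'n mink \<times> 'n mink \<Rightarrow> real" where
  "para_sasaki z \<xi> \<eta> = gen_comp z \<xi> * gen_comp z \<eta>
     + mink (hor_comp z \<xi>) (hor_comp z \<eta>) - mink (ver_comp z \<xi>) (ver_comp z \<eta>)"

text \<open>The orthogonal complement of the generator; the kernel of the connection form.\<close>

definition gen_perp :: "('n::finite) mink \<times> 'n mink \<Rightarrow> ('n mink \<times> 'n mink) set" where
  "gen_perp z = {\<xi> \<in> T1_tangent z. para_sasaki z \<xi> (gen z) = 0}"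

definition para_J ::
  "('n::finite) mink \<times> 'n mink \<Rightarrow> 'n mink \<times> 'n mink \<Rightarrow> 'n mink \<times> 'n mink" where
  "para_J z \<xi> = hor_lift (ver_comp z \<xi>) + ver_lift (hor_comp z \<xi>)"


section \<open>The space of geodesics\<close>

text \<open>
  An oriented geodesic, up to the choice of the origin of a unit speed parametrization, is an
  orbit of the geodesic flow.
\<close>

type_synonym 'n geodesic = "('n mink \<times> 'n mink) set"

definition geod :: "('n::finite) mink \<times> 'n mink \<Rightarrow> 'n geodesic" where
  "geod z = range (\<lambda>t. flow t z)"

definition geodesics :: "('n::finite) geodesic set" where
  "geodesics = geod ` T1hyp"

definition geod_act :: "('n::finite mink \<Rightarrow> 'n mink) \<Rightarrow> 'n geodesic \<Rightarrow> 'n geodesic" where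
  "geod_act f l = T1_act f ` l"

text \<open>The quotient topology.\<close>

definition geod_top :: "('n::finite) geodesic topology" where
  "geod_top = topology (\<lambda>V. V \<subseteq> geodesics \<and> openin (top_of_set T1hyp) {z \<in> T1hyp. geod z \<in> V})"

lemma openin_geod_top:
  fixes V :: "('a::finite) geodesic set"
  shows "openin geod_top V \<longleftrightarrow> V \<subseteq> geodesics \<and> openin (top_of_set T1hyp) {z \<in> T1hyp. geod z \<in> V}"
proof -
  have "istopology (\<lambda>V :: 'a geodesic set. V \<subseteq> geodesics \<and> openin (top_of_set T1hyp) {z \<in> T1hyp. geod z \<in> V})"
    unfolding istopology_def
  proof (intro conjI allI impI)
    fix S T :: "'a geodesic set"
    assume S: "S \<subseteq> geodesics \<and> openin (top_of_set T1hyp) {z \<in> T1hyp. geod z \<in> S}"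
      and T: "T \<subseteq> geodesics \<and> openin (top_of_set T1hyp) {z \<in> T1hyp. geod z \<in> T}"
    then show "S \<inter> T \<subseteq> geodesics" by auto
    have "{z \<in> T1hyp. geod z \<in> S \<inter> T} = {z \<in> T1hyp. geod z \<in> S} \<inter> {z \<in> T1hyp. geod z \<in> T}"
      by auto
    then show "openin (top_of_set T1hyp) {z \<in> T1hyp. geod z \<in> S \<inter> T}"
      using S T by (simp add: openin_Int)
  next
    fix K :: "'a geodesic set set"
    assume K: "\<forall>V\<in>K. V \<subseteq> geodesics \<and> openin (top_of_set T1hyp) {z \<in> T1hyp. geod z \<in> V}"
    then show "\<Union>K \<subseteq> geodesics" by auto
    have "{z \<in> T1hyp. geod z \<in> \<Union>K} = (\<Union>V\<in>K. {z \<in> T1hyp. geod z \<in> V})" by auto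
    then show "openin (top_of_set T1hyp) {z \<in> T1hyp. geod z \<in> \<Union>K}"
      using K by (auto intro!: openin_Union)
  qed
  then show ?thesis by (simp add: geod_top_def topology_inverse')
qed

lemma quotient_map_geod: "quotient_map (top_of_set T1hyp) geod_top geod"
proof -
  have "topspace geod_top = (geodesics :: 'a geodesic set)"
  proof
    show "topspace geod_top \<subseteq> (geodesics :: 'a geodesic set)"
      by (simp add: topspace_def openin_geod_top Sup_le_iff)
    have "{z \<in> T1hyp. geod z \<in> geodesics} = (T1hyp :: ('a mink \<times> 'a mink) set)"
      by (auto simp: geodesics_def)
    then have "openin geod_top (geodesics :: 'a geodesic set)"
      by (simp add: openin_geod_top)
    then show "(geodesics :: 'a geodesic set) \<subseteq> topspace geod_top"
      by (rule openin_subset)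
  qed
  then show ?thesis
    by (auto simp: quotient_map_def openin_geod_top geodesics_def)
qed

text \<open>
  The smooth structure for which \<open>geod\<close> is a submersion: the charts are the coordinate maps
  that pull back to smooth maps on the unit tangent bundle and whose inverse lifts to a smooth
  map into it.
\<close>

definition geod_atlas :: "(('n::finite) geodesic, (real^'n) \<times> (real^'n)) chart set" where
  "geod_atlas = {(V, \<psi>). openin geod_top V \<and> inj_on \<psi> V \<and> open (\<psi> ` V) \<and>
     smooth_within {z \<in> T1hyp. geod z \<in> V} (\<psi> \<circ> geod) \<and>
     (\<exists>s. smooth_on (\<psi> ` V) s \<and>
        (\<forall>y\<in>\<psi> ` V. s y \<in> T1hyp \<and> geod (s y) = inv_into V \<psi> y))}"

definition geod_diff ::
  "('n::finite) mink \<times> 'n mink \<Rightarrow> 'n mink \<times> 'n mink \<Rightarrow> (real^'n) \<times> (real^'n)" where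
  "geod_diff z = frechet_derivative (snd (chart_at geod_atlas (geod z)) \<circ> geod) (at z within T1hyp)"

definition geod_lift ::
  "('n::finite) mink \<times> 'n mink \<Rightarrow> (real^'n) \<times> (real^'n) \<Rightarrow> 'n mink \<times> 'n mink" where
  "geod_lift z = inv_into (gen_perp z) (geod_diff z)"

text \<open>By invariance under the flow, the choice of a point on the geodesic is irrelevant.\<close>

definition geod_point :: "('n::finite) geodesic \<Rightarrow> 'n mink \<times> 'n mink" where
  "geod_point l = (SOME z. z \<in> T1hyp \<and> geod z = l)"

definition geod_metric ::
  "('n::finite) geodesic \<Rightarrow> (real^'n) \<times> (real^'n) \<Rightarrow> (real^'n) \<times> (real^'n) \<Rightarrow> real" where
  "geod_metric l X Y =
     para_sasaki (geod_point l) (geod_lift (geod_point l) X) (geod_lift (geod_point l) Y)"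

definition geod_J ::
  "('n::finite) geodesic \<Rightarrow> (real^'n) \<times> (real^'n) \<Rightarrow> (real^'n) \<times> (real^'n)" where
  "geod_J l X = geod_diff (geod_point l) (para_J (geod_point l) (geod_lift (geod_point l) X))"

definition geod_symp ::
  "('n::finite) geodesic \<Rightarrow> (real^'n) \<times> (real^'n) \<Rightarrow> (real^'n) \<times> (real^'n) \<Rightarrow> real" where
  "geod_symp l X Y = geod_metric l X (geod_J l Y)"


section \<open>Equivariant immersions into the space of geodesics\<close>

definition universal_covering ::
  "('u::topological_space, real^'n) chart set \<Rightarrow> ('m::topological_space, real^'n) chart set \<Rightarrow>
   ('u \<Rightarrow> 'm) \<Rightarrow> bool" where
  "universal_covering A B \<pi> \<longleftrightarrow>
     simply_connected (UNIV :: 'u set) \<and> covering_space UNIV \<pi> UNIV \<and>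
     smooth_map euclidean A euclidean B \<pi> \<and> (\<forall>p. bij (tangent_map A B \<pi> p))"

text \<open>The fundamental group of the base, acting on the universal cover.\<close>

definition deck_group :: "('u::topological_space \<Rightarrow> 'm) \<Rightarrow> ('u \<Rightarrow> 'u) monoid" where
  "deck_group \<pi> = (BijGroup UNIV)\<lparr>carrier :=
     {\<alpha> \<in> Bij UNIV. homeomorphic_map euclidean euclidean \<alpha> \<and> \<pi> \<circ> \<alpha> = \<pi>}\<rparr>"

definition lagrangian :: "('u, real^'n) chart set \<Rightarrow> ('u \<Rightarrow> ('n::finite) geodesic) \<Rightarrow> bool" where
  "lagrangian A G \<longleftrightarrow> (\<forall>p v w.
     geod_symp (G p) (tangent_map A geod_atlas G p v) (tangent_map A geod_atlas G p w) = 0)"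

definition riemannian :: "('u, real^'n) chart set \<Rightarrow> ('u \<Rightarrow> ('n::finite) geodesic) \<Rightarrow> bool" where
  "riemannian A G \<longleftrightarrow> (\<forall>p v. v \<noteq> 0 \<longrightarrow> first_ff A geod_atlas geod_metric G p v v > 0)"

definition equivariant ::
  "('u::topological_space \<Rightarrow> 'm) \<Rightarrow> (('u \<Rightarrow> 'u) \<Rightarrow> 'n mink \<Rightarrow> 'n mink) \<Rightarrow>
   ('u \<Rightarrow> ('n::finite) geodesic) \<Rightarrow> bool" where
  "equivariant \<pi> \<rho> G \<longleftrightarrow> (\<forall>\<alpha>\<in>carrier (deck_group \<pi>). G \<circ> \<alpha> = geod_act (\<rho> \<alpha>) \<circ> G)"

text \<open>
  Global flat sections of the pull-back bundle, the induced trivialization, and the action of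
  the deck group on the pull-back bundle.
\<close>

definition flat_section ::
  "('u::topological_space, real^'n) chart set \<Rightarrow> ('u \<Rightarrow> ('n::finite) geodesic) \<Rightarrow>
   ('u \<Rightarrow> 'n mink \<times> 'n mink) \<Rightarrow> bool" where
  "flat_section A G \<zeta> \<longleftrightarrow> smooth_map euclidean A euclidean std_atlas \<zeta> \<and>
     (\<forall>p. \<zeta> p \<in> T1hyp \<and> geod (\<zeta> p) = G p) \<and>
     (\<forall>p v. tangent_map A std_atlas \<zeta> p v \<in> gen_perp (\<zeta> p))"

definition bundle_triv ::
  "('u \<Rightarrow> ('n::finite) mink \<times> 'n mink) \<Rightarrow> 'u \<times> real \<Rightarrow> 'u \<times> ('n mink \<times> 'n mink)" where
  "bundle_triv \<zeta> = (\<lambda>(p, s). (p, flow s (\<zeta> p)))"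

definition bundle_act ::
  "(('u \<Rightarrow> 'u) \<Rightarrow> ('n::finite) mink \<Rightarrow> 'n mink) \<Rightarrow> ('u \<Rightarrow> 'u) \<Rightarrow>
   'u \<times> ('n mink \<times> 'n mink) \<Rightarrow> 'u \<times> ('n mink \<times> 'n mink)" where
  "bundle_act \<rho> \<alpha> = (\<lambda>(p, z). (\<alpha> p, T1_act (\<rho> \<alpha>) z))"

definition holonomy ::
  "('u::topological_space, real^'n) chart set \<Rightarrow> (('u \<Rightarrow> 'u) \<Rightarrow> 'n mink \<Rightarrow> 'n mink) \<Rightarrow>
   ('u \<Rightarrow> ('n::finite) geodesic) \<Rightarrow> ('u \<Rightarrow> 'u) \<Rightarrow> real" where
  "holonomy A \<rho> G \<alpha> = (THE h. \<exists>\<zeta>. flat_section A G \<zeta> \<and>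
     (\<forall>p s. bundle_act \<rho> \<alpha> (bundle_triv \<zeta> (p, s)) = bundle_triv \<zeta> (\<alpha> p, h + s)))"

definition maslov_form ::
  "('u, real^'n) chart set \<Rightarrow> ('u \<Rightarrow> ('n::finite) geodesic) \<Rightarrow> 'u \<Rightarrow> real^'n \<Rightarrow> real" where
  "maslov_form A G p v =
     geod_symp (G p) (mean_curvature A geod_atlas geod_metric G p) (tangent_map A geod_atlas G p v)"

definition induced_form ::
  "('u, real^'n) chart set \<Rightarrow> ('m, real^'n) chart set \<Rightarrow> ('u \<Rightarrow> 'm) \<Rightarrow>
   ('u \<Rightarrow> real^'n \<Rightarrow> real) \<Rightarrow> 'm \<Rightarrow> real^'n \<Rightarrow> real" where
  "induced_form A B \<pi> \<eta> = (THE \<theta>. \<forall>p v. \<theta> (\<pi> p) (tangent_map A B \<pi> p v) = \<eta> p v)"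

definition maslov_class ::
  "('u, real^'n) chart set \<Rightarrow> ('m::topological_space, real^'n) chart set \<Rightarrow> ('u \<Rightarrow> 'm) \<Rightarrow>
   ('u \<Rightarrow> ('n::finite) geodesic) \<Rightarrow> ('m \<Rightarrow> real^'n \<Rightarrow> real) set" where
  "maslov_class A B \<pi> G = de_Rham_class B (induced_form A B \<pi> (maslov_form A G))"

end

theory Submission
  imports Defs
begin

text \<open>
  Write \<open>P = x + v\<close> and \<open>Q = x - v\<close>; the flow multiplies \<open>P\<close> by \<open>exp t\<close> and
  \<open>Q\<close> by \<open>exp (- t)\<close>. For a flat section \<open>\<zeta>\<close> with components \<open>P\<close>, \<open>Q\<close>,
  the pull-back metric is \<open>\<langle>\<partial>\<^sub>i P, \<partial>\<^sub>j Q\<rangle>\<close>, and the Maslov form turns out to be the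
  differential of
  \<open>F = (ln (det \<langle>\<partial>\<^sub>i P, \<partial>\<^sub>j Q\<rangle>)\<^sup>2 - ln (det \<langle>\<partial>\<^sub>i P, \<partial>\<^sub>j P\<rangle>)\<^sup>2) / (4 n)\<close>.
  This \<open>F\<close> is invariant under isometries and drops by \<open>t\<close> when \<open>\<zeta>\<close> is replaced by
  \<open>flow t \<circ> \<zeta>\<close>. Since \<open>\<rho> \<alpha> \<circ> \<zeta> = flow (hol \<alpha>) \<circ> \<zeta> \<circ> \<alpha>\<close>, it follows that
  \<open>F (\<alpha> p) - F p = hol \<alpha>\<close>, and the left-hand side is the integral of the Maslov form along a
  path from \<open>p\<close> to \<open>\<alpha> p\<close>.
\<close>

section \<open>Calculus of smooth functions\<close>

text \<open>Why \<open>F\<close> is a primitive: let \<open>a\<close> and \<open>b\<close> be the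
  pairings of second derivatives of \<open>P\<close> with first derivatives of \<open>Q\<close>, and
  of second derivatives of \<open>Q\<close> with first derivatives of \<open>P\<close>. The
  logarithm of the first determinant differentiates to the trace of \<open>a + b\<close> in the
  induced metric. The second gives a trace in another Gram matrix, but \<open>dual_basis\<close>
  turns it into twice the trace of \<open>a\<close> in the induced metric. What is left is the trace
  of \<open>b - a\<close>, and \<open>(b - a) / 2\<close> is the symplectic pairing with the second
  fundamental form. This cubic form is totally symmetric because the immersion is Lagrangian, which
  identifies the two possible traces. Up to squares, \<open>F\<close> is \<open>1 / n\<close> times
  the logarithm of the ratio of two volume densities, that of the induced metric and that of the
  metric pulled back by \<open>P\<close> from the light cone; hence it does not depend on charts.
  Two obstacles shape the rest: the Levi-Civita connection must be found for charts of which only a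
  characterization is known, and a global flat section must be built by continuation from local
  ones.\<close>

lemma frechet_derivative_eqI: "(f has_derivative f') (at x) \<Longrightarrow> frechet_derivative f (at x) = f'"
  using frechet_derivative_at by metis

lemma frechet_derivative_cong_open:
  assumes "open S" "x \<in> S" "\<And>y. y \<in> S \<Longrightarrow> f y = g y"
  shows "frechet_derivative f (at x) = frechet_derivative g (at x)"
proof -
  have "(f has_derivative D) (at x) \<longleftrightarrow> (g has_derivative D) (at x)" for D
    using has_derivative_transform_within_open[of f D x UNIV S g]
      has_derivative_transform_within_open[of g D x UNIV S f] assms by auto
  then show ?thesis unfolding frechet_derivative_def by simp
qed

lemma differentiable_cong_open:
  assumes "open S" "x \<in> S" "\<And>y. y \<in> S \<Longrightarrow> f y = g y" "f differentiable (at x)"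
  shows "g differentiable (at x)"
  using assms has_derivative_transform_within_open[of f _ x UNIV S g] unfolding differentiable_def by blast

section \<open>Functions with finitely many continuous derivatives\<close>

lemma Ck_on_subset: "Ck_on k S f \<Longrightarrow> T \<subseteq> S \<Longrightarrow> Ck_on k T f"
  by (induction k arbitrary: f) (auto intro: continuous_on_subset)

lemma Ck_on_cong:
  assumes "open S" "\<And>x. x \<in> S \<Longrightarrow> f x = g x" "Ck_on k S f"
  shows "Ck_on k S g"
  using assms(2,3)
proof (induction k arbitrary: f g)
  case 0 then show ?case using continuous_on_cong by auto
next
  case (Suc k)
  have "Ck_on k S (\<lambda>x. frechet_derivative g (at x) v)" for v
    by (rule Suc.IH[of "\<lambda>x. frechet_derivative f (at x) v"])
      (use Suc.prems frechet_derivative_cong_open[OF assms(1), of _ f g] in auto)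
  then show ?case using Suc.prems differentiable_cong_open[OF assms(1), of _ f g] by auto
qed

lemma Ck_on_SucD: "Ck_on (Suc k) S f \<Longrightarrow> Ck_on k S f"
proof (induction k arbitrary: f)
  case 0 then show ?case
    by (auto simp: continuous_at_imp_continuous_on differentiable_imp_continuous_within)
next
  case (Suc k)
  then have "Ck_on k S (\<lambda>x. frechet_derivative f (at x) v)" for v by (metis Ck_on.simps(2))
  then show ?case using Suc.prems by simp
qed

text \<open>\<open>Ck_on\<close> is phrased through \<open>frechet_derivative\<close>; on an open
  set this rule accepts any explicit derivative instead, and the closure proofs below enter through
  it.\<close>

lemma Ck_on_SucI:
  assumes "open S" "\<And>x. x \<in> S \<Longrightarrow> (f has_derivative f' x) (at x)" "\<And>v. Ck_on k S (\<lambda>x. f' x v)"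
  shows "Ck_on (Suc k) S f"
proof -
  have "Ck_on k S (\<lambda>x. frechet_derivative f (at x) v)" for v
    by (rule Ck_on_cong[OF assms(1) _ assms(3)[of v]]) (simp add: frechet_derivative_eqI[OF assms(2)])
  then show ?thesis using assms(2) by (auto simp: differentiable_def)
qed

lemma Ck_on_has_derivative:
  "Ck_on (Suc k) S f \<Longrightarrow> x \<in> S \<Longrightarrow> (f has_derivative frechet_derivative f (at x)) (at x)"
  using frechet_derivative_works by auto

lemma Ck_on_local:
  assumes "\<And>x. x \<in> S \<Longrightarrow> \<exists>T. open T \<and> x \<in> T \<and> Ck_on k T f"
  shows "Ck_on k S f"
  using assms
proof (induction k arbitrary: f)
  case 0
  have "continuous (at x within S) f" if x: "x \<in> S" for x
  proof -
    obtain T where T: "open T" "x \<in> T" "continuous_on T f" using 0[OF x] by auto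
    then show ?thesis by (meson continuous_at_imp_continuous_at_within continuous_on_eq_continuous_at)
  qed
  then show ?case by (simp add: continuous_on_eq_continuous_within)
next
  case (Suc k)
  have "f differentiable (at x)" if "x \<in> S" for x using Suc.prems[OF that] by auto
  moreover have "Ck_on k S (\<lambda>x. frechet_derivative f (at x) v)" for v
    by (rule Suc.IH) (use Suc.prems in fastforce)
  ultimately show ?case by simp
qed

lemma Ck_on_const: "Ck_on k S (\<lambda>x. c)"
proof (induction k arbitrary: c)
  case (Suc k)
  have "frechet_derivative (\<lambda>x. c) (at x) = (\<lambda>v. 0)" for x :: 'a
    by (rule frechet_derivative_eqI) (auto intro: derivative_eq_intros)
  with Suc show ?case by simp
qed simp

lemma Ck_on_bounded_linear:
  assumes "open S" "bounded_linear h" "Ck_on k S f" shows "Ck_on k S (\<lambda>x. h (f x))"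
  using assms(3)
proof (induction k arbitrary: f)
  case 0 then show ?case using assms(2) by (auto intro: bounded_linear.continuous_on)
next
  case (Suc k)
  show ?case
    by (rule Ck_on_SucI[OF assms(1), where f' = "\<lambda>x v. h (frechet_derivative f (at x) v)"])
      (use Suc bounded_linear.has_derivative[OF assms(2) Ck_on_has_derivative[OF Suc.prems]] in auto)
qed

lemma Ck_on_linear_id: "open S \<Longrightarrow> bounded_linear h \<Longrightarrow> Ck_on k S h"
proof (cases k)
  case (Suc m) assume "open S" and h: "bounded_linear h"
  then show ?thesis unfolding Suc
    by (intro Ck_on_SucI[where f' = "\<lambda>x. h"])
      (auto intro: bounded_linear.has_derivative[OF _ has_derivative_ident] Ck_on_const)
qed (auto intro: linear_continuous_on)

lemma Ck_on_add:
  assumes "open S" shows "Ck_on k S f \<Longrightarrow> Ck_on k S g \<Longrightarrow> Ck_on k S (\<lambda>x. f x + g x)"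
proof (induction k arbitrary: f g)
  case (Suc k)
  show ?case
    by (rule Ck_on_SucI[OF assms, where f' = "\<lambda>x v. frechet_derivative f (at x) v + frechet_derivative g (at x) v"])
      (use Suc has_derivative_add[OF Ck_on_has_derivative[OF Suc.prems(1)] Ck_on_has_derivative[OF Suc.prems(2)]] in auto)
qed (auto intro: continuous_intros)

text \<open>A single Leibniz argument covers scalar multiplication, products of reals, inner
  products and the Minkowski form.\<close>

lemma Ck_on_bilinear:
  assumes "open S" "bounded_bilinear b"
  shows "Ck_on k S f \<Longrightarrow> Ck_on k S g \<Longrightarrow> Ck_on k S (\<lambda>x. b (f x) (g x))"
proof (induction k arbitrary: f g)
  case 0 then show ?case using bounded_bilinear.continuous_on[OF assms(2)] by auto
next
  case (Suc k)
  show ?case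
  proof (rule Ck_on_SucI[OF assms(1), where f' =
        "\<lambda>x v. b (f x) (frechet_derivative g (at x) v) + b (frechet_derivative f (at x) v) (g x)"])
    show "((\<lambda>x. b (f x) (g x)) has_derivative (\<lambda>v. b (f x) (frechet_derivative g (at x) v)
        + b (frechet_derivative f (at x) v) (g x))) (at x)" if "x \<in> S" for x
      using bounded_bilinear.FDERIV[OF assms(2) Ck_on_has_derivative[OF Suc.prems(1) that]
          Ck_on_has_derivative[OF Suc.prems(2) that]] by simp
    show "Ck_on k S (\<lambda>x. b (f x) (frechet_derivative g (at x) v) + b (frechet_derivative f (at x) v) (g x))" for v
      by (intro Ck_on_add[OF assms(1)] Suc.IH Ck_on_SucD[OF Suc.prems(1)] Ck_on_SucD[OF Suc.prems(2)])
        (use Suc.prems in auto)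
  qed
qed

lemma Ck_on_sum:
  assumes "open S" "\<And>i. i \<in> I \<Longrightarrow> Ck_on k S (f i)" shows "Ck_on k S (\<lambda>x. \<Sum>i\<in>I. f i x)"
  using assms(2)
  by (induction I rule: infinite_finite_induct) (auto intro!: Ck_on_const Ck_on_add[OF assms(1)])

lemma linear_euclidean_expand:
  fixes h :: "'a::euclidean_space \<Rightarrow> 'b::real_vector"
  assumes "linear h" shows "h v = (\<Sum>b\<in>Basis. (v \<bullet> b) *\<^sub>R h b)"
proof -
  have "h v = h (\<Sum>b\<in>Basis. (v \<bullet> b) *\<^sub>R b)" by (simp add: euclidean_representation)
  also have "\<dots> = (\<Sum>b\<in>Basis. (v \<bullet> b) *\<^sub>R h b)" using assms by (simp add: linear_sum linear_scale)
  finally show ?thesis .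
qed

lemma Ck_on_compose:
  fixes f :: "'a::real_normed_vector \<Rightarrow> 'b::euclidean_space" and g :: "'b \<Rightarrow> 'c::real_normed_vector"
  assumes "open S" "open T" "\<And>x. x \<in> S \<Longrightarrow> f x \<in> T"
  shows "Ck_on k S f \<Longrightarrow> Ck_on k T g \<Longrightarrow> Ck_on k S (\<lambda>x. g (f x))"
proof (induction k arbitrary: g)
  case 0 then show ?case using continuous_on_compose2[of T g S f] assms(3) by auto
next
  case (Suc k)
  \<comment> \<open>By the chain rule the derivative of \<open>g\<close> is applied to a direction
    that varies with the point. Expansion in a basis leaves derivatives of \<open>g\<close> in fixed
    directions, to which the induction hypothesis applies.\<close>
  define D where "D = (\<lambda>x v. \<Sum>b\<in>Basis. (frechet_derivative f (at x) v \<bullet> b) *\<^sub>R frechet_derivative g (at (f x)) b)"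
  show ?case
  proof (rule Ck_on_SucI[OF assms(1), where f' = D])
    fix x assume x: "x \<in> S"
    have g: "(g has_derivative frechet_derivative g (at (f x))) (at (f x))"
      using Suc.prems(2) assms(3)[OF x] by (rule Ck_on_has_derivative)
    have "D x = (\<lambda>v. frechet_derivative g (at (f x)) (frechet_derivative f (at x) v))"
      unfolding D_def using linear_euclidean_expand[OF has_derivative_linear[OF g]] by metis
    then show "((\<lambda>x. g (f x)) has_derivative D x) (at x)"
      using has_derivative_compose[OF Ck_on_has_derivative[OF Suc.prems(1) x] g] by simp
  next
    fix v
    have "Ck_on k S (\<lambda>x. frechet_derivative g (at (f x)) b)" for b
      using Suc.IH[OF Ck_on_SucD[OF Suc.prems(1)], of "\<lambda>y. frechet_derivative g (at y) b"] Suc.prems(2) by auto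
    moreover have "Ck_on k S (\<lambda>x. frechet_derivative f (at x) v \<bullet> b)" for b
      by (rule Ck_on_bounded_linear[OF assms(1) bounded_linear_inner_left]) (use Suc.prems in auto)
    ultimately show "Ck_on k S (\<lambda>x. D x v)" unfolding D_def
      by (intro Ck_on_sum assms(1) Ck_on_bilinear[OF assms(1) bounded_bilinear_scaleR])
  qed
qed

lemma Ck_on_inverse: "Ck_on k (- {0}) (inverse :: real \<Rightarrow> real)"
proof (induction k)
  case 0 then show ?case by (auto intro!: continuous_intros)
next
  case (Suc k)
  have o: "open (- {0::real})" by auto
  show ?case
  proof (rule Ck_on_SucI[OF o, where f' = "\<lambda>x v. inverse x * (inverse x * (- v))"])
    show "Ck_on k (- {0}) (\<lambda>x::real. inverse x * (inverse x * (- v)))" for v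
      by (intro Ck_on_const Suc Ck_on_bilinear[OF o bounded_bilinear_mult])
  qed (auto intro!: derivative_eq_intros)
qed

lemma Ck_on_exp: "Ck_on k UNIV (exp :: real \<Rightarrow> real)"
proof (induction k)
  case (Suc k)
  show ?case
    by (rule Ck_on_SucI[OF open_UNIV, where f' = "\<lambda>x v. exp x * v"])
     (auto intro!: derivative_eq_intros Ck_on_const Suc Ck_on_bilinear[OF open_UNIV bounded_bilinear_mult])
qed (auto intro!: continuous_intros)

lemma Ck_on_ln: "Ck_on k {0<..} (ln :: real \<Rightarrow> real)"
proof (cases k)
  case (Suc m)
  have o: "open {0::real<..}" by auto
  show ?thesis unfolding Suc
    by (rule Ck_on_SucI[OF o, where f' = "\<lambda>x v. inverse x * v"])
     (auto intro!: derivative_eq_intros Ck_on_const Ck_on_subset[OF Ck_on_inverse] Ck_on_bilinear[OF o bounded_bilinear_mult]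
       simp: divide_inverse)
qed (auto intro!: continuous_intros)

section \<open>Smooth functions\<close>

lemma smooth_on_subset: "smooth_on S f \<Longrightarrow> T \<subseteq> S \<Longrightarrow> smooth_on T f"
  unfolding smooth_on_def by (metis Ck_on_subset)

lemma smooth_on_cong: "smooth_on S f \<Longrightarrow> open S \<Longrightarrow> (\<And>x. x \<in> S \<Longrightarrow> f x = g x) \<Longrightarrow> smooth_on S g"
  unfolding smooth_on_def by (metis Ck_on_cong)

lemma smooth_on_local: "(\<And>x. x \<in> S \<Longrightarrow> \<exists>T. open T \<and> x \<in> T \<and> smooth_on T f) \<Longrightarrow> smooth_on S f"
  unfolding smooth_on_def by (meson Ck_on_local)

lemma smooth_on_SucI:
  assumes "open S" "\<And>x. x \<in> S \<Longrightarrow> (f has_derivative f' x) (at x)" "\<And>v. smooth_on S (\<lambda>x. f' x v)"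
  shows "smooth_on S f"
  unfolding smooth_on_def using Ck_on_SucD[OF Ck_on_SucI[OF assms(1,2)]] assms(3) by (auto simp: smooth_on_def)

lemma smooth_on_has_derivative:
  "smooth_on S f \<Longrightarrow> x \<in> S \<Longrightarrow> (f has_derivative frechet_derivative f (at x)) (at x)"
  unfolding smooth_on_def by (metis Ck_on_has_derivative)

lemma smooth_on_differentiable: "smooth_on S f \<Longrightarrow> x \<in> S \<Longrightarrow> f differentiable (at x)"
  using smooth_on_has_derivative differentiable_def by blast

lemma smooth_on_frechet: "smooth_on S f \<Longrightarrow> smooth_on S (\<lambda>x. frechet_derivative f (at x) v)"
  unfolding smooth_on_def by (metis Ck_on.simps(2))

lemma smooth_on_continuous: "smooth_on S f \<Longrightarrow> continuous_on S f"
  unfolding smooth_on_def by (metis Ck_on.simps(1))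

lemma smooth_on_linear_frechet: "smooth_on S f \<Longrightarrow> x \<in> S \<Longrightarrow> linear (frechet_derivative f (at x))"
  using smooth_on_has_derivative has_derivative_linear by blast

named_theorems smooth_intros

lemma smooth_on_const [smooth_intros]: "smooth_on S (\<lambda>x. c)"
  unfolding smooth_on_def by (simp add: Ck_on_const)

lemma smooth_on_id [smooth_intros]: "open S \<Longrightarrow> smooth_on S (\<lambda>x. x)"
  unfolding smooth_on_def by (simp add: Ck_on_linear_id bounded_linear_ident)

lemma smooth_on_bounded_linear: "bounded_linear h \<Longrightarrow> open S \<Longrightarrow> smooth_on S f \<Longrightarrow> smooth_on S (\<lambda>x. h (f x))"
  unfolding smooth_on_def by (simp add: Ck_on_bounded_linear)

lemma smooth_on_linear:
  fixes h :: "'a::euclidean_space \<Rightarrow> 'b::real_normed_vector"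
  shows "linear h \<Longrightarrow> open S \<Longrightarrow> smooth_on S f \<Longrightarrow> smooth_on S (\<lambda>x. h (f x))"
  by (simp add: linear_conv_bounded_linear smooth_on_bounded_linear)

lemma smooth_on_bilinear:
  "bounded_bilinear b \<Longrightarrow> open S \<Longrightarrow> smooth_on S f \<Longrightarrow> smooth_on S g \<Longrightarrow> smooth_on S (\<lambda>x. b (f x) (g x))"
  unfolding smooth_on_def by (simp add: Ck_on_bilinear)

lemma smooth_on_add [smooth_intros]: "open S \<Longrightarrow> smooth_on S f \<Longrightarrow> smooth_on S g \<Longrightarrow> smooth_on S (\<lambda>x. f x + g x)"
  unfolding smooth_on_def by (simp add: Ck_on_add)

lemma smooth_on_uminus [smooth_intros]: "open S \<Longrightarrow> smooth_on S f \<Longrightarrow> smooth_on S (\<lambda>x. - f x)"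
  by (rule smooth_on_bounded_linear[OF bounded_linear_minus[OF bounded_linear_ident]])

lemma smooth_on_diff [smooth_intros]: "open S \<Longrightarrow> smooth_on S f \<Longrightarrow> smooth_on S g \<Longrightarrow> smooth_on S (\<lambda>x. f x - g x)"
  using smooth_on_add[of S f "\<lambda>x. - g x"] smooth_on_uminus[of S g] by simp

lemmas smooth_on_scaleR [smooth_intros] = smooth_on_bilinear[OF bounded_bilinear_scaleR]
lemmas smooth_on_inner [smooth_intros] = smooth_on_bilinear[OF bounded_bilinear_inner]
lemmas smooth_on_mult [smooth_intros] = smooth_on_bilinear[OF bounded_bilinear_mult]
lemmas smooth_on_fst [smooth_intros] = smooth_on_bounded_linear[OF bounded_linear_fst]
lemmas smooth_on_snd [smooth_intros] = smooth_on_bounded_linear[OF bounded_linear_snd]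
lemmas smooth_on_nth [smooth_intros] = smooth_on_bounded_linear[OF bounded_linear_vec_nth]

lemma smooth_on_sum [smooth_intros]:
  "open S \<Longrightarrow> (\<And>i. i \<in> I \<Longrightarrow> smooth_on S (f i)) \<Longrightarrow> smooth_on S (\<lambda>x. \<Sum>i\<in>I. f i x)"
  unfolding smooth_on_def by (simp add: Ck_on_sum)

lemma smooth_on_prod [smooth_intros]:
  fixes f :: "'i \<Rightarrow> 'a::real_normed_vector \<Rightarrow> real"
  shows "open S \<Longrightarrow> (\<And>i. i \<in> I \<Longrightarrow> smooth_on S (f i)) \<Longrightarrow> smooth_on S (\<lambda>x. \<Prod>i\<in>I. f i x)"
  by (induction I rule: infinite_finite_induct) (auto intro!: smooth_intros)

lemma smooth_on_Pair [smooth_intros]: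
  assumes "open S" "smooth_on S f" "smooth_on S g" shows "smooth_on S (\<lambda>x. (f x, g x))"
proof -
  have "bounded_linear (\<lambda>y::'b. (y, 0::'c))" "bounded_linear (\<lambda>y::'c. (0::'b, y))"
    by (auto intro!: bounded_linear_Pair bounded_linear_ident bounded_linear_zero)
  then have "smooth_on S (\<lambda>x. (f x, 0) + (0, g x))"
    by (intro smooth_on_add assms(1) smooth_on_bounded_linear[where h = "\<lambda>y. (y, 0)"]
        smooth_on_bounded_linear[where h = "\<lambda>y. (0, y)"] assms)
  then show ?thesis by simp
qed

lemma smooth_on_power [smooth_intros]:
  fixes f :: "'a::real_normed_vector \<Rightarrow> real"
  shows "open S \<Longrightarrow> smooth_on S f \<Longrightarrow> smooth_on S (\<lambda>x. f x ^ m)"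
  by (induction m) (auto intro!: smooth_intros)

lemma smooth_on_compose:
  fixes f :: "'a::real_normed_vector \<Rightarrow> 'b::euclidean_space" and g :: "'b \<Rightarrow> 'c::real_normed_vector"
  assumes "smooth_on T g" "open T" "open S" "smooth_on S f" "\<And>x. x \<in> S \<Longrightarrow> f x \<in> T"
  shows "smooth_on S (\<lambda>x. g (f x))"
  using assms Ck_on_compose[of S T f] unfolding smooth_on_def by blast

lemma smooth_on_inverse [smooth_intros]:
  fixes f :: "'a::real_normed_vector \<Rightarrow> real"
  assumes "open S" "smooth_on S f" "\<And>x. x \<in> S \<Longrightarrow> f x \<noteq> 0" shows "smooth_on S (\<lambda>x. inverse (f x))"
  by (rule smooth_on_compose[of "- {0}"]) (use assms Ck_on_inverse in \<open>auto simp: smooth_on_def\<close>)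

lemma smooth_on_divide [smooth_intros]:
  fixes f :: "'a::real_normed_vector \<Rightarrow> real"
  assumes "open S" "smooth_on S f" "smooth_on S g" "\<And>x. x \<in> S \<Longrightarrow> g x \<noteq> 0" shows "smooth_on S (\<lambda>x. f x / g x)"
  unfolding divide_inverse by (intro smooth_intros assms)

lemma smooth_on_exp [smooth_intros]:
  fixes f :: "'a::real_normed_vector \<Rightarrow> real"
  assumes "open S" "smooth_on S f" shows "smooth_on S (\<lambda>x. exp (f x))"
  by (rule smooth_on_compose[of UNIV]) (use assms Ck_on_exp in \<open>auto simp: smooth_on_def\<close>)

lemma smooth_on_ln [smooth_intros]:
  fixes f :: "'a::real_normed_vector \<Rightarrow> real"
  assumes "open S" "smooth_on S f" "\<And>x. x \<in> S \<Longrightarrow> f x > 0" shows "smooth_on S (\<lambda>x. ln (f x))"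
  by (rule smooth_on_compose[of "{0<..}"]) (use assms Ck_on_ln in \<open>auto simp: smooth_on_def\<close>)

lemma smooth_on_vec_lambda [smooth_intros]:
  fixes f :: "'i::finite \<Rightarrow> 'a::real_normed_vector \<Rightarrow> real"
  assumes "open S" "\<And>i. smooth_on S (f i)" shows "smooth_on S (\<lambda>x. \<chi> i. f i x)"
proof -
  have "(\<chi> i. f i x) = (\<Sum>i\<in>UNIV. f i x *\<^sub>R axis i 1)" for x
    by (simp add: vec_eq_iff axis_def if_distrib cong: if_cong)
  then show ?thesis using assms by (simp only:) (intro smooth_intros; auto)
qed

lemma smooth_on_det:
  fixes A :: "'a::real_normed_vector \<Rightarrow> real^'n^'n"
  assumes "open S" "\<And>i j. smooth_on S (\<lambda>x. A x $ i $ j)" shows "smooth_on S (\<lambda>x. det (A x))"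
  unfolding det_def by (intro smooth_intros assms)

lemma smooth_on_frechet' [smooth_intros]:
  assumes "open S" "smooth_on S f" shows "smooth_on S (\<lambda>x. frechet_derivative f (at x) v)"
  using assms smooth_on_frechet by blast

lemma frechet_derivative_compose:
  assumes "f differentiable (at x)" "g differentiable (at (f x))"
  shows "frechet_derivative (\<lambda>x. g (f x)) (at x) = (\<lambda>v. frechet_derivative g (at (f x)) (frechet_derivative f (at x) v))"
  by (rule frechet_derivative_eqI, rule has_derivative_compose)
    (use assms in \<open>auto simp: frechet_derivative_works\<close>)

text \<open>The mean value theorem is applied twice, first along \<open>u\<close> and then along
  \<open>w\<close>. The left-hand side is symmetric in \<open>u\<close> and \<open>w\<close>, which
  is the reason why second derivatives commute.\<close>

lemma mixed_difference:
  fixes f :: "'a::real_normed_vector \<Rightarrow> real"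
  assumes f: "Ck_on 2 S f" and S: "ball x r \<subseteq> S" and t: "0 < t" "t * (norm u + norm w) < r"
  shows "\<exists>y. dist y x \<le> t * (norm u + norm w) \<and>
    f (x + t *\<^sub>R u + t *\<^sub>R w) - f (x + t *\<^sub>R u) - f (x + t *\<^sub>R w) + f x
      = t * t * frechet_derivative (\<lambda>y. frechet_derivative f (at y) u) (at y) w"
proof -
  have f1: "Ck_on 1 S f" "\<And>v. Ck_on 1 S (\<lambda>y. frechet_derivative f (at y) v)"
    using f Ck_on_SucD[of 1 S f] by (auto simp: numeral_2_eq_2)
  have in_ball: "x + a *\<^sub>R u + b *\<^sub>R w \<in> S" "norm (a *\<^sub>R u + b *\<^sub>R w) \<le> t * (norm u + norm w)"
    if "0 \<le> a" "a \<le> t" "0 \<le> b" "b \<le> t" for a b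
  proof -
    have "norm (a *\<^sub>R u + b *\<^sub>R w) \<le> a * norm u + b * norm w"
      using norm_triangle_ineq[of "a *\<^sub>R u" "b *\<^sub>R w"] that by simp
    also have "\<dots> \<le> t * (norm u + norm w)"
      using that by (simp add: distrib_left add_mono mult_right_mono)
    finally show *: "norm (a *\<^sub>R u + b *\<^sub>R w) \<le> t * (norm u + norm w)" .
    moreover have "dist x (x + z) = norm z" for z by (simp add: dist_norm)
    ultimately have "dist x (x + a *\<^sub>R u + b *\<^sub>R w) < r" using t by (metis add.assoc order_le_less_trans)
    then show "x + a *\<^sub>R u + b *\<^sub>R w \<in> S" using S by auto
  qed
  have line: "((\<lambda>s. h (p + s *\<^sub>R v)) has_real_derivative frechet_derivative h (at (p + s *\<^sub>R v)) v) (at s)"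
    if h: "Ck_on 1 S h" and s: "p + s *\<^sub>R v \<in> S" for h :: "'a \<Rightarrow> real" and p v s
  proof -
    have *: "(h has_derivative frechet_derivative h (at (p + s *\<^sub>R v))) (at (p + s *\<^sub>R v))"
      using h s Ck_on_has_derivative[of 0] by simp
    have "((\<lambda>s. p + s *\<^sub>R v) has_derivative (\<lambda>s. s *\<^sub>R v)) (at s)"
      by (auto intro!: derivative_eq_intros)
    from has_derivative_compose[OF this *] show ?thesis
      using linear_scale[OF has_derivative_linear[OF *]]
      by (auto simp: has_field_derivative_def mult.commute elim!: has_derivative_eq_rhs)
  qed
  \<comment> \<open>One difference in direction \<open>w\<close>, viewed as a function of the
    displacement along \<open>u\<close>; the full mixed difference is its increment over the
    interval from 0 to \<open>t\<close>.\<close>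
  define g where "g s = f ((x + t *\<^sub>R w) + s *\<^sub>R u) - f (x + s *\<^sub>R u)" for s
  have "(g has_real_derivative frechet_derivative f (at ((x + t *\<^sub>R w) + s *\<^sub>R u)) u - frechet_derivative f (at (x + s *\<^sub>R u)) u) (at s)"
    if "0 \<le> s" "s \<le> t" for s
    unfolding g_def using in_ball(1)[OF that, of t] in_ball(1)[OF that, of 0] t that
    by (intro DERIV_diff line f1) (auto simp: algebra_simps)
  from MVT2[OF t(1) this] obtain a where a: "0 < a" "a < t" and
    ga: "g t - g 0 = t * (frechet_derivative f (at ((x + t *\<^sub>R w) + a *\<^sub>R u)) u - frechet_derivative f (at (x + a *\<^sub>R u)) u)"
    by auto
  define k where "k s = frechet_derivative f (at ((x + a *\<^sub>R u) + s *\<^sub>R w)) u" for s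
  have "(k has_real_derivative frechet_derivative (\<lambda>y. frechet_derivative f (at y) u) (at ((x + a *\<^sub>R u) + s *\<^sub>R w)) w) (at s)"
    if "0 \<le> s" "s \<le> t" for s
    unfolding k_def using in_ball(1)[of a s] a that by (intro line f1) auto
  from MVT2[OF t(1) this] obtain b where b: "0 < b" "b < t" and
    kb: "k t - k 0 = t * frechet_derivative (\<lambda>y. frechet_derivative f (at y) u) (at ((x + a *\<^sub>R u) + b *\<^sub>R w)) w"
    by auto
  have "f (x + t *\<^sub>R u + t *\<^sub>R w) - f (x + t *\<^sub>R u) - f (x + t *\<^sub>R w) + f x = g t - g 0"
    by (simp add: g_def algebra_simps)
  also have "\<dots> = t * (k t - k 0)" unfolding ga k_def by (simp add: algebra_simps)
  finally show ?thesis unfolding kb using in_ball(2)[of a b] a b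
    by (intro exI[of _ "(x + a *\<^sub>R u) + b *\<^sub>R w"]) (auto simp: dist_norm algebra_simps)
qed

text \<open>Both orders of differentiation express the same mixed difference at points near
  \<open>x\<close>; continuity of the second derivatives then bounds their difference at
  \<open>x\<close> by any positive number.\<close>

lemma symmetric_second_derivative_real:
  fixes f :: "'a::real_normed_vector \<Rightarrow> real"
  assumes f: "Ck_on 2 S f" and S: "open S" "x \<in> S"
  shows "frechet_derivative (\<lambda>y. frechet_derivative f (at y) u) (at x) w =
         frechet_derivative (\<lambda>y. frechet_derivative f (at y) w) (at x) u"
proof -
  define D where "D u w y = frechet_derivative (\<lambda>y. frechet_derivative f (at y) u) (at y) w" for u w y
  have cont: "continuous_on S (D u w)" for u w using f by (auto simp: numeral_2_eq_2 D_def)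
  have "\<bar>D u w x - D w u x\<bar> \<le> e" if "e > 0" for e
  proof -
    have ev: "\<forall>\<^sub>F y in nhds x. \<bar>D u w y - D u w x\<bar> < e / 2" for u w
    proof -
      have "(D u w \<longlongrightarrow> D u w x) (nhds x)"
        using cont S by (simp add: continuous_on_eq_continuous_at isCont_def tendsto_at_iff_tendsto_nhds)
      then show ?thesis using tendstoD[of "D u w" "D u w x" "nhds x" "e/2"] that by (simp add: dist_real_def)
    qed
    have "\<forall>\<^sub>F y in nhds x. y \<in> S" using S by (simp add: eventually_nhds_in_open)
    from eventually_conj[OF this eventually_conj[OF ev[of u w] ev[of w u]]]
    obtain r where r: "r > 0" "\<And>y. dist y x < r \<Longrightarrow> y \<in> S \<and> \<bar>D u w y - D u w x\<bar> < e / 2 \<and> \<bar>D w u y - D w u x\<bar> < e / 2"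
      by (auto simp: eventually_nhds_metric)
    \<comment> \<open>The summand 1 keeps the denominator positive when \<open>u\<close> and
      \<open>w\<close> both vanish.\<close>
    define t where "t = r / (2 * (norm u + norm w + 1))"
    have p: "norm u + norm w + 1 > 0" by (smt (verit) norm_ge_zero)
    have t: "0 < t" using r p by (simp add: t_def)
    have "t * (norm u + norm w) < t * (norm u + norm w + 1)" using t by simp
    also have "\<dots> = r / 2" using p by (simp add: t_def field_simps)
    finally have t2: "t * (norm u + norm w) < r" using r by simp
    have b: "ball x r \<subseteq> S" using r by (auto simp: dist_commute)
    obtain y1 where y1: "dist y1 x \<le> t * (norm u + norm w)"
      "f (x + t *\<^sub>R u + t *\<^sub>R w) - f (x + t *\<^sub>R u) - f (x + t *\<^sub>R w) + f x = t * t * D u w y1"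
      using mixed_difference[OF f b t t2] unfolding D_def by blast
    obtain y2 where y2: "dist y2 x \<le> t * (norm w + norm u)"
      "f (x + t *\<^sub>R w + t *\<^sub>R u) - f (x + t *\<^sub>R w) - f (x + t *\<^sub>R u) + f x = t * t * D w u y2"
      using mixed_difference[OF f b t, of w u] t2 unfolding D_def by (auto simp: add.commute)
    have "t * t * D u w y1 = t * t * D w u y2" using y1(2) y2(2) by (simp add: algebra_simps)
    then have "D u w y1 = D w u y2" using t by simp
    moreover have "\<bar>D u w y1 - D u w x\<bar> < e / 2" "\<bar>D w u y2 - D w u x\<bar> < e / 2"
      using r(2)[of y1] r(2)[of y2] y1(1) y2(1) t2 by (auto simp: add.commute)
    ultimately show ?thesis by linarith
  qed
  then have "\<bar>D u w x - D w u x\<bar> \<le> 0" by (rule field_le_epsilon[where y = 0, simplified])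
  then show ?thesis by (simp add: D_def)
qed

text \<open>Pairing with an arbitrary fixed vector reduces this to real-valued functions.\<close>

lemma symmetric_second_derivative:
  fixes f :: "'a::real_normed_vector \<Rightarrow> 'b::real_inner"
  assumes f: "smooth_on S f" and S: "open S" "x \<in> S"
  shows "frechet_derivative (\<lambda>y. frechet_derivative f (at y) u) (at x) w =
         frechet_derivative (\<lambda>y. frechet_derivative f (at y) w) (at x) u"
proof -
  have "frechet_derivative (\<lambda>y. frechet_derivative f (at y) u) (at x) w \<bullet> b =
         frechet_derivative (\<lambda>y. frechet_derivative f (at y) w) (at x) u \<bullet> b" for b
  proof -
    define h where "h y = f y \<bullet> b" for y
    have h: "smooth_on S h" unfolding h_def by (intro smooth_intros S f)
    have 1: "frechet_derivative h (at y) v = frechet_derivative f (at y) v \<bullet> b" if "y \<in> S" for y v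
      unfolding h_def
      using frechet_derivative_eqI[OF has_derivative_inner_left[OF smooth_on_has_derivative[OF f that]]] by simp
    have 2: "frechet_derivative (\<lambda>y. frechet_derivative h (at y) v) (at x) v' =
        frechet_derivative (\<lambda>y. frechet_derivative f (at y) v) (at x) v' \<bullet> b" for v v'
    proof -
      have "frechet_derivative (\<lambda>y. frechet_derivative f (at y) v \<bullet> b) (at x)
          = (\<lambda>v'. frechet_derivative (\<lambda>y. frechet_derivative f (at y) v) (at x) v' \<bullet> b)"
        by (rule frechet_derivative_eqI, rule has_derivative_inner_left,
            rule smooth_on_has_derivative[OF smooth_on_frechet[OF f] S(2)])
      moreover have "frechet_derivative (\<lambda>y. frechet_derivative h (at y) v) (at x)
          = frechet_derivative (\<lambda>y. frechet_derivative f (at y) v \<bullet> b) (at x)"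
        by (rule frechet_derivative_cong_open[OF S]) (rule 1)
      ultimately show ?thesis by simp
    qed
    have "Ck_on 2 S h" using h by (simp add: smooth_on_def)
    from symmetric_second_derivative_real[OF this S] show ?thesis unfolding 2 .
  qed
  then show ?thesis by (metis vector_eq_rdot)
qed

text \<open>The primitive is the integral of \<open>\<eta>\<close> along the segment from the centre
  \<open>x0\<close> to \<open>y\<close>. It is differentiated under the integral sign, and
  closedness makes the resulting integrand a total derivative in the segment parameter.\<close>

lemma Poincare_lemma:
  fixes \<eta> :: "'a::euclidean_space \<Rightarrow> 'a \<Rightarrow> real" and x0 :: 'a and r :: real
  defines "S \<equiv> ball x0 r"
  assumes lin: "\<And>y. y \<in> S \<Longrightarrow> linear (\<eta> y)" and sm: "\<And>v. smooth_on S (\<lambda>y. \<eta> y v)"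
    and closed: "\<And>y u w. y \<in> S \<Longrightarrow> frechet_derivative (\<lambda>y. \<eta> y w) (at y) u = frechet_derivative (\<lambda>y. \<eta> y u) (at y) w"
  shows "\<exists>f. smooth_on S f \<and> (\<forall>y\<in>S. (f has_derivative \<eta> y) (at y))"
proof -
  have oS: "open S" and cS: "convex S" unfolding S_def by auto
  define z where "z y t = x0 + t *\<^sub>R (y - x0)" for y t
  have zS: "z y t \<in> S" if "y \<in> S" "t \<in> {0..1}" for y t
  proof -
    have "norm (t *\<^sub>R (y - x0)) \<le> norm (y - x0)" using that by (simp add: mult_left_le_one_le)
    then show ?thesis using that(1) by (simp add: S_def z_def dist_norm norm_minus_commute)
  qed
  define D where "D b y = frechet_derivative (\<lambda>y. \<eta> y b) (at y)" for b y
  have D: "((\<lambda>y. \<eta> y b) has_derivative D b y) (at y)" if "y \<in> S" for b y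
    unfolding D_def by (rule smooth_on_has_derivative[OF sm that])
  have lD: "linear (D b y)" if "y \<in> S" for b y using has_derivative_linear[OF D[OF that]] .
  \<comment> \<open>The value of \<open>\<eta>\<close> at the point \<open>z y t\<close> of the
    segment on the vector \<open>y - x0\<close>, written in coordinates so that only components in
    fixed directions need to be differentiated.\<close>
  define f where "f y t = (\<Sum>b\<in>Basis. ((y - x0) \<bullet> b) * \<eta> (z y t) b)" for y t
  define f' where "f' y t v = (\<Sum>b\<in>Basis. ((y - x0) \<bullet> b) * (t * D b (z y t) v) + (v \<bullet> b) * \<eta> (z y t) b)" for y t v
  have der: "((\<lambda>y. f y t) has_derivative f' y t) (at y)" if "y \<in> S" "t \<in> {0..1}" for y t
  proof -
    have "((\<lambda>y. z y t) has_derivative (\<lambda>v. t *\<^sub>R v)) (at y)"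
      unfolding z_def by (auto intro!: derivative_eq_intros)
    from has_derivative_compose[OF this D[OF zS[OF that]]]
    have "((\<lambda>y. \<eta> (z y t) b) has_derivative (\<lambda>v. t * D b (z y t) v)) (at y)" for b
      using linear_scale[OF lD[OF zS[OF that]]] by (auto elim!: has_derivative_eq_rhs)
    then show ?thesis unfolding f_def f'_def
      by (auto intro!: derivative_eq_intros)
  qed
  have bl: "bounded_linear (f' y t)" if "y \<in> S" "t \<in> {0..1}" for y t
    using has_derivative_bounded_linear[OF der[OF that]] .
  have cz: "continuous_on A (\<lambda>p. z (fst p) (snd p))" for A unfolding z_def by (intro continuous_intros)
  have ceta: "continuous_on (S \<times> {0..1}) (\<lambda>p. \<eta> (z (fst p) (snd p)) b)" for b
    by (rule continuous_on_compose2[OF smooth_on_continuous[OF sm] cz]) (auto intro: zS)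
  have cD: "continuous_on (S \<times> {0..1}) (\<lambda>p. D b (z (fst p) (snd p)) v)" for b v
    unfolding D_def
    by (rule continuous_on_compose2[OF smooth_on_continuous[OF smooth_on_frechet[OF sm]] cz]) (auto intro: zS)
  have cf': "continuous_on (S \<times> {0..1}) (\<lambda>p. f' (fst p) (snd p) v)" for v
    unfolding f'_def by (intro continuous_intros ceta cD)
  have cf: "continuous_on (S \<times> {0..1}) (\<lambda>p. f (fst p) (snd p))"
    unfolding f_def by (intro continuous_intros ceta)
  have ct: "continuous_on {0..1} (g y)" if "continuous_on (S \<times> {0..1}) (\<lambda>p. g (fst p) (snd p))" "y \<in> S"
    for g :: "'a \<Rightarrow> real \<Rightarrow> real" and y
  proof -
    have "continuous_on {0..1} (\<lambda>t::real. (y, t))" by (intro continuous_intros)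
    from continuous_on_compose2[OF that(1) this] that(2) show ?thesis by auto
  qed
  define B where "B y t = Blinfun (f' y t)" for y t
  have B: "blinfun_apply (B y t) = f' y t" if "y \<in> S" "t \<in> {0..1}" for y t
    unfolding B_def using bl[OF that] by (rule bounded_linear_Blinfun_apply)
  have cB: "continuous_on (S \<times> cbox 0 1) (\<lambda>(y, t). B y t)"
  proof (rule continuous_on_blinfun_componentwise)
    fix i :: 'a
    have "blinfun_apply (case p of (y, t) \<Rightarrow> B y t) i = f' (fst p) (snd p) i" if "p \<in> S \<times> cbox 0 1" for p
      using that by (auto simp: B)
    then show "continuous_on (S \<times> cbox 0 1) (\<lambda>p. blinfun_apply (case p of (y, t) \<Rightarrow> B y t) i)"
      using cf'[of i] by (subst continuous_on_cong[OF refl]) (auto simp: B)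
  qed
  define F where "F y = integral (cbox 0 1) (f y)" for y
  have F: "(F has_derivative \<eta> y) (at y)" if y: "y \<in> S" for y
  proof -
    have "(F has_derivative integral (cbox 0 1) (B y)) (at y within S)"
      unfolding F_def
    proof (rule leibniz_rule[OF _ _ cB y cS])
      show "((\<lambda>y. f y t) has_derivative blinfun_apply (B y t)) (at y within S)" if "y \<in> S" "t \<in> cbox 0 1" for y t
        using der[of y t] B[of y t] that by (auto intro: has_derivative_at_withinI)
      show "f y integrable_on cbox 0 1" if "y \<in> S" for y
        using ct[OF cf that] by (intro integrable_continuous) auto
    qed
    moreover have "blinfun_apply (integral (cbox 0 1) (B y)) v = \<eta> y v" for v
    proof -
      have "continuous_on (cbox 0 1) (B y)"
      proof -
        have "continuous_on (cbox 0 1) (\<lambda>t::real. (y, t))" by (intro continuous_intros)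
        from continuous_on_compose2[OF cB this] y show ?thesis by auto
      qed
      then have iB: "B y integrable_on cbox 0 1" by (rule integrable_continuous)
      have "blinfun_apply (integral (cbox 0 1) (B y)) v = integral (cbox 0 1) (\<lambda>t. blinfun_apply (B y t) v)"
        using integral_linear[OF iB blinfun.bounded_linear_left[of v]] by (simp add: o_def)
      also have "\<dots> = integral {0..1} (\<lambda>t. f' y t v)"
        unfolding cbox_interval by (rule integral_cong) (use B[OF y] in auto)
      also have "\<dots> = \<eta> y v"
      proof (rule integral_unique)
        \<comment> \<open>The derivative of the integrand in direction \<open>v\<close> is the
          derivative of \<open>t * \<eta> (z y t) v\<close> in \<open>t\<close>; the boundary values
          are 0 at \<open>t = 0\<close> and \<open>\<eta> y v\<close> at
          \<open>t = 1\<close>.\<close>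
        have "((\<lambda>t. t * \<eta> (z y t) v) has_vector_derivative f' y t v) (at t within {0..1})"
          if t: "t \<in> {0..1}" for t
        proof -
          have "((\<lambda>t. z y t) has_derivative (\<lambda>s. s *\<^sub>R (y - x0))) (at t)"
            unfolding z_def by (auto intro!: derivative_eq_intros)
          from has_derivative_compose[OF this D[OF zS[OF y t], of v]]
          have "((\<lambda>t. \<eta> (z y t) v) has_real_derivative D v (z y t) (y - x0)) (at t)"
            using linear_scale[OF lD[OF zS[OF y t]]]
            by (auto simp: has_field_derivative_def mult.commute elim!: has_derivative_eq_rhs)
          then have 1: "((\<lambda>t. t * \<eta> (z y t) v) has_real_derivative (\<eta> (z y t) v + t * D v (z y t) (y - x0))) (at t)"
            by (auto intro!: derivative_eq_intros)
          have "f' y t v = (\<Sum>b\<in>Basis. ((y - x0) \<bullet> b) *\<^sub>R (t * D b (z y t) v)) + (\<Sum>b\<in>Basis. (v \<bullet> b) *\<^sub>R \<eta> (z y t) b)"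
            by (simp add: f'_def sum.distrib)
          also have "(\<Sum>b\<in>Basis. (v \<bullet> b) *\<^sub>R \<eta> (z y t) b) = \<eta> (z y t) v"
            by (rule linear_euclidean_expand[OF lin[OF zS[OF y t]], symmetric])
          \<comment> \<open>Closedness is used here: it exchanges the direction of differentiation
            \<open>v\<close> with the basis vector into which the form is fed.\<close>
          also have "(\<Sum>b\<in>Basis. ((y - x0) \<bullet> b) *\<^sub>R (t * D b (z y t) v)) = t * (\<Sum>b\<in>Basis. ((y - x0) \<bullet> b) *\<^sub>R D v (z y t) b)"
            using closed[OF zS[OF y t]] by (simp add: D_def sum_distrib_left algebra_simps)
          also have "(\<Sum>b\<in>Basis. ((y - x0) \<bullet> b) *\<^sub>R D v (z y t) b) = D v (z y t) (y - x0)"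
            by (rule linear_euclidean_expand[OF lD[OF zS[OF y t]], symmetric])
          finally show ?thesis using 1
            by (simp add: has_real_derivative_iff_has_vector_derivative has_vector_derivative_at_within add.commute)
        qed
        from fundamental_theorem_of_calculus[OF _ this]
        show "((\<lambda>t. f' y t v) has_integral \<eta> y v) {0..1}" by (simp add: z_def)
      qed
      finally show ?thesis .
    qed
    ultimately show ?thesis using at_within_open[OF y oS] by (metis (no_types, lifting) ext)
  qed
  have "smooth_on S F" by (rule smooth_on_SucI[OF oS F sm])
  with F show ?thesis by blast
qed

text \<open>Cramer's rule expresses the inverse through quotients of determinants, which are smooth
  in the entries.\<close>

lemma smooth_on_inverse_linear:
  fixes A :: "'a::real_normed_vector \<Rightarrow> real^'n \<Rightarrow> real^'n::finite"
  assumes "open S" "\<And>x. x \<in> S \<Longrightarrow> linear (A x)" "\<And>x. x \<in> S \<Longrightarrow> bij (A x)"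
    and A: "\<And>v. smooth_on S (\<lambda>x. A x v)"
  shows "smooth_on S (\<lambda>x. inv_into UNIV (A x) v)"
proof -
  define M where "M x = (\<chi> i j. A x (axis j 1) $ i)" for x
  have M: "A x u = M x *v u" if "x \<in> S" for x u
    using matrix_vector_mul(2)[OF assms(2)[OF that]] by (simp add: M_def matrix_def)
  have det: "det (M x) \<noteq> 0" if x: "x \<in> S" for x
  proof -
    have "A x = (*v) (M x)" using M[OF x] by auto
    then have "invertible (M x)" using assms(3)[OF x] by (metis bij_is_inj invertible_left_inverse matrix_left_invertible_injective)
    then show ?thesis by (simp add: invertible_det_nz)
  qed
  define R where "R x = (\<chi> k. det (\<chi> i j. if j = k then v $ i else M x $ i $ j) / det (M x))" for x
  have "inv_into UNIV (A x) v = R x" if x: "x \<in> S" for x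
  proof -
    have "M x *v inv_into UNIV (A x) v = v" using assms(3)[OF x] M[OF x] by (metis bij_inv_eq_iff)
    then show ?thesis using cramer[OF det[OF x]] by (simp add: R_def)
  qed
  moreover have M_smooth: "smooth_on S (\<lambda>x. M x $ i $ j)" for i j
    unfolding M_def using smooth_on_nth[OF assms(1) A] by simp
  have "smooth_on S R" unfolding R_def
  proof (rule smooth_on_vec_lambda[OF assms(1)], rule smooth_on_divide[OF assms(1) _ _ det])
    show "smooth_on S (\<lambda>x. det (M x))" by (rule smooth_on_det[OF assms(1) M_smooth])
    show "smooth_on S (\<lambda>x. det (\<chi> i j. if j = k then v $ i else M x $ i $ j))" for k
    proof (rule smooth_on_det[OF assms(1)])
      show "smooth_on S (\<lambda>x. (\<chi> i j. if j = k then v $ i else M x $ i $ j) $ i $ j)" for i j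
        by (cases "j = k") (simp_all add: smooth_on_const M_smooth)
    qed
  qed
  ultimately show ?thesis using smooth_on_cong[of S R] assms(1) by simp
qed

text \<open>The inverse function theorem yields a differentiable inverse; smoothness follows by
  bootstrapping from the formula for its derivative.\<close>

lemma smooth_local_inverse:
  fixes f :: "real^'n::finite \<Rightarrow> real^'n"
  assumes f: "smooth_on S f" "open S" "x0 \<in> S" and bij: "bij (frechet_derivative f (at x0))"
  obtains U V g where "open U" "x0 \<in> U" "U \<subseteq> S" "open V" "f x0 \<in> V" "homeomorphism U V f g" "smooth_on V g"
proof -
  define D where "D x = frechet_derivative f (at x)" for x
  have D: "(f has_derivative D x) (at x)" if "x \<in> S" for x
    unfolding D_def by (rule smooth_on_has_derivative[OF f(1) that])
  define f' where "f' x = Blinfun (D x)" for x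
  have f': "blinfun_apply (f' x) = D x" if "x \<in> S" for x
    unfolding f'_def using has_derivative_bounded_linear[OF D[OF that]] by (rule bounded_linear_Blinfun_apply)
  have cont: "continuous_on S f'"
  proof (rule continuous_on_blinfun_componentwise)
    show "continuous_on S (\<lambda>x. blinfun_apply (f' x) i)" for i
      using smooth_on_continuous[OF smooth_on_frechet[OF f(1)], of i]
      by (subst continuous_on_cong[OF refl]) (auto simp: f' D_def)
  qed
  define iD where "iD = inv_into UNIV (D x0)"
  have lin: "linear (D x0)" using has_derivative_linear[OF D[OF f(3)]] .
  have "linear iD" unfolding iD_def using lin bij by (simp add: D_def bij_is_inj inj_linear_imp_inv_linear)
  then have "bounded_linear iD" by (simp add: linear_conv_bounded_linear)
  then have "Blinfun iD o\<^sub>L f' x0 = id_blinfun"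
    using bij by (intro blinfun_eqI) (auto simp: bounded_linear_Blinfun_apply f' f(3) iD_def D_def bij_is_inj)
  from inverse_function_theorem[OF f(2) _ cont f(3) this] D f'
  obtain U V g g' where U: "open U" "U \<subseteq> S" "x0 \<in> U" "open V" "f x0 \<in> V" "homeomorphism U V f g"
    and g: "\<And>y. y \<in> V \<Longrightarrow> (g has_derivative (g' y)) (at y)" "\<And>y. y \<in> V \<Longrightarrow> g' y = inv_into UNIV (f'(g y))"
      "\<And>y. y \<in> V \<Longrightarrow> bij (f'(g y))" by (metis (no_types, lifting))
  have gU: "g y \<in> U" if "y \<in> V" for y using U(6) that by (auto simp: homeomorphism_def)
  have bU: "bij (D x)" if "x \<in> U" for x
    using g(3)[of "f x"] U(2,6) that f'[of x] by (auto simp: homeomorphism_def)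
  have sm: "smooth_on U (\<lambda>x. inv_into UNIV (D x) v)" for v
    by (rule smooth_on_inverse_linear[OF U(1)])
      (use U(2) bU smooth_on_linear_frechet[OF f(1)] smooth_on_subset[OF smooth_on_frechet[OF f(1)] U(2)] in \<open>auto simp: D_def\<close>)
  \<comment> \<open>The derivative of \<open>g\<close> at \<open>y\<close> is the inverse of the
    derivative of \<open>f\<close> at \<open>g y\<close>. If \<open>g\<close> is of class
    \<open>k\<close>, so is this expression, and therefore \<open>g\<close> is of class
    \<open>k + 1\<close>.\<close>
  have "Ck_on k V g" for k
  proof (induction k)
    case 0 then show ?case using U(6) by (simp add: homeomorphism_def)
  next
    case (Suc k)
    show ?case
    proof (rule Ck_on_SucI[OF U(4) g(1)])
      fix v
      have "Ck_on k V (\<lambda>y. inv_into UNIV (D (g y)) v)"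
        by (rule Ck_on_compose[OF U(4,1) gU Suc]) (use sm in \<open>auto simp: smooth_on_def\<close>)
      then show "Ck_on k V (\<lambda>y. g' y v)"
        by (rule Ck_on_cong[OF U(4), rotated]) (simp add: g(2) f' subsetD[OF U(2) gU])
    qed
  qed
  then have "smooth_on V g" by (simp add: smooth_on_def)
  with that U show ?thesis by blast
qed

section \<open>Charts and tangent maps\<close>

text \<open>
  The properties of an atlas on which the functoriality of \<open>tangent_map\<close> rests. They hold for
  the atlas of a manifold, for \<open>std_atlas\<close> and for \<open>geod_atlas\<close>.
\<close>

definition chart_atlas :: "'a topology \<Rightarrow> ('a, 'e::euclidean_space) chart set \<Rightarrow> bool" where
  "chart_atlas X A \<longleftrightarrow> (\<forall>p\<in>topspace X. \<exists>c\<in>A. p \<in> fst c) \<and>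
     (\<forall>c\<in>A. openin X (fst c) \<and> inj_on (snd c) (fst c) \<and>
        (\<forall>V. openin X V \<longrightarrow> open (snd c ` (V \<inter> fst c))) \<and>
        (\<forall>T. open T \<longrightarrow> openin X {p\<in>fst c. snd c p \<in> T})) \<and>
     (\<forall>c\<in>A. \<forall>d\<in>A. smooth_on (snd c ` (fst c \<inter> fst d)) (snd d \<circ> chart_inv c))"

text \<open>Smoothness on an open subset only: charts, their inverses and local flat sections are
  controlled on their domains and have arbitrary values elsewhere.\<close>

definition smooth_map_on ::
  "'a topology \<Rightarrow> ('a, 'e::euclidean_space) chart set \<Rightarrow>
   'b topology \<Rightarrow> ('b, 'f::euclidean_space) chart set \<Rightarrow> 'a set \<Rightarrow> ('a \<Rightarrow> 'b) \<Rightarrow> bool" where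
  "smooth_map_on X A Y B W f \<longleftrightarrow> openin X W \<and> f ` W \<subseteq> topspace Y \<and>
     (\<forall>V. openin Y V \<longrightarrow> openin X {p\<in>W. f p \<in> V}) \<and>
     (\<forall>c\<in>A. \<forall>d\<in>B. smooth_on (snd c ` {p \<in> W \<inter> fst c. f p \<in> fst d}) (snd d \<circ> f \<circ> chart_inv c))"

lemma chart_atlasD:
  assumes "chart_atlas X A" "c \<in> A"
  shows "openin X (fst c)" "inj_on (snd c) (fst c)" "openin X V \<Longrightarrow> open (snd c ` (V \<inter> fst c))"
    "open T \<Longrightarrow> openin X {p\<in>fst c. snd c p \<in> T}"
    "d \<in> A \<Longrightarrow> smooth_on (snd c ` (fst c \<inter> fst d)) (snd d \<circ> chart_inv c)"
    "open (snd c ` fst c)"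
proof -
  show *: "openin X (fst c)" "inj_on (snd c) (fst c)" "openin X V \<Longrightarrow> open (snd c ` (V \<inter> fst c))" for V
    using assms by (auto simp: chart_atlas_def)
  show "open T \<Longrightarrow> openin X {p\<in>fst c. snd c p \<in> T}" 
    "d \<in> A \<Longrightarrow> smooth_on (snd c ` (fst c \<inter> fst d)) (snd d \<circ> chart_inv c)"
    using assms by (auto simp: chart_atlas_def)
  show "open (snd c ` fst c)" using *(3)[OF *(1)] by simp
qed

lemma chart_at:
  assumes "chart_atlas X A" "p \<in> topspace X"
  shows "chart_at A p \<in> A" "p \<in> fst (chart_at A p)"
proof -
  have "\<exists>c. c \<in> A \<and> p \<in> fst c" using assms unfolding chart_atlas_def by blast
  then have "chart_at A p \<in> A \<and> p \<in> fst (chart_at A p)" unfolding chart_at_def by (rule someI_ex)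
  then show "chart_at A p \<in> A" "p \<in> fst (chart_at A p)" by auto
qed

lemma chart_inv:
  assumes "chart_atlas X A" "c \<in> A"
  shows "p \<in> fst c \<Longrightarrow> chart_inv c (snd c p) = p"
    "y \<in> snd c ` fst c \<Longrightarrow> chart_inv c y \<in> fst c" "y \<in> snd c ` fst c \<Longrightarrow> snd c (chart_inv c y) = y"
  using chart_atlasD(2)[OF assms]
  by (auto simp: chart_inv_def inv_into_into f_inv_into_f)

lemma smooth_map_onD:
  assumes "smooth_map_on X A Y B W f"
  shows "openin X W" "p \<in> W \<Longrightarrow> f p \<in> topspace Y" "openin Y V \<Longrightarrow> openin X {p\<in>W. f p \<in> V}"
    "c \<in> A \<Longrightarrow> d \<in> B \<Longrightarrow> smooth_on (snd c ` {p \<in> W \<inter> fst c. f p \<in> fst d}) (snd d \<circ> f \<circ> chart_inv c)"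
  using assms by (auto simp: smooth_map_on_def)

lemma smooth_map_on_domain:
  assumes "chart_atlas X A" "chart_atlas Y B" "c \<in> A" "d \<in> B" "smooth_map_on X A Y B W f"
  shows "open (snd c ` {p \<in> W \<inter> fst c. f p \<in> fst d})"
proof -
  have "{p \<in> W \<inter> fst c. f p \<in> fst d} = {p\<in>W. f p \<in> fst d} \<inter> fst c" by auto
  then show ?thesis using chart_atlasD(3)[OF assms(1,3)] smooth_map_onD(3)[OF assms(5) chart_atlasD(1)[OF assms(2,4)]]
    by simp
qed

lemma smooth_map_on_subset:
  assumes "smooth_map_on X A Y B W f" "openin X W'" "W' \<subseteq> W"
  shows "smooth_map_on X A Y B W' f"
proof -
  have "openin X {p\<in>W'. f p \<in> V}" if "openin Y V" for V
  proof -
    have "{p\<in>W'. f p \<in> V} = {p\<in>W. f p \<in> V} \<inter> W'" using assms(3) by auto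
    then show ?thesis using openin_Int[OF smooth_map_onD(3)[OF assms(1) that] assms(2)] by simp
  qed
  moreover have "smooth_on (snd c ` {p \<in> W' \<inter> fst c. f p \<in> fst d}) (snd d \<circ> f \<circ> chart_inv c)"
    if "c \<in> A" "d \<in> B" for c d
    by (rule smooth_on_subset[OF smooth_map_onD(4)[OF assms(1) that]]) (use assms(3) in auto)
  moreover have "f ` W' \<subseteq> topspace Y" using assms(1,3) by (auto simp: smooth_map_on_def)
  ultimately show ?thesis using assms(2) unfolding smooth_map_on_def by blast
qed

lemma smooth_map_on_if_smooth_map:
  assumes "smooth_map X A Y B f" "chart_atlas X A"
  shows "smooth_map_on X A Y B (topspace X) f"
proof -
  have "topspace X \<inter> fst c = fst c" if "c \<in> A" for c
    using chart_atlasD(1)[OF assms(2) that] openin_subset by blast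
  then show ?thesis using assms(1) by (auto simp: smooth_map_on_def smooth_map_def continuous_map_def)
qed

lemma smooth_map_if_smooth_map_on:
  assumes "smooth_map_on X A Y B (topspace X) f" "chart_atlas X A"
  shows "smooth_map X A Y B f"
proof -
  have "topspace X \<inter> fst c = fst c" if "c \<in> A" for c
    using chart_atlasD(1)[OF assms(2) that] openin_subset by blast
  then show ?thesis using assms(1) by (auto simp: smooth_map_on_def smooth_map_def continuous_map_def)
qed

text \<open>One pair of charts around each point is enough: transition maps on both sides carry
  smoothness over to every other pair, and continuity follows from continuity of the coordinate
  expressions.\<close>

lemma smooth_map_onI:
  assumes A: "chart_atlas X A" and B: "chart_atlas Y B" and W: "openin X W"
    and loc: "\<And>p. p \<in> W \<Longrightarrow> \<exists>c\<in>A. \<exists>d\<in>B. \<exists>T. open T \<and> p \<in> fst c \<and> snd c p \<in> T \<and> T \<subseteq> snd c ` (W \<inter> fst c) \<and>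
       (\<forall>y\<in>T. f (chart_inv c y) \<in> fst d) \<and> smooth_on T (snd d \<circ> f \<circ> chart_inv c)"
  shows "smooth_map_on X A Y B W f"
  unfolding smooth_map_on_def
proof (intro conjI allI impI ballI)
  show "f ` W \<subseteq> topspace Y"
  proof clarify
    fix p assume p: "p \<in> W"
    from loc[OF p] obtain c d T where *: "c \<in> A" "d \<in> B" "p \<in> fst c" "snd c p \<in> T" "\<forall>y\<in>T. f (chart_inv c y) \<in> fst d"
      by blast
    then have "f p \<in> fst d" using chart_inv(1)[OF A, of c p] by auto
    then show "f p \<in> topspace Y" using chart_atlasD(1)[OF B *(2)] openin_subset by blast
  qed
next
  fix V assume V: "openin Y V"
  show "openin X {p\<in>W. f p \<in> V}"
  proof (subst openin_subopen, clarify)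
    fix p assume p: "p \<in> W" "f p \<in> V"
    from loc[OF p(1)] obtain c d T where *: "c \<in> A" "d \<in> B" "p \<in> fst c" "open T" "snd c p \<in> T"
      "T \<subseteq> snd c ` (W \<inter> fst c)" "\<forall>y\<in>T. f (chart_inv c y) \<in> fst d" "smooth_on T (snd d \<circ> f \<circ> chart_inv c)" by blast
    \<comment> \<open>Inside the chart the condition that \<open>f\<close> takes a value in
      \<open>V\<close> becomes the condition that a continuous coordinate expression takes a value
      in an open set.\<close>
    define T' where "T' = {y\<in>T. (snd d \<circ> f \<circ> chart_inv c) y \<in> snd d ` (V \<inter> fst d)}"
    have "open T'" unfolding T'_def
      using continuous_open_preimage[OF smooth_on_continuous[OF *(8)] *(4) chart_atlasD(3)[OF B *(2) V]]
      by (simp add: vimage_def Int_def)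
    define U where "U = {q\<in>fst c. snd c q \<in> T'}"
    have "openin X U" unfolding U_def by (rule chart_atlasD(4)[OF A *(1) \<open>open T'\<close>])
    moreover have "p \<in> U" using * p chart_inv(1)[OF A *(1,3)] by (auto simp: U_def T'_def)
    moreover have "U \<subseteq> {p\<in>W. f p \<in> V}"
    proof
      fix q assume q: "q \<in> U"
      then have q2: "q \<in> fst c" "snd c q \<in> T" "snd d (f q) \<in> snd d ` (V \<inter> fst d)"
        using chart_inv(1)[OF A *(1)] by (auto simp: U_def T'_def)
      have "f q \<in> fst d" using *(7) q2 chart_inv(1)[OF A *(1) q2(1)] by auto
      then have "f q \<in> V" using q2(3) chart_atlasD(2)[OF B *(2)] by (auto dest: inj_onD)
      moreover have "q \<in> W" using q2 *(6) chart_atlasD(2)[OF A *(1)] by (auto dest: inj_onD)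
      ultimately show "q \<in> {p\<in>W. f p \<in> V}" by simp
    qed
    ultimately show "\<exists>T. openin X T \<and> p \<in> T \<and> T \<subseteq> {p \<in> W. f p \<in> V}" by blast
  qed
next
  fix c' d' assume c': "c' \<in> A" and d': "d' \<in> B"
  show "smooth_on (snd c' ` {p \<in> W \<inter> fst c'. f p \<in> fst d'}) (snd d' \<circ> f \<circ> chart_inv c')"
  proof (rule smooth_on_local, clarify)
    fix p assume p: "p \<in> W" "p \<in> fst c'" "f p \<in> fst d'"
    from loc[OF p(1)] obtain c d T where *: "c \<in> A" "d \<in> B" "p \<in> fst c" "open T" "snd c p \<in> T"
      "T \<subseteq> snd c ` (W \<inter> fst c)" "\<forall>y\<in>T. f (chart_inv c y) \<in> fst d" "smooth_on T (snd d \<circ> f \<circ> chart_inv c)" by blast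
    define R where "R = snd d ` (fst d' \<inter> fst d)"
    have R: "open R" unfolding R_def by (rule chart_atlasD(3)[OF B *(2) chart_atlasD(1)[OF B d']])
    define T1 where "T1 = {y\<in>T. (snd d \<circ> f \<circ> chart_inv c) y \<in> R}"
    have T1: "open T1" unfolding T1_def
      using continuous_open_preimage[OF smooth_on_continuous[OF *(8)] *(4) R] by (simp add: vimage_def Int_def)
    define Q where "Q = snd c' ` (fst c \<inter> fst c')"
    have Q: "open Q" unfolding Q_def by (rule chart_atlasD(3)[OF A c' chart_atlasD(1)[OF A *(1)]])
    have tr: "smooth_on Q (snd c \<circ> chart_inv c')" using chart_atlasD(5)[OF A c' *(1)] by (simp add: Q_def Int_commute)
    define Q1 where "Q1 = {y\<in>Q. (snd c \<circ> chart_inv c') y \<in> T1}"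
    have Q1: "open Q1" unfolding Q1_def
      using continuous_open_preimage[OF smooth_on_continuous[OF tr] Q T1] by (simp add: vimage_def Int_def)
    have in1: "snd c' p \<in> Q1"
      using p * chart_inv(1)[OF A *(1,3)] chart_inv(1)[OF A c' p(2)] by (auto simp: Q1_def Q_def T1_def R_def)
    have trd: "smooth_on R (snd d' \<circ> chart_inv d)" using chart_atlasD(5)[OF B *(2) d'] by (simp add: R_def Int_commute)
    have 1: "smooth_on Q1 (\<lambda>y. (snd d \<circ> f \<circ> chart_inv c) ((snd c \<circ> chart_inv c') y))"
      by (rule smooth_on_compose[OF smooth_on_subset[OF *(8)] T1 Q1 smooth_on_subset[OF tr]])
        (auto simp: Q1_def T1_def)
    \<comment> \<open>In the charts \<open>c'\<close> and \<open>d'\<close> the map is the known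
      expression in \<open>c\<close> and \<open>d\<close>, conjugated by two transition
      maps.\<close>
    have "smooth_on Q1 (\<lambda>y. (snd d' \<circ> chart_inv d) ((snd d \<circ> f \<circ> chart_inv c) ((snd c \<circ> chart_inv c') y)))"
      by (rule smooth_on_compose[OF trd R Q1 1]) (auto simp: Q1_def T1_def)
    then have "smooth_on Q1 (snd d' \<circ> f \<circ> chart_inv c')"
    proof (rule smooth_on_cong[OF _ Q1])
      fix y assume y: "y \<in> Q1"
      then obtain q where q: "q \<in> fst c" "q \<in> fst c'" "y = snd c' q" by (auto simp: Q1_def Q_def)
      have "f q \<in> fst d" using *(7) y q chart_inv(1)[OF A *(1) q(1)] chart_inv(1)[OF A c' q(2)] by (auto simp: Q1_def T1_def)
      then show "(snd d' \<circ> chart_inv d) ((snd d \<circ> f \<circ> chart_inv c) ((snd c \<circ> chart_inv c') y)) = (snd d' \<circ> f \<circ> chart_inv c') y"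
        using q chart_inv(1)[OF A *(1)] chart_inv(1)[OF A c'] chart_inv(1)[OF B *(2)] by simp
    qed
    then show "\<exists>T. open T \<and> snd c' p \<in> T \<and> smooth_on T (snd d' \<circ> f \<circ> chart_inv c')" using Q1 in1 by blast
  qed
qed (rule W)

lemma smooth_map_on_compose:
  assumes A: "chart_atlas X A" and B: "chart_atlas Y B" and C: "chart_atlas Z C"
    and f: "smooth_map_on X A Y B W f" and g: "smooth_map_on Y B Z C W' g" and sub: "f ` W \<subseteq> W'"
  shows "smooth_map_on X A Z C W (\<lambda>p. g (f p))"
proof (rule smooth_map_onI[OF A C smooth_map_onD(1)[OF f]])
  fix p assume p: "p \<in> W"
  have tp: "p \<in> topspace X" using p smooth_map_onD(1)[OF f] openin_subset by blast
  have fp: "f p \<in> W'" "f p \<in> topspace Y" "g (f p) \<in> topspace Z"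
    using p sub smooth_map_onD(2)[OF f] smooth_map_onD(2)[OF g] by auto
  define c d e where "c = chart_at A p" and "d = chart_at B (f p)" and "e = chart_at C (g (f p))"
  have c: "c \<in> A" "p \<in> fst c" and d: "d \<in> B" "f p \<in> fst d" and e: "e \<in> C" "g (f p) \<in> fst e"
    using chart_at[OF A tp] chart_at[OF B fp(2)] chart_at[OF C fp(3)] by (auto simp: c_def d_def e_def)
  define S where "S = snd d ` {q \<in> W' \<inter> fst d. g q \<in> fst e}"
  have S: "open S" unfolding S_def by (rule smooth_map_on_domain[OF B C d(1) e(1) g])
  define R where "R = snd c ` {q \<in> W \<inter> fst c. f q \<in> fst d}"
  have R: "open R" unfolding R_def by (rule smooth_map_on_domain[OF A B c(1) d(1) f])
  have sf: "smooth_on R (snd d \<circ> f \<circ> chart_inv c)" unfolding R_def by (rule smooth_map_onD(4)[OF f c(1) d(1)])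
  have sg: "smooth_on S (snd e \<circ> g \<circ> chart_inv d)" unfolding S_def by (rule smooth_map_onD(4)[OF g d(1) e(1)])
  define T where "T = {y\<in>R. (snd d \<circ> f \<circ> chart_inv c) y \<in> S}"
  have T: "open T" unfolding T_def
    using continuous_open_preimage[OF smooth_on_continuous[OF sf] R S] by (simp add: vimage_def Int_def)
  have Tp: "snd c p \<in> T" using p c d e fp chart_inv(1)[OF A c] by (auto simp: T_def R_def S_def)
  have "smooth_on T (\<lambda>y. (snd e \<circ> g \<circ> chart_inv d) ((snd d \<circ> f \<circ> chart_inv c) y))"
    by (rule smooth_on_compose[OF sg S T smooth_on_subset[OF sf]]) (auto simp: T_def)
  then have sm: "smooth_on T (snd e \<circ> (\<lambda>p. g (f p)) \<circ> chart_inv c)"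
    by (rule smooth_on_cong[OF _ T]) (use chart_inv(1)[OF A c(1)] chart_inv(1)[OF B d(1)] in \<open>auto simp: T_def R_def\<close>)
  have im: "\<forall>y\<in>T. g (f (chart_inv c y)) \<in> fst e"
  proof
    fix y assume "y \<in> T"
    then obtain q q' where "y = snd c q" "q \<in> fst c" "f q \<in> fst d" "snd d (f q) = snd d q'" "q' \<in> fst d" "g q' \<in> fst e"
      using chart_inv(1)[OF A c(1)] by (auto simp: T_def R_def S_def)
    then show "g (f (chart_inv c y)) \<in> fst e"
      using chart_inv(1)[OF A c(1)] chart_atlasD(2)[OF B d(1)] by (auto dest: inj_onD)
  qed
  have "T \<subseteq> snd c ` (W \<inter> fst c)" by (auto simp: T_def R_def)
  then show "\<exists>c\<in>A. \<exists>d\<in>C. \<exists>T. open T \<and> p \<in> fst c \<and> snd c p \<in> T \<and> T \<subseteq> snd c ` (W \<inter> fst c) \<and>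
       (\<forall>y\<in>T. g (f (chart_inv c y)) \<in> fst d) \<and> smooth_on T (snd d \<circ> (\<lambda>p. g (f p)) \<circ> chart_inv c)"
    using c e T Tp sm im by blast
qed

section \<open>Functoriality of tangent maps\<close>

lemma tangent_map_cong:
  assumes A: "chart_atlas X A" and W: "openin X W" "p \<in> W" and eq: "\<And>q. q \<in> W \<Longrightarrow> f q = g q"
  shows "tangent_map A B f p = tangent_map A B g p"
proof -
  have tp: "p \<in> topspace X" using W openin_subset by blast
  note c = chart_at[OF A tp]
  have 0: "f p = g p" using W eq by simp
  show ?thesis unfolding tangent_map_def 0
  proof (rule frechet_derivative_cong_open[OF chart_atlasD(3)[OF A c(1) W(1)]])
    show "snd (chart_at A p) p \<in> snd (chart_at A p) ` (W \<inter> fst (chart_at A p))" using W c by auto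
  qed (use eq chart_inv(1)[OF A c(1)] in auto)
qed

lemma tangent_map_has_derivative:
  assumes A: "chart_atlas X A" and B: "chart_atlas Y B" and f: "smooth_map_on X A Y B W f" and p: "p \<in> W"
  shows "((snd (chart_at B (f p)) \<circ> f \<circ> chart_inv (chart_at A p)) has_derivative tangent_map A B f p) (at (snd (chart_at A p) p))"
proof -
  have tp: "p \<in> topspace X" using p smooth_map_onD(1)[OF f] openin_subset by blast
  note c = chart_at[OF A tp] and d = chart_at[OF B smooth_map_onD(2)[OF f p]]
  show ?thesis unfolding tangent_map_def
    by (rule smooth_on_has_derivative[OF smooth_map_onD(4)[OF f c(1) d(1)]]) (use c d p in auto)
qed

lemma tangent_map_linear:
  assumes "chart_atlas X A" "chart_atlas Y B" "smooth_map_on X A Y B W f" "p \<in> W"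
  shows "linear (tangent_map A B f p)"
  using tangent_map_has_derivative[OF assms] has_derivative_linear by blast

text \<open>The chain rule holds exactly although charts are picked pointwise and without
  continuity: the chart picked at \<open>f p\<close> is the same in both factors and
  cancels.\<close>

lemma tangent_map_compose:
  assumes A: "chart_atlas X A" and B: "chart_atlas Y B" and C: "chart_atlas Z C"
    and f: "smooth_map_on X A Y B W f" and g: "smooth_map_on Y B Z C W' g" and p: "p \<in> W" "f p \<in> W'"
  shows "tangent_map A C (\<lambda>p. g (f p)) p v = tangent_map B C g (f p) (tangent_map A B f p v)"
proof -
  define c d e where "c = chart_at A p" and "d = chart_at B (f p)" and "e = chart_at C (g (f p))"
  have tp: "p \<in> topspace X" using p smooth_map_onD(1)[OF f] openin_subset by blast
  note c = chart_at[OF A tp, folded c_def] and d = chart_at[OF B smooth_map_onD(2)[OF f p(1)], folded d_def]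
  have 1: "((snd d \<circ> f \<circ> chart_inv c) has_derivative tangent_map A B f p) (at (snd c p))"
    unfolding c_def d_def by (rule tangent_map_has_derivative[OF A B f p(1)])
  have "((snd e \<circ> g \<circ> chart_inv d) has_derivative tangent_map B C g (f p)) (at ((snd d \<circ> f \<circ> chart_inv c) (snd c p)))"
    using tangent_map_has_derivative[OF B C g p(2)] chart_inv(1)[OF A c] by (simp add: d_def e_def)
  from has_derivative_compose[OF 1 this]
  have "((\<lambda>y. (snd e \<circ> g \<circ> chart_inv d) ((snd d \<circ> f \<circ> chart_inv c) y)) has_derivative
     (\<lambda>v. tangent_map B C g (f p) (tangent_map A B f p v))) (at (snd c p))" .
  then have "((snd e \<circ> (\<lambda>p. g (f p)) \<circ> chart_inv c) has_derivative
     (\<lambda>v. tangent_map B C g (f p) (tangent_map A B f p v))) (at (snd c p))"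
    by (rule has_derivative_transform_within_open[OF _ smooth_map_on_domain[OF A B c(1) d(1) f]])
      (use c d p chart_inv(1)[OF A c(1)] chart_inv(1)[OF B d(1)] in auto)
  then show ?thesis unfolding tangent_map_def[of A C] c_def[symmetric] e_def[symmetric]
    by (simp add: frechet_derivative_eqI)
qed

section \<open>Vector spaces as manifolds\<close>

lemma chart_atlas_std: "chart_atlas euclidean std_atlas"
  by (auto simp: chart_atlas_def std_atlas_def chart_inv_def smooth_on_id id_def inv_into_def intro!: smooth_on_cong[OF smooth_on_id])

lemma chart_at_std [simp]: "chart_at std_atlas p = (UNIV, id)"
  unfolding chart_at_def std_atlas_def by (rule some_equality) auto

lemma chart_inv_std [simp]: "chart_inv (UNIV, id) = id"
  by (simp add: chart_inv_def id_def inv_into_def)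

lemma tangent_map_std: "tangent_map std_atlas std_atlas f y = frechet_derivative f (at y)"
  by (simp add: tangent_map_def)

lemma smooth_map_on_std_iff:
  "smooth_map_on euclidean std_atlas euclidean std_atlas W f \<longleftrightarrow> open W \<and> smooth_on W f"
proof
  assume "open W \<and> smooth_on W f"
  then show "smooth_map_on euclidean std_atlas euclidean std_atlas W f"
    by (intro smooth_map_onI chart_atlas_std) (auto simp: std_atlas_def)
qed (auto simp: smooth_map_on_def std_atlas_def)

lemma smooth_map_on_to_std:
  assumes A: "chart_atlas X A" and W: "openin X W"
    and loc: "\<And>p. p \<in> W \<Longrightarrow> \<exists>c\<in>A. \<exists>T. open T \<and> p \<in> fst c \<and> snd c p \<in> T \<and> T \<subseteq> snd c ` (W \<inter> fst c) \<and>
       smooth_on T (\<lambda>y. f (chart_inv c y))"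
  shows "smooth_map_on X A euclidean std_atlas W f"
  by (rule smooth_map_onI[OF A chart_atlas_std W]) (use loc in \<open>fastforce simp: std_atlas_def o_def\<close>)

lemma smooth_map_on_std_chart:
  assumes "smooth_map_on X A euclidean std_atlas W f" "c \<in> A"
  shows "smooth_on (snd c ` (W \<inter> fst c)) (\<lambda>y. f (chart_inv c y))"
  using smooth_map_onD(4)[OF assms, of "(UNIV, id)"] by (simp add: std_atlas_def o_def Int_def)

section \<open>Charts as smooth maps, and coordinate fields\<close>

lemma smooth_map_on_chart:
  assumes A: "chart_atlas X A" and c: "c \<in> A"
  shows "smooth_map_on X A euclidean std_atlas (fst c) (snd c)"
proof (rule smooth_map_on_to_std[OF A chart_atlasD(1)[OF A c]])
  fix p assume p: "p \<in> fst c"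
  have "smooth_on (snd c ` fst c) (\<lambda>y. snd c (chart_inv c y))"
    by (rule smooth_on_cong[OF smooth_on_id]) (use chart_atlasD(6)[OF A c] chart_inv(3)[OF A c] in auto)
  then show "\<exists>c'\<in>A. \<exists>T. open T \<and> p \<in> fst c' \<and> snd c' p \<in> T \<and> T \<subseteq> snd c' ` (fst c \<inter> fst c') \<and>
       smooth_on T (\<lambda>y. snd c (chart_inv c' y))"
    using p c chart_atlasD(6)[OF A c] by (intro bexI[of _ c] exI[of _ "snd c ` fst c"]) auto
qed

lemma smooth_map_on_chart_inv:
  assumes A: "chart_atlas X A" and c: "c \<in> A"
  shows "smooth_map_on euclidean std_atlas X A (snd c ` fst c) (chart_inv c)"
proof (rule smooth_map_onI[OF chart_atlas_std A])
  show "openin euclidean (snd c ` fst c)" using chart_atlasD(6)[OF A c] by simp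
  fix y assume y: "y \<in> snd c ` fst c"
  have "smooth_on (snd c ` fst c) (\<lambda>y. snd c (chart_inv c y))"
    by (rule smooth_on_cong[OF smooth_on_id]) (use chart_atlasD(6)[OF A c] chart_inv(3)[OF A c] in auto)
  then show "\<exists>c'\<in>std_atlas. \<exists>d\<in>A. \<exists>T. open T \<and> y \<in> fst c' \<and> snd c' y \<in> T \<and> T \<subseteq> snd c' ` (snd c ` fst c \<inter> fst c') \<and>
       (\<forall>y\<in>T. chart_inv c (chart_inv c' y) \<in> fst d) \<and> smooth_on T (snd d \<circ> chart_inv c \<circ> chart_inv c')"
    using y c chart_atlasD(6)[OF A c] chart_inv(2)[OF A c]
    by (intro bexI[of _ "(UNIV, id)"] bexI[of _ c] exI[of _ "snd c ` fst c"]) (auto simp: std_atlas_def o_def)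
qed

lemma tangent_map_id:
  assumes A: "chart_atlas X A" and p: "p \<in> topspace X"
  shows "tangent_map A A (\<lambda>q. q) p v = v"
proof -
  note c = chart_at[OF A p]
  have "frechet_derivative (snd (chart_at A p) \<circ> (\<lambda>q. q) \<circ> chart_inv (chart_at A p)) (at (snd (chart_at A p) p)) = (\<lambda>v. v)"
    by (subst frechet_derivative_cong_open[OF chart_atlasD(6)[OF A c(1)], of _ _ "\<lambda>y. y"])
      (use c chart_inv(1)[OF A c(1)] in \<open>auto intro!: frechet_derivative_eqI has_derivative_ident\<close>)
  then show ?thesis by (simp add: tangent_map_def)
qed

text \<open>The bridge from pointwise chosen charts to calculus: evaluated on a coordinate field, a
  tangent map becomes the derivative of the expression of \<open>f\<close> in one fixed chart
  \<open>c\<close>, and so can itself be differentiated in the base point.\<close>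

lemma tangent_map_coord_field:
  assumes A: "chart_atlas X A" and B: "chart_atlas Y B" and c: "c \<in> A"
    and f: "smooth_map_on X A Y B W f" and y: "y \<in> snd c ` (W \<inter> fst c)"
  shows "tangent_map A B f (chart_inv c y) (coord_field A c w (chart_inv c y)) =
     tangent_map std_atlas B (\<lambda>y. f (chart_inv c y)) y w"
proof -
  have "y \<in> snd c ` fst c" "chart_inv c y \<in> W" using y chart_inv(1)[OF A c] by auto
  then show ?thesis unfolding coord_field_def
    using tangent_map_compose[OF chart_atlas_std A B smooth_map_on_chart_inv[OF A c] f, of y w] chart_inv(3)[OF A c] by simp
qed

lemma tangent_map_coord_field_std:
  assumes A: "chart_atlas X A" and c: "c \<in> A"
    and f: "smooth_map_on X A euclidean std_atlas W f" and y: "y \<in> snd c ` (W \<inter> fst c)"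
  shows "tangent_map A std_atlas f (chart_inv c y) (coord_field A c w (chart_inv c y)) =
     frechet_derivative (\<lambda>y. f (chart_inv c y)) (at y) w"
  using tangent_map_coord_field[OF A chart_atlas_std c f y] by (simp add: tangent_map_std)

lemma coord_field_chart_at:
  assumes A: "chart_atlas X A" and p: "p \<in> topspace X"
  shows "coord_field A (chart_at A p) w p = w"
proof -
  note c = chart_at[OF A p]
  have "tangent_map std_atlas A (chart_inv (chart_at A p)) (snd (chart_at A p) p) = tangent_map A A (\<lambda>q. q) p"
    using chart_inv(1)[OF A c] by (simp add: tangent_map_def o_def)
  then show ?thesis using tangent_map_id[OF A p] by (simp add: coord_field_def)
qed

lemma coord_field_inverse:
  assumes A: "chart_atlas X A" and c: "c \<in> A" and p: "p \<in> fst c"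
  shows "coord_field A c (tangent_map A std_atlas (snd c) p v) p = v"
    "tangent_map A std_atlas (snd c) p (coord_field A c w p) = w" "linear (\<lambda>w. coord_field A c w p)"
proof -
  have tp: "p \<in> topspace X" using p chart_atlasD(1)[OF A c] openin_subset by blast
  have y: "snd c p \<in> snd c ` fst c" using p by simp
  have "tangent_map A A (\<lambda>q. chart_inv c (snd c q)) p v = v"
    using tangent_map_cong[OF A chart_atlasD(1)[OF A c] p, of "\<lambda>q. chart_inv c (snd c q)" "\<lambda>q. q" A]
      chart_inv(1)[OF A c] tangent_map_id[OF A tp] by simp
  then show "coord_field A c (tangent_map A std_atlas (snd c) p v) p = v" unfolding coord_field_def
    using tangent_map_compose[OF A chart_atlas_std A smooth_map_on_chart[OF A c] smooth_map_on_chart_inv[OF A c] p y] by simp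
  have "frechet_derivative (\<lambda>y. snd c (chart_inv c y)) (at (snd c p)) = (\<lambda>v. v)"
    by (subst frechet_derivative_cong_open[OF chart_atlasD(6)[OF A c], of _ _ "\<lambda>y. y"])
      (use p chart_inv(3)[OF A c] in \<open>auto intro!: frechet_derivative_eqI has_derivative_ident\<close>)
  then show "tangent_map A std_atlas (snd c) p (coord_field A c w p) = w"
    using tangent_map_coord_field_std[OF A c smooth_map_on_chart[OF A c], of "snd c p" w] p chart_inv(1)[OF A c p] by simp
  show "linear (\<lambda>w. coord_field A c w p)" unfolding coord_field_def
    by (rule tangent_map_linear[OF chart_atlas_std A smooth_map_on_chart_inv[OF A c] y])
qed

lemma chart_atlas_manifold:
  fixes A :: "('a::topological_space, 'e::euclidean_space) chart set"
  assumes "smooth_manifold euclidean A" shows "chart_atlas euclidean A"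
proof -
  have "(\<forall>V. open V \<longrightarrow> open (snd c ` (V \<inter> fst c))) \<and> (\<forall>T. open T \<longrightarrow> open {p\<in>fst c. snd c p \<in> T}) \<and> inj_on (snd c) (fst c)"
    if c: "c \<in> A" for c
  proof -
    have o: "open (fst c)" "open (snd c ` fst c)" and h: "homeomorphic_map (top_of_set (fst c)) (top_of_set (snd c ` fst c)) (snd c)"
      using assms c by (auto simp: smooth_manifold_def)
    have "open_map (top_of_set (fst c)) (top_of_set (snd c ` fst c)) (snd c)"
      using h homeomorphic_imp_open_map by blast
    moreover have "continuous_map (top_of_set (fst c)) (top_of_set (snd c ` fst c)) (snd c)"
      using h homeomorphic_imp_continuous_map by blast
    moreover have "inj_on (snd c) (fst c)" using homeomorphic_imp_injective_map[OF h] by simp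
    moreover have "open {p\<in>fst c. snd c p \<in> T}" if "open T" "continuous_on (fst c) (snd c)" for T
      using continuous_open_preimage[OF that(2) o(1) that(1)] by (simp add: vimage_def Int_def)
    ultimately show ?thesis using o by (auto simp: open_map_def openin_open_eq)
  qed
  then show ?thesis using assms unfolding chart_atlas_def smooth_manifold_def by auto
qed

section \<open>Monodromy\<close>

text \<open>
  A family of local sections with unique continuation. It serves twice: for the lifts of a
  covering map through itself, and for the flat sections of the pull-back bundle.
\<close>

locale local_sections =
  fixes E :: "'a::topological_space \<Rightarrow> 's set" and H :: "('a set \<times> ('a \<Rightarrow> 's)) set"
  assumes section_open: "(W, h) \<in> H \<Longrightarrow> open W"
    and section_val: "(W, h) \<in> H \<Longrightarrow> x \<in> W \<Longrightarrow> h x \<in> E x"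
    and agree_open: "(W, h) \<in> H \<Longrightarrow> (W', h') \<in> H \<Longrightarrow> open {x \<in> W \<inter> W'. h x = h' x}"
    and differ_open: "(W, h) \<in> H \<Longrightarrow> (W', h') \<in> H \<Longrightarrow> open {x \<in> W \<inter> W'. h x \<noteq> h' x}"
    and section_ex: "\<exists>W. open W \<and> x \<in> W \<and> (\<forall>y\<in>W. \<forall>s\<in>E y. \<exists>h. (W, h) \<in> H \<and> h y = s)"
begin

text \<open>The values carry no topology, so continuity of a lift along \<open>g\<close> is replaced
  by the condition that near each parameter it is a member of \<open>H\<close> composed with
  \<open>g\<close>. The set \<open>K\<close> will be an interval, a rectangle or the whole
  space.\<close>

definition lift_on :: "('k::topological_space \<Rightarrow> 'a) \<Rightarrow> 'k set \<Rightarrow> ('k \<Rightarrow> 's) \<Rightarrow> bool" where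
  "lift_on g K \<theta> \<longleftrightarrow> (\<forall>k\<in>K. \<exists>W h. (W, h) \<in> H \<and> g k \<in> W \<and> (\<forall>\<^sub>F k' in nhds k. k' \<in> K \<longrightarrow> \<theta> k' = h (g k')))"

lemma lift_onD:
  assumes "lift_on g K \<theta>" "k \<in> K"
  obtains W h where "(W, h) \<in> H" "g k \<in> W" "\<forall>\<^sub>F k' in nhds k. k' \<in> K \<longrightarrow> \<theta> k' = h (g k')" "\<theta> k = h (g k)"
proof -
  obtain W h where *: "(W, h) \<in> H" "g k \<in> W" "\<forall>\<^sub>F k' in nhds k. k' \<in> K \<longrightarrow> \<theta> k' = h (g k')"
    using assms unfolding lift_on_def by metis
  moreover have "\<theta> k = h (g k)" using eventually_nhds_x_imp_x[OF *(3)] assms(2) by simp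
  ultimately show ?thesis using that by blast
qed

lemma lift_onE:
  assumes "lift_on g K \<theta>" "k \<in> K"
  obtains W h where "(W, h) \<in> H" "g k \<in> W" "\<forall>\<^sub>F k' in nhds k. k' \<in> K \<longrightarrow> \<theta> k' = h (g k')"
  using assms by (rule lift_onD)

lemma lift_on_val: "lift_on g K \<theta> \<Longrightarrow> k \<in> K \<Longrightarrow> \<theta> k \<in> E (g k)"
  by (metis lift_onD section_val)

lemma lift_on_subset:
  assumes "lift_on g K \<theta>" "J \<subseteq> K" shows "lift_on g J \<theta>"
  unfolding lift_on_def
proof
  fix k assume "k \<in> J"
  then obtain W h where *: "(W, h) \<in> H" "g k \<in> W" "\<forall>\<^sub>F k' in nhds k. k' \<in> K \<longrightarrow> \<theta> k' = h (g k')"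
    using lift_onE[OF assms(1), of k] assms(2) by blast
  have "\<forall>\<^sub>F k' in nhds k. k' \<in> J \<longrightarrow> \<theta> k' = h (g k')"
    using *(3) by (rule eventually_mono) (use assms(2) in auto)
  with * show "\<exists>W h. (W, h) \<in> H \<and> g k \<in> W \<and> (\<forall>\<^sub>F k' in nhds k. k' \<in> J \<longrightarrow> \<theta> k' = h (g k'))" by blast
qed

lemma lift_on_cong:
  assumes "lift_on g K \<theta>" "\<And>k. k \<in> K \<Longrightarrow> g k = g' k" shows "lift_on g' K \<theta>"
  unfolding lift_on_def
proof
  fix k assume k: "k \<in> K"
  then obtain W h where *: "(W, h) \<in> H" "g k \<in> W" "\<forall>\<^sub>F k' in nhds k. k' \<in> K \<longrightarrow> \<theta> k' = h (g k')"
    using lift_onE[OF assms(1), of k] by blast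
  have "\<forall>\<^sub>F k' in nhds k. k' \<in> K \<longrightarrow> \<theta> k' = h (g' k')"
    using *(3) by (rule eventually_mono) (use assms(2) in auto)
  with * k assms(2) show "\<exists>W h. (W, h) \<in> H \<and> g' k \<in> W \<and> (\<forall>\<^sub>F k' in nhds k. k' \<in> K \<longrightarrow> \<theta> k' = h (g' k'))" by auto
qed

lemma lift_on_section: "(W, h) \<in> H \<Longrightarrow> g ` K \<subseteq> W \<Longrightarrow> lift_on g K (\<lambda>k. h (g k))"
  unfolding lift_on_def by (intro ballI exI[of _ W] exI[of _ h]) auto

lemma lift_on_compose:
  assumes "lift_on g K \<theta>" "continuous_on UNIV f" "f ` J \<subseteq> K"
  shows "lift_on (\<lambda>j. g (f j)) J (\<lambda>j. \<theta> (f j))"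
  unfolding lift_on_def
proof
  fix j assume j: "j \<in> J"
  then have "f j \<in> K" using assms(3) by auto
  then obtain W h where *: "(W, h) \<in> H" "g (f j) \<in> W" "\<forall>\<^sub>F k' in nhds (f j). k' \<in> K \<longrightarrow> \<theta> k' = h (g k')"
    by (rule lift_onE[OF assms(1)])
  from *(3) obtain S where S: "open S" "f j \<in> S" "\<forall>k'\<in>S. k' \<in> K \<longrightarrow> \<theta> k' = h (g k')"
    unfolding eventually_nhds by blast
  have "open (f -` S)" using assms(2) S(1) by (simp add: continuous_on_open_vimage)
  then have "\<forall>\<^sub>F j' in nhds j. f j' \<in> K \<longrightarrow> \<theta> (f j') = h (g (f j'))"
    unfolding eventually_nhds using S by (intro exI[of _ "f -` S"]) auto
  then have "\<forall>\<^sub>F j' in nhds j. j' \<in> J \<longrightarrow> \<theta> (f j') = h (g (f j'))"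
    by (rule eventually_mono) (use assms(3) in auto)
  with * show "\<exists>W h. (W, h) \<in> H \<and> g (f j) \<in> W \<and> (\<forall>\<^sub>F j' in nhds j. j' \<in> J \<longrightarrow> \<theta> (f j') = h (g (f j')))" by blast
qed

lemma eventually_in_open:
  assumes "continuous_on UNIV g" "open A" "g k \<in> A" shows "\<forall>\<^sub>F k' in nhds k. g k' \<in> A"
proof -
  have "open (g -` A)" using assms(1,2) by (simp add: continuous_on_open_vimage)
  then have "\<forall>\<^sub>F k' in nhds k. k' \<in> g -` A" using assms(3) by (intro eventually_nhds_in_open) auto
  then show ?thesis by simp
qed

text \<open>By \<open>agree_open\<close> and \<open>differ_open\<close>, agreement of two lifts is
  locally constant along \<open>K\<close>, hence constant on a connected set.\<close>

lemma lift_on_unique: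
  assumes g: "continuous_on UNIV g" and K: "connected K" and 1: "lift_on g K \<theta>" and 2: "lift_on g K \<theta>'"
    and eq: "k0 \<in> K" "\<theta> k0 = \<theta>' k0" and k: "k \<in> K"
  shows "\<theta> k = \<theta>' k"
proof (rule connected_induction_simple[OF K eq(1) k, where P = "\<lambda>k. \<theta> k = \<theta>' k"])
  fix a assume a: "a \<in> K"
  obtain W h where h: "(W, h) \<in> H" "g a \<in> W" "\<forall>\<^sub>F k' in nhds a. k' \<in> K \<longrightarrow> \<theta> k' = h (g k')"
    by (rule lift_onE[OF 1 a])
  obtain W' h' where h': "(W', h') \<in> H" "g a \<in> W'" "\<forall>\<^sub>F k' in nhds a. k' \<in> K \<longrightarrow> \<theta>' k' = h' (g k')"
    by (rule lift_onE[OF 2 a])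
  have "\<exists>b. \<forall>\<^sub>F k' in nhds a. k' \<in> K \<longrightarrow> (\<theta> k' = \<theta>' k') = b"
  proof (cases "h (g a) = h' (g a)")
    case True
    have "\<forall>\<^sub>F k' in nhds a. g k' \<in> {x \<in> W \<inter> W'. h x = h' x}"
      by (rule eventually_in_open[OF g agree_open[OF h(1) h'(1)]]) (use h h' True in auto)
    with h(3) h'(3) have "\<forall>\<^sub>F k' in nhds a. k' \<in> K \<longrightarrow> (\<theta> k' = \<theta>' k') = True" by eventually_elim auto
    then show ?thesis ..
  next
    case False
    have "\<forall>\<^sub>F k' in nhds a. g k' \<in> {x \<in> W \<inter> W'. h x \<noteq> h' x}"
      by (rule eventually_in_open[OF g differ_open[OF h(1) h'(1)]]) (use h h' False in auto)
    with h(3) h'(3) have "\<forall>\<^sub>F k' in nhds a. k' \<in> K \<longrightarrow> (\<theta> k' = \<theta>' k') = False" by eventually_elim auto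
    then show ?thesis ..
  qed
  then obtain b N where N: "open N" "a \<in> N" "\<And>k'. k' \<in> N \<Longrightarrow> k' \<in> K \<longrightarrow> (\<theta> k' = \<theta>' k') = b"
    unfolding eventually_nhds by blast
  then show "\<exists>T. openin (top_of_set K) T \<and> a \<in> T \<and> (\<forall>x\<in>T. \<forall>y\<in>T. \<theta> x = \<theta>' x \<longrightarrow> \<theta> y = \<theta>' y)"
    using a by (intro exI[of _ "K \<inter> N"]) (auto simp: openin_open)
qed (rule eq)

lemma lift_on_unique':
  assumes "continuous_on UNIV g" "lift_on g K1 \<theta>1" "lift_on g K2 \<theta>2" "connected J" "J \<subseteq> K1" "J \<subseteq> K2"
    and "k0 \<in> J" "\<theta>1 k0 = \<theta>2 k0" "k \<in> J"
  shows "\<theta>1 k = \<theta>2 k"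
  by (rule lift_on_unique[OF assms(1,4) lift_on_subset[OF assms(2,5)] lift_on_subset[OF assms(3,6)] assms(7-9)])

lemma lift_on_glue:
  assumes g: "continuous_on UNIV g" and K: "closed K1" "closed K2"
    and 1: "lift_on g K1 \<theta>1" and 2: "lift_on g K2 \<theta>2" and eq: "\<And>k. k \<in> K1 \<inter> K2 \<Longrightarrow> \<theta>1 k = \<theta>2 k"
  shows "lift_on g (K1 \<union> K2) (\<lambda>k. if k \<in> K1 then \<theta>1 k else \<theta>2 k)"
  unfolding lift_on_def
proof
  fix k assume k: "k \<in> K1 \<union> K2"
  have out: "\<forall>\<^sub>F k' in nhds k. k' \<notin> K" if "closed K" "k \<notin> K" for K
    using eventually_nhds_in_open[of "- K" k] that by auto
  consider "k \<in> K1" "k \<notin> K2" | "k \<notin> K1" "k \<in> K2" | "k \<in> K1" "k \<in> K2" using k by blast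
  then show "\<exists>W h. (W, h) \<in> H \<and> g k \<in> W \<and>
      (\<forall>\<^sub>F k' in nhds k. k' \<in> K1 \<union> K2 \<longrightarrow> (if k' \<in> K1 then \<theta>1 k' else \<theta>2 k') = h (g k'))"
  proof cases
    case 1: 1
    obtain W h where h: "(W, h) \<in> H" "g k \<in> W" "\<forall>\<^sub>F k' in nhds k. k' \<in> K1 \<longrightarrow> \<theta>1 k' = h (g k')"
      by (rule lift_onE[OF assms(4) 1(1)])
    have "\<forall>\<^sub>F k' in nhds k. k' \<in> K1 \<union> K2 \<longrightarrow> (if k' \<in> K1 then \<theta>1 k' else \<theta>2 k') = h (g k')"
      using h(3) out[OF K(2) 1(2)] by eventually_elim auto
    with h show ?thesis by blast
  next
    case 2: 2
    obtain W h where h: "(W, h) \<in> H" "g k \<in> W" "\<forall>\<^sub>F k' in nhds k. k' \<in> K2 \<longrightarrow> \<theta>2 k' = h (g k')"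
      by (rule lift_onE[OF assms(5) 2(2)])
    have "\<forall>\<^sub>F k' in nhds k. k' \<in> K1 \<union> K2 \<longrightarrow> (if k' \<in> K1 then \<theta>1 k' else \<theta>2 k') = h (g k')"
      using h(3) out[OF K(1) 2(1)] by eventually_elim auto
    with h show ?thesis by blast
  next
    \<comment> \<open>Where the two closed sets meet, the local sections describing the two lifts
      agree at the point, hence near it by \<open>agree_open\<close>, and one of them describes
      both.\<close>
    case 3
    obtain W h where h: "(W, h) \<in> H" "g k \<in> W" "\<forall>\<^sub>F k' in nhds k. k' \<in> K1 \<longrightarrow> \<theta>1 k' = h (g k')" "\<theta>1 k = h (g k)"
      by (rule lift_onD[OF assms(4) 3(1)])
    obtain W' h' where h': "(W', h') \<in> H" "g k \<in> W'" "\<forall>\<^sub>F k' in nhds k. k' \<in> K2 \<longrightarrow> \<theta>2 k' = h' (g k')" "\<theta>2 k = h' (g k)"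
      by (rule lift_onD[OF assms(5) 3(2)])
    have "\<forall>\<^sub>F k' in nhds k. g k' \<in> {x \<in> W \<inter> W'. h x = h' x}"
      by (rule eventually_in_open[OF g agree_open[OF h(1) h'(1)]]) (use h h' eq[of k] 3 in auto)
    with h(3) h'(3) have "\<forall>\<^sub>F k' in nhds k. k' \<in> K1 \<union> K2 \<longrightarrow> (if k' \<in> K1 then \<theta>1 k' else \<theta>2 k') = h (g k')"
      by eventually_elim auto
    with h show ?thesis by blast
  qed
qed

text \<open>Subdivision in the second variable: \<open>Bolzano\<close> plays the role of the
  Lebesgue number. The width of the strip around \<open>x\<close> may shrink at each subdivision,
  but only finitely often.\<close>

lemma lift_on_strip:
  fixes g :: "real \<times> real \<Rightarrow> 'a"
  assumes g: "continuous_on UNIV g" and "c \<le> d"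
  shows "\<exists>\<delta>>0. \<forall>a b. a \<le> x \<and> x \<le> b \<and> b - a < \<delta> \<longrightarrow>
    (\<forall>s\<in>E (g (a, c)). \<exists>\<theta>. lift_on g ({a..b} \<times> {c..d}) \<theta> \<and> \<theta> (a, c) = s)"
  using \<open>c \<le> d\<close>
proof (induct rule: Bolzano)
  case (trans u v w)
  obtain d1 where d1: "d1 > 0" "\<forall>a b. a \<le> x \<and> x \<le> b \<and> b - a < d1 \<longrightarrow>
      (\<forall>s\<in>E (g (a, u)). \<exists>\<theta>. lift_on g ({a..b} \<times> {u..v}) \<theta> \<and> \<theta> (a, u) = s)"
    using trans(1) by (elim exE conjE)
  obtain d2 where d2: "d2 > 0" "\<forall>a b. a \<le> x \<and> x \<le> b \<and> b - a < d2 \<longrightarrow>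
      (\<forall>s\<in>E (g (a, v)). \<exists>\<theta>. lift_on g ({a..b} \<times> {v..w}) \<theta> \<and> \<theta> (a, v) = s)"
    using trans(2) by (elim exE conjE)
  show ?case
  proof (intro exI[of _ "min d1 d2"] conjI allI impI ballI)
    fix a b s assume ab: "a \<le> x \<and> x \<le> b \<and> b - a < min d1 d2" and s: "s \<in> E (g (a, u))"
    obtain \<theta>1 where t1: "lift_on g ({a..b} \<times> {u..v}) \<theta>1" "\<theta>1 (a, u) = s" using d1(2)[rule_format, of a b s] ab s by auto
    have "\<theta>1 (a, v) \<in> E (g (a, v))" using lift_on_val[OF t1(1)] ab trans(3) by auto
    then obtain \<theta>2 where t2: "lift_on g ({a..b} \<times> {v..w}) \<theta>2" "\<theta>2 (a, v) = \<theta>1 (a, v)" using d2(2)[rule_format, of a b] ab by fastforce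
    have con: "connected ({a..b} \<times> {v})" by (intro connected_Times) auto
    \<comment> \<open>The two lifts were matched at one corner only; uniqueness along the connected
      common edge extends this to the whole edge, as gluing requires.\<close>
    have "\<theta>1 k = \<theta>2 k" if "k \<in> {a..b} \<times> {v}" for k
      by (rule lift_on_unique'[OF g t1(1) t2(1) con _ _ _ t2(2)[symmetric] that])
        (use ab trans(3,4) in auto)
    then have "lift_on g ({a..b} \<times> {u..v} \<union> {a..b} \<times> {v..w}) (\<lambda>k. if k \<in> {a..b} \<times> {u..v} then \<theta>1 k else \<theta>2 k)"
      by (intro lift_on_glue[OF g _ _ t1(1) t2(1)] closed_Times) auto
    moreover have "{a..b} \<times> {u..v} \<union> {a..b} \<times> {v..w} = {a..b} \<times> {u..w}" using trans(3,4) by auto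
    ultimately show "\<exists>\<theta>. lift_on g ({a..b} \<times> {u..w}) \<theta> \<and> \<theta> (a, u) = s"
      using t1(2) ab trans(3) by (intro exI[of _ "\<lambda>k. if k \<in> {a..b} \<times> {u..v} then \<theta>1 k else \<theta>2 k"]) auto
  qed (use d1 d2 in auto)
next
  case (local u)
  obtain W where W: "open W" "g (x, u) \<in> W" "\<forall>y\<in>W. \<forall>s\<in>E y. \<exists>h. (W, h) \<in> H \<and> h y = s"
    using section_ex by blast
  have "open (g -` W)" using g W(1) by (simp add: continuous_on_open_vimage)
  then obtain A B where AB0: "open A" "open B" "(x, u) \<in> A \<times> B" "A \<times> B \<subseteq> g -` W"
    by (rule open_prod_elim[of _ "(x, u)"]) (use W(2) in auto)
  then have AB: "open A" "open B" "x \<in> A" "u \<in> B" "A \<times> B \<subseteq> g -` W" by auto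
  obtain e1 where e1: "e1 > 0" "\<And>y. dist y x < e1 \<Longrightarrow> y \<in> A" using AB(1,3) unfolding open_dist by blast
  obtain e2 where e2: "e2 > 0" "\<And>y. dist y u < e2 \<Longrightarrow> y \<in> B" using AB(2,4) unfolding open_dist by blast
  show ?case
  proof (rule exI[of _ e2], intro conjI allI impI)
    fix c d assume cd: "c \<le> u \<and> u \<le> d \<and> d - c < e2"
    show "\<exists>\<delta>>0. \<forall>a b. a \<le> x \<and> x \<le> b \<and> b - a < \<delta> \<longrightarrow>
      (\<forall>s\<in>E (g (a, c)). \<exists>\<theta>. lift_on g ({a..b} \<times> {c..d}) \<theta> \<and> \<theta> (a, c) = s)"
    proof (intro exI[of _ e1] conjI allI impI ballI)
      fix a b s assume ab: "a \<le> x \<and> x \<le> b \<and> b - a < e1" and s: "s \<in> E (g (a, c))"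
      have sub: "g ` ({a..b} \<times> {c..d}) \<subseteq> W"
      proof clarify
        fix p q assume "p \<in> {a..b}" "q \<in> {c..d}"
        then have "p \<in> A" "q \<in> B" using ab cd e1(2)[of p] e2(2)[of q] by (auto simp: dist_real_def)
        then show "g (p, q) \<in> W" using AB(5) by auto
      qed
      have "g (a, c) \<in> W" using sub ab cd by auto
      then obtain h where "(W, h) \<in> H" "h (g (a, c)) = s" using W(3) s by blast
      then show "\<exists>\<theta>. lift_on g ({a..b} \<times> {c..d}) \<theta> \<and> \<theta> (a, c) = s"
        using lift_on_section[OF _ sub] by blast
    qed (rule e1)
  qed (rule e2)
qed

text \<open>Subdivision in the first variable, whose small pieces are the strips just
  treated.\<close>

lemma lift_on_rectangle:
  fixes g :: "real \<times> real \<Rightarrow> 'a"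
  assumes g: "continuous_on UNIV g" and cd: "c \<le> d" and "a \<le> b"
  shows "\<forall>s\<in>E (g (a, c)). \<exists>\<theta>. lift_on g ({a..b} \<times> {c..d}) \<theta> \<and> \<theta> (a, c) = s"
  using \<open>a \<le> b\<close>
proof (induct rule: Bolzano)
  case (trans u v w)
  show ?case
  proof
    fix s assume "s \<in> E (g (u, c))"
    then obtain \<theta>1 where t1: "lift_on g ({u..v} \<times> {c..d}) \<theta>1" "\<theta>1 (u, c) = s" using trans(1) by blast
    have "\<theta>1 (v, c) \<in> E (g (v, c))" using lift_on_val[OF t1(1)] cd trans(3) by auto
    then obtain \<theta>2 where t2: "lift_on g ({v..w} \<times> {c..d}) \<theta>2" "\<theta>2 (v, c) = \<theta>1 (v, c)" using trans(2) by blast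
    have con: "connected ({v} \<times> {c..d})" by (intro connected_Times) auto
    have "\<theta>1 k = \<theta>2 k" if "k \<in> {v} \<times> {c..d}" for k
      by (rule lift_on_unique'[OF g t1(1) t2(1) con _ _ _ t2(2)[symmetric] that])
        (use cd trans(3,4) in auto)
    then have "lift_on g ({u..v} \<times> {c..d} \<union> {v..w} \<times> {c..d}) (\<lambda>k. if k \<in> {u..v} \<times> {c..d} then \<theta>1 k else \<theta>2 k)"
      by (intro lift_on_glue[OF g _ _ t1(1) t2(1)] closed_Times) auto
    moreover have "{u..v} \<times> {c..d} \<union> {v..w} \<times> {c..d} = {u..w} \<times> {c..d}" using trans(3,4) by auto
    ultimately show "\<exists>\<theta>. lift_on g ({u..w} \<times> {c..d}) \<theta> \<and> \<theta> (u, c) = s"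
      using t1(2) cd trans(3) by (intro exI[of _ "\<lambda>k. if k \<in> {u..v} \<times> {c..d} then \<theta>1 k else \<theta>2 k"]) auto
  qed
next
  case (local x)
  show ?case by (rule lift_on_strip[OF g cd])
qed

text \<open>A path is regarded as a map on the square that is constant in the second
  variable.\<close>

lemma lift_on_path:
  fixes g :: "real \<Rightarrow> 'a"
  assumes g: "continuous_on UNIV g" and s: "s \<in> E (g 0)"
  obtains \<theta> where "lift_on g {0..1} \<theta>" "\<theta> 0 = s"
proof -
  have "continuous_on UNIV (\<lambda>k::real \<times> real. g (fst k))"
    by (rule continuous_on_compose2[OF g]) (auto intro!: continuous_intros)
  from lift_on_rectangle[OF this, of 0 1 0 1] s
  obtain \<theta> where *: "lift_on (\<lambda>k::real \<times> real. g (fst k)) ({0..1} \<times> {0..1}) \<theta>" "\<theta> (0, 0) = s" by auto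
  have "continuous_on UNIV (\<lambda>t::real. (t, 0::real))" by (intro continuous_intros)
  from lift_on_compose[OF *(1) this, of "{0..1}"] have "lift_on g {0..1} (\<lambda>t. \<theta> (t, 0))" by force
  with *(2) show ?thesis by (intro that[of "\<lambda>t. \<theta> (t, 0)"]) auto
qed

text \<open>A homotopy of loops to a constant loop is lifted over the square. Its top and bottom
  edges follow the same path, and the edge over the constant loop has a constant lift.\<close>

lemma lift_on_loop:
  fixes g :: "real \<Rightarrow> 'a"
  assumes sc: "simply_connected (UNIV :: 'a set)" and g: "continuous_on UNIV g" "g 0 = g 1"
    and \<theta>: "lift_on g {0..1} \<theta>"
  shows "\<theta> 0 = \<theta> 1"
proof -
  define x0 where "x0 = g 0"
  have "homotopic_loops UNIV g (\<lambda>_. x0)"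
    by (rule sc[unfolded simply_connected_def, rule_format])
      (use g in \<open>auto simp: path_def pathfinish_def pathstart_def intro: continuous_on_subset\<close>)
  then obtain h where h: "continuous_on ({0..1::real} \<times> {0..1::real}) h" "\<And>x. x \<in> {0..1} \<Longrightarrow> h (0, x) = g x"
    "\<And>x. x \<in> {0..1} \<Longrightarrow> h (1, x) = x0" "\<And>t. t \<in> {0..1} \<Longrightarrow> h (t, 1) = h (t, 0)"
    unfolding homotopic_loops by (auto simp: pathfinish_def pathstart_def)
  \<comment> \<open>Clamping to the unit interval extends the homotopy to the whole plane, since
    lifting is stated for globally continuous maps.\<close>
  define cl where "cl t = max 0 (min 1 t)" for t :: real
  have cl: "continuous_on UNIV cl" unfolding cl_def by (intro continuous_intros)
  have cl01: "cl t \<in> {0..1}" "t \<in> {0..1} \<Longrightarrow> cl t = t" for t by (auto simp: cl_def)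
  define G where "G k = h (cl (fst k), cl (snd k))" for k
  have G: "continuous_on UNIV G" unfolding G_def
    by (rule continuous_on_compose2[OF h(1)])
      (use cl01 in \<open>auto intro!: continuous_intros continuous_on_compose2[OF cl]\<close>)
  have G_edges: "G (0, u) = g (cl u)" "G (1, u) = x0" "G (t, 1) = G (t, 0)" for t u
    using h(2-4) cl01 by (auto simp: G_def)
  have "\<theta> 0 \<in> E (G (0, 0))" using lift_on_val[OF \<theta>, of 0] G_edges(1)[of 0] cl01(2)[of 0] by simp
  then obtain T where T: "lift_on G ({0..1} \<times> {0..1}) T" "T (0, 0) = \<theta> 0"
    using lift_on_rectangle[OF G, of 0 1 0 1] by auto
  have edge: "lift_on (\<lambda>t. G (f t)) {0..1} (\<lambda>t. T (f t))" "continuous_on UNIV (\<lambda>t. G (f t))"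
    if "continuous_on UNIV f" "f ` {0..1} \<subseteq> {0..1} \<times> {0..1}" for f :: "real \<Rightarrow> real \<times> real"
    using lift_on_compose[OF T(1) that] continuous_on_compose2[OF G that(1)] by auto
  have im: "Pair c ` {0..1} \<subseteq> {0..1} \<times> {0..1}" "(\<lambda>t. (t, c)) ` {0..1} \<subseteq> {0..1} \<times> {0..1}" if "c \<in> {0..1}" for c :: real
    using that by auto
  have c1: "continuous_on UNIV (\<lambda>t::real. (c, t))" "continuous_on UNIV (\<lambda>t::real. (t, c))" for c :: real
    by (intro continuous_intros)+
  have left: "lift_on (\<lambda>t. g (cl t)) {0..1} (\<lambda>t. T (0, t))" and right: "lift_on (\<lambda>t. x0) {0..1} (\<lambda>t. T (1, t))"
    using edge(1)[OF c1(1) im(1), of 0] edge(1)[OF c1(1) im(1), of 1] G_edges by simp_all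
  have bot: "lift_on (\<lambda>t. G (t, 0)) {0..1} (\<lambda>t. T (t, 0))" and top: "lift_on (\<lambda>t. G (t, 0)) {0..1} (\<lambda>t. T (t, 1))"
    using edge(1)[OF c1(2) im(2), of 0] edge(1)[OF c1(2) im(2), of 1] G_edges by simp_all
  have cb: "continuous_on UNIV (\<lambda>t. G (t, 0))" using edge(2)[OF c1(2) im(2), of 0] by simp
  have con: "connected {0..1::real}" by simp
  have "T (1, 1) = T (1, 0)"
  proof -
    have "T (1, 0) \<in> E x0" using lift_on_val[OF right, of 0] by simp
    then obtain W h where "(W, h) \<in> H" "x0 \<in> W" "h x0 = T (1, 0)" using section_ex[of x0] by metis
    then have "lift_on (\<lambda>t::real. x0) {0..1} (\<lambda>t. T (1, 0))" using lift_on_section[of W h "\<lambda>_. x0" "{0..1}"] by auto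
    from lift_on_unique[OF _ con right this, of 0 1] show ?thesis by simp
  qed
  \<comment> \<open>Top and bottom are lifts of one path and agree at parameter 1, by the previous
    step; hence they agree at parameter 0, where they are the end values of the lift of the
    loop.\<close>
  then have "T (0, 0) = T (0, 1)" using lift_on_unique[OF cb con bot top, of 1 0] by auto
  moreover have "T (0, 1) = \<theta> 1"
  proof -
    have "lift_on g {0..1} (\<lambda>t. T (0, t))" by (rule lift_on_cong[OF left]) (use cl01 in auto)
    from lift_on_unique[OF g(1) con this \<theta>, of 0 1] T(2) show ?thesis by auto
  qed
  ultimately show ?thesis using T(2) by simp
qed

text \<open>The value at \<open>x\<close> is obtained by continuation from \<open>x0\<close> along a
  path. Simple connectedness makes it independent of the path, local path-connectedness makes the
  outcome locally a section.\<close>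

lemma global_section:
  assumes sc: "simply_connected (UNIV :: 'a set)"
    and lpc: "\<And>W x. open W \<Longrightarrow> x \<in> W \<Longrightarrow> \<exists>V. open V \<and> x \<in> V \<and> V \<subseteq> W \<and> path_connected (V :: 'a set)"
    and s0: "s0 \<in> E x0"
  obtains \<sigma> where "lift_on (\<lambda>x. x) UNIV \<sigma>" "\<sigma> x0 = s0"
proof -
  define cl where "cl t = max 0 (min 1 t)" for t :: real
  have cl: "continuous_on UNIV cl" unfolding cl_def by (intro continuous_intros)
  have cl01: "cl t \<in> {0..1}" "t \<in> {0..1} \<Longrightarrow> cl t = t" for t by (auto simp: cl_def)
  have ext: "continuous_on UNIV (\<lambda>t. p (cl t))" if "path p" for p :: "real \<Rightarrow> 'a"
    using that cl01 by (auto simp: path_def intro: continuous_on_compose2[OF _ cl])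
  define R where "R x s \<longleftrightarrow> (\<exists>g \<theta>. continuous_on UNIV g \<and> g 0 = x0 \<and> g (1::real) = x \<and>
     lift_on g {0..1} \<theta> \<and> \<theta> 0 = s0 \<and> \<theta> 1 = s)" for x s
  have ex: "\<exists>s. R x s" for x
  proof -
    \<comment> \<open>Constant loops at any two points are freely homotopic; the track of the base
      point is a path joining them.\<close>
    have "homotopic_loops UNIV (\<lambda>_. x0) (\<lambda>_. x)"
      using sc unfolding simply_connected_def by (auto simp: path_def pathfinish_def pathstart_def)
    then obtain h where h: "continuous_on ({0..1::real} \<times> {0..1::real}) h" "h (0, 0) = x0" "h (1, 0) = x"
      unfolding homotopic_loops by auto
    have "path (\<lambda>t. h (t, 0))" unfolding path_def
      by (rule continuous_on_compose2[OF h(1)]) (auto intro!: continuous_intros)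
    note g = ext[OF this]
    obtain \<theta> where "lift_on (\<lambda>t. h (cl t, 0)) {0..1} \<theta>" "\<theta> 0 = s0"
      using lift_on_path[OF g, of s0] s0 h cl01 by auto
    then show ?thesis unfolding R_def using g h cl01 by (intro exI[of _ "\<theta> 1"] exI[of _ "\<lambda>t. h (cl t, 0)"]) auto
  qed
  have uniq: "s = s'" if "R x s" "R x s'" for x s s'
  proof -
    obtain g1 \<theta>1 where 1: "continuous_on UNIV g1" "g1 0 = x0" "g1 (1::real) = x" "lift_on g1 {0..1} \<theta>1" "\<theta>1 0 = s0" "\<theta>1 1 = s"
      using \<open>R x s\<close> unfolding R_def by blast
    obtain g2 \<theta>2 where 2: "continuous_on UNIV g2" "g2 0 = x0" "g2 (1::real) = x" "lift_on g2 {0..1} \<theta>2" "\<theta>2 0 = s0" "\<theta>2 1 = s'"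
      using \<open>R x s'\<close> unfolding R_def by blast
    \<comment> \<open>The first path followed by the reverse of the second is a loop; the lift of a
      loop returns to its initial value, so its value halfway is the end value of both
      lifts.\<close>
    define g where "g t = (if t \<le> 1/2 then g1 (2 * t) else g2 (2 - 2 * t))" for t :: real
    have g: "continuous_on UNIV g" unfolding g_def
    proof (rule continuous_on_cases_le)
      fix t :: real assume t: "t = 1/2"
      show "g1 (2 * t) = g2 (2 - 2 * t)" unfolding t using 1 2 by simp
    qed (use 1 2 in \<open>auto intro!: continuous_intros continuous_on_compose2[OF 1(1)] continuous_on_compose2[OF 2(1)]\<close>)
    have g01: "g 0 = x0" "g 1 = x0" using 1 2 by (auto simp: g_def)
    obtain \<theta> where \<theta>: "lift_on g {0..1} \<theta>" "\<theta> 0 = s0" using lift_on_path[OF g, of s0] s0 g01 by auto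
    have \<theta>1: "\<theta> 1 = s0" using lift_on_loop[OF sc g _ \<theta>(1)] g01 \<theta>(2) by simp
    have con: "connected {0..1::real}" by simp
    have "lift_on (\<lambda>t. g (t / 2)) {0..1} (\<lambda>t. \<theta> (t / 2))"
      by (rule lift_on_compose[OF \<theta>(1)]) (auto intro!: continuous_intros)
    then have "lift_on g1 {0..1} (\<lambda>t. \<theta> (t / 2))" by (rule lift_on_cong) (auto simp: g_def)
    from lift_on_unique[OF 1(1) con this 1(4), of 0 1] have a: "\<theta> (1/2) = s" using \<theta> 1 by simp
    have "lift_on (\<lambda>t. g (1 - t / 2)) {0..1} (\<lambda>t. \<theta> (1 - t / 2))"
      by (rule lift_on_compose[OF \<theta>(1)]) (auto intro!: continuous_intros)
    then have "lift_on g2 {0..1} (\<lambda>t. \<theta> (1 - t / 2))"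
    proof (rule lift_on_cong)
      show "g (1 - t / 2) = g2 t" if "t \<in> {0..1}" for t using that 1 2 by (cases "t = 1") (auto simp: g_def)
    qed
    from lift_on_unique[OF 2(1) con this 2(4), of 0 1] have "\<theta> (1/2) = s'" using \<theta>1 2 by simp
    with a show ?thesis by simp
  qed
  define \<sigma> where "\<sigma> x = (THE s. R x s)" for x
  have \<sigma>: "R x s \<longleftrightarrow> s = \<sigma> x" for x s using ex[of x] uniq unfolding \<sigma>_def by (metis the_equality)
  have "lift_on (\<lambda>x. x) UNIV \<sigma>" unfolding lift_on_def
  proof
    fix x
    obtain g \<theta> where g: "continuous_on UNIV g" "g 0 = x0" "g (1::real) = x" "lift_on g {0..1} \<theta>" "\<theta> 0 = s0" "\<theta> 1 = \<sigma> x"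
      using \<sigma>[of x "\<sigma> x"] unfolding R_def by blast
    have "\<sigma> x \<in> E x" using lift_on_val[OF g(4), of 1] g by simp
    then obtain W h where W: "open W" "x \<in> W" "(W, h) \<in> H" "h x = \<sigma> x" using section_ex[of x] by metis
    obtain V where V: "open V" "x \<in> V" "V \<subseteq> W" "path_connected V" using lpc[OF W(1,2)] by blast
    \<comment> \<open>A path from \<open>x0\<close> to \<open>x\<close> is prolonged by a short path
      inside \<open>V\<close>; along the latter the continuation is given by the single section
      \<open>h\<close>.\<close>
    have "\<sigma> y = h y" if y: "y \<in> V" for y
    proof -
      obtain p where p: "path p" "path_image p \<subseteq> V" "pathstart p = x" "pathfinish p = y"
        using V y unfolding path_connected_def by blast
      define q where "q t = p (cl t)" for t
      have q: "continuous_on UNIV q" "q 0 = x" "q 1 = y" "\<And>t. q t \<in> V"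
        using ext[OF p(1)] p cl01 by (auto simp: q_def pathstart_def pathfinish_def path_image_def)
      define g' where "g' t = (if t \<le> 1/2 then g (2 * t) else q (2 * t - 1))" for t :: real
      have g': "continuous_on UNIV g'" unfolding g'_def
      proof (rule continuous_on_cases_le)
        fix t :: real assume t: "t = 1/2"
        have "g (2 * (1/2)) = q (2 * (1/2) - 1)" using g q by simp
        then show "g (2 * t) = q (2 * t - 1)" unfolding t .
      qed (use g q in \<open>auto intro!: continuous_intros continuous_on_compose2[OF g(1)] continuous_on_compose2[OF q(1)]\<close>)
      have "lift_on (\<lambda>t. g (2 * t)) {0..1/2} (\<lambda>t. \<theta> (2 * t))"
        by (rule lift_on_compose[OF g(4)]) (auto intro!: continuous_intros)
      then have l1: "lift_on g' {0..1/2} (\<lambda>t. \<theta> (2 * t))" by (rule lift_on_cong) (auto simp: g'_def)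
      have g'2: "g' t = q (2 * t - 1)" if "t \<in> {1/2..1}" for t
      proof -
        have "g (2 * (1/2)) = q (2 * (1/2) - 1)" using g q by simp
        moreover have "t = 1/2 \<or> \<not> t \<le> 1/2" using that by auto
        ultimately show ?thesis unfolding g'_def by metis
      qed
      then have l2: "lift_on g' {1/2..1} (\<lambda>t. h (g' t))" using q(4) V(3) by (intro lift_on_section[OF W(3)]) auto
      have "lift_on g' ({0..1/2} \<union> {1/2..1}) (\<lambda>t. if t \<in> {0..1/2} then \<theta> (2 * t) else h (g' t))"
      proof (rule lift_on_glue[OF g' _ _ l1 l2])
        fix k :: real assume "k \<in> {0..1/2} \<inter> {1/2..1}"
        then have k: "k = 1/2" by auto
        show "\<theta> (2 * k) = h (g' k)" unfolding k using g'2[of "1/2"] q g W by simp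
      qed auto
      moreover have "{0..1/2} \<union> {1/2..1} = {0..1::real}" by auto
      ultimately have "R y (h y)" unfolding R_def using g' g q g'2[of 1]
        by (intro exI[of _ g'] exI[of _ "\<lambda>t. if t \<in> {0..1/2} then \<theta> (2 * t) else h (g' t)"]) (auto simp: g'_def)
      then show ?thesis using \<sigma> by simp
    qed
    then have "\<forall>\<^sub>F k' in nhds x. k' \<in> UNIV \<longrightarrow> \<sigma> k' = h k'"
      using V(1,2) unfolding eventually_nhds by blast
    with W show "\<exists>W h. (W, h) \<in> H \<and> x \<in> W \<and> (\<forall>\<^sub>F k' in nhds x. k' \<in> UNIV \<longrightarrow> \<sigma> k' = h k')" by blast
  qed
  moreover have "\<sigma> x0 = s0"
  proof -
    obtain W h where "(W, h) \<in> H" "x0 \<in> W" "h x0 = s0" using section_ex[of x0] s0 by metis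
    then have "lift_on (\<lambda>t::real. x0) {0..1} (\<lambda>t. s0)" using lift_on_section[of W h "\<lambda>_. x0" "{0..1}"] by auto
    then have "R x0 s0" unfolding R_def by (intro exI[of _ "\<lambda>_. x0"] exI[of _ "\<lambda>_. s0"]) auto
    then show ?thesis using \<sigma> by simp
  qed
  ultimately show ?thesis using that by blast
qed

end

section \<open>Transitivity of deck transformations on fibres\<close>

lemma simply_connected_connected:
  assumes "simply_connected (UNIV :: 'a::topological_space set)" shows "connected (UNIV :: 'a set)"
proof -
  have "\<exists>g. path g \<and> path_image g \<subseteq> UNIV \<and> pathstart g = x \<and> pathfinish g = y" for x y :: 'a
  proof -
    have "homotopic_loops UNIV (\<lambda>_. x) (\<lambda>_. y)"
      using assms unfolding simply_connected_def by (auto simp: path_def pathfinish_def pathstart_def)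
    then obtain h where h: "continuous_on ({0..1::real} \<times> {0..1::real}) h" "h (0, 0) = x" "h (1, 0) = y"
      unfolding homotopic_loops by auto
    have "path (\<lambda>t. h (t, 0))" unfolding path_def
      by (rule continuous_on_compose2[OF h(1)]) (auto intro!: continuous_intros)
    with h(2,3) show ?thesis by (intro exI[of _ "\<lambda>t. h (t, 0)"]) (auto simp: pathstart_def pathfinish_def)
  qed
  then show ?thesis by (intro path_connected_imp_connected) (auto simp: path_connected_def)
qed

text \<open>The covering map is lifted through itself with \<open>p\<close> sent to
  \<open>q\<close>, and likewise with \<open>q\<close> sent to \<open>p\<close>. Both composites
  lift the covering map and fix a point, so they are the identity.\<close>

lemma deck_group_transitive:
  fixes \<pi> :: "'u::t2_space \<Rightarrow> 'm::topological_space"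
  assumes sc: "simply_connected (UNIV :: 'u set)" and cov: "covering_space UNIV \<pi> UNIV"
    and lpc: "\<And>W x. open W \<Longrightarrow> x \<in> W \<Longrightarrow> \<exists>V. open V \<and> x \<in> V \<and> V \<subseteq> W \<and> path_connected (V :: 'u set)"
    and pq: "\<pi> p = \<pi> q"
  obtains \<alpha> where "\<alpha> \<in> carrier (deck_group \<pi>)" "\<alpha> p = q"
proof -
  define E where "E x = {y. \<pi> y = \<pi> x}" for x
  define H where "H = {(W, h). open W \<and> continuous_on W h \<and> (\<forall>x\<in>W. \<pi> (h x) = \<pi> x)}"
  have cont: "continuous_on UNIV \<pi>" using covering_space_imp_continuous[OF cov] .
  interpret local_sections E H
  proof
    fix W h W' h' assume 1: "(W, h) \<in> H" and 2: "(W', h') \<in> H"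
    have o: "open W" "open W'" and c: "continuous_on W h" "continuous_on W' h'" using 1 2 by (auto simp: H_def)
    have pre: "open {x \<in> W \<inter> W'. h x \<in> A \<and> h' x \<in> B}" if "open A" "open B" for A B
    proof -
      have "{x \<in> W \<inter> W'. h x \<in> A \<and> h' x \<in> B} = (W \<inter> h -` A) \<inter> (W' \<inter> h' -` B)" by auto
      then show ?thesis using continuous_open_preimage[OF c(1) o(1) that(1)] continuous_open_preimage[OF c(2) o(2) that(2)]
        by (simp add: open_Int)
    qed
    \<comment> \<open>Local injectivity of the covering map forces nearby values of two lifts to
      coincide.\<close>
    show "open {x \<in> W \<inter> W'. h x = h' x}"
    proof (subst open_subopen, clarify)
      fix x assume x: "x \<in> W" "x \<in> W'" "h x = h' x"
      obtain N where N: "open N" "h x \<in> N" "inj_on \<pi> N"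
              proof -
        obtain N u k where "h x \<in> N" "openin (top_of_set UNIV) N" "\<pi> (h x) \<in> u" "openin (top_of_set UNIV) u"
          "homeomorphism N u \<pi> k"
          by (rule covering_space_local_homeomorphism[OF cov UNIV_I])
        moreover from this have "inj_on \<pi> N" by (metis homeomorphism_apply1 inj_on_inverseI)
        ultimately show ?thesis by (intro that[of N]) auto
      qed
      have "{y \<in> W \<inter> W'. h y \<in> N \<and> h' y \<in> N} \<subseteq> {x \<in> W \<inter> W'. h x = h' x}"
      proof
        fix y assume y: "y \<in> {y \<in> W \<inter> W'. h y \<in> N \<and> h' y \<in> N}"
        then have "\<pi> (h y) = \<pi> (h' y)" using 1 2 by (auto simp: H_def)
        then have "h y = h' y" using inj_onD[OF N(3)] y by blast
        then show "y \<in> {x \<in> W \<inter> W'. h x = h' x}" using y by auto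
      qed
      then show "\<exists>T. open T \<and> x \<in> T \<and> T \<subseteq> {x \<in> W \<inter> W'. h x = h' x}"
        using pre[OF N(1,1)] x N(2) by (intro exI[of _ "{y \<in> W \<inter> W'. h y \<in> N \<and> h' y \<in> N}"]) auto
    qed
    \<comment> \<open>Here the Hausdorff property of the covering space separates the
      values.\<close>
    show "open {x \<in> W \<inter> W'. h x \<noteq> h' x}"
    proof (subst open_subopen, clarify)
      fix x assume x: "x \<in> W" "x \<in> W'" "h x \<noteq> h' x"
      obtain A B where AB: "open A" "open B" "h x \<in> A" "h' x \<in> B" "A \<inter> B = {}"
        using hausdorff[OF x(3)] by blast
      then show "\<exists>T. open T \<and> x \<in> T \<and> T \<subseteq> {x \<in> W \<inter> W'. h x \<noteq> h' x}"
        using pre[OF AB(1,2)] x by (intro exI[of _ "{y \<in> W \<inter> W'. h y \<in> A \<and> h' y \<in> B}"]) auto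
    qed
  next
    fix x
    obtain T v where T: "\<pi> x \<in> T" "open T" "\<Union>v = UNIV \<inter> \<pi> -` T" "\<forall>u\<in>v. \<exists>q. homeomorphism u T \<pi> q"
          proof -
      have "\<exists>T. \<pi> x \<in> T \<and> openin (top_of_set UNIV) T \<and> (\<exists>v. \<Union>v = UNIV \<inter> \<pi> -` T \<and>
          (\<forall>u\<in>v. openin (top_of_set UNIV) u) \<and> pairwise disjnt v \<and> (\<forall>u\<in>v. \<exists>q. homeomorphism u T \<pi> q))"
        by (rule bspec[OF cov[unfolded covering_space_def, THEN conjunct2, THEN conjunct2] UNIV_I])
      then show ?thesis using that by auto
    qed
    have W: "open (\<pi> -` T)" using cont T(2) by (simp add: continuous_on_open_vimage)
    have "\<exists>h. (\<pi> -` T, h) \<in> H \<and> h y = s" if y: "y \<in> \<pi> -` T" and s: "s \<in> E y" for y s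
    proof -
      have "s \<in> \<Union>v" using T(3) y s by (auto simp: E_def)
      then obtain u q where u: "u \<in> v" "s \<in> u" "homeomorphism u T \<pi> q" using T(4) by auto
      have "continuous_on (\<pi> -` T) (\<lambda>z. q (\<pi> z))"
        by (rule continuous_on_compose2[of T q]) (use u(3) cont in \<open>auto simp: homeomorphism_def intro: continuous_on_subset\<close>)
      moreover have "q (\<pi> y) = s" using u s homeomorphism_apply1[OF u(3), of s] by (simp add: E_def)
      ultimately show ?thesis using W u(3)
        by (intro exI[of _ "\<lambda>z. q (\<pi> z)"]) (auto simp: H_def homeomorphism_def)
    qed
    then show "\<exists>W. open W \<and> x \<in> W \<and> (\<forall>y\<in>W. \<forall>s\<in>E y. \<exists>h. (W, h) \<in> H \<and> h y = s)"
      using W T(1) by (intro exI[of _ "\<pi> -` T"]) auto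
  qed (auto simp: H_def E_def)
  have lift: "continuous_on UNIV \<sigma> \<and> (\<forall>x. \<pi> (\<sigma> x) = \<pi> x)" if \<sigma>: "lift_on (\<lambda>x. x) UNIV \<sigma>" for \<sigma>
  proof -
    have "isCont \<sigma> x" for x
    proof -
      obtain W h where h: "(W, h) \<in> H" "x \<in> W" "\<forall>\<^sub>F k' in nhds x. k' \<in> UNIV \<longrightarrow> \<sigma> k' = h k'"
        by (rule lift_onE[OF \<sigma> UNIV_I])
      have "isCont h x" using h(1,2) by (auto simp: H_def continuous_on_eq_continuous_at)
      then show ?thesis using isCont_cong[of \<sigma> h x] h(3) by simp
    qed
    then show ?thesis using lift_on_val[OF \<sigma>] by (auto simp: E_def continuous_on_eq_continuous_at)
  qed
  have unique: "\<sigma> x = x" if "continuous_on UNIV \<sigma>" "\<And>x. \<pi> (\<sigma> x) = \<pi> x" "\<sigma> x0 = x0" for \<sigma> x x0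
  proof -
    have "(UNIV, \<sigma>) \<in> H" "(UNIV, \<lambda>x. x) \<in> H" using that by (simp_all add: H_def)
    then have 1: "lift_on (\<lambda>x. x) UNIV \<sigma>" and 2: "lift_on (\<lambda>x. x) UNIV (\<lambda>x. x)"
      using lift_on_section[of UNIV _ "\<lambda>x. x" UNIV] by auto
    show ?thesis
      by (rule lift_on_unique[OF _ simply_connected_connected[OF sc] 1 2, where ?k0.0 = x0]) (use that in auto)
  qed
  obtain \<sigma> where \<sigma>0: "lift_on (\<lambda>x. x) UNIV \<sigma>" "\<sigma> p = q"
    by (rule global_section[OF sc lpc, of q p]) (use pq in \<open>auto simp: E_def\<close>)
  obtain \<tau> where \<tau>0: "lift_on (\<lambda>x. x) UNIV \<tau>" "\<tau> q = p"
    by (rule global_section[OF sc lpc, of p q]) (use pq in \<open>auto simp: E_def\<close>)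
  note \<sigma> = lift[OF \<sigma>0(1)] and \<tau> = lift[OF \<tau>0(1)]
  have 1: "\<tau> (\<sigma> x) = x" for x
    by (rule unique[of "\<lambda>x. \<tau> (\<sigma> x)" p]) (use \<sigma> \<tau> \<sigma>0 \<tau>0 in \<open>auto intro: continuous_on_compose2\<close>)
  have 2: "\<sigma> (\<tau> x) = x" for x
    by (rule unique[of "\<lambda>x. \<sigma> (\<tau> x)" q]) (use \<sigma> \<tau> \<sigma>0 \<tau>0 in \<open>auto intro: continuous_on_compose2\<close>)
  have "homeomorphic_maps euclidean euclidean \<sigma> \<tau>"
    using \<sigma> \<tau> 1 2 by (auto simp: homeomorphic_maps_def)
  then have "homeomorphic_map euclidean euclidean \<sigma>" using homeomorphic_map_maps by blast
  moreover have "bij \<sigma>" using 1 2 by (metis bij_betw_byWitness UNIV_I subset_UNIV)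
  ultimately have "\<sigma> \<in> carrier (deck_group \<pi>)" using \<sigma> by (auto simp: deck_group_def Bij_def)
  with that \<sigma>0(2) show ?thesis by blast
qed

lemma manifold_locally_path_connected:
  fixes A :: "('a::topological_space, 'e::euclidean_space) chart set"
  assumes A: "smooth_manifold euclidean A" and W: "open W" "(x::'a) \<in> W"
  shows "\<exists>V. open V \<and> x \<in> V \<and> V \<subseteq> W \<and> path_connected V"
proof -
  note cA = chart_atlas_manifold[OF A]
  define c where "c = chart_at A x"
  note c = chart_at[OF cA, of x, folded c_def, simplified]
  have "open (snd c ` (W \<inter> fst c))" using chart_atlasD(3)[OF cA c(1), of W] W by simp
  then obtain r where r: "r > 0" "ball (snd c x) r \<subseteq> snd c ` (W \<inter> fst c)"
    using W c open_contains_ball by (metis IntI imageI)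
  define V where "V = {q\<in>fst c. snd c q \<in> ball (snd c x) r}"
  have V1: "V = chart_inv c ` ball (snd c x) r"
    using r(2) chart_inv[OF cA c(1)] by (force simp: V_def)
  have sm: "smooth_map_on euclidean std_atlas euclidean A (snd c ` fst c) (chart_inv c)"
    by (rule smooth_map_on_chart_inv[OF cA c(1)])
  have "continuous_on (ball (snd c x) r) (chart_inv c)"
    unfolding continuous_on_open_invariant
  proof (intro allI impI)
    fix B :: "'a set" assume "open B"
    then have "open {y \<in> snd c ` fst c. chart_inv c y \<in> B}" using smooth_map_onD(3)[OF sm, of B] by simp
    moreover have "{y \<in> snd c ` fst c. chart_inv c y \<in> B} \<inter> ball (snd c x) r = chart_inv c -` B \<inter> ball (snd c x) r"
      using r(2) by auto
    ultimately show "\<exists>A. open A \<and> A \<inter> ball (snd c x) r = chart_inv c -` B \<inter> ball (snd c x) r" by blast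
  qed
  then have "path_connected V" unfolding V1
    by (intro path_connected_continuous_image) (auto intro: convex_imp_path_connected)
  moreover have "V \<subseteq> W" using r(2) chart_inv(1)[OF cA c(1)] unfolding V1 by force
  moreover have "open V" unfolding V_def using chart_atlasD(4)[OF cA c(1), of "ball (snd c x) r"] by simp
  ultimately show ?thesis using r(1) c by (intro exI[of _ V]) (auto simp: V_def)
qed

section \<open>The unit tangent bundle in null coordinates\<close>

lemma sum_UNIV_option: "(\<Sum>i\<in>(UNIV :: 'a::finite option set). f i) = f None + (\<Sum>i\<in>UNIV. f (Some i))"
  by (simp add: UNIV_option_conv sum.reindex)

lemma bounded_bilinear_mink: "bounded_bilinear (mink :: 'n::finite mink \<Rightarrow> _)"
proof -
  have "bilinear (mink :: 'n mink \<Rightarrow> _)"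
    unfolding bilinear_def mink_def
    by (auto intro!: linearI simp: algebra_simps sum.distrib sum_distrib_left)
  then show ?thesis by (simp add: bilinear_conv_bounded_bilinear)
qed

interpretation mink: bounded_bilinear "mink :: 'n::finite mink \<Rightarrow> 'n mink \<Rightarrow> real"
  by (rule bounded_bilinear_mink)

lemmas mink_simps = mink.add_left mink.add_right mink.diff_left mink.diff_right mink.scaleR_left mink.scaleR_right
  mink.minus_left mink.minus_right mink.zero_left mink.zero_right

lemma mink_commute: "mink x y = mink y x"
  by (simp add: mink_def mult.commute)

text \<open>Reflection in the timelike coordinate converts the Minkowski form into the inner
  product, so that nondegeneracy and dimension counts can be taken from Euclidean linear
  algebra.\<close>

definition mink_conj :: "'n::finite mink \<Rightarrow> 'n mink" where
  "mink_conj x = (\<chi> i. if i = None then - (x $ i) else x $ i)"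

lemma mink_inner: "mink x y = mink_conj x \<bullet> y"
  by (simp add: mink_def mink_conj_def inner_vec_def sum_UNIV_option)

lemma mink_conj_conj [simp]: "mink_conj (mink_conj x) = x"
  by (simp add: mink_conj_def vec_eq_iff)

lemma linear_mink_conj: "linear mink_conj"
  by (auto intro!: linearI simp: mink_conj_def vec_eq_iff)

lemma mink_nondegenerate: "(\<And>w. mink x w = 0) \<Longrightarrow> x = 0"
proof -
  assume "\<And>w. mink x w = 0"
  then have "mink_conj x \<bullet> mink_conj x = 0" by (simp add: mink_inner)
  then have "mink_conj x = 0" by simp
  then show "x = 0" by (metis linear_0[OF linear_mink_conj] mink_conj_conj)
qed

lemma smooth_on_mink [smooth_intros]:
  "open S \<Longrightarrow> smooth_on S f \<Longrightarrow> smooth_on S g \<Longrightarrow> smooth_on S (\<lambda>x. mink (f x) (g x))"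
  by (rule smooth_on_bilinear[OF bounded_bilinear_mink])

text \<open>The null vectors \<open>x + v\<close> and \<open>x - v\<close>, on which the flow acts by dilations.\<close>

definition npos :: "'n::finite mink \<times> 'n mink \<Rightarrow> 'n mink" where "npos z = fst z + snd z"
definition nneg :: "'n::finite mink \<times> 'n mink \<Rightarrow> 'n mink" where "nneg z = fst z - snd z"
definition of_null :: "'n::finite mink \<Rightarrow> 'n mink \<Rightarrow> 'n mink \<times> 'n mink" where
  "of_null p q = ((1/2) *\<^sub>R (p + q), (1/2) *\<^sub>R (p - q))"

lemma half_sum: "(1/2) *\<^sub>R (a + b) + (1/2) *\<^sub>R (a - b) = (a :: 'a::real_vector)"
  "(1/2) *\<^sub>R (a + b) - (1/2) *\<^sub>R (a - b) = (b :: 'a::real_vector)"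
  by (simp_all add: algebra_simps scaleR_left_distrib[symmetric])

lemma npos_of_null [simp]: "npos (of_null p q) = p" and nneg_of_null [simp]: "nneg (of_null p q) = q"
  by (simp_all only: npos_def nneg_def of_null_def fst_conv snd_conv half_sum)

lemma of_null_npos_nneg [simp]: "of_null (npos z) (nneg z) = z"
proof -
  have "(a + b) + (a - b) = 2 *\<^sub>R a" "(a + b) - (a - b) = 2 *\<^sub>R b" for a b :: "'a mink"
    by (simp_all add: scaleR_2)
  then show ?thesis by (simp add: of_null_def npos_def nneg_def prod_eq_iff)
qed

lemma null_eqI: "npos z = npos z' \<Longrightarrow> nneg z = nneg z' \<Longrightarrow> z = z'"
  using of_null_npos_nneg by metis

lemma fst_of_null: "fst z = (1/2) *\<^sub>R (npos z + nneg z)" and snd_of_null: "snd z = (1/2) *\<^sub>R (npos z - nneg z)"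
  using of_null_npos_nneg[of z] by (simp_all add: of_null_def prod_eq_iff)

lemma bounded_linear_npos: "bounded_linear npos" and bounded_linear_nneg: "bounded_linear nneg"
  unfolding npos_def[abs_def] nneg_def[abs_def]
  by (intro bounded_linear_add bounded_linear_sub bounded_linear_fst bounded_linear_snd)+

lemma npos_simps: "npos (a + b) = npos a + npos b" "npos (a - b) = npos a - npos b" "npos (c *\<^sub>R a) = c *\<^sub>R npos a" "npos 0 = 0"
  "nneg (a + b) = nneg a + nneg b" "nneg (a - b) = nneg a - nneg b" "nneg (c *\<^sub>R a) = c *\<^sub>R nneg a" "nneg 0 = 0"
  by (simp_all add: npos_def nneg_def algebra_simps)

lemmas smooth_on_npos [smooth_intros] = smooth_on_bounded_linear[OF bounded_linear_npos]
lemmas smooth_on_nneg [smooth_intros] = smooth_on_bounded_linear[OF bounded_linear_nneg]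

lemma smooth_on_of_null [smooth_intros]:
  "open S \<Longrightarrow> smooth_on S f \<Longrightarrow> smooth_on S g \<Longrightarrow> smooth_on S (\<lambda>x. of_null (f x) (g x))"
  unfolding of_null_def by (intro smooth_intros)

section \<open>The geodesic flow in null coordinates\<close>

lemma npos_flow [simp]: "npos (flow t z) = exp t *\<^sub>R npos z" and nneg_flow [simp]: "nneg (flow t z) = exp (- t) *\<^sub>R nneg z"
proof -
  have e: "exp t = cosh t + sinh t" "exp (- t) = cosh t - sinh t" by (simp_all add: cosh_plus_sinh cosh_minus_sinh)
  show "npos (flow t z) = exp t *\<^sub>R npos z" "nneg (flow t z) = exp (- t) *\<^sub>R nneg z"
    unfolding npos_def nneg_def flow_def fst_conv snd_conv e by (simp_all add: algebra_simps)
qed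

lemma flow_of_null: "flow t z = of_null (exp t *\<^sub>R npos z) (exp (- t) *\<^sub>R nneg z)"
  by (rule null_eqI) simp_all

lemma flow_flow: "flow s (flow t z) = flow (s + t) z"
  by (rule null_eqI) (simp_all add: mult_exp_exp algebra_simps)

lemma flow_0 [simp]: "flow 0 z = z"
  by (rule null_eqI) simp_all

lemma linear_flow: "linear (flow t)"
  by (rule linearI; rule null_eqI) (simp_all add: npos_simps scaleR_right_distrib mult.commute)

lemma smooth_on_flow [smooth_intros]:
  "open S \<Longrightarrow> smooth_on S f \<Longrightarrow> smooth_on S g \<Longrightarrow> smooth_on S (\<lambda>x. flow (f x) (g x))"
  unfolding flow_of_null by (intro smooth_intros)

lemma T1hyp_null:
  assumes "z \<in> T1hyp"
  shows "mink (npos z) (npos z) = 0" "mink (nneg z) (nneg z) = 0" "mink (npos z) (nneg z) = -2" "mink (nneg z) (npos z) = -2"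
  using assms mink_commute[of "snd z" "fst z"]
  by (auto simp: T1hyp_def hyp_def npos_def nneg_def mink_simps)

lemma T1hyp_iff:
  "z \<in> T1hyp \<longleftrightarrow> mink (npos z) (npos z) = 0 \<and> mink (nneg z) (nneg z) = 0 \<and> mink (npos z) (nneg z) = -2 \<and>
     (npos z + nneg z) $ None > 0"
proof
  assume z: "z \<in> T1hyp"
  then show "mink (npos z) (npos z) = 0 \<and> mink (nneg z) (nneg z) = 0 \<and> mink (npos z) (nneg z) = -2 \<and>
     (npos z + nneg z) $ None > 0"
    using T1hyp_null[OF z] by (auto simp: npos_def nneg_def T1hyp_def hyp_def)
next
  assume *: "mink (npos z) (npos z) = 0 \<and> mink (nneg z) (nneg z) = 0 \<and> mink (npos z) (nneg z) = -2 \<and>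
     (npos z + nneg z) $ None > 0"
  then have "mink (fst z) (fst z) = -1" "mink (fst z) (snd z) = 0" "mink (snd z) (snd z) = 1" "fst z $ None > 0"
    using mink_commute[of "nneg z" "npos z"] unfolding fst_of_null snd_of_null by (simp_all add: mink_simps)
  then show "z \<in> T1hyp" by (auto simp: T1hyp_def hyp_def split: prod.splits)
qed

text \<open>By the Cauchy-Schwarz inequality the time component of \<open>v\<close> is smaller in
  absolute value than that of \<open>x\<close>. Below, the time component of a null vector is the
  positive functional by which dilation factors are read off.\<close>

lemma T1hyp_pos:
  assumes "z \<in> T1hyp" shows "npos z $ None > 0" "nneg z $ None > 0"
proof -
  define x v where "x = fst z" and "v = snd z"
  define a b c where "a = (\<chi> i. x $ Some i)" and "b = (\<chi> i. v $ Some i)" and "c = a \<bullet> b"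
  have m: "mink x x = -1" "mink x v = 0" "mink v v = 1" "x $ None > 0"
    using assms by (auto simp: T1hyp_def hyp_def x_def v_def)
  have e: "a \<bullet> a = (x $ None)\<^sup>2 - 1" "a \<bullet> b = x $ None * v $ None" "b \<bullet> b = 1 + (v $ None)\<^sup>2"
    using m by (auto simp: mink_def a_def b_def inner_vec_def power2_eq_square)
  have "(a \<bullet> b)\<^sup>2 \<le> (a \<bullet> a) * (b \<bullet> b)" by (rule Cauchy_Schwarz_ineq)
  then have "(v $ None)\<^sup>2 < (x $ None)\<^sup>2" unfolding e by (simp add: algebra_simps power_mult_distrib)
  then have "\<bar>v $ None\<bar> < x $ None" using m(4) by (metis power2_abs power2_less_imp_less less_imp_le)
  then show "npos z $ None > 0" "nneg z $ None > 0" by (auto simp: npos_def nneg_def x_def v_def)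
qed

lemma T1hyp_flow [simp]: "flow t z \<in> T1hyp \<longleftrightarrow> z \<in> T1hyp"
proof -
  have "flow t z \<in> T1hyp" if z: "z \<in> T1hyp" for t z
  proof -
    have "exp t * exp (- t) = (1::real)" "exp (- t) * exp t = (1::real)" by (simp_all add: mult_exp_exp)
    then show ?thesis using T1hyp_null[OF z] T1hyp_pos[OF z] unfolding T1hyp_iff[of "flow t z"]
      by (simp add: mink_simps add_pos_pos)
  qed
  from this[of z t] this[of "flow t z" "- t"] show ?thesis by (auto simp: flow_flow)
qed

lemma flow_inject: "z \<in> T1hyp \<Longrightarrow> flow s z = flow t z \<longleftrightarrow> s = t"
proof
  assume "z \<in> T1hyp" "flow s z = flow t z"
  then have "exp s *\<^sub>R npos z = exp t *\<^sub>R npos z" by (metis npos_flow)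
  moreover have "npos z \<noteq> 0" using T1hyp_pos[OF \<open>z \<in> T1hyp\<close>] by auto
  ultimately show "s = t" by simp
qed simp

lemma geod_eq_iff: "geod z = geod z' \<longleftrightarrow> (\<exists>t. z' = flow t z)"
proof
  assume "geod z = geod z'"
  moreover have "z' \<in> geod z'" unfolding geod_def by (metis flow_0 rangeI)
  ultimately show "\<exists>t. z' = flow t z" by (auto simp: geod_def)
next
  assume "\<exists>t. z' = flow t z"
  then obtain t where t: "z' = flow t z" ..
  show "geod z = geod z'"
  proof (intro equalityI subsetI)
    fix y assume "y \<in> geod z"
    then obtain s where "y = flow s z" by (auto simp: geod_def)
    then have "y = flow (s - t) z'" by (simp add: t flow_flow)
    then show "y \<in> geod z'" by (auto simp: geod_def)
  qed (auto simp: geod_def t flow_flow)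
qed

lemma geod_flow [simp]: "geod (flow t z) = geod z"
  using geod_eq_iff[of z "flow t z"] by auto

section \<open>Tangent vectors orthogonal to the flow\<close>

lemma perp_iff: "w \<in> perp z \<longleftrightarrow> mink (npos z) w = 0 \<and> mink (nneg z) w = 0"
  by (auto simp: perp_def npos_def nneg_def mink_simps)

lemma perp_flow [simp]: "perp (flow t z) = perp z"
  by (auto simp: perp_iff mink_simps)

lemma subspace_perp: "subspace (perp z)"
  by (auto simp: subspace_def perp_def mink_simps)

text \<open>\<open>perp z\<close> is the Euclidean orthogonal complement of the plane spanned by the
  reflections of \<open>x\<close> and \<open>v\<close>, in a space of dimension
  \<open>n + 2\<close>.\<close>

lemma dim_perp:
  fixes z :: "'n::finite mink \<times> 'n mink"
  assumes "z \<in> T1hyp" shows "dim (perp z) = CARD('n)"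
proof -
  define A where "A = {mink_conj (fst z), mink_conj (snd z)}"
  have m: "mink (fst z) (fst z) = -1" "mink (snd z) (snd z) = 1"
    using assms by (auto simp: T1hyp_def hyp_def)
  have 0: "mink_conj (fst z) \<noteq> 0" using m(1) by (auto simp: mink_inner)
  have ind: "mink_conj (snd z) \<notin> span {mink_conj (fst z)}"
  proof
    assume "mink_conj (snd z) \<in> span {mink_conj (fst z)}"
    then obtain k where "mink_conj (snd z) = k *\<^sub>R mink_conj (fst z)" by (auto simp: span_singleton)
    then have "mink_conj (mink_conj (snd z)) = k *\<^sub>R mink_conj (mink_conj (fst z))"
      by (simp add: linear_scale[OF linear_mink_conj])
    then have "snd z = k *\<^sub>R fst z" by simp
    then have "mink (snd z) (snd z) = - (k * k)" using m(1) by (simp add: mink_simps)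
    then show False using m(2) by (smt (verit) zero_le_square)
  qed
  then have "mink_conj (fst z) \<noteq> mink_conj (snd z)" by (metis insertI1 span_base)
  moreover have "independent A" unfolding A_def using 0 ind
    by (metis independent_insert insert_commute dependent_single singletonD)
  ultimately have "dim (span A) = 2" unfolding dim_span by (simp add: dim_eq_card_independent A_def)
  moreover have "{y \<in> UNIV. \<forall>x\<in>span A. orthogonal x y} = perp z"
  proof -
    have "(\<forall>x\<in>span A. orthogonal x y) \<longleftrightarrow> (\<forall>x\<in>A. orthogonal x y)" for y
    proof
      assume "\<forall>x\<in>A. orthogonal x y"
      then show "\<forall>x\<in>span A. orthogonal x y"
        using orthogonal_to_span[of _ A y] by (auto simp: orthogonal_commute)
    qed (auto intro: span_base)
    then show ?thesis by (auto simp: A_def perp_def mink_inner orthogonal_def)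
  qed
  moreover have "DIM('n mink) = CARD('n) + 2" by simp
  ultimately show ?thesis
    using dim_subspace_orthogonal_to_vectors[of "span A" UNIV] by (simp add: subspace_span)
qed

text \<open>The linearization of the three quadratic equations in \<open>T1hyp_iff\<close>.\<close>

definition T1_tan :: "'n::finite mink \<times> 'n mink \<Rightarrow> 'n mink \<times> 'n mink \<Rightarrow> bool" where
  "T1_tan z \<xi> \<longleftrightarrow> mink (npos z) (npos \<xi>) = 0 \<and> mink (nneg z) (nneg \<xi>) = 0 \<and>
     mink (npos z) (nneg \<xi>) + mink (nneg z) (npos \<xi>) = 0"

lemma gen_perp_iff:
  assumes z: "z \<in> T1hyp" shows "\<xi> \<in> gen_perp z \<longleftrightarrow> npos \<xi> \<in> perp z \<and> nneg \<xi> \<in> perp z"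
proof -
  have m: "mink (fst z) (fst z) = -1" "mink (fst z) (snd z) = 0" "mink (snd z) (snd z) = 1" "mink (snd z) (fst z) = 0"
    using z mink_commute[of "snd z" "fst z"] by (auto simp: T1hyp_def hyp_def)
  have g: "gen_comp z (gen z) = 1" "hor_comp z (gen z) = 0" "ver_comp z (gen z) = 0"
    using m by (auto simp: gen_comp_def gen_def hor_comp_def ver_comp_def)
  have p: "fst \<xi> \<in> perp z \<and> snd \<xi> \<in> perp z \<longleftrightarrow> npos \<xi> \<in> perp z \<and> nneg \<xi> \<in> perp z"
  proof
    assume "fst \<xi> \<in> perp z \<and> snd \<xi> \<in> perp z"
    then show "npos \<xi> \<in> perp z \<and> nneg \<xi> \<in> perp z"
      by (auto simp: npos_def nneg_def subspace_add subspace_diff subspace_perp)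
  next
    assume "npos \<xi> \<in> perp z \<and> nneg \<xi> \<in> perp z"
    then show "fst \<xi> \<in> perp z \<and> snd \<xi> \<in> perp z"
      unfolding fst_of_null snd_of_null
      by (meson subspace_add subspace_diff subspace_perp subspace_scale)
  qed
  have "\<xi> \<in> gen_perp z \<longleftrightarrow> fst \<xi> \<in> perp z \<and> snd \<xi> \<in> perp z"
  proof
    assume "\<xi> \<in> gen_perp z"
    then obtain a w1 w2 where *: "\<xi> = a *\<^sub>R gen z + hor_lift w1 + ver_lift w2" "w1 \<in> perp z" "w2 \<in> perp z"
      and 0: "para_sasaki z \<xi> (gen z) = 0"
      by (auto simp: gen_perp_def T1_tangent_def)
    have "a = 0" using decomposition(1)[OF z *(2,3), of a] 0 g by (simp add: *(1) para_sasaki_def mink_simps)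
    then show "fst \<xi> \<in> perp z \<and> snd \<xi> \<in> perp z" using * by (simp add: hor_lift_def ver_lift_def)
  next
    assume w: "fst \<xi> \<in> perp z \<and> snd \<xi> \<in> perp z"
    have "\<xi> = 0 *\<^sub>R gen z + hor_lift (fst \<xi>) + ver_lift (snd \<xi>)" by (simp add: hor_lift_def ver_lift_def prod_eq_iff)
    then have "\<xi> \<in> T1_tangent z" using w unfolding T1_tangent_def by blast
    moreover have "para_sasaki z \<xi> (gen z) = 0" using w g by (simp add: para_sasaki_def mink_simps gen_comp_def perp_def)
    ultimately show "\<xi> \<in> gen_perp z" by (simp add: gen_perp_def)
  qed
  with p show ?thesis by simp
qed

lemma gen_comp_gen_perp: "z \<in> T1hyp \<Longrightarrow> \<xi> \<in> gen_perp z \<Longrightarrow> gen_comp z \<xi> = 0"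
  using gen_perp_iff[of z \<xi>] unfolding gen_comp_def fst_of_null[of \<xi>] by (auto simp: perp_def mink_simps)

lemma subspace_gen_perp: "z \<in> T1hyp \<Longrightarrow> subspace (gen_perp z)"
  unfolding subspace_def by (auto simp: gen_perp_iff npos_simps subspace_0 subspace_add subspace_scale subspace_perp)

text \<open>The polarized form of the identity that the difference of the squares of the horizontal
  and vertical parts is the product of their sum and their difference.\<close>

lemma para_sasaki_null:
  assumes "z \<in> T1hyp" "\<xi> \<in> gen_perp z" "\<eta> \<in> gen_perp z"
  shows "para_sasaki z \<xi> \<eta> = (mink (npos \<xi>) (nneg \<eta>) + mink (nneg \<xi>) (npos \<eta>)) / 2"
  using gen_comp_gen_perp[OF assms(1,2)] gen_comp_gen_perp[OF assms(1,3)]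
  by (simp add: para_sasaki_def hor_comp_def ver_comp_def npos_def nneg_def mink_simps mink_commute)

lemma para_J_null:
  assumes "z \<in> T1hyp" "\<xi> \<in> gen_perp z"
  shows "npos (para_J z \<xi>) = npos \<xi>" "nneg (para_J z \<xi>) = - nneg \<xi>" "para_J z \<xi> \<in> gen_perp z"
proof -
  show 1: "npos (para_J z \<xi>) = npos \<xi>" "nneg (para_J z \<xi>) = - nneg \<xi>"
    using gen_comp_gen_perp[OF assms]
    by (simp_all add: para_J_def hor_comp_def ver_comp_def hor_lift_def ver_lift_def npos_def nneg_def)
  show "para_J z \<xi> \<in> gen_perp z" using assms
    by (auto simp: gen_perp_iff 1 subspace_neg subspace_perp)
qed

lemma flow_gen_perp:
  assumes "z \<in> T1hyp" shows "flow t \<xi> \<in> gen_perp (flow t z) \<longleftrightarrow> \<xi> \<in> gen_perp z"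
  using assms by (auto simp: gen_perp_iff perp_iff mink_simps)

text \<open>On vectors tangent to \<open>T1hyp\<close> this is the projection to
  \<open>gen_perp z\<close> along the generator. The plus sign and the factor \<open>1/2\<close>
  come from \<open>mink (npos z) (nneg z) = -2\<close>.\<close>

definition gen_proj :: "'n::finite mink \<times> 'n mink \<Rightarrow> 'n mink \<times> 'n mink \<Rightarrow> 'n mink \<times> 'n mink" where
  "gen_proj z \<xi> = \<xi> + ((1/2) * mink (npos \<xi>) (nneg z)) *\<^sub>R gen z"

lemma npos_gen [simp]: "npos (gen z) = npos z" and nneg_gen [simp]: "nneg (gen z) = - nneg z"
  by (simp_all add: npos_def nneg_def gen_def)

lemma gen_proj_in:
  assumes z: "z \<in> T1hyp" and "T1_tan z \<xi>" shows "gen_proj z \<xi> \<in> gen_perp z"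
  using assms T1hyp_null[OF z] mink_commute[of "nneg z" "npos \<xi>"]
  by (auto simp: gen_perp_iff perp_iff gen_proj_def T1_tan_def npos_simps mink_simps)

lemma T1_tan_derivative:
  fixes Z :: "'e::real_normed_vector \<Rightarrow> 'n::finite mink \<times> 'n mink"
  assumes D: "(Z has_derivative D) (at y)" and W: "open W" "y \<in> W" "\<And>y. y \<in> W \<Longrightarrow> Z y \<in> T1hyp"
  shows "T1_tan (Z y) (D u)"
proof -
  have const: "mink (f (Z y)) (g (D u)) + mink (f (D u)) (g (Z y)) = 0"
    if f: "bounded_linear f" and g: "bounded_linear g" and c: "\<And>z. z \<in> T1hyp \<Longrightarrow> mink (f z) (g z) = c"
    for f g :: "'n mink \<times> 'n mink \<Rightarrow> 'n mink" and c
  proof -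
    have "((\<lambda>y. mink (f (Z y)) (g (Z y))) has_derivative (\<lambda>u. mink (f (Z y)) (g (D u)) + mink (f (D u)) (g (Z y)))) (at y)"
      by (rule mink.FDERIV[OF bounded_linear.has_derivative[OF f D] bounded_linear.has_derivative[OF g D]])
    moreover have "((\<lambda>y. mink (f (Z y)) (g (Z y))) has_derivative (\<lambda>u. 0)) (at y)"
      by (rule has_derivative_transform_within_open[OF has_derivative_const W(1,2), of c]) (use W c in auto)
    ultimately have "(\<lambda>u. mink (f (Z y)) (g (D u)) + mink (f (D u)) (g (Z y))) = (\<lambda>u. 0)"
      by (rule has_derivative_unique)
    then show ?thesis by meson
  qed
  show ?thesis unfolding T1_tan_def
    using const[OF bounded_linear_npos bounded_linear_npos T1hyp_null(1)]
      const[OF bounded_linear_nneg bounded_linear_nneg T1hyp_null(2)]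
      const[OF bounded_linear_npos bounded_linear_nneg T1hyp_null(3)]
      mink_commute[of "npos (D u)" "npos (Z y)"] mink_commute[of "nneg (D u)" "nneg (Z y)"]
      mink_commute[of "npos (D u)" "nneg (Z y)"] by simp
qed

section \<open>Charts of the space of geodesics\<close>

lemma topspace_geod_top: "topspace geod_top = geodesics"
  using quotient_imp_surjective_map[OF quotient_map_geod] unfolding geodesics_def topspace_euclidean_subtopology
  by (rule sym)

lemma smooth_within_compose:
  fixes s :: "'a::real_normed_vector \<Rightarrow> 'b::euclidean_space"
  assumes f: "smooth_within K f" and s: "smooth_on S s" "open S" "\<And>y. y \<in> S \<Longrightarrow> s y \<in> K"
  shows "smooth_on S (\<lambda>y. f (s y))"
proof (rule smooth_on_local)
  fix y assume y: "y \<in> S"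
  then obtain U g where U: "open U" "s y \<in> U" "smooth_on U g" "\<forall>z\<in>K \<inter> U. g z = f z"
    using f s(3) unfolding smooth_within_def by blast
  define T where "T = S \<inter> s -` U"
  have T: "open T" unfolding T_def by (rule continuous_open_preimage[OF smooth_on_continuous[OF s(1)] s(2) U(1)])
  have "smooth_on T (\<lambda>y. g (s y))"
    by (rule smooth_on_compose[OF U(3,1) T smooth_on_subset[OF s(1)]]) (auto simp: T_def)
  then have "smooth_on T (\<lambda>y. f (s y))"
    by (rule smooth_on_cong[OF _ T]) (use U(4) s(3) in \<open>auto simp: T_def\<close>)
  then show "\<exists>T. open T \<and> y \<in> T \<and> smooth_on T (\<lambda>y. f (s y))" using T y U(2) by (intro exI[of _ T]) (auto simp: T_def)
qed

lemma smooth_within_continuous: "smooth_within K f \<Longrightarrow> continuous_on K f"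
  unfolding continuous_on_eq_continuous_within
proof
  fix x assume f: "smooth_within K f" and x: "x \<in> K"
  then obtain U g where U: "open U" "x \<in> U" "smooth_on U g" "\<forall>y\<in>K \<inter> U. g y = f y"
    unfolding smooth_within_def by blast
  have "continuous (at x within K) g"
    using smooth_on_continuous[OF U(3)] U(1,2) by (simp add: continuous_on_eq_continuous_at continuous_at_imp_continuous_at_within)
  then show "continuous (at x within K) f"
    by (rule continuous_transform_within_openin[where T = K and S = "K \<inter> U"])
      (use U x in \<open>auto simp: openin_open\<close>)
qed

lemma geod_chart:
  assumes "c \<in> geod_atlas"
  shows "openin geod_top (fst c)" "inj_on (snd c) (fst c)" "open (snd c ` fst c)"
    "smooth_within {z \<in> T1hyp. geod z \<in> fst c} (\<lambda>z. snd c (geod z))"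
  using assms by (auto simp: geod_atlas_def o_def)

lemma geod_chart_section:
  assumes "c \<in> geod_atlas"
  obtains s where "smooth_on (snd c ` fst c) s" "\<And>y. y \<in> snd c ` fst c \<Longrightarrow> s y \<in> T1hyp"
    "\<And>y. y \<in> snd c ` fst c \<Longrightarrow> geod (s y) = chart_inv c y"
proof -
  obtain V \<psi> where c: "c = (V, \<psi>)" by (cases c)
  obtain s where "smooth_on (\<psi> ` V) s" "\<forall>y\<in>\<psi> ` V. s y \<in> T1hyp \<and> geod (s y) = inv_into V \<psi> y"
    using assms unfolding geod_atlas_def c by blast
  then show ?thesis using that[of s] unfolding c chart_inv_def fst_conv snd_conv by blast
qed

text \<open>
  Stereographic coordinates for the two endpoints: with \<open>N = perp z0\<close> and the null vectors
  \<open>p\<close>, \<open>q\<close> of \<open>z0\<close>, the null lines other than that of \<open>q\<close> are spanned by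
  \<open>p + a + (\<langle>a, a\<rangle> / 4) q\<close> with \<open>a\<close> in \<open>N\<close>.
\<close>

lemma geod_atlas_cover:
  fixes z0 :: "'n::finite mink \<times> 'n mink"
  assumes z0: "z0 \<in> T1hyp"
  shows "\<exists>c\<in>geod_atlas. geod z0 \<in> fst c"
proof -
  define p q where "p = npos z0" and "q = nneg z0"
  have pq: "mink p p = 0" "mink q q = 0" "mink p q = -2" "mink q p = -2"
    using T1hyp_null[OF z0] by (auto simp: p_def q_def)
  have "dim (UNIV :: (real^'n) set) = dim (perp z0)" using dim_perp[OF z0] by simp
  then obtain L :: "real^'n \<Rightarrow> 'n mink" where L: "linear L" "L ` UNIV = perp z0" "inj_on L UNIV"
    using subspace_isomorphism[OF subspace_UNIV subspace_perp] by blast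
  obtain L' where L': "linear L'" "L' \<circ> L = id" using linear_injective_left_inverse[OF L(1,3)] by blast
  have L'L: "L' (L u) = u" for u using L'(2) by (metis comp_apply id_apply)
  have LL': "L (L' w) = w" if "w \<in> perp z0" for w using that L(2) L'L by (metis imageE)
  have Lp: "mink p (L u) = 0" "mink q (L u) = 0" "mink (L u) p = 0" "mink (L u) q = 0" for u
    using L(2) mink_commute[of "L u"] by (auto simp: perp_iff p_def q_def)
  define h where "h u = mink (L u) (L u) / 4" for u
  define A where "A u = p + L u + h u *\<^sub>R q" for u
  define B where "B w = q + L w + h w *\<^sub>R p" for w
  have AA: "mink (A u) (A u) = 0" and BB: "mink (B u) (B u) = 0" for u
    by (simp_all add: A_def B_def mink_simps pq Lp h_def)
  define \<Omega> where "\<Omega> = {y. mink (A (fst y)) (B (snd y)) < 0 \<and> A (fst y) $ None > 0 \<and> B (snd y) $ None > 0}"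
  \<comment> \<open>The common factor that normalizes the pairing of the two null vectors to -2. The
    square root is written with \<open>exp\<close> and \<open>ln\<close>, for which smoothness is at
    hand.\<close>
  define k where "k y = exp (ln (- 2 / mink (A (fst y)) (B (snd y))) / 2)" for y
  define s where "s y = of_null (k y *\<^sub>R A (fst y)) (k y *\<^sub>R B (snd y))" for y
  have smL: "smooth_on S (\<lambda>y. L (f y))" if "open S" "smooth_on S f" for S and f :: "(real^'n) \<times> (real^'n) \<Rightarrow> real^'n"
    by (rule smooth_on_linear[OF L(1) that])
  have smA: "smooth_on S (\<lambda>y. A (fst y))" and smB: "smooth_on S (\<lambda>y. B (snd y))"
    if "open S" for S :: "((real^'n) \<times> (real^'n)) set"
    unfolding A_def B_def h_def by (intro smooth_intros smL that; simp)+
  have \<Omega>: "open \<Omega>" unfolding \<Omega>_def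
    using smooth_on_continuous[OF smA[OF open_UNIV]] smooth_on_continuous[OF smB[OF open_UNIV]]
    by (intro open_Collect_conj open_Collect_less continuous_intros mink.continuous_on)
  have k: "k y > 0" "k y * k y * mink (A (fst y)) (B (snd y)) = - 2" if "y \<in> \<Omega>" for y
  proof -
    have c: "mink (A (fst y)) (B (snd y)) < 0" using that by (simp add: \<Omega>_def)
    show "k y > 0" by (simp add: k_def)
    have "k y * k y = exp (ln (- 2 / mink (A (fst y)) (B (snd y))))" by (simp add: k_def exp_add[symmetric])
    also have "\<dots> = - 2 / mink (A (fst y)) (B (snd y))" using c by (intro exp_ln) (simp add: field_simps)
    finally show "k y * k y * mink (A (fst y)) (B (snd y)) = - 2" using c by simp
  qed
  have sT: "s y \<in> T1hyp" if y: "y \<in> \<Omega>" for y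
    using k[OF y] y by (simp add: T1hyp_iff s_def mink_simps AA BB mult.assoc \<Omega>_def add_pos_pos)
  have sms: "smooth_on \<Omega> s" unfolding s_def k_def
    by (intro smooth_intros smA smB \<Omega>) (auto simp: \<Omega>_def field_simps)
  \<comment> \<open>The forward endpoint differs from that of \<open>q\<close> and the backward
    endpoint from that of \<open>p\<close>: exactly the geodesics whose two endpoints lie in the
    stereographic charts.\<close>
  define P where "P z \<longleftrightarrow> mink (npos z) q < 0 \<and> mink (nneg z) p < 0" for z
  define ca where "ca z = - mink (npos z) q / 2" for z
  define cb where "cb z = - mink (nneg z) p / 2" for z
  \<comment> \<open>The multiples of \<open>p\<close> and \<open>q\<close> are removed from each
    null vector and the rest is divided by the coefficient of the leading one. The quotient is
    insensitive to dilations, hence to the flow.\<close>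
  define \<Psi> where "\<Psi> z = ((1 / ca z) *\<^sub>R L' (npos z - ca z *\<^sub>R p + (mink (npos z) p / 2) *\<^sub>R q),
     (1 / cb z) *\<^sub>R L' (nneg z - cb z *\<^sub>R q + (mink (nneg z) q / 2) *\<^sub>R p))" for z
  have P_flow: "P (flow t z) \<longleftrightarrow> P z" for t z by (simp add: P_def mink_simps mult_less_0_iff)
  have \<Psi>_flow: "\<Psi> (flow t z) = \<Psi> z" for t z
  proof -
    have c: "ca (flow t z) = exp t * ca z" "cb (flow t z) = exp (- t) * cb z" by (simp_all add: ca_def cb_def mink_simps)
    have 1: "npos (flow t z) - ca (flow t z) *\<^sub>R p + (mink (npos (flow t z)) p / 2) *\<^sub>R q
        = exp t *\<^sub>R (npos z - ca z *\<^sub>R p + (mink (npos z) p / 2) *\<^sub>R q)"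
      unfolding c by (simp add: mink_simps algebra_simps)
    have 2: "nneg (flow t z) - cb (flow t z) *\<^sub>R q + (mink (nneg (flow t z)) q / 2) *\<^sub>R p
        = exp (- t) *\<^sub>R (nneg z - cb z *\<^sub>R q + (mink (nneg z) q / 2) *\<^sub>R p)"
      unfolding c by (simp add: mink_simps algebra_simps)
    show ?thesis unfolding \<Psi>_def 1 2 unfolding c by (simp add: linear_scale[OF L'(1)])
  qed
  define V where "V = {geod z | z. z \<in> T1hyp \<and> P z}"
  define \<psi> where "\<psi> l = \<Psi> (geod_point l)" for l
  have gp: "geod_point (geod z) \<in> T1hyp \<and> geod (geod_point (geod z)) = geod z" if "z \<in> T1hyp" for z :: "'n mink \<times> 'n mink"
    unfolding geod_point_def by (rule someI[of _ z]) (simp add: that)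
  have \<psi>: "\<psi> (geod z) = \<Psi> z" if "z \<in> T1hyp" for z
    using gp[OF that] geod_eq_iff[of z "geod_point (geod z)"] \<Psi>_flow unfolding \<psi>_def by metis
  have V: "geod z \<in> V \<longleftrightarrow> P z" if "z \<in> T1hyp" for z
  proof
    assume "geod z \<in> V"
    then obtain z' where z': "geod z = geod z'" "P z'" unfolding V_def by blast
    then obtain t where "z' = flow t z" using geod_eq_iff by metis
    then show "P z" using z'(2) P_flow by simp
  qed (use that in \<open>unfold V_def, blast\<close>)
  have \<Psi>s: "\<Psi> (s y) = y" "P (s y)" if y: "y \<in> \<Omega>" for y
  proof -
    have c: "ca (s y) = k y" "cb (s y) = k y" by (simp_all add: ca_def cb_def s_def A_def B_def mink_simps pq Lp)
    have 1: "npos (s y) - ca (s y) *\<^sub>R p + (mink (npos (s y)) p / 2) *\<^sub>R q = k y *\<^sub>R L (fst y)"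
      unfolding c by (simp add: s_def A_def mink_simps pq Lp algebra_simps)
    have 2: "nneg (s y) - cb (s y) *\<^sub>R q + (mink (nneg (s y)) q / 2) *\<^sub>R p = k y *\<^sub>R L (snd y)"
      unfolding c by (simp add: s_def B_def mink_simps pq Lp algebra_simps)
    show "\<Psi> (s y) = y" unfolding \<Psi>_def 1 2 unfolding c using k(1)[OF y] by (simp add: linear_scale[OF L'(1)] L'L)
    show "P (s y)" using c k(1)[OF y] by (simp add: P_def ca_def cb_def)
  qed
  have inv: "\<Psi> z \<in> \<Omega> \<and> geod (s (\<Psi> z)) = geod z" if z: "z \<in> T1hyp" "P z" for z
  proof -
    have n: "mink (npos z) (npos z) = 0" "mink (nneg z) (nneg z) = 0" "mink (npos z) (nneg z) = -2"
      using T1hyp_null[OF z(1)] by auto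
    have c: "ca z > 0" "cb z > 0" using z(2) by (auto simp: P_def ca_def cb_def)
    define a where "a = npos z - ca z *\<^sub>R p + (mink (npos z) p / 2) *\<^sub>R q"
    define b where "b = nneg z - cb z *\<^sub>R q + (mink (nneg z) q / 2) *\<^sub>R p"
    have "a \<in> perp z0" "b \<in> perp z0"
      using mink_commute[of p "npos z"] mink_commute[of q "npos z"] mink_commute[of p "nneg z"] mink_commute[of q "nneg z"]
      by (auto simp: perp_iff p_def[symmetric] q_def[symmetric] a_def b_def mink_simps pq ca_def cb_def)
    then have LL: "L (L' a) = a" "L (L' b) = b" by (auto intro: LL')
    have La: "L (fst (\<Psi> z)) = (1 / ca z) *\<^sub>R a" and Lb: "L (snd (\<Psi> z)) = (1 / cb z) *\<^sub>R b"
      unfolding \<Psi>_def fst_conv snd_conv a_def[symmetric] b_def[symmetric] linear_scale[OF L(1)] LL by simp_all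
    have ha: "h (fst (\<Psi> z)) = - mink (npos z) p / (2 * ca z)"
    proof -
      have "mink a a = - 2 * ca z * mink (npos z) p"
        unfolding a_def using mink_commute[of p "npos z"] mink_commute[of q "npos z"]
        by (simp add: mink_simps pq n ca_def algebra_simps)
      then show ?thesis using c by (simp add: h_def La mink_simps field_simps)
    qed
    have hb: "h (snd (\<Psi> z)) = - mink (nneg z) q / (2 * cb z)"
    proof -
      have "mink b b = - 2 * cb z * mink (nneg z) q"
        unfolding b_def using mink_commute[of p "nneg z"] mink_commute[of q "nneg z"]
        by (simp add: mink_simps pq n cb_def algebra_simps)
      then show ?thesis using c by (simp add: h_def Lb mink_simps field_simps)
    qed
    have A: "npos z = ca z *\<^sub>R A (fst (\<Psi> z))"
    proof -
      have "ca z *\<^sub>R A (fst (\<Psi> z)) = ca z *\<^sub>R p + a + (ca z * h (fst (\<Psi> z))) *\<^sub>R q"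
        using c by (simp add: A_def La scaleR_right_distrib)
      also have "\<dots> = npos z" using c unfolding ha a_def by (simp add: field_simps)
      finally show ?thesis by simp
    qed
    have B: "nneg z = cb z *\<^sub>R B (snd (\<Psi> z))"
    proof -
      have "cb z *\<^sub>R B (snd (\<Psi> z)) = cb z *\<^sub>R q + b + (cb z * h (snd (\<Psi> z))) *\<^sub>R p"
        using c by (simp add: B_def Lb scaleR_right_distrib)
      also have "\<dots> = nneg z" using c unfolding hb b_def by (simp add: field_simps)
      finally show ?thesis by simp
    qed
    have m: "ca z * cb z * mink (A (fst (\<Psi> z))) (B (snd (\<Psi> z))) = -2"
    proof -
      have "mink (ca z *\<^sub>R A (fst (\<Psi> z))) (cb z *\<^sub>R B (snd (\<Psi> z))) = -2"
        unfolding A[symmetric] B[symmetric] by (rule n(3))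
      then show ?thesis by (simp add: mink_simps mult.assoc mult.left_commute)
    qed
    have neg: "mink (A (fst (\<Psi> z))) (B (snd (\<Psi> z))) < 0"
    proof (rule ccontr)
      assume "\<not> mink (A (fst (\<Psi> z))) (B (snd (\<Psi> z))) < 0"
      then have "ca z * cb z * mink (A (fst (\<Psi> z))) (B (snd (\<Psi> z))) \<ge> 0" using c by simp
      then show False using m by simp
    qed
    have "ca z * A (fst (\<Psi> z)) $ None > 0" "cb z * B (snd (\<Psi> z)) $ None > 0"
      using T1hyp_pos[OF z(1)] A[symmetric] B[symmetric] by (metis vector_scaleR_component real_scaleR_def)+
    then have "A (fst (\<Psi> z)) $ None > 0" "B (snd (\<Psi> z)) $ None > 0"
      using c by (auto dest: zero_less_mult_pos)
    with neg have \<Omega>z: "\<Psi> z \<in> \<Omega>" by (simp add: \<Omega>_def)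
    \<comment> \<open>The section hits the geodesic of \<open>z\<close> at this flow time. The two
      null components give the same time because
      \<open>k (\<Psi> z) * k (\<Psi> z) = ca z * cb z\<close>.\<close>
    define t where "t = ln (k (\<Psi> z) / ca z)"
    have kk: "k (\<Psi> z) * k (\<Psi> z) = ca z * cb z" "k (\<Psi> z) > 0"
      using k[OF \<Omega>z] m neg by (metis mult_right_cancel less_irrefl)+
    have et: "exp t = k (\<Psi> z) / ca z" unfolding t_def using kk c by (intro exp_ln) simp
    have et': "exp (- t) = k (\<Psi> z) / cb z" unfolding exp_minus et using kk c by (simp add: field_simps)
    have "s (\<Psi> z) = flow t z"
    proof (rule null_eqI)
      show "npos (s (\<Psi> z)) = npos (flow t z)" unfolding npos_flow et using c A by (simp add: s_def)
      show "nneg (s (\<Psi> z)) = nneg (flow t z)" unfolding nneg_flow et' using c B by (simp add: s_def)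
    qed
    with \<Omega>z show ?thesis by simp
  qed
  have im: "\<psi> ` V = \<Omega>"
  proof
    show "\<psi> ` V \<subseteq> \<Omega>"
    proof
      fix y assume "y \<in> \<psi> ` V"
      then obtain z where z: "y = \<psi> (geod z)" "z \<in> T1hyp" "P z" unfolding V_def by blast
      then show "y \<in> \<Omega>" using inv[OF z(2,3)] \<psi>[OF z(2)] by simp
    qed
    show "\<Omega> \<subseteq> \<psi> ` V"
    proof
      fix y assume y: "y \<in> \<Omega>"
      have "geod (s y) \<in> V" "\<psi> (geod (s y)) = y"
        using sT[OF y] \<Psi>s[OF y] V[OF sT[OF y]] \<psi>[OF sT[OF y]] by simp_all
      then show "y \<in> \<psi> ` V" by (metis imageI)
    qed
  qed
  have inj: "inj_on \<psi> V"
  proof (rule inj_on_inverseI[where g = "\<lambda>y. geod (s y)"])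
    fix l assume "l \<in> V"
    then obtain z where z: "l = geod z" "z \<in> T1hyp" "P z" unfolding V_def by blast
    then show "geod (s (\<psi> l)) = l" using inv[OF z(2,3)] \<psi>[OF z(2)] by simp
  qed
  have pre: "{z \<in> T1hyp. geod z \<in> V} = T1hyp \<inter> {z. P z}" using V by blast
  have oP: "open {z. P z}" unfolding P_def
    by (intro open_Collect_conj open_Collect_less continuous_intros mink.continuous_on
        linear_continuous_on bounded_linear_npos bounded_linear_nneg)
  have "openin geod_top V" unfolding openin_geod_top pre
    using oP by (auto simp: V_def geodesics_def openin_open)
  moreover have "smooth_within {z \<in> T1hyp. geod z \<in> V} (\<psi> \<circ> geod)"
    unfolding smooth_within_def
  proof
    fix z assume "z \<in> {z \<in> T1hyp. geod z \<in> V}"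
    then have "P z" using V[of z] by blast
    moreover have "smooth_on {z. P z} \<Psi>" unfolding \<Psi>_def ca_def cb_def
      by (intro smooth_intros oP smooth_on_linear[OF L'(1)]) (auto simp: P_def)
    moreover have "\<forall>y\<in>{z \<in> T1hyp. geod z \<in> V} \<inter> {z. P z}. \<Psi> y = (\<psi> \<circ> geod) y"
    proof
      fix y assume "y \<in> {z \<in> T1hyp. geod z \<in> V} \<inter> {z. P z}"
      then show "\<Psi> y = (\<psi> \<circ> geod) y" using \<psi>[of y] by simp
    qed
    ultimately show "\<exists>U g. open U \<and> z \<in> U \<and> smooth_on U g \<and> (\<forall>y\<in>{z \<in> T1hyp. geod z \<in> V} \<inter> U. g y = (\<psi> \<circ> geod) y)"
      using oP by (intro exI[of _ "{z. P z}"] exI[of _ \<Psi>]) auto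
  qed
  moreover have "geod (s y) = inv_into V \<psi> y" if y: "y \<in> \<Omega>" for y
  proof -
    have "geod (s y) \<in> V" "\<psi> (geod (s y)) = y" using sT[OF y] \<Psi>s[OF y] V[OF sT[OF y]] \<psi>[OF sT[OF y]] by simp_all
    then show ?thesis using inv_into_f_f[OF inj] by metis
  qed
  ultimately have "(V, \<psi>) \<in> geod_atlas" using inj \<Omega> sms sT unfolding geod_atlas_def mem_Collect_eq prod.case im by blast
  moreover have "geod z0 \<in> V" unfolding V[OF z0] using pq by (simp add: P_def p_def[symmetric] q_def[symmetric])
  ultimately show ?thesis by force
qed

lemma chart_atlas_geod: "chart_atlas geod_top (geod_atlas :: ('n::finite geodesic, _) chart set)"
  unfolding chart_atlas_def
proof (intro conjI ballI allI impI)
  fix l :: "'n geodesic" assume "l \<in> topspace geod_top"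
  then show "\<exists>c\<in>geod_atlas. l \<in> fst c" using geod_atlas_cover by (auto simp: topspace_geod_top geodesics_def)
next
  fix c :: "('n geodesic, (real^'n) \<times> (real^'n)) chart" assume c: "c \<in> geod_atlas"
  show "openin geod_top (fst c)" "inj_on (snd c) (fst c)" using geod_chart[OF c] by auto
  have inv: "chart_inv c y \<in> fst c" "snd c (chart_inv c y) = y" if "y \<in> snd c ` fst c" for y
    using that by (simp_all add: chart_inv_def inv_into_into f_inv_into_f)
  have inv2: "chart_inv c (snd c l) = l" if "l \<in> fst c" for l
    using that geod_chart(2)[OF c] by (simp add: chart_inv_def)
  obtain s where s: "smooth_on (snd c ` fst c) s" "\<And>y. y \<in> snd c ` fst c \<Longrightarrow> s y \<in> T1hyp"
    "\<And>y. y \<in> snd c ` fst c \<Longrightarrow> geod (s y) = chart_inv c y" using geod_chart_section[OF c] by blast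
  show op: "open (snd c ` (W \<inter> fst c))" if W: "openin geod_top W" for W
  proof -
    obtain U where U: "open U" "{z \<in> T1hyp. geod z \<in> W} = T1hyp \<inter> U"
      using W unfolding openin_geod_top by (auto simp: openin_open)
    \<comment> \<open>An open set of geodesics has, in coordinates, the form of a preimage under the
      continuous section \<open>s\<close>; this is what the existence of sections in
      \<open>geod_atlas\<close> provides.\<close>
    have "snd c ` (W \<inter> fst c) = snd c ` fst c \<inter> s -` U"
    proof (intro equalityI subsetI)
      fix y assume y: "y \<in> snd c ` (W \<inter> fst c)"
      then obtain l where l: "y = snd c l" "l \<in> W" "l \<in> fst c" by blast
      then have y': "y \<in> snd c ` fst c" by blast
      have "geod (s y) \<in> W" "s y \<in> T1hyp" using s(2,3)[OF y'] inv2[OF l(3)] l by simp_all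
      then show "y \<in> snd c ` fst c \<inter> s -` U" using U y by auto
    next
      fix y assume y: "y \<in> snd c ` fst c \<inter> s -` U"
      then have "s y \<in> {z \<in> T1hyp. geod z \<in> W}" using s(2) U(2) by blast
      then have "chart_inv c y \<in> W" using s(3)[of y] y by simp
      then show "y \<in> snd c ` (W \<inter> fst c)" using inv y by (metis IntD1 IntI imageI)
    qed
    then show ?thesis using continuous_open_preimage[OF smooth_on_continuous[OF s(1)] geod_chart(3)[OF c] U(1)] by simp
  qed
  show "openin geod_top {l \<in> fst c. snd c l \<in> T}" if T: "open T" for T
  proof -
    let ?K = "{z \<in> T1hyp. geod z \<in> fst c}"
    have K: "openin (top_of_set T1hyp) ?K" using geod_chart(1)[OF c] by (simp add: openin_geod_top)
    have "openin (top_of_set ?K) (?K \<inter> (\<lambda>z. snd c (geod z)) -` T)"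
      by (rule continuous_openin_preimage_gen[OF smooth_within_continuous[OF geod_chart(4)[OF c]] T])
    then have "openin (top_of_set T1hyp) (?K \<inter> (\<lambda>z. snd c (geod z)) -` T)" using K openin_trans by blast
    moreover have "?K \<inter> (\<lambda>z. snd c (geod z)) -` T = {z \<in> T1hyp. geod z \<in> {l \<in> fst c. snd c l \<in> T}}" by auto
    moreover have "fst c \<subseteq> geodesics" using geod_chart(1)[OF c] by (simp add: openin_geod_top)
    ultimately show ?thesis unfolding openin_geod_top by auto
  qed
  fix d :: "('n geodesic, (real^'n) \<times> (real^'n)) chart" assume d: "d \<in> geod_atlas"
  have o: "open (snd c ` (fst c \<inter> fst d))" using op[OF geod_chart(1)[OF d]] by (simp add: Int_commute)
  have sub: "snd c ` (fst c \<inter> fst d) \<subseteq> snd c ` fst c" by auto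
  have val: "s y \<in> T1hyp" "geod (s y) = chart_inv c y" "chart_inv c y \<in> fst d"
    if y: "y \<in> snd c ` (fst c \<inter> fst d)" for y
  proof -
    obtain l where l: "y = snd c l" "l \<in> fst c" "l \<in> fst d" using y by blast
    show "s y \<in> T1hyp" "geod (s y) = chart_inv c y" "chart_inv c y \<in> fst d"
      using s(2,3)[of y] subsetD[OF sub y] l inv2[OF l(2)] by simp_all
  qed
  \<comment> \<open>A transition map is the coordinate map of \<open>d\<close>, pulled back to the
    unit tangent bundle, composed with a section over \<open>c\<close>.\<close>
  have "smooth_on (snd c ` (fst c \<inter> fst d)) (\<lambda>y. snd d (geod (s y)))"
    by (rule smooth_within_compose[OF geod_chart(4)[OF d] smooth_on_subset[OF s(1) sub] o])
      (use val in \<open>simp only: mem_Collect_eq simp_thms\<close>)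
  then show "smooth_on (snd c ` (fst c \<inter> fst d)) (snd d \<circ> chart_inv c)"
    by (rule smooth_on_cong[OF _ o]) (use val in \<open>simp only: o_def\<close>)
qed

section \<open>Horizontal lifts\<close>

lemma geod_chart_at:
  assumes "z \<in> T1hyp"
  shows "chart_at geod_atlas (geod z) \<in> geod_atlas" "geod z \<in> fst (chart_at geod_atlas (geod z))"
proof -
  have "geod z \<in> topspace geod_top" using assms by (auto simp: topspace_geod_top geodesics_def)
  from chart_at[OF chart_atlas_geod this]
  show "chart_at geod_atlas (geod z) \<in> geod_atlas" "geod z \<in> fst (chart_at geod_atlas (geod z))" .
qed

lemma geod_diff_derivative:
  assumes z: "z \<in> T1hyp"
  shows "((\<lambda>w. snd (chart_at geod_atlas (geod z)) (geod w)) has_derivative geod_diff z) (at z within T1hyp)"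
proof -
  let ?c = "chart_at geod_atlas (geod z)"
  note c = geod_chart_at[OF z]
  obtain U g where U: "open U" "z \<in> U" "smooth_on U g" "\<forall>y\<in>{z \<in> T1hyp. geod z \<in> fst ?c} \<inter> U. g y = snd ?c (geod y)"
    using geod_chart(4)[OF c(1)] c(2) z unfolding smooth_within_def by blast
  obtain T where T: "open T" "{z \<in> T1hyp. geod z \<in> fst ?c} = T1hyp \<inter> T"
    using geod_chart(1)[OF c(1)] unfolding openin_geod_top by (auto simp: openin_open)
  have g: "(g has_derivative frechet_derivative g (at z)) (at z within T1hyp)"
    using smooth_on_has_derivative[OF U(3,2)] by (rule has_derivative_at_withinI)
  have "\<forall>\<^sub>F w in at z within T1hyp. w \<in> U \<inter> T \<and> w \<in> T1hyp"
    using U(1,2) T z c(2) by (auto simp: eventually_at_topological intro!: exI[of _ "U \<inter> T"])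
  then have "\<forall>\<^sub>F w in at z within T1hyp. g w = snd ?c (geod w)"
    by (rule eventually_mono) (use U(4) T(2) in auto)
  then have "((\<lambda>w. snd ?c (geod w)) has_derivative frechet_derivative g (at z)) (at z within T1hyp)"
    using has_derivative_transform_eventually[OF g] U(2,4) z c(2) by auto
  then have "(\<lambda>w. snd ?c (geod w)) differentiable (at z within T1hyp)" by (auto simp: differentiable_def)
  then show ?thesis unfolding geod_diff_def o_def by (simp add: frechet_derivative_works)
qed

lemma linear_geod_diff: "z \<in> T1hyp \<Longrightarrow> linear (geod_diff z)"
  using geod_diff_derivative has_derivative_linear by blast

text \<open>A derivative within \<open>T1hyp\<close> is determined only on directions tangent to
  \<open>T1hyp\<close>. Composition with maps into \<open>T1hyp\<close> extracts precisely this
  part.\<close>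

lemma geod_diff_compose:
  assumes Z: "(Z has_derivative D) (at y)" and W: "open W" "y \<in> W" "\<And>y. y \<in> W \<Longrightarrow> Z y \<in> T1hyp"
  shows "((\<lambda>y'. snd (chart_at geod_atlas (geod (Z y))) (geod (Z y'))) has_derivative (\<lambda>u. geod_diff (Z y) (D u))) (at y)"
proof -
  have "((\<lambda>w. snd (chart_at geod_atlas (geod (Z y))) (geod w)) has_derivative geod_diff (Z y)) (at (Z y) within Z ` W)"
    by (rule has_derivative_subset[OF geod_diff_derivative[OF W(3)[OF W(2)]]]) (use W in auto)
  from diff_chain_within[OF has_derivative_at_withinI[OF Z] this]
  show ?thesis using at_within_open[OF W(2,1)] by (simp add: o_def)
qed

lemma flow_derivative: "((\<lambda>t. flow t z) has_derivative (\<lambda>h. h *\<^sub>R gen z)) (at 0)"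
proof -
  have 1: "((\<lambda>t::real. exp t *\<^sub>R npos z) has_derivative (\<lambda>h. h *\<^sub>R npos z)) (at 0)"
    by (auto intro!: derivative_eq_intros)
  have 2: "((\<lambda>t::real. exp (- t) *\<^sub>R nneg z) has_derivative (\<lambda>h. - (h *\<^sub>R nneg z))) (at 0)"
    by (auto intro!: derivative_eq_intros)
  have "((\<lambda>t. of_null (exp t *\<^sub>R npos z) (exp (- t) *\<^sub>R nneg z)) has_derivative
     (\<lambda>h. of_null (h *\<^sub>R npos z) (- (h *\<^sub>R nneg z)))) (at 0)"
    unfolding of_null_def
    by (intro has_derivative_Pair has_derivative_scaleR_right has_derivative_add has_derivative_diff 1 2)
  moreover have "of_null (h *\<^sub>R npos z) (- (h *\<^sub>R nneg z)) = h *\<^sub>R gen z" for h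
    by (rule null_eqI) (simp_all add: npos_simps)
  ultimately show ?thesis by (simp add: flow_of_null)
qed

lemma geod_diff_gen: assumes z: "z \<in> T1hyp" shows "geod_diff z (gen z) = 0"
proof -
  have "((\<lambda>t. snd (chart_at geod_atlas (geod (flow 0 z))) (geod (flow t z))) has_derivative
      (\<lambda>h. geod_diff (flow 0 z) (h *\<^sub>R gen z))) (at 0)"
    by (rule geod_diff_compose[OF flow_derivative open_UNIV]) (use z in auto)
  moreover have "((\<lambda>t. snd (chart_at geod_atlas (geod (flow 0 z))) (geod (flow t z))) has_derivative (\<lambda>h. 0)) (at (0::real))"
    by simp
  ultimately have "(\<lambda>h. geod_diff (flow 0 z) (h *\<^sub>R gen z)) = (\<lambda>h. 0)" by (rule has_derivative_unique)
  then have "geod_diff z (1 *\<^sub>R gen z) = 0" by (metis flow_0)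
  then show ?thesis by simp
qed

lemma geod_diff_gen_proj: "z \<in> T1hyp \<Longrightarrow> geod_diff z (gen_proj z \<xi>) = geod_diff z \<xi>"
  using linear_add[OF linear_geod_diff, of z] linear_scale[OF linear_geod_diff, of z] geod_diff_gen[of z]
  by (simp add: gen_proj_def)

text \<open>A section supplied by the atlas meets the geodesic of \<open>z\<close> somewhere on its
  orbit; flowing for a constant time moves it through \<open>z\<close>.\<close>

lemma local_section:
  assumes z: "z \<in> T1hyp"
  defines "c \<equiv> chart_at geod_atlas (geod z)"
  obtains s where "smooth_on (snd c ` fst c) s" "\<And>y. y \<in> snd c ` fst c \<Longrightarrow> s y \<in> T1hyp"
    "\<And>y. y \<in> snd c ` fst c \<Longrightarrow> geod (s y) = chart_inv c y" "s (snd c (geod z)) = z"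
    "\<And>u. geod_diff z (frechet_derivative s (at (snd c (geod z))) u) = u"
proof -
  note c = geod_chart_at[OF z, folded c_def]
  let ?y = "snd c (geod z)"
  have y: "?y \<in> snd c ` fst c" using c by simp
  obtain s0 where s0: "smooth_on (snd c ` fst c) s0" "\<And>y. y \<in> snd c ` fst c \<Longrightarrow> s0 y \<in> T1hyp"
    "\<And>y. y \<in> snd c ` fst c \<Longrightarrow> geod (s0 y) = chart_inv c y" using geod_chart_section[OF c(1)] by blast
  have "geod (s0 ?y) = geod z" using s0(3)[OF y] chart_inv(1)[OF chart_atlas_geod c] by simp
  then obtain t where t: "z = flow t (s0 ?y)" using geod_eq_iff by metis
  define s where "s y = flow t (s0 y)" for y
  have sm: "smooth_on (snd c ` fst c) s" unfolding s_def by (intro smooth_intros s0 geod_chart(3) c)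
  have s: "\<And>y. y \<in> snd c ` fst c \<Longrightarrow> s y \<in> T1hyp" "\<And>y. y \<in> snd c ` fst c \<Longrightarrow> geod (s y) = chart_inv c y" "s ?y = z"
    using s0 t by (auto simp: s_def)
  have "geod_diff z (frechet_derivative s (at ?y) u) = u" for u
  proof -
    have "((\<lambda>y'. snd c (geod (s y'))) has_derivative (\<lambda>u. geod_diff z (frechet_derivative s (at ?y) u))) (at ?y)"
      using geod_diff_compose[OF smooth_on_has_derivative[OF sm y] geod_chart(3)[OF c(1)] y s(1)] s(3) by (simp add: c_def)
    moreover have "((\<lambda>y'. snd c (geod (s y'))) has_derivative (\<lambda>u. u)) (at ?y)"
      by (rule has_derivative_transform_within_open[OF has_derivative_ident geod_chart(3)[OF c(1)] y])
        (use s chart_inv(3)[OF chart_atlas_geod c(1)] in auto)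
    ultimately have "(\<lambda>u. geod_diff z (frechet_derivative s (at ?y) u)) = (\<lambda>u. u)" by (rule has_derivative_unique)
    then show ?thesis by meson
  qed
  with that sm s show ?thesis by blast
qed

lemma dim_gen_perp:
  fixes z :: "'n::finite mink \<times> 'n mink"
  assumes z: "z \<in> T1hyp" shows "dim (gen_perp z) = 2 * CARD('n)"
proof -
  define f where "f y = of_null (fst y) (snd y)" for y :: "'n mink \<times> 'n mink"
  have lin: "linear f"
    by (rule linearI; rule null_eqI) (simp_all add: f_def npos_simps)
  have inj: "inj f"
  proof (rule injI)
    fix x y assume e: "f x = f y"
    have "npos (f x) = npos (f y)" "nneg (f x) = nneg (f y)" by (simp_all only: e)
    then show "x = y" by (simp add: f_def prod_eq_iff)
  qed
  have "gen_perp z = f ` (perp z \<times> perp z)"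
  proof (intro equalityI subsetI)
    fix \<xi> assume "\<xi> \<in> gen_perp z"
    moreover have "\<xi> = f (npos \<xi>, nneg \<xi>)" by (simp add: f_def)
    ultimately show "\<xi> \<in> f ` (perp z \<times> perp z)" using gen_perp_iff[OF z, of \<xi>] by blast
  next
    fix \<xi> assume "\<xi> \<in> f ` (perp z \<times> perp z)"
    then obtain x y where "\<xi> = f (x, y)" "x \<in> perp z" "y \<in> perp z" by blast
    then show "\<xi> \<in> gen_perp z" by (simp add: gen_perp_iff[OF z] f_def)
  qed
  moreover have "dim (f ` (perp z \<times> perp z)) = dim (perp z \<times> perp z)"
    by (rule dim_image_eq[OF lin]) (rule inj_on_subset[OF inj subset_UNIV])
  ultimately show ?thesis using dim_Times[OF subspace_perp subspace_perp, of z z] dim_perp[OF z] by simp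
qed

text \<open>The derivative of a local section, projected along the generator, gives preimages in
  \<open>gen_perp z\<close>; injectivity then follows because both spaces have dimension
  \<open>2 n\<close>.\<close>

lemma bij_betw_geod_diff:
  fixes z :: "'n::finite mink \<times> 'n mink"
  assumes z: "z \<in> T1hyp" shows "bij_betw (geod_diff z) (gen_perp z) UNIV"
proof -
  let ?c = "chart_at geod_atlas (geod z)"
  obtain s where s: "smooth_on (snd ?c ` fst ?c) s" "\<And>y. y \<in> snd ?c ` fst ?c \<Longrightarrow> s y \<in> T1hyp" "s (snd ?c (geod z)) = z"
    "\<And>u. geod_diff z (frechet_derivative s (at (snd ?c (geod z))) u) = u"
    using local_section[OF z] by metis
  note c = geod_chart_at[OF z]
  have y: "snd ?c (geod z) \<in> snd ?c ` fst ?c" using c by simp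
  have lin: "linear (geod_diff z)" by (rule linear_geod_diff[OF z])
  have surj: "geod_diff z ` gen_perp z = UNIV"
  proof -
    have "u \<in> geod_diff z ` gen_perp z" for u
    proof -
      have "T1_tan z (frechet_derivative s (at (snd ?c (geod z))) u)"
        using T1_tan_derivative[OF smooth_on_has_derivative[OF s(1) y] geod_chart(3)[OF c(1)] y s(2)] s(3) by simp
      from gen_proj_in[OF z this] show ?thesis
        using geod_diff_gen_proj[OF z] s(4) by (metis imageI)
    qed
    then show ?thesis by auto
  qed
  obtain B where B: "B \<subseteq> gen_perp z" "independent B" "gen_perp z \<subseteq> span B" "card B = dim (gen_perp z)"
    using basis_exists by blast
  have fB: "finite B" using B(2) by (rule independent_imp_finite)
  have sp: "span B = gen_perp z" using B subspace_gen_perp[OF z] by (metis span_minimal subset_antisym)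
  have sB: "span (geod_diff z ` B) = UNIV" using linear_span_image[OF lin, of B] surj sp by simp
  have d: "dim (UNIV :: ((real^'n) \<times> (real^'n)) set) = card B" using B(4) dim_gen_perp[OF z] by simp
  have "card B \<le> card (geod_diff z ` B)"
    using dim_le_card[of "UNIV :: ((real^'n) \<times> (real^'n)) set" "geod_diff z ` B"] sB fB d by simp
  then have cB: "card (geod_diff z ` B) = card B" using card_image_le[OF fB, of "geod_diff z"] by simp
  then have "inj_on (geod_diff z) B" using eq_card_imp_inj_on[OF fB] by simp
  moreover have "independent (geod_diff z ` B)"
    by (rule card_le_dim_spanning[of _ UNIV]) (use sB fB d cB in auto)
  ultimately have "inj_on (geod_diff z) (span B)" using linear_inj_on_span_independent_image[OF lin] by blast
  then show ?thesis using surj by (simp add: sp bij_betw_def)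
qed

lemma geod_lift:
  assumes z: "z \<in> T1hyp"
  shows "geod_lift z X \<in> gen_perp z" "geod_diff z (geod_lift z X) = X"
    "\<xi> \<in> gen_perp z \<Longrightarrow> geod_lift z (geod_diff z \<xi>) = \<xi>" "linear (geod_lift z)"
proof -
  note b = bij_betw_geod_diff[OF z]
  have X: "X \<in> geod_diff z ` gen_perp z" for X using b by (simp add: bij_betw_def)
  show 1: "geod_lift z X \<in> gen_perp z" "geod_diff z (geod_lift z X) = X" for X
    using X[of X] by (simp_all add: geod_lift_def inv_into_into f_inv_into_f)
  show 2: "\<xi> \<in> gen_perp z \<Longrightarrow> geod_lift z (geod_diff z \<xi>) = \<xi>" for \<xi>
    using b by (simp add: geod_lift_def bij_betw_def)
  show "linear (geod_lift z)"
  proof (rule linearI)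
    fix X Y r
    have "geod_lift z X + geod_lift z Y \<in> gen_perp z" "r *\<^sub>R geod_lift z X \<in> gen_perp z"
      using 1 subspace_gen_perp[OF z] by (auto simp: subspace_add subspace_scale)
    from 2[OF this(1)] 2[OF this(2)]
    show "geod_lift z (X + Y) = geod_lift z X + geod_lift z Y" "geod_lift z (r *\<^sub>R X) = r *\<^sub>R geod_lift z X"
      by (simp_all add: linear_add[OF linear_geod_diff[OF z]] linear_scale[OF linear_geod_diff[OF z]] 1)
  qed
qed

text \<open>The tool by which all tangent vectors to the space of geodesics are computed: lift a
  family of geodesics arbitrarily to \<open>Z\<close>, differentiate in the ambient vector space,
  and project along the generator.\<close>

lemma geod_lift_derivative:
  assumes Z: "(Z has_derivative D) (at y)" and W: "open W" "y \<in> W" "\<And>y. y \<in> W \<Longrightarrow> Z y \<in> T1hyp"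
  shows "geod_lift (Z y) (frechet_derivative (\<lambda>y'. snd (chart_at geod_atlas (geod (Z y))) (geod (Z y'))) (at y) u)
     = gen_proj (Z y) (D u)"
proof -
  have z: "Z y \<in> T1hyp" using W by blast
  have "frechet_derivative (\<lambda>y'. snd (chart_at geod_atlas (geod (Z y))) (geod (Z y'))) (at y) u = geod_diff (Z y) (gen_proj (Z y) (D u))"
    using frechet_derivative_eqI[OF geod_diff_compose[OF assms]] geod_diff_gen_proj[OF z] by simp
  then show ?thesis using geod_lift(3)[OF z gen_proj_in[OF z T1_tan_derivative[OF assms]]] by simp
qed

text \<open>If \<open>s\<close> is a section through \<open>z\<close>, then
  \<open>flow t \<circ> s\<close> is one through \<open>flow t z\<close>, and the flow commutes with
  \<open>gen_proj\<close>. This makes the arbitrary choice in \<open>geod_point\<close>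
  harmless.\<close>

lemma geod_lift_flow:
  assumes z: "z \<in> T1hyp" shows "geod_lift (flow t z) X = flow t (geod_lift z X)"
proof -
  let ?c = "chart_at geod_atlas (geod z)" and ?y = "snd (chart_at geod_atlas (geod z)) (geod z)"
  obtain s where s: "smooth_on (snd ?c ` fst ?c) s" "\<And>y. y \<in> snd ?c ` fst ?c \<Longrightarrow> s y \<in> T1hyp" "s ?y = z"
    "\<And>y. y \<in> snd ?c ` fst ?c \<Longrightarrow> geod (s y) = chart_inv ?c y"
    using local_section[OF z] by metis
  note c = geod_chart_at[OF z]
  have y: "?y \<in> snd ?c ` fst ?c" using c by simp
  have o: "open (snd ?c ` fst ?c)" by (rule geod_chart(3)[OF c(1)])
  define D where "D = frechet_derivative s (at ?y)"
  have D: "(s has_derivative D) (at ?y)" unfolding D_def by (rule smooth_on_has_derivative[OF s(1) y])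
  have D': "((\<lambda>y. flow t (s y)) has_derivative (\<lambda>u. flow t (D u))) (at ?y)"
    by (rule bounded_linear.has_derivative[OF _ D]) (simp add: linear_conv_bounded_linear[symmetric] linear_flow)
  have "frechet_derivative (\<lambda>y'. snd ?c (geod (s y'))) (at ?y) X = X"
  proof -
    have "((\<lambda>y'. snd ?c (geod (s y'))) has_derivative (\<lambda>u. u)) (at ?y)"
      by (rule has_derivative_transform_within_open[OF has_derivative_ident o y])
        (use s chart_inv(3)[OF chart_atlas_geod c(1)] in auto)
    then show ?thesis by (simp add: frechet_derivative_eqI)
  qed
  then have "geod_lift z X = gen_proj z (D X)" "geod_lift (flow t z) X = gen_proj (flow t z) (flow t (D X))"
    using geod_lift_derivative[OF D o y s(2), of X] geod_lift_derivative[OF D' o y, of X] s(2,3) by simp_all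
  moreover have "gen_proj (flow t z) (flow t (D X)) = flow t (gen_proj z (D X))"
    by (rule null_eqI) (simp_all add: gen_proj_def npos_simps mink_simps mult_exp_exp scaleR_right_distrib scaleR_right_diff_distrib)
  ultimately show ?thesis by simp
qed

section \<open>The metric, the tensor J and the symplectic form in terms of lifts\<close>

lemma geod_point:
  assumes "z \<in> T1hyp" obtains t where "geod_point (geod z) = flow t z"
proof -
  have "geod_point (geod z) \<in> T1hyp \<and> geod (geod_point (geod z)) = geod z"
    unfolding geod_point_def by (rule someI[of _ z]) (simp add: assms)
  then show ?thesis using that geod_eq_iff by metis
qed

lemma exp_cancel: "exp (- t) * (exp t * a) = (a :: real)" "exp t * (exp (- t) * a) = (a :: real)"
  by (simp_all add: mult.assoc[symmetric] mult_exp_exp)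

text \<open>The metric pairs one positive with one negative null component, so the dilation factors
  of the flow cancel and any point on the geodesic may be used.\<close>

lemma geod_metric_eq:
  assumes z: "z \<in> T1hyp"
  shows "geod_metric (geod z) X Y = (mink (npos (geod_lift z X)) (nneg (geod_lift z Y)) + mink (nneg (geod_lift z X)) (npos (geod_lift z Y))) / 2"
proof -
  obtain t where t: "geod_point (geod z) = flow t z" using geod_point[OF z] .
  have "flow t z \<in> T1hyp" using z by simp
  from para_sasaki_null[OF this geod_lift(1)[OF this, of X] geod_lift(1)[OF this, of Y]] show ?thesis
    unfolding geod_metric_def t geod_lift_flow[OF z] by (simp add: mink_simps exp_cancel)
qed

lemma geod_lift_J:
  assumes z: "z \<in> T1hyp"
  shows "npos (geod_lift z (geod_J (geod z) X)) = npos (geod_lift z X)" "nneg (geod_lift z (geod_J (geod z) X)) = - nneg (geod_lift z X)"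
proof -
  obtain t where t: "geod_point (geod z) = flow t z" using geod_point[OF z] .
  have z': "flow t z \<in> T1hyp" using z by simp
  note J = para_J_null[OF z' geod_lift(1)[OF z', of X]]
  have "flow t (geod_lift z (geod_J (geod z) X)) = para_J (flow t z) (geod_lift (flow t z) X)"
    unfolding geod_lift_flow[OF z, symmetric] geod_J_def t by (rule geod_lift(3)[OF z' J(3)])
  then have "npos (flow t (geod_lift z (geod_J (geod z) X))) = npos (flow t (geod_lift z X))"
    "nneg (flow t (geod_lift z (geod_J (geod z) X))) = - nneg (flow t (geod_lift z X))"
    using J(1,2) geod_lift_flow[OF z, of t X] by simp_all
  then show "npos (geod_lift z (geod_J (geod z) X)) = npos (geod_lift z X)" "nneg (geod_lift z (geod_J (geod z) X)) = - nneg (geod_lift z X)"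
    by (simp_all add: scaleR_minus_right[symmetric] del: scaleR_minus_right)
qed

lemma geod_symp_eq:
  assumes z: "z \<in> T1hyp"
  shows "geod_symp (geod z) X Y = (mink (nneg (geod_lift z X)) (npos (geod_lift z Y)) - mink (npos (geod_lift z X)) (nneg (geod_lift z Y))) / 2"
  unfolding geod_symp_def geod_metric_eq[OF z] geod_lift_J[OF z] by (simp add: mink_simps)

section \<open>Flat sections\<close>

lemma gen_proj_gen_perp: "z \<in> T1hyp \<Longrightarrow> \<xi> \<in> gen_perp z \<Longrightarrow> gen_proj z \<xi> = \<xi>"
  using mink_commute[of "npos \<xi>" "nneg z"] by (simp add: gen_proj_def gen_perp_iff perp_iff)

lemma gen_perpI: "z \<in> T1hyp \<Longrightarrow> T1_tan z \<xi> \<Longrightarrow> mink (npos \<xi>) (nneg z) = 0 \<Longrightarrow> \<xi> \<in> gen_perp z"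
  using mink_commute[of "npos \<xi>" "nneg z"] by (simp add: gen_perp_iff perp_iff T1_tan_def)

lemma gen_perp_mink:
  assumes "z \<in> T1hyp" "\<xi> \<in> gen_perp z"
  shows "mink (npos \<xi>) (npos z) = 0" "mink (npos \<xi>) (nneg z) = 0" "mink (nneg \<xi>) (npos z) = 0" "mink (nneg \<xi>) (nneg z) = 0"
    "mink (npos z) (npos \<xi>) = 0" "mink (nneg z) (npos \<xi>) = 0" "mink (npos z) (nneg \<xi>) = 0" "mink (nneg z) (nneg \<xi>) = 0"
  using assms mink_commute[of _ "npos z"] mink_commute[of _ "nneg z"] by (simp_all add: gen_perp_iff perp_iff)

definition flat_on ::
  "('u::topological_space, real^'n) chart set \<Rightarrow> ('u \<Rightarrow> ('n::finite) geodesic) \<Rightarrow> 'u set \<Rightarrow>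
   ('u \<Rightarrow> 'n mink \<times> 'n mink) \<Rightarrow> bool" where
  "flat_on A G W \<zeta> \<longleftrightarrow> smooth_map_on euclidean A euclidean std_atlas W \<zeta> \<and>
     (\<forall>p\<in>W. \<zeta> p \<in> T1hyp \<and> geod (\<zeta> p) = G p \<and> (\<forall>v. tangent_map A std_atlas \<zeta> p v \<in> gen_perp (\<zeta> p)))"

lemma flat_onD:
  assumes "flat_on A G W \<zeta>"
  shows "smooth_map_on euclidean A euclidean std_atlas W \<zeta>" "p \<in> W \<Longrightarrow> \<zeta> p \<in> T1hyp"
    "p \<in> W \<Longrightarrow> geod (\<zeta> p) = G p" "p \<in> W \<Longrightarrow> tangent_map A std_atlas \<zeta> p v \<in> gen_perp (\<zeta> p)" "open W"
  using assms by (auto simp: flat_on_def smooth_map_on_def)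

text \<open>This locale is interpreted a second time for \<open>G\<close> composed with a deck
  transformation, in \<open>equivariant_flow\<close>.\<close>

locale lagrangian_map =
  fixes A :: "('u::t2_space, real^'n::finite) chart set" and G :: "'u \<Rightarrow> 'n geodesic"
  assumes manifold: "smooth_manifold euclidean A"
    and smooth_G: "smooth_map_on euclidean A geod_top geod_atlas UNIV G"
    and lagrangian_G: "lagrangian A G"
begin

lemma atlas: "chart_atlas euclidean A"
  by (rule chart_atlas_manifold[OF manifold])

lemma chart_at_A: "chart_at A p \<in> A" "p \<in> fst (chart_at A p)"
  using chart_at[OF atlas, of p] by auto

lemma flat_section_iff: "flat_section A G \<zeta> \<longleftrightarrow> flat_on A G UNIV \<zeta>"
proof -
  have "smooth_map euclidean A euclidean std_atlas \<zeta> \<longleftrightarrow> smooth_map_on euclidean A euclidean std_atlas UNIV \<zeta>"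
    using smooth_map_on_if_smooth_map[OF _ atlas, of euclidean std_atlas \<zeta>]
      smooth_map_if_smooth_map_on[OF _ atlas, of euclidean std_atlas \<zeta>] by auto
  then show ?thesis by (auto simp: flat_section_def flat_on_def)
qed

lemma chart_lift:
  assumes c: "c \<in> A" and S: "open S" "S \<subseteq> snd c ` fst c" and Z: "smooth_on S Z"
    and ZT: "\<And>y. y \<in> S \<Longrightarrow> Z y \<in> T1hyp" and ZG: "\<And>y. y \<in> S \<Longrightarrow> geod (Z y) = G (chart_inv c y)" and y: "y \<in> S"
  shows "geod_lift (Z y) (tangent_map A geod_atlas G (chart_inv c y) (coord_field A c w (chart_inv c y)))
    = gen_proj (Z y) (frechet_derivative Z (at y) w)"
proof -
  have "tangent_map A geod_atlas G (chart_inv c y) (coord_field A c w (chart_inv c y)) =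
      tangent_map std_atlas geod_atlas (\<lambda>y. G (chart_inv c y)) y w"
    by (rule tangent_map_coord_field[OF atlas chart_atlas_geod c smooth_G]) (use S y in auto)
  also have "\<dots> = frechet_derivative (\<lambda>y'. snd (chart_at geod_atlas (geod (Z y))) (G (chart_inv c y'))) (at y) w"
    unfolding tangent_map_def using ZG[OF y] by (simp add: o_def)
  also have "\<dots> = frechet_derivative (\<lambda>y'. snd (chart_at geod_atlas (geod (Z y))) (geod (Z y'))) (at y) w"
    by (subst frechet_derivative_cong_open[OF S(1) y, of _ "\<lambda>y'. snd (chart_at geod_atlas (geod (Z y))) (geod (Z y'))"])
      (simp_all only: ZG)
  finally show ?thesis
    using geod_lift_derivative[OF smooth_on_has_derivative[OF Z y] S(1) y ZT] by simp
qed

text \<open>Valid for every lift \<open>Z\<close>, horizontal or not: the projection along the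
  generator changes both sides by the same term, a product of two values of the connection form. For
  a general lift this says that the connection form pulled back by \<open>Z\<close> is
  closed.\<close>

lemma lagrangian_chart:
  assumes c: "c \<in> A" and S: "open S" "S \<subseteq> snd c ` fst c" and Z: "smooth_on S Z"
    and ZT: "\<And>y. y \<in> S \<Longrightarrow> Z y \<in> T1hyp" and ZG: "\<And>y. y \<in> S \<Longrightarrow> geod (Z y) = G (chart_inv c y)" and y: "y \<in> S"
  shows "mink (nneg (frechet_derivative Z (at y) u)) (npos (frechet_derivative Z (at y) w)) =
    mink (npos (frechet_derivative Z (at y) u)) (nneg (frechet_derivative Z (at y) w))"
proof -
  define X where "X w = tangent_map A geod_atlas G (chart_inv c y) (coord_field A c w (chart_inv c y))" for w
  define D where "D = frechet_derivative Z (at y)"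
  note z = ZT[OF y]
  have "geod_symp (geod (Z y)) (X u) (X w) = 0"
    using lagrangian_G unfolding lagrangian_def X_def ZG[OF y] by blast
  moreover have "geod_lift (Z y) (X w) = gen_proj (Z y) (D w)" for w
    unfolding X_def D_def by (rule chart_lift[OF assms])
  ultimately have "mink (nneg (gen_proj (Z y) (D u))) (npos (gen_proj (Z y) (D w))) =
      mink (npos (gen_proj (Z y) (D u))) (nneg (gen_proj (Z y) (D w)))"
    by (simp add: geod_symp_eq[OF z])
  moreover have t: "T1_tan (Z y) (D w)" for w unfolding D_def
    by (rule T1_tan_derivative[OF smooth_on_has_derivative[OF Z y] S(1) y ZT])
  have m: "mink (nneg (D w)) (npos (Z y)) = - mink (npos (D w)) (nneg (Z y))"
    "mink (npos (Z y)) (nneg (D w)) = - mink (npos (D w)) (nneg (Z y))"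
    "mink (nneg (Z y)) (npos (D w)) = mink (npos (D w)) (nneg (Z y))" for w
    using t[of w] mink_commute[of "nneg (D w)" "npos (Z y)"] mink_commute[of "npos (D w)" "nneg (Z y)"]
    by (auto simp: T1_tan_def)
  ultimately show ?thesis using T1hyp_null[OF z]
    by (simp add: gen_proj_def npos_simps mink_simps m D_def[symmetric] algebra_simps)
qed

lemma flat_chart:
  assumes c: "c \<in> A" and \<zeta>: "flat_on A G W \<zeta>"
  defines "S \<equiv> snd c ` (W \<inter> fst c)" and "Z \<equiv> \<lambda>y. \<zeta> (chart_inv c y)"
  shows "open S" "S \<subseteq> snd c ` fst c" "smooth_on S Z" "y \<in> S \<Longrightarrow> Z y \<in> T1hyp" "y \<in> S \<Longrightarrow> geod (Z y) = G (chart_inv c y)"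
    "y \<in> S \<Longrightarrow> frechet_derivative Z (at y) w \<in> gen_perp (Z y)"
    "y \<in> S \<Longrightarrow> tangent_map A std_atlas \<zeta> (chart_inv c y) (coord_field A c w (chart_inv c y)) = frechet_derivative Z (at y) w"
proof -
  note f = flat_onD[OF \<zeta>]
  show "open S" unfolding S_def by (rule chart_atlasD(3)[OF atlas c]) (use f(5) in simp)
  show sub: "S \<subseteq> snd c ` fst c" by (auto simp: S_def)
  show "smooth_on S Z" unfolding S_def Z_def by (rule smooth_map_on_std_chart[OF f(1) c])
  have W: "chart_inv c y \<in> W" if "y \<in> S" for y using that chart_inv(1)[OF atlas c] by (auto simp: S_def)
  show "y \<in> S \<Longrightarrow> Z y \<in> T1hyp" "y \<in> S \<Longrightarrow> geod (Z y) = G (chart_inv c y)"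
    using f(2,3)[OF W] by (auto simp: Z_def)
  show t: "y \<in> S \<Longrightarrow> tangent_map A std_atlas \<zeta> (chart_inv c y) (coord_field A c w (chart_inv c y)) = frechet_derivative Z (at y) w"
    unfolding S_def Z_def by (rule tangent_map_coord_field_std[OF atlas c f(1)])
  show "y \<in> S \<Longrightarrow> frechet_derivative Z (at y) w \<in> gen_perp (Z y)"
    using f(4)[OF W] t by (metis Z_def)
qed

text \<open>Two lifts differ by a time-dependent flow, that is, by a dilation of
  \<open>npos\<close>. Pairing the derivative of this relation with \<open>nneg\<close> kills both
  horizontal terms and leaves the derivative of the dilation factor, which must vanish.\<close>

lemma flat_unique_local:
  assumes 1: "flat_on A G W \<zeta>" and 2: "flat_on A G W' \<zeta>'" and p: "p \<in> W" "p \<in> W'"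
  obtains V t where "open V" "p \<in> V" "V \<subseteq> W \<inter> W'" "\<And>q. q \<in> V \<Longrightarrow> \<zeta>' q = flow t (\<zeta> q)"
proof -
  define c where "c = chart_at A p"
  note c = chart_at_A[of p, folded c_def]
  define Z Z' where "Z y = \<zeta> (chart_inv c y)" and "Z' y = \<zeta>' (chart_inv c y)" for y
  define S S' where "S = snd c ` (W \<inter> fst c)" and "S' = snd c ` (W' \<inter> fst c)"
  note Z = flat_chart[OF c(1) 1, folded Z_def S_def] and Z' = flat_chart[OF c(1) 2, folded Z'_def S'_def]
  have "snd c p \<in> S \<inter> S'" using c p by (auto simp: S_def S'_def)
  then obtain r where r: "r > 0" "ball (snd c p) r \<subseteq> S \<inter> S'"
    using openE[OF open_Int[OF Z(1) Z'(1)]] by blast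
  define B where "B = ball (snd c p) r"
  have B: "open B" "convex B" "snd c p \<in> B" "B \<subseteq> S" "B \<subseteq> S'" using r by (auto simp: B_def)
  have pos: "npos (Z y) $ None > 0" "npos (Z' y) $ None > 0" if "y \<in> B" for y
    using T1hyp_pos(1)[OF Z(4)[OF subsetD[OF B(4) that]]] T1hyp_pos(1)[OF Z'(4)[OF subsetD[OF B(5) that]]] by auto
  define l where "l y = npos (Z' y) $ None / npos (Z y) $ None" for y
  have lpos: "l y > 0" if "y \<in> B" for y using pos[OF that] by (simp add: l_def)
  have fl: "Z' y = flow (ln (l y)) (Z y)" if y: "y \<in> B" for y
  proof -
    have "geod (Z y) = geod (Z' y)" using Z(5)[OF subsetD[OF B(4) y]] Z'(5)[OF subsetD[OF B(5) y]] by simp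
    then obtain t where t: "Z' y = flow t (Z y)" using geod_eq_iff by blast
    then have "l y = exp t" using pos(1)[OF y] by (simp add: l_def)
    then show ?thesis using t by simp
  qed
  have sl: "smooth_on B l" unfolding l_def
    by (intro smooth_intros B smooth_on_subset[OF Z(3)] smooth_on_subset[OF Z'(3)]) (use pos in force)
  have "(l has_derivative (\<lambda>h. 0)) (at y)" if y: "y \<in> B" for y
  proof -
    note dl = smooth_on_has_derivative[OF sl y]
    have yS: "y \<in> S" "y \<in> S'" using y B by auto
    note dP = bounded_linear.has_derivative[OF bounded_linear_npos smooth_on_has_derivative[OF Z(3) yS(1)]]
    note dP' = bounded_linear.has_derivative[OF bounded_linear_npos smooth_on_has_derivative[OF Z'(3) yS(2)]]
    have "((\<lambda>y. l y *\<^sub>R npos (Z y)) has_derivative (\<lambda>h. npos (frechet_derivative Z' (at y) h))) (at y)"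
      by (rule has_derivative_transform_within_open[OF dP' B(1) y]) (use fl lpos in simp)
    from has_derivative_unique[OF this has_derivative_scaleR[OF dl dP]]
    have eq: "npos (frechet_derivative Z' (at y) h) = l y *\<^sub>R npos (frechet_derivative Z (at y) h) + frechet_derivative l (at y) h *\<^sub>R npos (Z y)" for h
      by metis
    have "frechet_derivative l (at y) h = 0" for h
    proof -
      have "nneg (Z' y) = exp (- ln (l y)) *\<^sub>R nneg (Z y)" using fl[OF y] by simp
      then have "mink (npos (frechet_derivative Z' (at y) h)) (nneg (Z y)) = 0"
        using gen_perp_mink(2)[OF Z'(4)[OF yS(2)] Z'(6)[OF yS(2)], of h] by (simp add: mink_simps)
      then show ?thesis unfolding eq
        using gen_perp_mink(2)[OF Z(4)[OF yS(1)] Z(6)[OF yS(1)], of h] T1hyp_null(3)[OF Z(4)[OF yS(1)]] by (simp add: mink_simps)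
    qed
    then have "frechet_derivative l (at y) = (\<lambda>h. 0)" by auto
    with dl show ?thesis by simp
  qed
  then obtain k where k: "\<And>y. y \<in> B \<Longrightarrow> l y = k"
    using has_derivative_zero_constant[OF B(2), of l] has_derivative_at_withinI by metis
  define V where "V = {q \<in> fst c. snd c q \<in> B}"
  show ?thesis
  proof (rule that[of V "ln k"])
    show "open V" unfolding V_def using chart_atlasD(4)[OF atlas c(1) B(1)] by simp
    show "p \<in> V" using c B by (simp add: V_def)
    have "q \<in> W \<and> q \<in> W'" if q: "q \<in> V" for q
    proof -
      have "snd c q \<in> S" "snd c q \<in> S'" "q \<in> fst c" using q B by (auto simp: V_def)
      then show ?thesis using chart_atlasD(2)[OF atlas c(1)] by (auto simp: S_def S'_def dest: inj_onD)
    qed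
    then show "V \<subseteq> W \<inter> W'" by auto
    show "\<zeta>' q = flow (ln k) (\<zeta> q)" if "q \<in> V" for q
      using fl[of "snd c q"] k[of "snd c q"] that chart_inv(1)[OF atlas c(1), of q] by (simp add: V_def Z_def Z'_def)
  qed
qed

lemma flat_unique:
  assumes con: "connected (UNIV :: 'u set)" and 1: "flat_on A G UNIV \<zeta>" and 2: "flat_on A G UNIV \<zeta>'"
  obtains t where "\<And>q. \<zeta>' q = flow t (\<zeta> q)"
proof -
  obtain p :: 'u where True by simp
  have "geod (\<zeta> p) = geod (\<zeta>' p)" using flat_onD(3)[OF 1] flat_onD(3)[OF 2] by auto
  then obtain t where t: "\<zeta>' p = flow t (\<zeta> p)" using geod_eq_iff by blast
  have "\<zeta>' q = flow t (\<zeta> q)" for q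
  proof (rule connected_induction_simple[OF con UNIV_I UNIV_I, where P = "\<lambda>q. \<zeta>' q = flow t (\<zeta> q)" and a = p])
    fix a
    obtain V s where V: "open V" "a \<in> V" "\<And>q. q \<in> V \<Longrightarrow> \<zeta>' q = flow s (\<zeta> q)"
      using flat_unique_local[OF 1 2 UNIV_I UNIV_I, of a] by metis
    have step: "\<zeta>' y = flow t (\<zeta> y)" if "x \<in> V" "y \<in> V" "\<zeta>' x = flow t (\<zeta> x)" for x y
    proof -
      have "flow s (\<zeta> x) = flow t (\<zeta> x)" using V(3)[OF that(1)] that(3) by simp
      then have "s = t" using flow_inject[OF flat_onD(2)[OF 1 UNIV_I]] by blast
      then show ?thesis using V(3)[OF that(2)] by simp
    qed
    have "openin (top_of_set UNIV) V" using V(1) by simp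
    with V(2) step show "\<exists>T. openin (top_of_set UNIV) T \<and> a \<in> T \<and> (\<forall>x\<in>T. \<forall>y\<in>T. \<zeta>' x = flow t (\<zeta> x) \<longrightarrow> \<zeta>' y = flow t (\<zeta> y))"
      by (intro exI[of _ V] conjI ballI impI)
  qed (rule t)
  then show ?thesis using that by blast
qed

text \<open>An arbitrary smooth lift is made horizontal by flowing for a time that is a primitive of
  minus its connection form; the Lagrangian condition makes this form closed, so the Poincare lemma
  applies.\<close>

lemma flat_exists_local:
  obtains W where "open W" "p \<in> W"
    "\<And>q z. q \<in> W \<Longrightarrow> z \<in> T1hyp \<Longrightarrow> geod z = G q \<Longrightarrow> \<exists>\<zeta>. flat_on A G W \<zeta> \<and> \<zeta> q = z"
proof -
  define c where "c = chart_at A p"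
  note c = chart_at_A[of p, folded c_def]
  define d where "d = chart_at geod_atlas (G p)"
  have "G p \<in> topspace geod_top" using smooth_map_onD(2)[OF smooth_G, of p] by simp
  note d = chart_at[OF chart_atlas_geod this, folded d_def]
  define S where "S = snd c ` {q \<in> UNIV \<inter> fst c. G q \<in> fst d}"
  have S: "open S" unfolding S_def by (rule smooth_map_on_domain[OF atlas chart_atlas_geod c(1) d(1) smooth_G])
  have "snd c p \<in> S" using c d by (auto simp: S_def)
  then obtain r where r: "r > 0" "ball (snd c p) r \<subseteq> S" using S open_contains_ball by blast
  define B where "B = ball (snd c p) r"
  have B: "open B" "snd c p \<in> B" "B \<subseteq> S" "B \<subseteq> snd c ` fst c" using r by (auto simp: B_def S_def)
  obtain s where s: "smooth_on (snd d ` fst d) s" "\<And>y. y \<in> snd d ` fst d \<Longrightarrow> s y \<in> T1hyp"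
    "\<And>y. y \<in> snd d ` fst d \<Longrightarrow> geod (s y) = chart_inv d y" using geod_chart_section[OF d(1)] by blast
  define Z where "Z y = s ((snd d \<circ> G \<circ> chart_inv c) y)" for y
  have Gd: "G (chart_inv c y) \<in> fst d" if "y \<in> B" for y
    using that B(3) chart_inv(1)[OF atlas c(1)] by (auto simp: S_def)
  have Zs: "smooth_on B Z" unfolding Z_def
    by (rule smooth_on_compose[OF s(1) geod_chart(3)[OF d(1)] B(1) smooth_on_subset[OF smooth_map_onD(4)[OF smooth_G c(1) d(1)]]])
      (use Gd B(3) in \<open>auto simp: S_def\<close>)
  have ZT: "Z y \<in> T1hyp" and ZG: "geod (Z y) = G (chart_inv c y)" if "y \<in> B" for y
    using s(2,3) Gd[OF that] chart_inv(1)[OF chart_atlas_geod d(1)] by (auto simp: Z_def)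
  \<comment> \<open>Minus the connection form of the lift. The factor is chosen so that the
    derivative of \<open>npos (Z y)\<close> plus \<open>\<eta>\<close> times
    \<open>npos (Z y)\<close> is orthogonal to \<open>nneg (Z y)\<close>, whose pairing with
    \<open>npos (Z y)\<close> is -2.\<close>
  define \<eta> where "\<eta> y w = mink (npos (frechet_derivative Z (at y) w)) (nneg (Z y)) / 2" for y w
  have lin: "linear (\<eta> y)" if y: "y \<in> B" for y
    using smooth_on_linear_frechet[OF Zs y]
    by (intro linearI) (simp_all add: \<eta>_def linear_add linear_scale npos_simps mink_simps add_divide_distrib)
  have sm: "smooth_on B (\<lambda>y. \<eta> y v)" for v unfolding \<eta>_def by (intro smooth_intros B Zs) simp
  have closed: "frechet_derivative (\<lambda>y. \<eta> y w) (at y) u = frechet_derivative (\<lambda>y. \<eta> y u) (at y) w" if y: "y \<in> B" for y u w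
  proof -
    define D where "D = frechet_derivative Z (at y)"
    define H where "H u = frechet_derivative (\<lambda>y. frechet_derivative Z (at y) u) (at y)" for u
    have d\<eta>: "frechet_derivative (\<lambda>y. \<eta> y w) (at y) u = (mink (npos (D w)) (nneg (D u)) + mink (npos (H w u)) (nneg (Z y))) / 2" for u w
    proof -
      have "((\<lambda>y. mink (npos (frechet_derivative Z (at y) w)) (nneg (Z y))) has_derivative
          (\<lambda>u. mink (npos (D w)) (nneg (D u)) + mink (npos (H w u)) (nneg (Z y)))) (at y)"
        unfolding D_def H_def
        by (intro mink.FDERIV bounded_linear.has_derivative[OF bounded_linear_npos] bounded_linear.has_derivative[OF bounded_linear_nneg]
            smooth_on_has_derivative[OF Zs y] smooth_on_has_derivative[OF smooth_on_frechet[OF Zs] y])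
      from frechet_derivative_eqI[OF bounded_linear.has_derivative[OF bounded_linear_divide this, of 2]]
      show ?thesis unfolding \<eta>_def by simp
    qed
    have "H w u = H u w" unfolding H_def by (rule symmetric_second_derivative[OF Zs B(1) y])
    \<comment> \<open>The terms with second derivatives are symmetric anyway; symmetry of the
      remaining product of first derivatives is the Lagrangian condition.\<close>
    moreover have "mink (npos (D w)) (nneg (D u)) = mink (npos (D u)) (nneg (D w))"
      using lagrangian_chart[OF c(1) B(1,4) Zs ZT ZG y, of u w] mink_commute[of "npos (D w)" "nneg (D u)"] by (simp add: D_def)
    ultimately show ?thesis unfolding d\<eta> by simp
  qed
  obtain f where f: "smooth_on B f" "\<And>y. y \<in> B \<Longrightarrow> (f has_derivative \<eta> y) (at y)"
    using Poincare_lemma[of "snd c p" r \<eta>] lin sm closed unfolding B_def by blast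
  define W where "W = {q \<in> fst c. snd c q \<in> B}"
  have W: "open W" "p \<in> W" using chart_atlasD(4)[OF atlas c(1) B(1)] c B(2) by (auto simp: W_def)
  have BW: "B = snd c ` (W \<inter> fst c)" using B(4) by (auto simp: W_def)
  \<comment> \<open>The additive constant \<open>k\<close> moves the section along the orbits, so
    that every prescribed value on the geodesic can be attained.\<close>
  define \<zeta> where "\<zeta> k q = flow (f (snd c q) + k) (Z (snd c q))" for k q
  have flat: "flat_on A G W (\<zeta> k)" for k
  proof -
    define Y where "Y y = flow (f y + k) (Z y)" for y
    have Ys: "smooth_on B Y" unfolding Y_def by (intro smooth_intros B f Zs)
    have \<zeta>Y: "\<zeta> k (chart_inv c y) = Y y" if "y \<in> B" for y
      using chart_inv(3)[OF atlas c(1)] B(4) that by (auto simp: \<zeta>_def Y_def)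
    have smooth: "smooth_map_on euclidean A euclidean std_atlas W (\<zeta> k)"
    proof (rule smooth_map_on_to_std[OF atlas])
      fix q assume "q \<in> W"
      then have "q \<in> fst c" "snd c q \<in> B" by (auto simp: W_def)
      moreover have "smooth_on B (\<lambda>y. \<zeta> k (chart_inv c y))" by (rule smooth_on_cong[OF Ys B(1)]) (simp add: \<zeta>Y)
      ultimately show "\<exists>c\<in>A. \<exists>T. open T \<and> q \<in> fst c \<and> snd c q \<in> T \<and> T \<subseteq> snd c ` (W \<inter> fst c) \<and> smooth_on T (\<lambda>y. \<zeta> k (chart_inv c y))"
        using c(1) B(1) equalityD1[OF BW] by (intro bexI[of _ c] exI[of _ B] conjI)
    qed (use W in simp)
    moreover have "\<zeta> k q \<in> T1hyp \<and> geod (\<zeta> k q) = G q" if "q \<in> W" for q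
      using that ZT[of "snd c q"] ZG[of "snd c q"] chart_inv(1)[OF atlas c(1), of q] by (simp add: W_def \<zeta>_def)
    moreover have "tangent_map A std_atlas (\<zeta> k) q v \<in> gen_perp (\<zeta> k q)" if q: "q \<in> W" for q v
    proof -
      define y w where "y = snd c q" and "w = tangent_map A std_atlas (snd c) q v"
      have y: "y \<in> B" "q = chart_inv c y" "q \<in> fst c" using q chart_inv(1)[OF atlas c(1), of q] by (auto simp: W_def y_def)
      have "v = coord_field A c w q" unfolding w_def by (rule coord_field_inverse(1)[OF atlas c(1) y(3), symmetric])
      then have "tangent_map A std_atlas (\<zeta> k) q v = frechet_derivative (\<lambda>y. \<zeta> k (chart_inv c y)) (at y) w"
        using tangent_map_coord_field_std[OF atlas c(1) smooth, of y w] y BW by simp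
      also have "\<dots> = frechet_derivative Y (at y) w"
        by (subst frechet_derivative_cong_open[OF B(1) y(1), of _ Y]) (simp_all add: \<zeta>Y)
      finally have t: "tangent_map A std_atlas (\<zeta> k) q v = frechet_derivative Y (at y) w" .
      have YT: "Y y \<in> T1hyp" if "y \<in> B" for y using ZT[OF that] by (simp add: Y_def)
      have "((\<lambda>y. exp (f y + k) *\<^sub>R npos (Z y)) has_derivative (\<lambda>w. exp (f y + k) *\<^sub>R npos (frechet_derivative Z (at y) w)
          + (exp (f y + k) * \<eta> y w) *\<^sub>R npos (Z y))) (at y)"
        by (rule has_derivative_eq_rhs[OF has_derivative_scaleR[OF has_derivative_exp[OF has_derivative_add[OF f(2)[OF y(1)] has_derivative_const]]
              bounded_linear.has_derivative[OF bounded_linear_npos smooth_on_has_derivative[OF Zs y(1)]]]])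
          (simp add: fun_eq_iff)
      moreover have "((\<lambda>y. exp (f y + k) *\<^sub>R npos (Z y)) has_derivative (\<lambda>w. npos (frechet_derivative Y (at y) w))) (at y)"
        using bounded_linear.has_derivative[OF bounded_linear_npos smooth_on_has_derivative[OF Ys y(1)]] by (simp add: Y_def)
      ultimately have "(\<lambda>w. npos (frechet_derivative Y (at y) w)) = (\<lambda>w. exp (f y + k) *\<^sub>R npos (frechet_derivative Z (at y) w)
          + (exp (f y + k) * \<eta> y w) *\<^sub>R npos (Z y))" by (rule has_derivative_unique[rotated])
      then have e: "npos (frechet_derivative Y (at y) w) = exp (f y + k) *\<^sub>R npos (frechet_derivative Z (at y) w)
          + (exp (f y + k) * \<eta> y w) *\<^sub>R npos (Z y)" by metis
      have "mink (npos (frechet_derivative Y (at y) w)) (nneg (Y y)) = 0"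
        unfolding e using T1hyp_null(3)[OF ZT[OF y(1)]] by (simp add: Y_def mink_simps \<eta>_def)
      then have "frechet_derivative Y (at y) w \<in> gen_perp (Y y)"
        by (intro gen_perpI YT y(1) T1_tan_derivative[OF smooth_on_has_derivative[OF Ys y(1)] B(1) y(1) YT])
      then show ?thesis unfolding t using \<zeta>Y[OF y(1)] y(2) by simp
    qed
    ultimately show ?thesis by (simp add: flat_on_def)
  qed
  show ?thesis
  proof (rule that[OF W])
    fix q z assume q: "q \<in> W" and z: "z \<in> T1hyp" "geod z = G q"
    have "geod (\<zeta> 0 q) = geod z" using flat_onD(3)[OF flat q] z by simp
    then obtain t where "z = flow t (\<zeta> 0 q)" using geod_eq_iff by blast
    then have "\<zeta> t q = z" by (simp add: \<zeta>_def flow_flow add.commute)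
    then show "\<exists>\<zeta>. flat_on A G W \<zeta> \<and> \<zeta> q = z" using flat by blast
  qed
qed

text \<open>The monodromy argument applied to local flat sections, with the points of the geodesic
  \<open>G q\<close> as possible values at \<open>q\<close>.\<close>

lemma flat_exists:
  assumes sc: "simply_connected (UNIV :: 'u set)"
  obtains \<zeta> where "flat_on A G UNIV \<zeta>"
proof -
  define E where "E q = {z. z \<in> T1hyp \<and> geod z = G q}" for q
  define H where "H = {(W, \<zeta>). flat_on A G W \<zeta>}"
  \<comment> \<open>Two flat sections differ by a constant flow time near each common point, and the
    flow acts freely. Thus agreement at one point and agreement at a nearby point are equivalent,
    which gives both openness conditions.\<close>
  have shift: "(\<zeta>' y = \<zeta> y) = (\<zeta>' x = \<zeta> x)" if "flat_on A G W \<zeta>" "x \<in> V" "y \<in> V" "V \<subseteq> W \<inter> W'" "\<And>q. q \<in> V \<Longrightarrow> \<zeta>' q = flow t (\<zeta> q)"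
    for \<zeta> \<zeta>' W W' V t x y
  proof -
    have "\<zeta>' q = \<zeta> q \<longleftrightarrow> t = 0" if "q \<in> V" for q
      using that(1) flow_inject[of "\<zeta> q" t 0] \<open>\<And>q. q \<in> V \<Longrightarrow> \<zeta>' q = flow t (\<zeta> q)\<close>[OF that] flat_onD(2)[OF \<open>flat_on A G W \<zeta>\<close>, of q] \<open>V \<subseteq> W \<inter> W'\<close> by auto
    then show ?thesis using that by blast
  qed
  interpret local_sections E H
  proof
    fix W \<zeta> W' \<zeta>' assume "(W, \<zeta>) \<in> H" "(W', \<zeta>') \<in> H"
    then have 1: "flat_on A G W \<zeta>" and 2: "flat_on A G W' \<zeta>'" by (auto simp: H_def)
    have loc: "\<exists>V. open V \<and> x \<in> V \<and> V \<subseteq> W \<inter> W' \<and> (\<forall>y\<in>V. (\<zeta> y = \<zeta>' y) = (\<zeta> x = \<zeta>' x))" if x: "x \<in> W" "x \<in> W'" for x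
    proof -
      obtain V t where V: "open V" "x \<in> V" "V \<subseteq> W \<inter> W'" "\<And>q. q \<in> V \<Longrightarrow> \<zeta>' q = flow t (\<zeta> q)"
        using flat_unique_local[OF 1 2 x] by blast
      have "(\<zeta> y = \<zeta>' y) = (\<zeta> x = \<zeta>' x)" if "y \<in> V" for y
        using shift[OF 1 V(2) that V(3,4)] by metis
      then show ?thesis using V(1-3) by blast
    qed
    show "open {x \<in> W \<inter> W'. \<zeta> x = \<zeta>' x}"
    proof (subst open_subopen, intro ballI)
      fix x assume x: "x \<in> {x \<in> W \<inter> W'. \<zeta> x = \<zeta>' x}"
      then obtain V where V: "open V" "x \<in> V" "V \<subseteq> W \<inter> W'" "\<forall>y\<in>V. (\<zeta> y = \<zeta>' y) = (\<zeta> x = \<zeta>' x)"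
        using loc[of x] by (elim CollectE conjE IntE) metis
      have "y \<in> {x \<in> W \<inter> W'. \<zeta> x = \<zeta>' x}" if "y \<in> V" for y
        using V(4)[rule_format, OF that] x subsetD[OF V(3) that] by simp
      then show "\<exists>T. open T \<and> x \<in> T \<and> T \<subseteq> {x \<in> W \<inter> W'. \<zeta> x = \<zeta>' x}"
        using V(1,2) by (intro exI[of _ V] conjI subsetI)
    qed
    show "open {x \<in> W \<inter> W'. \<zeta> x \<noteq> \<zeta>' x}"
    proof (subst open_subopen, intro ballI)
      fix x assume x: "x \<in> {x \<in> W \<inter> W'. \<zeta> x \<noteq> \<zeta>' x}"
      then obtain V where V: "open V" "x \<in> V" "V \<subseteq> W \<inter> W'" "\<forall>y\<in>V. (\<zeta> y = \<zeta>' y) = (\<zeta> x = \<zeta>' x)"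
        using loc[of x] by (elim CollectE conjE IntE) metis
      have "y \<in> {x \<in> W \<inter> W'. \<zeta> x \<noteq> \<zeta>' x}" if "y \<in> V" for y
        using V(4)[rule_format, OF that] x subsetD[OF V(3) that] by simp
      then show "\<exists>T. open T \<and> x \<in> T \<and> T \<subseteq> {x \<in> W \<inter> W'. \<zeta> x \<noteq> \<zeta>' x}"
        using V(1,2) by (intro exI[of _ V] conjI subsetI)
    qed
  next
    fix x
    obtain W where W: "open W" "x \<in> W" "\<And>q z. q \<in> W \<Longrightarrow> z \<in> T1hyp \<Longrightarrow> geod z = G q \<Longrightarrow> \<exists>\<zeta>. flat_on A G W \<zeta> \<and> \<zeta> q = z"
      using flat_exists_local by blast
    then show "\<exists>W. open W \<and> x \<in> W \<and> (\<forall>y\<in>W. \<forall>s\<in>E y. \<exists>h. (W, h) \<in> H \<and> h y = s)"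
      by (intro exI[of _ W]) (simp add: E_def H_def)
  next
    fix W \<zeta> x assume "(W, \<zeta>) \<in> H"
    then have f: "flat_on A G W \<zeta>" by (simp add: H_def)
    show "open W" by (rule flat_onD(5)[OF f])
    assume "x \<in> W"
    then show "\<zeta> x \<in> E x" using flat_onD(2,3)[OF f] by (simp add: E_def)
  qed
  obtain p :: 'u where True by simp
  have "G p \<in> topspace geod_top" using smooth_map_onD(2)[OF smooth_G, of p] by simp
  then obtain z where "z \<in> E p" by (auto simp: E_def topspace_geod_top geodesics_def)
  from global_section[OF sc manifold_locally_path_connected[OF manifold] this]
  obtain \<sigma> where \<sigma>: "lift_on (\<lambda>x. x) UNIV \<sigma>" by blast
  have loc: "\<exists>W h V. flat_on A G W h \<and> open V \<and> q \<in> V \<and> V \<subseteq> W \<and> (\<forall>x\<in>V. \<sigma> x = h x)" for q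
  proof -
    obtain W h where h: "(W, h) \<in> H" "q \<in> W" "\<forall>\<^sub>F k' in nhds q. k' \<in> UNIV \<longrightarrow> \<sigma> k' = h k'"
      by (rule lift_onE[OF \<sigma> UNIV_I])
    then obtain N where N: "open N" "q \<in> N" "\<forall>k\<in>N. \<sigma> k = h k" unfolding eventually_nhds by auto
    have f: "flat_on A G W h" using h(1) by (simp add: H_def)
    then show ?thesis using N h(2) flat_onD(5)[OF f] by (intro exI[of _ W] exI[of _ h] exI[of _ "N \<inter> W"]) auto
  qed
  have "smooth_map_on euclidean A euclidean std_atlas UNIV \<sigma>"
  proof (rule smooth_map_on_to_std[OF atlas])
    fix q
    obtain W h V where V: "flat_on A G W h" "open V" "q \<in> V" "V \<subseteq> W" "\<forall>x\<in>V. \<sigma> x = h x"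
      using loc[of q] by (elim exE conjE) (rule that)
    define c where "c = chart_at A q"
    note c = chart_at_A[of q, folded c_def]
    let ?T = "snd c ` (V \<inter> fst c)"
    have T: "open ?T" by (rule chart_atlasD(3)[OF atlas c(1)]) (use V in simp)
    have "smooth_on ?T (\<lambda>y. h (chart_inv c y))"
      by (rule smooth_on_subset[OF smooth_map_on_std_chart[OF flat_onD(1)[OF V(1)] c(1)]]) (use V(4) in auto)
    then have "smooth_on ?T (\<lambda>y. \<sigma> (chart_inv c y))"
    proof (rule smooth_on_cong[OF _ T])
      fix y assume "y \<in> ?T"
      then have "chart_inv c y \<in> V" using chart_inv(1)[OF atlas c(1)] by auto
      then show "h (chart_inv c y) = \<sigma> (chart_inv c y)" using V(5) by simp
    qed
    then show "\<exists>c\<in>A. \<exists>T. open T \<and> q \<in> fst c \<and> snd c q \<in> T \<and> T \<subseteq> snd c ` (UNIV \<inter> fst c) \<and> smooth_on T (\<lambda>y. \<sigma> (chart_inv c y))"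
      using c T V(3) by (intro bexI[of _ c] exI[of _ ?T] conjI) auto
  qed simp
  moreover have "\<sigma> q \<in> T1hyp \<and> geod (\<sigma> q) = G q \<and> (\<forall>v. tangent_map A std_atlas \<sigma> q v \<in> gen_perp (\<sigma> q))" for q
  proof -
    obtain W h V where V: "flat_on A G W h" "open V" "q \<in> V" "V \<subseteq> W" "\<forall>x\<in>V. \<sigma> x = h x"
      using loc[of q] by (elim exE conjE) (rule that)
    have "tangent_map A std_atlas \<sigma> q = tangent_map A std_atlas h q"
      by (rule tangent_map_cong[OF atlas, of V]) (use V(2,3,5) in simp_all)
    moreover have "q \<in> W" "\<sigma> q = h q" using V(3,4,5) by blast+
    ultimately show ?thesis using flat_onD(2-4)[OF V(1), of q] by simp
  qed
  ultimately show ?thesis using that[of \<sigma>] by (simp add: flat_on_def)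
qed

end

section \<open>Determinants\<close>

text \<open>At the identity matrix only the identity permutation contributes to the derivative of
  the Leibniz expansion.\<close>

lemma has_derivative_det_one:
  fixes M :: "'e::real_normed_vector \<Rightarrow> real^'n^'n::finite"
  assumes M: "\<And>i j. ((\<lambda>y. M y $ i $ j) has_derivative M' i j) (at y0)" and one: "M y0 = mat 1"
  shows "((\<lambda>y. det (M y)) has_derivative (\<lambda>u. \<Sum>i\<in>UNIV. M' i i u)) (at y0)"
proof -
  have "((\<lambda>y. det (M y)) has_derivative (\<lambda>u. \<Sum>p\<in>{p. p permutes (UNIV :: 'n set)}. of_int (sign p) *
      (\<Sum>i\<in>UNIV. M' i (p i) u * (\<Prod>j\<in>UNIV - {i}. M y0 $ j $ p j)))) (at y0)"
    unfolding det_def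
    by (intro has_derivative_sum has_derivative_mult_right has_derivative_prod M)
  moreover have "(\<Sum>p\<in>{p. p permutes (UNIV :: 'n set)}. of_int (sign p) *
      (\<Sum>i\<in>UNIV. M' i (p i) u * (\<Prod>j\<in>UNIV - {i}. M y0 $ j $ p j))) = (\<Sum>i\<in>UNIV. M' i i u)" for u
  proof -
    \<comment> \<open>A permutation other than the identity moves at least two indices, so an
      off-diagonal factor survives the removal of the index \<open>i\<close>.\<close>
    have zero: "(\<Prod>j\<in>UNIV - {i}. M y0 $ j $ p j) = 0" if p: "p permutes (UNIV :: 'n set)" "p \<noteq> id" for p i
    proof -
      obtain a where a: "p a \<noteq> a" using p(2) by (auto simp: fun_eq_iff)
      moreover have "p (p a) \<noteq> p a" using a p(1) by (metis permutes_def)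
      ultimately obtain j where "j \<noteq> i" "p j \<noteq> j" by metis
      then have "j \<in> UNIV - {i}" "M y0 $ j $ p j = 0" by (auto simp: one mat_def)
      then show ?thesis by (meson finite prod_zero_iff)
    qed
    have "(\<Sum>p\<in>{p. p permutes (UNIV :: 'n set)}. of_int (sign p) *
      (\<Sum>i\<in>UNIV. M' i (p i) u * (\<Prod>j\<in>UNIV - {i}. M y0 $ j $ p j))) =
      (\<Sum>p\<in>{id}. of_int (sign p) * (\<Sum>i\<in>UNIV. M' i (p i) u * (\<Prod>j\<in>UNIV - {i}. M y0 $ j $ p j)))"
      by (intro sum.mono_neutral_right ballI) (simp_all add: permutes_id finite_permutations zero del: prod_zero_iff)
    also have "\<dots> = (\<Sum>i\<in>UNIV. M' i i u)" by (simp add: sign_id one mat_def)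
    finally show ?thesis .
  qed
  ultimately show ?thesis by simp
qed

text \<open>Jacobi's formula, obtained by multiplying with the constant inverse \<open>K\<close> so
  as to arrive at the identity matrix.\<close>

lemma has_derivative_det:
  fixes M :: "'e::real_normed_vector \<Rightarrow> real^'n^'n::finite"
  assumes M: "\<And>i j. ((\<lambda>y. M y $ i $ j) has_derivative M' i j) (at y0)" and K: "K ** M y0 = mat 1"
  shows "((\<lambda>y. det (M y)) has_derivative (\<lambda>u. det (M y0) * (\<Sum>i\<in>UNIV. \<Sum>j\<in>UNIV. K $ i $ j * M' j i u))) (at y0)"
proof -
  have "((\<lambda>y. det (K ** M y)) has_derivative (\<lambda>u. \<Sum>i\<in>UNIV. \<Sum>j\<in>UNIV. K $ i $ j * M' j i u)) (at y0)"
  proof (rule has_derivative_det_one[where M' = "\<lambda>i k u. \<Sum>j\<in>UNIV. K $ i $ j * M' j k u"])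
    show "K ** M y0 = mat 1" by (rule K)
    fix i k
    show "((\<lambda>y. (K ** M y) $ i $ k) has_derivative (\<lambda>u. \<Sum>j\<in>UNIV. K $ i $ j * M' j k u)) (at y0)"
      unfolding matrix_matrix_mult_def by (simp, intro has_derivative_sum has_derivative_mult_right M)
  qed
  from has_derivative_mult_right[OF this, of "det (M y0)"]
  have "((\<lambda>y. det (M y0) * det (K ** M y)) has_derivative (\<lambda>u. det (M y0) * (\<Sum>i\<in>UNIV. \<Sum>j\<in>UNIV. K $ i $ j * M' j i u))) (at y0)" .
  moreover have "det (M y0) * det K = 1" using K by (metis det_I det_mul mult.commute)
  then have "det (M y0) * det (K ** M y) = det (M y)" for y by (simp add: det_mul mult.assoc[symmetric])
  ultimately show ?thesis by simp
qed

lemma has_derivative_ln_det_square: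
  fixes M :: "'e::real_normed_vector \<Rightarrow> real^'n^'n::finite"
  assumes M: "\<And>i j. ((\<lambda>y. M y $ i $ j) has_derivative M' i j) (at y0)" and K: "K ** M y0 = mat 1"
  shows "((\<lambda>y. ln ((det (M y))\<^sup>2)) has_derivative (\<lambda>u. 2 * (\<Sum>i\<in>UNIV. \<Sum>j\<in>UNIV. K $ i $ j * M' j i u))) (at y0)"
proof -
  have "det K * det (M y0) = 1" using K by (metis det_I det_mul)
  then have nz: "det (M y0) \<noteq> 0" by auto
  then have p: "(det (M y0))\<^sup>2 > 0" by simp
  have "((\<lambda>y. ln ((det (M y))\<^sup>2)) has_derivative (\<lambda>u. (2 * (det (M y0) * (\<Sum>i\<in>UNIV. \<Sum>j\<in>UNIV. K $ i $ j * M' j i u)) * det (M y0)) / (det (M y0))\<^sup>2)) (at y0)"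
    by (rule derivative_eq_intros has_derivative_det[OF M K] p refl)+ (simp add: fun_eq_iff divide_inverse)
  then show ?thesis using nz by (simp add: power2_eq_square mult.assoc)
qed

section \<open>Second derivatives\<close>

lemma hessian_linear:
  fixes s :: "'a::euclidean_space \<Rightarrow> 'b::euclidean_space"
  assumes s: "smooth_on T s" "open T" "x \<in> T"
  shows "linear (\<lambda>k. frechet_derivative (\<lambda>x. frechet_derivative s (at x) k) (at x) v)"
proof -
  have "(\<lambda>k. frechet_derivative (\<lambda>x. frechet_derivative s (at x) k) (at x) v) = frechet_derivative (\<lambda>x. frechet_derivative s (at x) v) (at x)"
    using symmetric_second_derivative[OF s] by blast
  then show ?thesis using smooth_on_linear_frechet[OF smooth_on_frechet[OF s(1)] s(3)] by simp
qed

text \<open>This has the shape of a covariant derivative: the Hessian term will match the connection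
  coefficients of \<open>levi_civita_geod\<close>, the second term the ordinary derivative of the
  components.\<close>

lemma second_derivative_compose:
  fixes g :: "'c::euclidean_space \<Rightarrow> 'a::euclidean_space" and s :: "'a \<Rightarrow> 'b::euclidean_space"
  assumes s: "smooth_on T s" "open T" and g: "smooth_on S g" "open S" "\<And>y. y \<in> S \<Longrightarrow> g y \<in> T" and y: "y \<in> S"
  shows "frechet_derivative (\<lambda>y. frechet_derivative (\<lambda>y. s (g y)) (at y) w) (at y) v =
    frechet_derivative (\<lambda>x. frechet_derivative s (at x) (frechet_derivative g (at y) w)) (at (g y)) (frechet_derivative g (at y) v)
    + frechet_derivative s (at (g y)) (frechet_derivative (\<lambda>y. frechet_derivative g (at y) w) (at y) v)"
proof -
  define h where "h y = frechet_derivative g (at y) w" for y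
  define D where "D b x = frechet_derivative s (at x) b" for b x
  have h: "smooth_on S h" unfolding h_def by (rule smooth_on_frechet[OF g(1)])
  have Ds: "smooth_on T (D b)" for b unfolding D_def by (rule smooth_on_frechet[OF s(1)])
  \<comment> \<open>The direction in which \<open>s\<close> is differentiated depends on the point;
    expansion in a basis separates this dependence from that of the base point.\<close>
  have expand: "D k x = (\<Sum>b\<in>Basis. (k \<bullet> b) *\<^sub>R D b x)" if "x \<in> T" for k x
    unfolding D_def by (rule linear_euclidean_expand[OF smooth_on_linear_frechet[OF s(1) that]])
  have gy: "g y \<in> T" using g(3) y .
  have 1: "frechet_derivative (\<lambda>y. s (g y)) (at y') w = (\<Sum>b\<in>Basis. (h y' \<bullet> b) *\<^sub>R D b (g y'))" if "y' \<in> S" for y'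
    using frechet_derivative_compose[OF smooth_on_differentiable[OF g(1) that] smooth_on_differentiable[OF s(1) g(3)[OF that]]]
      expand[OF g(3)[OF that], of "h y'"] by (simp add: D_def h_def)
  have "((\<lambda>y. \<Sum>b\<in>Basis. (h y \<bullet> b) *\<^sub>R D b (g y)) has_derivative
     (\<lambda>v. \<Sum>b\<in>Basis. (h y \<bullet> b) *\<^sub>R frechet_derivative (D b) (at (g y)) (frechet_derivative g (at y) v) + (frechet_derivative h (at y) v \<bullet> b) *\<^sub>R D b (g y))) (at y)"
    by (intro has_derivative_sum has_derivative_scaleR has_derivative_inner_left smooth_on_has_derivative[OF h y]
        has_derivative_compose[OF smooth_on_has_derivative[OF g(1) y] smooth_on_has_derivative[OF Ds gy]])
  from frechet_derivative_eqI[OF this]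
  have "frechet_derivative (\<lambda>y. \<Sum>b\<in>Basis. (h y \<bullet> b) *\<^sub>R D b (g y)) (at y) v =
     (\<Sum>b\<in>Basis. (h y \<bullet> b) *\<^sub>R frechet_derivative (D b) (at (g y)) (frechet_derivative g (at y) v) + (frechet_derivative h (at y) v \<bullet> b) *\<^sub>R D b (g y))"
    by simp
  moreover have "frechet_derivative (\<lambda>y. frechet_derivative (\<lambda>y. s (g y)) (at y) w) (at y) =
      frechet_derivative (\<lambda>y. \<Sum>b\<in>Basis. (h y \<bullet> b) *\<^sub>R D b (g y)) (at y)"
    by (rule frechet_derivative_cong_open[OF g(2) y]) (rule 1)
  ultimately have "frechet_derivative (\<lambda>y. frechet_derivative (\<lambda>y. s (g y)) (at y) w) (at y) v =
     (\<Sum>b\<in>Basis. (h y \<bullet> b) *\<^sub>R frechet_derivative (D b) (at (g y)) (frechet_derivative g (at y) v) + (frechet_derivative h (at y) v \<bullet> b) *\<^sub>R D b (g y))"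
    by simp
  also have "\<dots> = frechet_derivative (D (h y)) (at (g y)) (frechet_derivative g (at y) v) + D (frechet_derivative h (at y) v) (g y)"
    using linear_euclidean_expand[OF hessian_linear[OF s gy, of "frechet_derivative g (at y) v"], of "h y"]
      expand[OF gy, of "frechet_derivative h (at y) v"] by (simp add: sum.distrib D_def[abs_def])
  finally show ?thesis unfolding h_def D_def .
qed

lemma second_derivative_bounded_linear:
  assumes f: "bounded_linear f" and Z: "smooth_on S Z" "open S" "y \<in> S"
  shows "frechet_derivative (\<lambda>y. f (Z y)) (at y) w = f (frechet_derivative Z (at y) w)"
    "frechet_derivative (\<lambda>y. frechet_derivative (\<lambda>y. f (Z y)) (at y) w) (at y) v = f (frechet_derivative (\<lambda>y. frechet_derivative Z (at y) w) (at y) v)"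
proof -
  have 1: "frechet_derivative (\<lambda>y. f (Z y)) (at y) w = f (frechet_derivative Z (at y) w)" if "y \<in> S" for y
    using frechet_derivative_eqI[OF bounded_linear.has_derivative[OF f smooth_on_has_derivative[OF Z(1) that]]] by simp
  show "frechet_derivative (\<lambda>y. f (Z y)) (at y) w = f (frechet_derivative Z (at y) w)" by (rule 1[OF Z(3)])
  have "frechet_derivative (\<lambda>y. frechet_derivative (\<lambda>y. f (Z y)) (at y) w) (at y) = frechet_derivative (\<lambda>y. f (frechet_derivative Z (at y) w)) (at y)"
    by (rule frechet_derivative_cong_open[OF Z(2,3)]) (rule 1)
  also have "\<dots> = (\<lambda>v. f (frechet_derivative (\<lambda>y. frechet_derivative Z (at y) w) (at y) v))"
    by (rule frechet_derivative_eqI[OF bounded_linear.has_derivative[OF f smooth_on_has_derivative[OF smooth_on_frechet[OF Z(1)] Z(3)]]])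
  finally show "frechet_derivative (\<lambda>y. frechet_derivative (\<lambda>y. f (Z y)) (at y) w) (at y) v = f (frechet_derivative (\<lambda>y. frechet_derivative Z (at y) w) (at y) v)"
    by simp
qed

lemma derivative_scale:
  fixes l :: "'a::real_normed_vector \<Rightarrow> real"
  assumes S: "open S" "y \<in> S" and l: "smooth_on S l" and P: "smooth_on S P" and eq: "\<And>y. y \<in> S \<Longrightarrow> Q y = l y *\<^sub>R P y"
  shows "frechet_derivative Q (at y) w = l y *\<^sub>R frechet_derivative P (at y) w + frechet_derivative l (at y) w *\<^sub>R P y"
proof -
  have "frechet_derivative Q (at y) = frechet_derivative (\<lambda>y. l y *\<^sub>R P y) (at y)"
    by (rule frechet_derivative_cong_open[OF S]) (rule eq)
  also have "\<dots> = (\<lambda>w. l y *\<^sub>R frechet_derivative P (at y) w + frechet_derivative l (at y) w *\<^sub>R P y)"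
    by (rule frechet_derivative_eqI[OF has_derivative_scaleR[OF smooth_on_has_derivative[OF l S(2)] smooth_on_has_derivative[OF P S(2)]]])
  finally show ?thesis by simp
qed

text \<open>When the factor equals 1 to first order, the cross terms vanish and rescaling changes
  second derivatives only by a multiple of \<open>P y\<close>. In \<open>cov_lift\<close> such a
  multiple is invisible to vectors of \<open>perp\<close>.\<close>

lemma second_derivative_scale:
  fixes l :: "'a::real_normed_vector \<Rightarrow> real"
  assumes S: "open S" "y \<in> S" and l: "smooth_on S l" and P: "smooth_on S P" and eq: "\<And>y. y \<in> S \<Longrightarrow> Q y = l y *\<^sub>R P y"
    and l1: "l y = 1" and l0: "\<And>v. frechet_derivative l (at y) v = 0"
  shows "frechet_derivative (\<lambda>y. frechet_derivative Q (at y) w) (at y) v =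
    frechet_derivative (\<lambda>y. frechet_derivative P (at y) w) (at y) v + frechet_derivative (\<lambda>y. frechet_derivative l (at y) w) (at y) v *\<^sub>R P y"
proof -
  have "frechet_derivative (\<lambda>y. frechet_derivative Q (at y) w) (at y) =
      frechet_derivative (\<lambda>y. l y *\<^sub>R frechet_derivative P (at y) w + frechet_derivative l (at y) w *\<^sub>R P y) (at y)"
    by (rule frechet_derivative_cong_open[OF S]) (rule derivative_scale[OF S(1) _ l P eq])
  also have "\<dots> = (\<lambda>v. (l y *\<^sub>R frechet_derivative (\<lambda>y. frechet_derivative P (at y) w) (at y) v + frechet_derivative l (at y) v *\<^sub>R frechet_derivative P (at y) w)
      + (frechet_derivative l (at y) w *\<^sub>R frechet_derivative P (at y) v + frechet_derivative (\<lambda>y. frechet_derivative l (at y) w) (at y) v *\<^sub>R P y))"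
    by (rule frechet_derivative_eqI[OF has_derivative_add[OF
          has_derivative_scaleR[OF smooth_on_has_derivative[OF l S(2)] smooth_on_has_derivative[OF smooth_on_frechet[OF P] S(2)]]
          has_derivative_scaleR[OF smooth_on_has_derivative[OF smooth_on_frechet[OF l] S(2)] smooth_on_has_derivative[OF P S(2)]]]])
  finally show ?thesis using l1 l0 by simp
qed

section \<open>The Levi-Civita connection of the space of geodesics\<close>

text \<open>The Koszul formula determines \<open>\<Gamma>\<close>.\<close>

lemma levi_civita_symbol_eq:
  assumes \<Gamma>: "bilinear \<Gamma>" "\<And>u w. \<Gamma> u w = \<Gamma> w u"
    "\<And>u w z. frechet_derivative (\<lambda>y. h y w z) (at y) u = h y (\<Gamma> u w) z + h y w (\<Gamma> u z)"
    and sym: "\<And>u w. h y u w = h y w u" and nondeg: "\<And>a b. (\<And>z. h y a z = h y b z) \<Longrightarrow> a = b"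
  shows "levi_civita_symbol h y = \<Gamma>"
  unfolding levi_civita_symbol_def
proof (rule the_equality)
  show "bilinear \<Gamma> \<and> (\<forall>u w. \<Gamma> u w = \<Gamma> w u) \<and>
     (\<forall>u w z. frechet_derivative (\<lambda>y. h y w z) (at y) u = h y (\<Gamma> u w) z + h y w (\<Gamma> u z))"
    using \<Gamma> by blast
next
  fix \<Delta> assume \<Delta>: "bilinear \<Delta> \<and> (\<forall>u w. \<Delta> u w = \<Delta> w u) \<and>
     (\<forall>u w z. frechet_derivative (\<lambda>y. h y w z) (at y) u = h y (\<Delta> u w) z + h y w (\<Delta> u z))"
  have "2 * h y (\<Lambda> u w) z = frechet_derivative (\<lambda>y. h y w z) (at y) u + frechet_derivative (\<lambda>y. h y u z) (at y) w
      - frechet_derivative (\<lambda>y. h y u w) (at y) z"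
    if "\<And>u w. \<Lambda> u w = \<Lambda> w u" "\<And>u w z. frechet_derivative (\<lambda>y. h y w z) (at y) u = h y (\<Lambda> u w) z + h y w (\<Lambda> u z)"
    for \<Lambda> u w z
    unfolding that(2) using sym[of w "\<Lambda> u z"] sym[of u "\<Lambda> w z"] sym[of u "\<Lambda> z w"] that(1)[of z u] that(1)[of w u] that(1)[of z w]
    by simp
  from this[of \<Gamma>] this[of \<Delta>] \<Gamma> \<Delta> have "h y (\<Delta> u w) z = h y (\<Gamma> u w) z" for u w z
    by (metis mult_left_cancel zero_neq_numeral)
  then show "\<Delta> = \<Gamma>" by (intro ext nondeg)
qed

text \<open>The orthogonal projection to \<open>perp z\<close>; the plus signs and halves again come
  from the value -2 of the pairing of \<open>npos z\<close> and \<open>nneg z\<close>.\<close>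

definition perp_proj :: "'n::finite mink \<times> 'n mink \<Rightarrow> 'n mink \<Rightarrow> 'n mink" where
  "perp_proj z w = w + (mink w (nneg z) / 2) *\<^sub>R npos z + (mink w (npos z) / 2) *\<^sub>R nneg z"

lemma perp_proj:
  assumes "z \<in> T1hyp"
  shows "perp_proj z w \<in> perp z" "b \<in> perp z \<Longrightarrow> mink (perp_proj z w) b = mink w b" "linear (perp_proj z)"
proof -
  show "perp_proj z w \<in> perp z"
    using T1hyp_null[OF assms] mink_commute[of "npos z" w] mink_commute[of "nneg z" w]
    by (simp add: perp_iff perp_proj_def mink_simps)
  show "b \<in> perp z \<Longrightarrow> mink (perp_proj z w) b = mink w b"
    by (simp add: perp_iff perp_proj_def mink_simps)
  show "linear (perp_proj z)"
    by (intro linearI) (simp_all add: perp_proj_def mink_simps algebra_simps add_divide_distrib)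
qed

lemma perp_eqI:
  assumes z: "z \<in> T1hyp" and "a \<in> perp z" "a' \<in> perp z" "\<And>b. b \<in> perp z \<Longrightarrow> mink a b = mink a' b"
  shows "a = a'"
proof -
  have d: "a - a' \<in> perp z" using assms subspace_diff[OF subspace_perp] by blast
  have "mink (a - a') w = 0" for w
  proof -
    have "mink (perp_proj z w) (a - a') = mink w (a - a')" by (rule perp_proj(2)[OF z d])
    moreover have "mink a (perp_proj z w) = mink a' (perp_proj z w)" by (rule assms(4)[OF perp_proj(1)[OF z]])
    ultimately show ?thesis
      using mink_commute[of a "perp_proj z w"] mink_commute[of a' "perp_proj z w"] mink_commute[of "a - a'" w]
      by (simp add: mink_simps)
  qed
  then have "a - a' = 0" by (rule mink_nondegenerate)
  then show ?thesis by simp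
qed

text \<open>The two eigenspaces of J are null and paired with each other, so testing against vectors
  with a single null component isolates the other component, where the form on \<open>perp z\<close>
  is nondegenerate.\<close>

lemma geod_metric_nondegenerate:
  assumes z: "z \<in> T1hyp" and eq: "\<And>Y. geod_metric (geod z) X Y = geod_metric (geod z) X' Y"
  shows "X = X'"
proof -
  note L = geod_lift[OF z]
  have lift: "geod_lift z (geod_diff z (of_null a b)) = of_null a b" if "a \<in> perp z" "b \<in> perp z" for a b
    by (rule L(3)) (simp add: gen_perp_iff[OF z] that)
  have pp: "npos (geod_lift z Y) \<in> perp z" "nneg (geod_lift z Y) \<in> perp z" for Y
    using L(1)[of Y] by (simp_all add: gen_perp_iff[OF z])
  have 0: "0 \<in> perp z" by (rule subspace_0[OF subspace_perp])
  have "npos (geod_lift z X) = npos (geod_lift z X')"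
  proof (rule perp_eqI[OF z pp(1) pp(1)])
    fix b assume b: "b \<in> perp z"
    show "mink (npos (geod_lift z X)) b = mink (npos (geod_lift z X')) b"
      using eq[of "geod_diff z (of_null 0 b)"] unfolding geod_metric_eq[OF z] lift[OF 0 b] by (simp add: mink_simps)
  qed
  moreover have "nneg (geod_lift z X) = nneg (geod_lift z X')"
  proof (rule perp_eqI[OF z pp(2) pp(2)])
    fix b assume b: "b \<in> perp z"
    show "mink (nneg (geod_lift z X)) b = mink (nneg (geod_lift z X')) b"
      using eq[of "geod_diff z (of_null b 0)"] unfolding geod_metric_eq[OF z] lift[OF b 0] by (simp add: mink_simps)
  qed
  ultimately have "geod_lift z X = geod_lift z X'" by (rule null_eqI)
  then show ?thesis using L(2) by metis
qed

text \<open>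
  A section that is horizontal at \<open>z\<close>, so that at this point the connection form drops out of
  the first derivatives of the metric.
\<close>

lemma normal_section:
  assumes z: "z \<in> T1hyp"
  defines "d \<equiv> chart_at geod_atlas (geod z)"
  obtains s where "smooth_on (snd d ` fst d) s" "\<And>x. x \<in> snd d ` fst d \<Longrightarrow> s x \<in> T1hyp"
    "\<And>x. x \<in> snd d ` fst d \<Longrightarrow> geod (s x) = chart_inv d x" "s (snd d (geod z)) = z"
    "\<And>u. frechet_derivative s (at (snd d (geod z))) u \<in> gen_perp z"
proof -
  let ?x = "snd d (geod z)" and ?I = "snd d ` fst d"
  note d = geod_chart_at[OF z, folded d_def]
  have x: "?x \<in> ?I" and I: "open ?I" using d geod_chart(3)[OF d(1)] by auto
  obtain s0 where s0: "smooth_on ?I s0" "\<And>y. y \<in> ?I \<Longrightarrow> s0 y \<in> T1hyp" "\<And>y. y \<in> ?I \<Longrightarrow> geod (s0 y) = chart_inv d y" "s0 ?x = z"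
    using local_section[OF z] unfolding d_def by metis
  define D where "D = frechet_derivative s0 (at ?x)"
  have D: "(s0 has_derivative D) (at ?x)" unfolding D_def by (rule smooth_on_has_derivative[OF s0(1) x])
  \<comment> \<open>A linear flow time suffices, since the connection form has to be removed at one
    point only.\<close>
  define \<tau>' where "\<tau>' u = mink (npos (D u)) (nneg z) / 2" for u
  define \<tau> where "\<tau> y = \<tau>' (y - ?x)" for y
  have lin: "linear \<tau>'" using has_derivative_linear[OF D]
    by (intro linearI) (simp_all add: \<tau>'_def linear_add linear_scale npos_simps mink_simps add_divide_distrib)
  have \<tau>s: "smooth_on ?I \<tau>" unfolding \<tau>_def by (intro smooth_on_linear[OF lin] smooth_intros I)
  have d\<tau>: "(\<tau> has_derivative \<tau>') (at ?x)" unfolding \<tau>_def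
    by (rule bounded_linear.has_derivative[OF lin[unfolded linear_conv_bounded_linear]]) (auto intro!: derivative_eq_intros)
  have \<tau>0: "\<tau> ?x = 0" using linear_0[OF lin] by (simp add: \<tau>_def)
  define s where "s y = flow (\<tau> y) (s0 y)" for y
  have sm: "smooth_on ?I s" unfolding s_def by (intro smooth_intros \<tau>s s0(1) I)
  have sT: "s y \<in> T1hyp" if "y \<in> ?I" for y using s0(2)[OF that] by (simp add: s_def)
  have sx: "s ?x = z" using s0(4) \<tau>0 by (simp add: s_def)
  have "frechet_derivative s (at ?x) u \<in> gen_perp z" for u
  proof (rule gen_perpI[OF z])
    note ds = smooth_on_has_derivative[OF sm x]
    show "T1_tan z (frechet_derivative s (at ?x) u)" using T1_tan_derivative[OF ds I x sT, of u] sx by simp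
    have "((\<lambda>y. npos (s y)) has_derivative (\<lambda>u. npos (frechet_derivative s (at ?x) u))) (at ?x)"
      by (rule bounded_linear.has_derivative[OF bounded_linear_npos ds])
    moreover have "((\<lambda>y. npos (s y)) has_derivative (\<lambda>u. exp (\<tau> ?x) *\<^sub>R npos (D u) + (exp (\<tau> ?x) * \<tau>' u) *\<^sub>R npos (s0 ?x))) (at ?x)"
      unfolding s_def npos_flow
      by (rule has_derivative_eq_rhs[OF has_derivative_scaleR[OF has_derivative_exp[OF d\<tau>] bounded_linear.has_derivative[OF bounded_linear_npos D]]])
        (simp add: fun_eq_iff)
    ultimately have eq: "(\<lambda>u. npos (frechet_derivative s (at ?x) u)) = (\<lambda>u. exp (\<tau> ?x) *\<^sub>R npos (D u) + (exp (\<tau> ?x) * \<tau>' u) *\<^sub>R npos (s0 ?x))"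
      by (rule has_derivative_unique)
    have "npos (frechet_derivative s (at ?x) u) = npos (D u) + \<tau>' u *\<^sub>R npos z"
      using fun_cong[OF eq, of u] \<tau>0 s0(4) by simp
    then show "mink (npos (frechet_derivative s (at ?x) u)) (nneg z) = 0"
      using T1hyp_null[OF z] by (simp add: mink_simps \<tau>'_def)
  qed
  moreover have "geod (s y) = chart_inv d y" if "y \<in> ?I" for y using s0(3)[OF that] by (simp add: s_def)
  ultimately show ?thesis by (intro that[OF sm sT _ sx])
qed

text \<open>Through a lift \<open>s\<close>, the coordinate metric is a pairing of first derivatives
  of \<open>s\<close> minus a product of two values of the connection form. This product vanishes to
  second order at \<open>x0\<close>, so the metric behaves there to first order as if induced from
  the ambient vector space, and the connection coefficients are the projections of the second
  derivatives of \<open>s\<close>.\<close>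

lemma levi_civita_geod:
  fixes z :: "'n::finite mink \<times> 'n mink" and u v w :: "(real^'n) \<times> (real^'n)"
  assumes z: "z \<in> T1hyp"
  defines "d \<equiv> chart_at geod_atlas (geod z)"
  defines "x0 \<equiv> snd d (geod z)"
  assumes s: "smooth_on (snd d ` fst d) s" "\<And>x. x \<in> snd d ` fst d \<Longrightarrow> s x \<in> T1hyp"
    "\<And>x. x \<in> snd d ` fst d \<Longrightarrow> geod (s x) = chart_inv d x" "s x0 = z"
    "\<And>u. frechet_derivative s (at x0) u \<in> gen_perp z"
  defines "H \<equiv> \<lambda>u v. frechet_derivative (\<lambda>x. frechet_derivative s (at x) u) (at x0) v"
  defines "L \<equiv> geod_lift z (levi_civita_symbol (metric_coord geod_atlas d geod_metric) x0 u v)"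
  shows "geod_lift z w = frechet_derivative s (at x0) w"
    and "b \<in> perp z \<Longrightarrow> mink (npos L) b = mink (npos (H u v)) b"
    and "b \<in> perp z \<Longrightarrow> mink (nneg L) b = mink (nneg (H u v)) b"
proof -
  let ?I = "snd d ` fst d" and ?h = "metric_coord geod_atlas d geod_metric"
  note d = geod_chart_at[OF z, folded d_def]
  have x0: "x0 \<in> ?I" and I: "open ?I" using d geod_chart(3)[OF d(1)] by (auto simp: x0_def)
  have inv0: "chart_inv d x0 = geod z" using chart_inv(1)[OF chart_atlas_geod d] by (simp add: x0_def)
  define D where "D x u = frechet_derivative s (at x) u" for x u
  have lift: "geod_lift (s x) (coord_field geod_atlas d u (chart_inv d x)) = gen_proj (s x) (D x u)" if x: "x \<in> ?I" for x u
  proof -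
    have "coord_field geod_atlas d u (chart_inv d x) =
        frechet_derivative (\<lambda>x'. snd (chart_at geod_atlas (geod (s x))) (chart_inv d x')) (at x) u"
      unfolding coord_field_def tangent_map_def using chart_inv(3)[OF chart_atlas_geod d(1) x] s(3)[OF x] by (simp add: o_def)
    also have "\<dots> = frechet_derivative (\<lambda>x'. snd (chart_at geod_atlas (geod (s x))) (geod (s x'))) (at x) u"
      by (subst frechet_derivative_cong_open[OF I x, of _ "\<lambda>x'. snd (chart_at geod_atlas (geod (s x))) (geod (s x'))"])
        (simp_all only: s(3))
    finally show ?thesis using geod_lift_derivative[OF smooth_on_has_derivative[OF s(1) x] I x s(2)] by (simp add: D_def)
  qed
  have gp: "gen_proj z (D x0 u) = D x0 u" for u unfolding D_def by (rule gen_proj_gen_perp[OF z s(5)])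
  have "coord_field geod_atlas d u (geod z) = u" for u
    unfolding d_def by (rule coord_field_chart_at[OF chart_atlas_geod]) (use z in \<open>auto simp: topspace_geod_top geodesics_def\<close>)
  then have lift0: "geod_lift z u = D x0 u" and h0: "?h x0 X Y = geod_metric (geod z) X Y" for u X Y
    using lift[OF x0, of u] inv0 s(4) gp by (simp_all add: metric_coord_def)
  then show "geod_lift z w = frechet_derivative s (at x0) w" by (simp add: D_def)
  \<comment> \<open>The subtracted product appears because \<open>s\<close> is horizontal only at
    \<open>x0\<close>, so that \<open>gen_proj\<close> contributes elsewhere.\<close>
  have h: "?h x u w = (mink (npos (D x u)) (nneg (D x w)) + mink (nneg (D x u)) (npos (D x w))
      - mink (npos (D x u)) (nneg (s x)) * mink (npos (D x w)) (nneg (s x))) / 2" if x: "x \<in> ?I" for x u w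
  proof -
    note zx = s(2)[OF x]
    have t: "T1_tan (s x) (D x w)" for w unfolding D_def
      by (rule T1_tan_derivative[OF smooth_on_has_derivative[OF s(1) x] I x s(2)])
    have m: "mink (nneg (D x w)) (npos (s x)) = - mink (npos (D x w)) (nneg (s x))"
      "mink (npos (s x)) (nneg (D x w)) = - mink (npos (D x w)) (nneg (s x))"
      "mink (nneg (s x)) (npos (D x w)) = mink (npos (D x w)) (nneg (s x))" for w
      using t[of w] mink_commute[of "nneg (D x w)" "npos (s x)"] mink_commute[of "npos (D x w)" "nneg (s x)"]
      by (auto simp: T1_tan_def)
    have "?h x u w = geod_metric (geod (s x)) (coord_field geod_atlas d u (chart_inv d x)) (coord_field geod_atlas d w (chart_inv d x))"
      using s(3)[OF x] by (simp add: metric_coord_def)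
    then show ?thesis unfolding geod_metric_eq[OF zx] lift[OF x] using T1hyp_null[OF zx]
      by (simp add: gen_proj_def npos_simps mink_simps m algebra_simps)
  qed
  have dD: "((\<lambda>x. D x u) has_derivative H u) (at x0)" for u
    unfolding D_def H_def by (rule smooth_on_has_derivative[OF smooth_on_frechet[OF s(1)] x0])
  have dh: "frechet_derivative (\<lambda>x. ?h x u w) (at x0) v = (mink (npos (H u v)) (nneg (D x0 w)) + mink (npos (D x0 u)) (nneg (H w v))
      + mink (nneg (H u v)) (npos (D x0 w)) + mink (nneg (D x0 u)) (npos (H w v))) / 2" for u w v
  proof -
    have zero: "mink (npos (D x0 u)) (nneg (s x0)) = 0" for u
      using gen_perp_mink(2)[OF z s(5)] s(4) by (simp add: D_def)
    note dp = bounded_linear.has_derivative[OF bounded_linear_npos dD] and dn = bounded_linear.has_derivative[OF bounded_linear_nneg dD]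
    note ds = bounded_linear.has_derivative[OF bounded_linear_nneg smooth_on_has_derivative[OF s(1) x0]]
    have "frechet_derivative (\<lambda>x. ?h x u w) (at x0) = frechet_derivative (\<lambda>x. (mink (npos (D x u)) (nneg (D x w)) + mink (nneg (D x u)) (npos (D x w))
      - mink (npos (D x u)) (nneg (s x)) * mink (npos (D x w)) (nneg (s x))) / 2) (at x0)"
      by (rule frechet_derivative_cong_open[OF I x0]) (rule h)
    also have "\<dots> = (\<lambda>v. ((mink (npos (D x0 u)) (nneg (H w v)) + mink (npos (H u v)) (nneg (D x0 w)))
        + (mink (nneg (D x0 u)) (npos (H w v)) + mink (nneg (H u v)) (npos (D x0 w)))
        - (mink (npos (D x0 u)) (nneg (s x0)) * (mink (npos (D x0 w)) (nneg (frechet_derivative s (at x0) v)) + mink (npos (H w v)) (nneg (s x0)))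
          + (mink (npos (D x0 u)) (nneg (frechet_derivative s (at x0) v)) + mink (npos (H u v)) (nneg (s x0))) * mink (npos (D x0 w)) (nneg (s x0)))) / 2)"
      by (rule frechet_derivative_eqI[OF bounded_linear.has_derivative[OF bounded_linear_divide has_derivative_diff[OF
            has_derivative_add[OF mink.FDERIV[OF dp dn] mink.FDERIV[OF dn dp]]
            has_derivative_mult[OF mink.FDERIV[OF dp ds] mink.FDERIV[OF dp ds]]]]])
    finally show ?thesis by (simp add: zero)
  qed
  \<comment> \<open>The candidate: the Hessian of \<open>s\<close> with both null components
    projected to \<open>perp z\<close>. Its symmetry is that of second derivatives.\<close>
  define \<Gamma> where "\<Gamma> u v = geod_diff z (of_null (perp_proj z (npos (H u v))) (perp_proj z (nneg (H u v))))" for u v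
  have lift\<Gamma>: "geod_lift z (\<Gamma> u v) = of_null (perp_proj z (npos (H u v))) (perp_proj z (nneg (H u v)))" for u v
    unfolding \<Gamma>_def by (rule geod_lift(3)[OF z]) (simp add: gen_perp_iff[OF z] perp_proj(1)[OF z])
  have Dperp: "npos (D x0 u) \<in> perp z" "nneg (D x0 u) \<in> perp z" for u
    using s(5)[of u] by (simp_all add: gen_perp_iff[OF z] D_def)
  have Hsym: "H u v = H v u" for u v unfolding H_def by (rule symmetric_second_derivative[OF s(1) I x0])
  have Hlin: "linear (H u)" for u unfolding H_def
    by (rule smooth_on_linear_frechet[OF smooth_on_frechet[OF s(1)] x0])
  have \<Gamma>sym: "\<Gamma> u v = \<Gamma> v u" for u v by (simp add: \<Gamma>_def Hsym)
  have h\<Gamma>: "?h x0 (\<Gamma> u v) w = (mink (npos (H u v)) (nneg (D x0 w)) + mink (nneg (H u v)) (npos (D x0 w))) / 2"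
    "?h x0 w (\<Gamma> u v) = (mink (nneg (D x0 w)) (npos (H u v)) + mink (npos (D x0 w)) (nneg (H u v))) / 2" for u v w
    unfolding h0 geod_metric_eq[OF z] lift\<Gamma> unfolding lift0
    using perp_proj(2)[OF z Dperp(1)[of w]] perp_proj(2)[OF z Dperp(2)[of w]]
      mink_commute[of "npos (D x0 w)"] mink_commute[of "nneg (D x0 w)"] by simp_all
  have "levi_civita_symbol ?h x0 = \<Gamma>"
  proof (rule levi_civita_symbol_eq)
    have l: "linear (\<lambda>v. \<Gamma> u v)" for u
      by (intro linearI; simp add: \<Gamma>_def linear_add[OF Hlin] linear_scale[OF Hlin] npos_simps linear_add[OF perp_proj(3)[OF z]]
          linear_scale[OF perp_proj(3)[OF z]] linear_add[OF linear_geod_diff[OF z], symmetric] linear_scale[OF linear_geod_diff[OF z], symmetric];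
          intro arg_cong[where f = "geod_diff z"] null_eqI; simp add: npos_simps)
    moreover have "(\<lambda>u. \<Gamma> u v) = (\<lambda>u. \<Gamma> v u)" for v using \<Gamma>sym by auto
    ultimately show "bilinear \<Gamma>" unfolding bilinear_def by simp
    show "\<Gamma> u w = \<Gamma> w u" for u w by (rule \<Gamma>sym)
    show "frechet_derivative (\<lambda>y. ?h y w t) (at x0) u = ?h x0 (\<Gamma> u w) t + ?h x0 w (\<Gamma> u t)" for u w t
      unfolding dh h\<Gamma> using Hsym by (simp add: add_divide_distrib)
    show "?h x0 u w = ?h x0 w u" for u w unfolding h[OF x0] by (simp add: mink_commute mult.commute)
    show "a = b" if "\<And>t. ?h x0 a t = ?h x0 b t" for a b
      using that unfolding h0 by (rule geod_metric_nondegenerate[OF z])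
  qed
  then have L: "L = of_null (perp_proj z (npos (H u v))) (perp_proj z (nneg (H u v)))" unfolding L_def using lift\<Gamma> by simp
  show "b \<in> perp z \<Longrightarrow> mink (npos L) b = mink (npos (H u v)) b" "b \<in> perp z \<Longrightarrow> mink (nneg L) b = mink (nneg (H u v)) b"
    unfolding L using perp_proj(2)[OF z] by simp_all
qed

section \<open>The potential of the Maslov form\<close>

definition gram_neg :: "(real^'n \<Rightarrow> ('n::finite) mink \<times> 'n mink) \<Rightarrow> real^'n^'n" where
  "gram_neg D = (\<chi> i j. mink (npos (D (axis i 1))) (nneg (D (axis j 1))))"

definition gram_pos :: "(real^'n \<Rightarrow> ('n::finite) mink \<times> 'n mink) \<Rightarrow> real^'n^'n" where
  "gram_pos D = (\<chi> i j. mink (npos (D (axis i 1))) (npos (D (axis j 1))))"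

text \<open>The squares make the logarithms meaningful whatever the signs of the determinants.\<close>

definition potential :: "(real^'n \<Rightarrow> ('n::finite) mink \<times> 'n mink) \<Rightarrow> real" where
  "potential D = (ln ((det (gram_neg D))\<^sup>2) - ln ((det (gram_pos D))\<^sup>2)) / (4 * real CARD('n))"

text \<open>The pointwise data of a flat section of a Riemannian immersion, detached from manifolds
  so that the potential can be treated by linear algebra.\<close>

definition immersive :: "('n::finite) mink \<times> 'n mink \<Rightarrow> (real^'n \<Rightarrow> 'n mink \<times> 'n mink) \<Rightarrow> bool" where
  "immersive z D \<longleftrightarrow> z \<in> T1hyp \<and> linear D \<and> (\<forall>v. D v \<in> gen_perp z) \<and>
     (\<forall>v. v \<noteq> 0 \<longrightarrow> mink (npos (D v)) (nneg (D v)) > 0)"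

section \<open>Linear algebra of the Gram matrices\<close>

lemma vec_expand: "(v :: real^'n) = (\<Sum>i\<in>UNIV. v $ i *\<^sub>R axis i 1)"
  by (simp add: vec_eq_iff axis_def if_distrib cong: if_cong)

lemma linear_vec_expand:
  fixes f :: "real^'n::finite \<Rightarrow> 'b::real_vector"
  assumes "linear f" shows "f v = (\<Sum>i\<in>UNIV. v $ i *\<^sub>R f (axis i 1))"
  using assms by (subst vec_expand) (simp add: linear_sum linear_scale)

lemma linear_npos: "linear npos" and linear_nneg: "linear nneg"
  using bounded_linear_npos bounded_linear_nneg by (simp_all add: linear_conv_bounded_linear)

lemma det_nonzeroI:
  fixes M :: "real^'n^'n::finite"
  assumes "\<And>x. M *v x = 0 \<Longrightarrow> x = 0" shows "det M \<noteq> 0"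
proof -
  have "\<exists>B. B ** M = mat 1" using assms by (simp add: matrix_left_invertible_ker)
  then show ?thesis by (metis det_I det_mul mult_eq_0_iff zero_neq_one)
qed

lemma matrix_inv:
  fixes M :: "real^'n^'n::finite"
  assumes "det M \<noteq> 0" shows "matrix_inv M ** M = mat 1" "M ** matrix_inv M = mat 1"
proof -
  have "\<exists>B. M ** B = mat 1 \<and> B ** M = mat 1" using assms by (simp add: invertible_det_nz[symmetric] invertible_def)
  then have "M ** matrix_inv M = mat 1 \<and> matrix_inv M ** M = mat 1" unfolding matrix_inv_def by (rule someI_ex)
  then show "matrix_inv M ** M = mat 1" "M ** matrix_inv M = mat 1" by auto
qed

lemma matrix_inv_symmetric:
  fixes M :: "real^'n^'n::finite"
  assumes "det M \<noteq> 0" "transpose M = M" shows "transpose (matrix_inv M) = matrix_inv M"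
proof -
  have "transpose (matrix_inv M) ** M = mat 1"
    using matrix_inv(2)[OF assms(1)] assms(2) by (metis matrix_transpose_mul transpose_mat)
  then have "transpose (matrix_inv M) ** M ** matrix_inv M = matrix_inv M" by simp
  then show ?thesis using matrix_inv(2)[OF assms(1)] by (simp add: matrix_mul_assoc[symmetric])
qed

text \<open>Positivity makes \<open>npos \<circ> D\<close> injective, so by dimension its image is
  all of \<open>perp z\<close>, and there the form is nondegenerate.\<close>

lemma immersive_eq_0:
  fixes D :: "real^'n \<Rightarrow> ('n::finite) mink \<times> 'n mink"
  assumes D: "immersive z D" and E: "E \<in> perp z" "\<And>i. mink (npos (D (axis i 1))) E = 0"
  shows "E = 0"
proof -
  have z: "z \<in> T1hyp" and lin: "linear D" and perp: "\<And>v. D v \<in> gen_perp z"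
    and pos: "\<And>v. v \<noteq> 0 \<Longrightarrow> mink (npos (D v)) (nneg (D v)) > 0" using D by (auto simp: immersive_def)
  define f where "f v = npos (D v)" for v
  have f: "linear f" using linear_compose[OF lin linear_npos] by (simp add: f_def[abs_def] o_def)
  have "inj f" unfolding linear_injective_0[OF f] f_def using pos by (metis less_irrefl mink.zero_left)
  then have "dim (range f) = dim (UNIV :: (real^'n) set)" by (intro dim_image_eq[OF f]) auto
  moreover have "range f \<subseteq> perp z" using perp by (auto simp: f_def gen_perp_iff[OF z])
  ultimately have range: "range f = perp z"
    using subspace_dim_equal[of "range f" "perp z"] dim_perp[OF z] linear_subspace_image[OF f subspace_UNIV] subspace_perp[of z]
    by simp
  have fE: "mink (f v) E = 0" for v
    unfolding linear_vec_expand[OF f, of v] using E(2) by (simp add: mink.sum_left mink_simps f_def)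
  show ?thesis
  proof (rule perp_eqI[OF z E(1) subspace_0[OF subspace_perp]])
    fix b assume "b \<in> perp z"
    then obtain v where "b = f v" using range by auto
    then show "mink E b = mink 0 b" using fE mink_commute[of E b] by (simp add: mink_simps)
  qed
qed

lemma immersive_det:
  fixes D :: "real^'n \<Rightarrow> ('n::finite) mink \<times> 'n mink"
  assumes D: "immersive z D" shows "det (gram_neg D) \<noteq> 0" "det (gram_pos D) \<noteq> 0"
proof -
  have z: "z \<in> T1hyp" and lin: "linear D" and perp: "\<And>v. D v \<in> gen_perp z"
    and pos: "\<And>v. v \<noteq> 0 \<Longrightarrow> mink (npos (D v)) (nneg (D v)) > 0" using D by (auto simp: immersive_def)
  have f: "linear (\<lambda>v. npos (D v))" and g: "linear (\<lambda>v. nneg (D v))"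
    using linear_compose[OF lin linear_npos] linear_compose[OF lin linear_nneg] by (simp_all add: o_def)
  show "det (gram_neg D) \<noteq> 0"
  proof (rule det_nonzeroI, rule ccontr)
    fix x assume x: "gram_neg D *v x = 0" "x \<noteq> 0"
    have "mink (npos (D (axis i 1))) (nneg (D x)) = (gram_neg D *v x) $ i" for i
      unfolding linear_vec_expand[OF g, of x]
      by (simp add: gram_neg_def matrix_vector_mult_def mink.sum_right mink_simps mult.commute)
    then have "mink (npos (D x)) (nneg (D x)) = 0"
      unfolding linear_vec_expand[OF f, of x] by (simp add: x(1) mink.sum_left mink_simps)
    then show False using pos[OF x(2)] by simp
  qed
  show "det (gram_pos D) \<noteq> 0"
  proof (rule det_nonzeroI, rule ccontr)
    fix x assume x: "gram_pos D *v x = 0" "x \<noteq> 0"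
    have "mink (npos (D (axis i 1))) (npos (D x)) = (gram_pos D *v x) $ i" for i
      unfolding linear_vec_expand[OF f, of x]
      by (simp add: gram_pos_def matrix_vector_mult_def mink.sum_right mink_simps mult.commute)
    then have "npos (D x) = 0" using immersive_eq_0[OF D, of "npos (D x)"] perp[of x]
      by (simp add: x(1) gen_perp_iff[OF z])
    then show False using pos[OF x(2)] by (simp add: mink_simps)
  qed
qed

text \<open>A change of basis multiplies both Gram determinants by the square of the same
  determinant, and the difference of logarithms cancels it. Hence the potential does not see the
  choice of chart.\<close>

lemma potential_compose:
  fixes D :: "real^'n \<Rightarrow> ('n::finite) mink \<times> 'n mink"
  assumes D: "immersive z D" and T: "linear T" "inj T"
  shows "potential (\<lambda>v. D (T v)) = potential D"
proof -
  have lin: "linear D" using D by (simp add: immersive_def)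
  have DT: "f (D (T (axis i 1))) = (\<Sum>k\<in>UNIV. matrix T $ k $ i *\<^sub>R f (D (axis k 1)))" if "linear f" for f :: "_ \<Rightarrow> 'n mink" and i
    using linear_vec_expand[OF linear_compose[OF lin that], of "T (axis i 1)"] by (simp add: matrix_def)
  have neg: "gram_neg (\<lambda>v. D (T v)) = transpose (matrix T) ** gram_neg D ** matrix T"
    unfolding gram_neg_def DT[OF linear_npos] DT[OF linear_nneg] matrix_matrix_mult_def transpose_def
    by (simp add: vec_eq_iff mink.sum_left mink.sum_right mink_simps sum_distrib_right sum_distrib_left mult.commute mult.left_commute)
  have pos: "gram_pos (\<lambda>v. D (T v)) = transpose (matrix T) ** gram_pos D ** matrix T"
    unfolding gram_pos_def DT[OF linear_npos] matrix_matrix_mult_def transpose_def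
    by (simp add: vec_eq_iff mink.sum_left mink.sum_right mink_simps sum_distrib_right sum_distrib_left mult.commute mult.left_commute)
  have t: "det (matrix T) \<noteq> 0"
  proof (rule det_nonzeroI)
    fix x assume "matrix T *v x = 0"
    then have "T x = 0" using matrix_vector_mul(2)[OF T(1)] by metis
    then show "x = 0" using T by (simp add: linear_injective_0)
  qed
  have "ln ((det (matrix T) * a * det (matrix T))\<^sup>2) = ln ((det (matrix T))\<^sup>2 * (det (matrix T))\<^sup>2) + ln (a\<^sup>2)" if "a \<noteq> 0" for a
  proof -
    have "(det (matrix T) * a * det (matrix T))\<^sup>2 = ((det (matrix T))\<^sup>2 * (det (matrix T))\<^sup>2) * a\<^sup>2"
      by (simp add: power2_eq_square)
    then show ?thesis using t that by (simp add: ln_mult_pos)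
  qed
  then show ?thesis unfolding potential_def neg pos det_mul det_transpose
    using immersive_det[OF D] by simp
qed

text \<open>The mixed Gram matrix is invariant, while \<open>gram_pos\<close> is multiplied by
  \<open>exp (2 * t)\<close>. Its squared determinant then gains the exponential of
  \<open>4 n t\<close>, which is why the potential is divided by \<open>4 n\<close>.\<close>

lemma potential_flow:
  fixes D :: "real^'n \<Rightarrow> ('n::finite) mink \<times> 'n mink"
  assumes D: "immersive z D" shows "potential (\<lambda>v. flow t (D v)) = potential D - t"
proof -
  have neg: "gram_neg (\<lambda>v. flow t (D v)) = gram_neg D"
    by (simp add: gram_neg_def mink_simps exp_cancel)
  have "gram_pos (\<lambda>v. flow t (D v)) = (exp t * exp t) *\<^sub>R gram_pos D"
    by (simp add: gram_pos_def vec_eq_iff mink_simps)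
  then have "gram_pos (\<lambda>v. flow t (D v)) = (\<chi> i. exp (2 * t) *s (gram_pos D $ i))"
    by (simp add: vec_eq_iff mult_exp_exp)
  then have pos: "det (gram_pos (\<lambda>v. flow t (D v))) = exp (2 * t) ^ CARD('n) * det (gram_pos D)"
    by (simp add: det_rows_mul)
  have "ln ((exp (2 * t) ^ CARD('n) * det (gram_pos D))\<^sup>2) = 4 * real CARD('n) * t + ln ((det (gram_pos D))\<^sup>2)"
  proof -
    have "(exp (2 * t) ^ CARD('n) * det (gram_pos D))\<^sup>2 = exp (4 * real CARD('n) * t) * (det (gram_pos D))\<^sup>2"
      by (simp add: power_mult_distrib exp_of_nat_mult[symmetric] power_mult[symmetric] mult.commute mult.left_commute)
    then show ?thesis using immersive_det(2)[OF D] by (simp add: ln_mult_pos)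
  qed
  then show ?thesis unfolding potential_def neg pos by (simp add: field_simps)
qed

lemma immersive_flow:
  assumes "immersive z D" shows "immersive (flow t z) (\<lambda>v. flow t (D v))"
  using assms linear_compose[of D "flow t"] linear_flow[of t]
  by (auto simp: immersive_def flow_gen_perp o_def mink_simps exp_cancel)

text \<open>Both sides are the \<open>j\<close>-th member of the basis of \<open>perp z\<close> dual to \<open>npos (D e\<^sub>i)\<close>.\<close>

lemma dual_basis:
  fixes D :: "real^'n \<Rightarrow> ('n::finite) mink \<times> 'n mink"
  assumes D: "immersive z D"
  shows "(\<Sum>i\<in>UNIV. matrix_inv (gram_pos D) $ i $ j *\<^sub>R npos (D (axis i 1))) = (\<Sum>i\<in>UNIV. matrix_inv (gram_neg D) $ i $ j *\<^sub>R nneg (D (axis i 1)))"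
    (is "?a = ?b")
proof -
  have z: "z \<in> T1hyp" and perp: "\<And>v. D v \<in> gen_perp z" using D by (auto simp: immersive_def)
  have p: "npos (D v) \<in> perp z" "nneg (D v) \<in> perp z" for v using perp[of v] by (simp_all add: gen_perp_iff[OF z])
  have "?a - ?b \<in> perp z"
    by (intro subspace_diff[OF subspace_perp] subspace_sum[OF subspace_perp] subspace_scale[OF subspace_perp] p)
  moreover have "mink (npos (D (axis k 1))) (?a - ?b) = 0" for k
  proof -
    have "mink (npos (D (axis k 1))) ?a = (gram_pos D ** matrix_inv (gram_pos D)) $ k $ j"
      by (simp add: mink.sum_right mink_simps matrix_matrix_mult_def gram_pos_def mult.commute)
    moreover have "mink (npos (D (axis k 1))) ?b = (gram_neg D ** matrix_inv (gram_neg D)) $ k $ j"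
      by (simp add: mink.sum_right mink_simps matrix_matrix_mult_def gram_neg_def mult.commute)
    ultimately show ?thesis using immersive_det[OF D] by (simp add: matrix_inv mink_simps)
  qed
  ultimately have "?a - ?b = 0" using immersive_eq_0[OF D] by blast
  then show ?thesis by simp
qed

text \<open>Jacobi's formula turns both logarithms into traces. The trace coming from
  \<open>gram_pos\<close> is rewritten over \<open>gram_neg\<close> by means of the dual basis and
  cancels half of the mixed terms up to sign.\<close>

lemma has_derivative_potential:
  fixes T :: "'e::real_normed_vector \<Rightarrow> real^'n \<Rightarrow> ('n::finite) mink \<times> 'n mink"
  assumes D: "immersive z (T y0)" and sym: "\<And>v w. mink (npos (T y0 v)) (nneg (T y0 w)) = mink (nneg (T y0 v)) (npos (T y0 w))"
    and T: "\<And>v. ((\<lambda>y. T y v) has_derivative T' v) (at y0)"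
  shows "((\<lambda>y. potential (T y)) has_derivative (\<lambda>u. (\<Sum>i\<in>UNIV. \<Sum>j\<in>UNIV. matrix_inv (gram_neg (T y0)) $ i $ j *
    ((mink (nneg (T' (axis i 1) u)) (npos (T y0 (axis j 1))) - mink (npos (T' (axis i 1) u)) (nneg (T y0 (axis j 1)))) / 2)) / real CARD('n))) (at y0)"
proof -
  let ?e = "\<lambda>i. axis i (1::real) :: real^'n"
  define IK PK where "IK = matrix_inv (gram_neg (T y0))" and "PK = matrix_inv (gram_pos (T y0))"
  note det = immersive_det[OF D]
  have "mink (npos (T y0 v)) (nneg (T y0 w)) = mink (npos (T y0 w)) (nneg (T y0 v))" for v w
    using sym[of v w] mink_commute[of "nneg (T y0 v)" "npos (T y0 w)"] by simp
  then have "transpose (gram_neg (T y0)) = gram_neg (T y0)"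
    unfolding gram_neg_def transpose_def by (simp add: vec_eq_iff)
  then have "transpose IK = IK" unfolding IK_def by (rule matrix_inv_symmetric[OF det(1)])
  then have IKs: "IK $ i $ j = IK $ j $ i" for i j by (metis transpose_def vec_lambda_beta)
  have "transpose (gram_pos (T y0)) = gram_pos (T y0)"
    using mink_commute by (auto simp: gram_pos_def transpose_def vec_eq_iff)
  then have "transpose PK = PK" unfolding PK_def by (rule matrix_inv_symmetric[OF det(2)])
  then have PKs: "PK $ i $ j = PK $ j $ i" for i j by (metis transpose_def vec_lambda_beta)
  note dp = bounded_linear.has_derivative[OF bounded_linear_npos T] and dn = bounded_linear.has_derivative[OF bounded_linear_nneg T]
  define a where "a i j u = mink (npos (T' (?e i) u)) (nneg (T y0 (?e j)))" for i j u
  define b where "b i j u = mink (nneg (T' (?e i) u)) (npos (T y0 (?e j)))" for i j u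
  define c where "c i j u = mink (npos (T' (?e i) u)) (npos (T y0 (?e j)))" for i j u
  have "((\<lambda>y. gram_neg (T y) $ i $ j) has_derivative (\<lambda>u. b j i u + a i j u)) (at y0)" for i j
    unfolding gram_neg_def a_def b_def vec_lambda_beta
    by (rule has_derivative_eq_rhs[OF mink.FDERIV[OF dp dn]]) (simp add: fun_eq_iff mink_commute)
  from has_derivative_ln_det_square[OF this matrix_inv(1)[OF det(1)]]
  have 1: "((\<lambda>y. ln ((det (gram_neg (T y)))\<^sup>2)) has_derivative (\<lambda>u. 2 * (\<Sum>i\<in>UNIV. \<Sum>j\<in>UNIV. IK $ i $ j * (b i j u + a j i u)))) (at y0)"
    by (simp add: IK_def)
  have "((\<lambda>y. gram_pos (T y) $ i $ j) has_derivative (\<lambda>u. c j i u + c i j u)) (at y0)" for i j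
    unfolding gram_pos_def c_def vec_lambda_beta
    by (rule has_derivative_eq_rhs[OF mink.FDERIV[OF dp dp]]) (simp add: fun_eq_iff mink_commute)
  from has_derivative_ln_det_square[OF this matrix_inv(1)[OF det(2)]]
  have 2: "((\<lambda>y. ln ((det (gram_pos (T y)))\<^sup>2)) has_derivative (\<lambda>u. 2 * (\<Sum>i\<in>UNIV. \<Sum>j\<in>UNIV. PK $ i $ j * (c i j u + c j i u)))) (at y0)"
    by (simp add: PK_def)
  have swap: "(\<Sum>i\<in>UNIV. \<Sum>j\<in>UNIV. K $ i $ j * f i j) = (\<Sum>i\<in>UNIV. \<Sum>j\<in>UNIV. K $ i $ j * f j i)"
    if "\<And>i j. K $ i $ j = K $ j $ i" for K :: "real^'n^'n" and f :: "'n \<Rightarrow> 'n \<Rightarrow> real"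
    by (subst sum.swap) (simp add: that)
  \<comment> \<open>Since \<open>dual_basis\<close> describes one dual basis in two ways, pairing
    derivatives of the positive component with it can be expressed by either Gram matrix.\<close>
  have Pa: "(\<Sum>i\<in>UNIV. \<Sum>j\<in>UNIV. PK $ i $ j * c j i u) = (\<Sum>i\<in>UNIV. \<Sum>j\<in>UNIV. IK $ i $ j * a j i u)" for u
  proof -
    have "(\<Sum>i\<in>UNIV. \<Sum>j\<in>UNIV. PK $ i $ j * c j i u) = (\<Sum>j\<in>UNIV. mink (npos (T' (?e j) u)) (\<Sum>i\<in>UNIV. PK $ i $ j *\<^sub>R npos (T y0 (?e i))))"
      by (subst sum.swap) (simp add: mink.sum_right mink_simps c_def)
    also have "\<dots> = (\<Sum>j\<in>UNIV. mink (npos (T' (?e j) u)) (\<Sum>i\<in>UNIV. IK $ i $ j *\<^sub>R nneg (T y0 (?e i))))"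
      unfolding PK_def IK_def dual_basis[OF D] ..
    also have "\<dots> = (\<Sum>j\<in>UNIV. \<Sum>i\<in>UNIV. IK $ i $ j * a j i u)"
      by (simp add: mink.sum_right mink_simps a_def)
    also have "\<dots> = (\<Sum>i\<in>UNIV. \<Sum>j\<in>UNIV. IK $ i $ j * a j i u)" by (rule sum.swap)
    finally show ?thesis .
  qed
  have "((\<lambda>y. potential (T y)) has_derivative (\<lambda>u. (2 * (\<Sum>i\<in>UNIV. \<Sum>j\<in>UNIV. IK $ i $ j * (b i j u + a j i u))
      - 2 * (\<Sum>i\<in>UNIV. \<Sum>j\<in>UNIV. PK $ i $ j * (c i j u + c j i u))) / (4 * real CARD('n)))) (at y0)"
    unfolding potential_def by (rule bounded_linear.has_derivative[OF bounded_linear_divide has_derivative_diff[OF 1 2]])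
  moreover have "(2 * (\<Sum>i\<in>UNIV. \<Sum>j\<in>UNIV. IK $ i $ j * (b i j u + a j i u)) - 2 * (\<Sum>i\<in>UNIV. \<Sum>j\<in>UNIV. PK $ i $ j * (c i j u + c j i u))) / (4 * real CARD('n))
      = (\<Sum>i\<in>UNIV. \<Sum>j\<in>UNIV. IK $ i $ j * ((b i j u - a i j u) / 2)) / real CARD('n)" for u
  proof -
    have "(\<Sum>i\<in>UNIV. \<Sum>j\<in>UNIV. PK $ i $ j * c i j u) = (\<Sum>i\<in>UNIV. \<Sum>j\<in>UNIV. PK $ i $ j * c j i u)"
      by (rule swap[OF PKs])
    moreover have "(\<Sum>i\<in>UNIV. \<Sum>j\<in>UNIV. IK $ i $ j * a i j u) = (\<Sum>i\<in>UNIV. \<Sum>j\<in>UNIV. IK $ i $ j * a j i u)"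
      by (rule swap[OF IKs])
    moreover have e3: "(\<Sum>i\<in>UNIV. \<Sum>j\<in>UNIV. IK $ i $ j * ((b i j u - a i j u) / 2)) =
        ((\<Sum>i\<in>UNIV. \<Sum>j\<in>UNIV. IK $ i $ j * b i j u) - (\<Sum>i\<in>UNIV. \<Sum>j\<in>UNIV. IK $ i $ j * a i j u)) / 2"
      by (simp add: sum_subtractf sum_divide_distrib diff_divide_distrib right_diff_distrib)
    moreover have e1: "(\<Sum>i\<in>UNIV. \<Sum>j\<in>UNIV. IK $ i $ j * (b i j u + a j i u)) =
        (\<Sum>i\<in>UNIV. \<Sum>j\<in>UNIV. IK $ i $ j * b i j u) + (\<Sum>i\<in>UNIV. \<Sum>j\<in>UNIV. IK $ i $ j * a j i u)"
      by (simp add: distrib_left sum.distrib)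
    moreover have e2: "(\<Sum>i\<in>UNIV. \<Sum>j\<in>UNIV. PK $ i $ j * (c i j u + c j i u)) =
        (\<Sum>i\<in>UNIV. \<Sum>j\<in>UNIV. PK $ i $ j * c i j u) + (\<Sum>i\<in>UNIV. \<Sum>j\<in>UNIV. PK $ i $ j * c j i u)"
      by (simp add: distrib_left sum.distrib)
    ultimately show ?thesis unfolding e1 e2 e3 Pa by (simp add: field_simps)
  qed
  ultimately show ?thesis unfolding IK_def[symmetric] a_def[symmetric] b_def[symmetric] by simp
qed

section \<open>The Maslov form is exact on the universal cover\<close>

locale riemannian_lagrangian = lagrangian_map A G for A :: "('u::t2_space, real^'n::finite) chart set" and G +
  assumes riemannian_G: "riemannian A G"

context riemannian_lagrangian
begin

context
  fixes \<zeta> assumes flat: "flat_on A G UNIV \<zeta>"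
begin

abbreviation d\<zeta> :: "'u \<Rightarrow> real^'n \<Rightarrow> 'n mink \<times> 'n mink" where "d\<zeta> p \<equiv> tangent_map A std_atlas \<zeta> p"
abbreviation dG :: "'u \<Rightarrow> real^'n \<Rightarrow> (real^'n) \<times> (real^'n)" where "dG p \<equiv> tangent_map A geod_atlas G p"

lemma flat_T1: "\<zeta> p \<in> T1hyp" and flat_geod: "G p = geod (\<zeta> p)" and flat_perp: "d\<zeta> p v \<in> gen_perp (\<zeta> p)"
  using flat_onD[OF flat] by auto

lemma linear_dzeta: "linear (d\<zeta> p)"
  by (rule tangent_map_linear[OF atlas chart_atlas_std flat_onD(1)[OF flat]]) simp

lemma linear_dG: "linear (dG p)"
  by (rule tangent_map_linear[OF atlas chart_atlas_geod smooth_G]) simp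

lemma chart_inv_at: "chart_inv (chart_at A p) (snd (chart_at A p) p) = p"
  using chart_inv(1)[OF atlas chart_at_A] .

lemma coord_field_at: "coord_field A (chart_at A p) w p = w"
  by (rule coord_field_chart_at[OF atlas]) simp

text \<open>For a flat section the derivative is already horizontal, so the projection in
  \<open>chart_lift\<close> does nothing.\<close>

lemma lift_dG: "geod_lift (\<zeta> p) (dG p v) = d\<zeta> p v"
proof -
  note F = flat_chart[OF chart_at_A(1)[of p] flat]
  have y: "snd (chart_at A p) p \<in> snd (chart_at A p) ` (UNIV \<inter> fst (chart_at A p))" using chart_at_A[of p] by simp
  from chart_lift[OF chart_at_A(1)[of p] F(1,2,3,4,5) y, of v] F(7)[OF y, of v, symmetric]
  have "geod_lift (\<zeta> p) (dG p v) = gen_proj (\<zeta> p) (d\<zeta> p v)"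
    by (simp only: chart_inv_at coord_field_at)
  then show ?thesis using gen_proj_gen_perp[OF flat_T1 flat_perp] by simp
qed

lemma dzeta_sym: "mink (npos (d\<zeta> p v)) (nneg (d\<zeta> p w)) = mink (nneg (d\<zeta> p v)) (npos (d\<zeta> p w))"
proof -
  have "geod_symp (geod (\<zeta> p)) (dG p v) (dG p w) = 0"
    using lagrangian_G unfolding lagrangian_def flat_geod[symmetric] by blast
  then show ?thesis unfolding geod_symp_eq[OF flat_T1] lift_dG by simp
qed

lemma first_ff_eq: "first_ff A geod_atlas geod_metric G p v w = mink (npos (d\<zeta> p v)) (nneg (d\<zeta> p w))"
  unfolding first_ff_def flat_geod[of p] geod_metric_eq[OF flat_T1] using dzeta_sym[of p v w] lift_dG[of p]
  by (simp add: flat_geod[symmetric])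

lemma immersive_dzeta: "immersive (\<zeta> p) (d\<zeta> p)"
  using riemannian_G flat_T1 flat_perp linear_dzeta unfolding immersive_def riemannian_def first_ff_eq by blast

text \<open>An ambient second derivative in the chart picked at \<open>p\<close>. It depends on the
  chart, but a change of chart alters it only by values of \<open>d\<zeta> p\<close>, which cancel
  in \<open>cubic\<close> by \<open>dzeta_sym\<close>.\<close>

definition hess :: "'u \<Rightarrow> real^'n \<Rightarrow> real^'n \<Rightarrow> 'n mink \<times> 'n mink" where
  "hess p w v = frechet_derivative (\<lambda>y. frechet_derivative (\<lambda>y. \<zeta> (chart_inv (chart_at A p) y)) (at y) w) (at (snd (chart_at A p) p)) v"

lemma chart_facts:
  fixes p
  defines "c \<equiv> chart_at A p"
  defines "S \<equiv> snd c ` (UNIV \<inter> fst c)" and "Z \<equiv> \<lambda>y. \<zeta> (chart_inv c y)"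
  shows "open S" "smooth_on S Z" "snd c p \<in> S" "frechet_derivative Z (at (snd c p)) w = d\<zeta> p w"
    "hess p v w = hess p w v" "((\<lambda>y. frechet_derivative Z (at y) w) has_derivative hess p w) (at (snd c p))"
proof -
  have c: "c \<in> A" "p \<in> fst c" using chart_at_A by (auto simp: c_def)
  note F = flat_chart[OF c(1) flat, folded S_def Z_def]
  show S: "open S" "smooth_on S Z" using F by auto
  show y: "snd c p \<in> S" using c by (simp add: S_def)
  show "frechet_derivative Z (at (snd c p)) w = d\<zeta> p w"
    using F(7)[OF y, of w] chart_inv(1)[OF atlas c] coord_field_at[of p w] by (simp add: c_def)
  show "hess p v w = hess p w v" unfolding hess_def c_def[symmetric] Z_def[symmetric]
    by (rule symmetric_second_derivative[OF S(2,1) y])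
  show "((\<lambda>y. frechet_derivative Z (at y) w) has_derivative hess p w) (at (snd c p))"
    unfolding hess_def c_def[symmetric] Z_def[symmetric]
    by (rule smooth_on_has_derivative[OF smooth_on_frechet[OF S(2)] y])
qed

text \<open>The cubic form of the Lagrangian immersion, that is, the symplectic pairing of the
  second fundamental form on \<open>v\<close>, \<open>w\<close> with the tangent vector of
  \<open>u\<close>; see \<open>second_ff_cubic\<close>.\<close>

definition cubic :: "'u \<Rightarrow> real^'n \<Rightarrow> real^'n \<Rightarrow> real^'n \<Rightarrow> real" where
  "cubic p v w u = (mink (nneg (hess p w v)) (npos (d\<zeta> p u)) - mink (npos (hess p w v)) (nneg (d\<zeta> p u))) / 2"

lemma cubic_sym1: "cubic p v w u = cubic p w v u"
  unfolding cubic_def using chart_facts(5)[of p v w] by simp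

text \<open>The derivative of the Lagrangian condition along \<open>v\<close>.\<close>

lemma cubic_sym2: "cubic p v w u = cubic p v u w"
proof -
  define c where "c = chart_at A p"
  define S where "S = snd c ` (UNIV \<inter> fst c)"
  define Z where "Z y = \<zeta> (chart_inv c y)" for y
  note C = chart_facts[of p, folded c_def, folded S_def Z_def]
  have c: "c \<in> A" using chart_at_A by (simp add: c_def)
  note F = flat_chart[OF c flat, folded S_def Z_def]
  let ?y = "snd c p"
  define T where "T y w = frechet_derivative Z (at y) w" for y w
  have T0: "T ?y w = d\<zeta> p w" for w using C(4) by (simp add: T_def)
  have dT: "((\<lambda>y. T y w) has_derivative hess p w) (at ?y)" for w unfolding T_def by (rule C(6))
  note dp = bounded_linear.has_derivative[OF bounded_linear_npos dT] and dn = bounded_linear.has_derivative[OF bounded_linear_nneg dT]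
  have lag: "mink (nneg (T y w)) (npos (T y u)) = mink (npos (T y w)) (nneg (T y u))" if "y \<in> S" for y
    unfolding T_def by (rule lagrangian_chart[OF c C(1) F(2) C(2) F(4,5) that])
  have "((\<lambda>y. mink (npos (T y w)) (nneg (T y u))) has_derivative (\<lambda>v. mink (nneg (T ?y w)) (npos (hess p u v)) + mink (nneg (hess p w v)) (npos (T ?y u)))) (at ?y)"
    by (rule has_derivative_transform_within_open[OF mink.FDERIV[OF dn dp] C(1,3)]) (rule lag)
  from has_derivative_unique[OF this mink.FDERIV[OF dp dn]]
  have eq: "(\<lambda>v. mink (nneg (T ?y w)) (npos (hess p u v)) + mink (nneg (hess p w v)) (npos (T ?y u)))
    = (\<lambda>v. mink (npos (T ?y w)) (nneg (hess p u v)) + mink (npos (hess p w v)) (nneg (T ?y u)))" .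
  show ?thesis using fun_cong[OF eq, of v] unfolding cubic_def T0
    using mink_commute[of "nneg (d\<zeta> p w)" "npos (hess p u v)"] mink_commute[of "npos (d\<zeta> p w)" "nneg (hess p u v)"] by simp
qed

lemma cubic_cyclic: "cubic p v w u = cubic p u v w"
  using cubic_sym1 cubic_sym2 by metis

text \<open>A covariant derivative taken in the abstract charts agrees, as tested on
  \<open>perp\<close>, with the ambient Hessian of the flat section. It is first identified with the
  second derivative of another lift \<open>f\<close>, built from a normal section; \<open>f\<close>
  and the flat section are then compared by the dilation that relates them.\<close>

lemma cov_lift:
  fixes p v w
  defines "L \<equiv> geod_lift (\<zeta> p) (cov_deriv A geod_atlas geod_metric G (\<lambda>q. dG q (coord_field A (chart_at A p) w q)) p v)"
  assumes b: "b \<in> perp (\<zeta> p)"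
  shows "mink (npos L) b = mink (npos (hess p w v)) b" "mink (nneg L) b = mink (nneg (hess p w v)) b"
proof -
  define z where "z = \<zeta> p"
  have z: "z \<in> T1hyp" and Gz: "G p = geod z" using flat_T1 flat_geod by (auto simp: z_def)
  define c where "c = chart_at A p"
  have c: "c \<in> A" "p \<in> fst c" using chart_at_A by (auto simp: c_def)
  define d where "d = chart_at geod_atlas (geod z)"
  note d = geod_chart_at[OF z, folded d_def]
  define x0 y0 where "x0 = snd d (geod z)" and "y0 = snd c p"
  obtain s where s: "smooth_on (snd d ` fst d) s" "\<And>x. x \<in> snd d ` fst d \<Longrightarrow> s x \<in> T1hyp"
    "\<And>x. x \<in> snd d ` fst d \<Longrightarrow> geod (s x) = chart_inv d x" "s x0 = z" "\<And>u. frechet_derivative s (at x0) u \<in> gen_perp z"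
    using normal_section[OF z] unfolding d_def x0_def by metis
  note LC = levi_civita_geod[OF z, folded d_def, folded x0_def, OF s]
  define S where "S = snd c ` (UNIV \<inter> fst c)"
  define Z where "Z y = \<zeta> (chart_inv c y)" for y
  note C = chart_facts[of p, folded c_def, folded S_def Z_def]
  define W where "W = {q. G q \<in> fst d}"
  have W: "openin euclidean W" using smooth_map_onD(3)[OF smooth_G chart_atlasD(1)[OF chart_atlas_geod d(1)]] by (simp add: W_def)
  define R where "R = snd c ` (W \<inter> fst c)"
  have R: "open R" "R \<subseteq> S" "y0 \<in> R" using chart_atlasD(3)[OF atlas c(1) W] c(2) d(2) Gz by (auto simp: R_def S_def W_def y0_def)
  define g where "g y = snd d (G (chart_inv c y))" for y
  have inv: "chart_inv c y \<in> W" "chart_inv c y \<in> fst c" if "y \<in> R" for y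
    using that chart_inv(1)[OF atlas c(1)] by (auto simp: R_def)
  have inv0: "chart_inv c y0 = p" using chart_inv(1)[OF atlas c] by (simp add: y0_def)
  have GW: "smooth_map_on euclidean A geod_top geod_atlas W G" by (rule smooth_map_on_subset[OF smooth_G W]) simp
  have dG: "smooth_map_on euclidean A euclidean std_atlas W (\<lambda>q. snd d (G q))"
    by (rule smooth_map_on_compose[OF atlas chart_atlas_geod chart_atlas_std GW smooth_map_on_chart[OF chart_atlas_geod d(1)]])
      (auto simp: W_def)
  have gs: "smooth_on R g" unfolding R_def g_def by (rule smooth_map_on_std_chart[OF dG c(1)])
  have gd: "g y \<in> snd d ` fst d" if "y \<in> R" for y using inv(1)[OF that] by (simp add: g_def W_def)
  have g0: "g y0 = x0" using inv0 Gz by (simp add: g_def x0_def)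
  define gw where "gw w y = frechet_derivative g (at y) w" for w y
  have gw: "tangent_map geod_atlas std_atlas (snd d) (G (chart_inv c y)) (dG (chart_inv c y) (coord_field A c w (chart_inv c y))) = gw w y"
    if y: "y \<in> R" for y w
  proof -
    have "tangent_map A std_atlas (\<lambda>q. snd d (G q)) (chart_inv c y) (coord_field A c w (chart_inv c y)) = gw w y"
      unfolding gw_def g_def by (rule tangent_map_coord_field_std[OF atlas c(1) dG]) (use y in \<open>simp add: R_def\<close>)
    moreover have "tangent_map A std_atlas (\<lambda>q. snd d (G q)) (chart_inv c y) X =
        tangent_map geod_atlas std_atlas (snd d) (G (chart_inv c y)) (dG (chart_inv c y) X)" for X
      by (rule tangent_map_compose[OF atlas chart_atlas_geod chart_atlas_std GW smooth_map_on_chart[OF chart_atlas_geod d(1)] inv(1)[OF y]])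
        (use inv(1)[OF y] in \<open>simp add: W_def\<close>)
    ultimately show ?thesis by simp
  qed
  have dG0: "dG p w = gw w y0" for w
    unfolding tangent_map_def gw_def Gz c_def[symmetric] d_def[symmetric] y0_def[symmetric] by (simp add: o_def g_def[abs_def])
  define gwv where "gwv = frechet_derivative (gw w) (at y0) v"
  have cov: "cov_deriv A geod_atlas geod_metric G (\<lambda>q. dG q (coord_field A c w q)) p v =
      gwv + levi_civita_symbol (metric_coord geod_atlas d geod_metric) x0 (gw v y0) (gw w y0)"
  proof -
    have "frechet_derivative (\<lambda>y. tangent_map geod_atlas std_atlas (snd d) (G (chart_inv c y)) (dG (chart_inv c y) (coord_field A c w (chart_inv c y)))) (at y0)
        = frechet_derivative (gw w) (at y0)"
      by (rule frechet_derivative_cong_open[OF R(1,3)]) (rule gw)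
    then show ?thesis unfolding cov_deriv_def Let_def Gz c_def[symmetric] d_def[symmetric] x0_def[symmetric] y0_def[symmetric]
      using coord_field_at[of p w] by (simp add: c_def[symmetric] gwv_def dG0 Gz)
  qed
  \<comment> \<open>A second lift of \<open>G\<close> near \<open>p\<close>, horizontal at
    \<open>y0\<close>. Its second derivative splits by the chain rule into the two terms that make
    up the covariant derivative.\<close>
  define f where "f y = s (g y)" for y
  have fs: "smooth_on R f" unfolding f_def by (rule smooth_on_compose[OF s(1) geod_chart(3)[OF d(1)] R(1) gs gd])
  have f0: "f y0 = z" by (simp add: f_def g0 s(4))
  have fT: "f y \<in> T1hyp" "geod (f y) = geod (Z y)" if "y \<in> R" for y
    using s(2,3)[OF gd[OF that]] chart_inv(1)[OF chart_atlas_geod d(1), of "G (chart_inv c y)"] inv(1)[OF that] flat_geod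
    by (auto simp: f_def Z_def g_def W_def)
  have ZT: "Z y \<in> T1hyp" for y using flat_T1 by (simp add: Z_def)
  have Z0: "Z y0 = z" by (simp add: Z_def inv0 z_def)
  define F where "F = frechet_derivative (\<lambda>y. frechet_derivative f (at y) w) (at y0) v"
  have F: "F = frechet_derivative (\<lambda>x. frechet_derivative s (at x) (gw w y0)) (at x0) (gw v y0) + frechet_derivative s (at x0) gwv"
    unfolding F_def f_def gwv_def gw_def using second_derivative_compose[OF s(1) geod_chart(3)[OF d(1)] gs R(1) gd R(3)] by (simp add: g0)
  have fw: "frechet_derivative f (at y0) w \<in> gen_perp z" for w
    using frechet_derivative_compose[OF smooth_on_differentiable[OF gs R(3)] smooth_on_differentiable[OF s(1) gd[OF R(3)]]] s(5)
    by (simp add: f_def[abs_def] g0)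
  have Zw: "frechet_derivative Z (at y0) w \<in> gen_perp z" for w using C(4)[of w] flat_perp by (simp add: y0_def z_def)
  have ZsR: "smooth_on R Z" using smooth_on_subset[OF C(2) R(2)] .
  have scale: "\<exists>t. f y = flow t (Z y)" if "y \<in> R" for y using fT(2)[OF that] geod_eq_iff by metis
  have bS: "b \<in> perp z" using b by (simp add: z_def)
  \<comment> \<open>Stated for \<open>h\<close> and its partner \<open>k\<close> in order to treat
    \<open>npos\<close> and \<open>nneg\<close> alike: two lifts with horizontal derivatives at the
    same point have second derivatives that differ by a multiple of \<open>h z\<close>, which is
    orthogonal to \<open>b\<close>.\<close>
  have key: "mink (h F) b = mink (h (hess p w v)) b"
    if h: "bounded_linear h" and k: "k \<in> {npos, nneg}" and hz: "mink (h z) (k z) \<noteq> 0" "mink (h z) b = 0"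
      and perp: "\<And>\<xi>. \<xi> \<in> gen_perp z \<Longrightarrow> mink (h \<xi>) (k z) = 0" and pos: "\<And>y. y \<in> T1hyp \<Longrightarrow> h y $ None > 0"
      and hf: "\<And>t z. \<exists>r. h (flow t z) = r *\<^sub>R h z"
    for h k
  proof -
    define l where "l y = h (f y) $ None / h (Z y) $ None" for y
    have ls: "smooth_on R l" unfolding l_def
      by (intro smooth_intros R(1) smooth_on_bounded_linear[OF h] fs ZsR) (use pos[OF ZT] in \<open>metis less_irrefl\<close>)
    have leq: "h (f y) = l y *\<^sub>R h (Z y)" if "y \<in> R" for y
    proof -
      obtain t where "f y = flow t (Z y)" using scale[OF \<open>y \<in> R\<close>] by blast
      then obtain r where r: "h (f y) = r *\<^sub>R h (Z y)" using hf[of t "Z y"] by auto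
      moreover have "h (Z y) $ None \<noteq> 0" using pos[OF ZT[of y]] by simp
      ultimately show ?thesis by (simp add: l_def)
    qed
    have l1: "l y0 = 1" using pos[OF z] by (simp add: l_def f0 Z0)
    have hs: "smooth_on R (\<lambda>y. h (Z y))" "smooth_on R (\<lambda>y. h (f y))" by (intro smooth_on_bounded_linear[OF h R(1)] ZsR fs)+
    \<comment> \<open>Pairing with \<open>k z\<close> annihilates the derivatives of both lifts,
      since both are horizontal at this point, and isolates the derivative of the dilation
      factor.\<close>
    have l0: "frechet_derivative l (at y0) v = 0" for v
    proof -
      have "frechet_derivative (\<lambda>y. h (f y)) (at y0) v = l y0 *\<^sub>R frechet_derivative (\<lambda>y. h (Z y)) (at y0) v + frechet_derivative l (at y0) v *\<^sub>R h (Z y0)"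
        by (rule derivative_scale[OF R(1,3) ls hs(1) leq])
      then have "h (frechet_derivative f (at y0) v) = h (frechet_derivative Z (at y0) v) + frechet_derivative l (at y0) v *\<^sub>R h z"
        unfolding second_derivative_bounded_linear(1)[OF h fs R(1,3)] second_derivative_bounded_linear(1)[OF h ZsR R(1,3)] l1 Z0 by simp
      then have "mink (h (frechet_derivative f (at y0) v)) (k z) = mink (h (frechet_derivative Z (at y0) v)) (k z) + frechet_derivative l (at y0) v * mink (h z) (k z)"
        by (simp add: mink_simps)
      then show ?thesis using perp[OF fw] perp[OF Zw] hz(1) by simp
    qed
    have "h F = h (hess p w v) + frechet_derivative (\<lambda>y. frechet_derivative l (at y) w) (at y0) v *\<^sub>R h z"
      using second_derivative_scale[OF R(1,3) ls hs(1) leq l1 l0, of w v]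
      unfolding second_derivative_bounded_linear(2)[OF h fs R(1,3)] second_derivative_bounded_linear(2)[OF h ZsR R(1,3)] F_def[symmetric] Z0
      by (simp add: hess_def c_def[symmetric] Z_def[symmetric] y0_def)
    then show ?thesis using hz(2) by (simp add: mink_simps)
  qed
  have LC1: "geod_lift z gwv = frechet_derivative s (at x0) gwv" by (rule LC(1))
  have LC2: "mink (npos (geod_lift z (levi_civita_symbol (metric_coord geod_atlas d geod_metric) x0 u v))) b =
      mink (npos (frechet_derivative (\<lambda>x. frechet_derivative s (at x) u) (at x0) v)) b"
    "mink (nneg (geod_lift z (levi_civita_symbol (metric_coord geod_atlas d geod_metric) x0 u v))) b =
      mink (nneg (frechet_derivative (\<lambda>x. frechet_derivative s (at x) u) (at x0) v)) b" for u v
    by (rule LC(2)[OF _ _ bS], assumption+) (rule LC(3)[OF _ _ bS], assumption+)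
  have LF: "mink (npos L) b = mink (npos F) b" "mink (nneg L) b = mink (nneg F) b"
    unfolding L_def z_def[symmetric] c_def[symmetric] cov linear_add[OF geod_lift(4)[OF z]] LC1 F npos_simps mink.add_left LC2
    using symmetric_second_derivative[OF s(1) geod_chart(3)[OF d(1)], of x0 "gw w y0" "gw v y0"] gd[OF R(3)] g0 by simp_all
  have 1: "mink (npos F) b = mink (npos (hess p w v)) b"
    by (rule key[OF bounded_linear_npos, of nneg])
      (use T1hyp_null[OF z] bS gen_perp_mink[OF z] T1hyp_pos npos_flow in \<open>auto simp: perp_iff\<close>)
  have 2: "mink (nneg F) b = mink (nneg (hess p w v)) b"
    by (rule key[OF bounded_linear_nneg, of npos])
      (use T1hyp_null[OF z] bS gen_perp_mink[OF z] T1hyp_pos nneg_flow in \<open>auto simp: perp_iff\<close>)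
  show "mink (npos L) b = mink (npos (hess p w v)) b" "mink (nneg L) b = mink (nneg (hess p w v)) b"
    using LF 1 2 by simp_all
qed

text \<open>Passing to the normal part subtracts a tangent vector, which the Lagrangian condition
  makes orthogonal to J of the tangent space. The covariant derivative may therefore replace its
  normal part.\<close>

lemma second_ff_cubic:
  "geod_metric (G p) (second_ff A geod_atlas geod_metric G p v w) (geod_J (G p) (dG p u)) = cubic p v w u"
proof -
  define h where "h = geod_metric (G p)"
  define X where "X = cov_deriv A geod_atlas geod_metric G (\<lambda>q. dG q (coord_field A (chart_at A p) w q)) p v"
  have h: "h X Y = (mink (npos (geod_lift (\<zeta> p) X)) (nneg (geod_lift (\<zeta> p) Y)) + mink (nneg (geod_lift (\<zeta> p) X)) (npos (geod_lift (\<zeta> p) Y))) / 2" for X Y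
    unfolding h_def flat_geod[of p] by (rule geod_metric_eq[OF flat_T1])
  note lin = geod_lift(4)[OF flat_T1[of p]]
  have hl: "linear (\<lambda>X. h X Y)" for Y
    by (intro linearI) (simp_all add: h linear_add[OF lin] linear_scale[OF lin] npos_simps mink_simps algebra_simps add_divide_distrib)
  have hr: "linear (\<lambda>Y. h X Y)" for X
    by (intro linearI) (simp_all add: h linear_add[OF lin] linear_scale[OF lin] npos_simps mink_simps algebra_simps add_divide_distrib)
  have hJ: "h (dG p x) (geod_J (G p) (dG p u)) = 0" for x
  proof -
    have "geod_symp (G p) (dG p x) (dG p u) = 0" using lagrangian_G unfolding lagrangian_def by blast
    then show ?thesis by (simp add: geod_symp_def h_def)
  qed
  have pos: "h (dG p x) (dG p x) > 0" if "x \<noteq> 0" for x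
    using riemannian_G that unfolding riemannian_def first_ff_def h_def by blast
  have "\<exists>x. \<forall>w. h (X - dG p x) (dG p w) = 0"
  proof -
    \<comment> \<open>The tangential component solves a linear system whose matrix is the induced
      metric; positivity makes it solvable, so the description in \<open>normal_part\<close> is
      met.\<close>
    define \<phi> where "\<phi> x = (\<chi> i. h (dG p x) (dG p (axis i 1)))" for x
    have \<phi>: "linear \<phi>"
      by (intro linearI) (simp_all add: \<phi>_def vec_eq_iff linear_add[OF linear_dG] linear_scale[OF linear_dG] linear_add[OF hl] linear_scale[OF hl])
    have e: "h Y (dG p w) = (\<Sum>i\<in>UNIV. w $ i * h Y (dG p (axis i 1)))" for Y w
      using linear_vec_expand[OF linear_compose[OF linear_dG[of p] hr[of Y]], of w] by simp
    have "inj \<phi>" unfolding linear_injective_0[OF \<phi>]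
    proof (intro allI impI, rule ccontr)
      fix x assume "\<phi> x = 0" "x \<noteq> 0"
      then have "h (dG p x) (dG p (axis i 1)) = 0" for i by (metis \<phi>_def vec_lambda_beta zero_index)
      then have "h (dG p x) (dG p x) = 0" using e[of "dG p x" x] by simp
      then show False using pos[OF \<open>x \<noteq> 0\<close>] by simp
    qed
    then have "surj \<phi>" using \<phi> linear_injective_imp_surjective by blast
    then obtain x where "\<phi> x = (\<chi> i. h X (dG p (axis i 1)))" by (metis surjD)
    then have "h (dG p x) (dG p (axis i 1)) = h X (dG p (axis i 1))" for i by (simp add: \<phi>_def vec_eq_iff)
    then have "h (X - dG p x) (dG p w) = 0" for w
      using e[of "dG p x" w] e[of X w] by (simp add: linear_diff[OF hl])
    then show ?thesis by blast
  qed
  then obtain x where x: "\<And>w. h (X - dG p x) (dG p w) = 0" by blast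
  have "normal_part h (range (dG p)) X = X - dG p x"
    unfolding normal_part_def
  proof (rule the_equality)
    show "X - (X - dG p x) \<in> range (dG p) \<and> (\<forall>Y\<in>range (dG p). h (X - dG p x) Y = 0)" using x by auto
    fix N assume N: "X - N \<in> range (dG p) \<and> (\<forall>Y\<in>range (dG p). h N Y = 0)"
    then obtain x' where x': "X - N = dG p x'" by auto
    have "N - (X - dG p x) = dG p (x - x')" unfolding linear_diff[OF linear_dG] x'[symmetric] by simp
    moreover have "h (N - (X - dG p x)) (dG p (x - x')) = 0" using N x by (simp add: linear_diff[OF hl])
    ultimately have "x - x' = 0" using pos[of "x - x'"] by (metis less_irrefl)
    then show "N = X - dG p x" using x' by (simp add: algebra_simps)
  qed
  then have "second_ff A geod_atlas geod_metric G p v w = X - dG p x"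
    by (simp add: second_ff_def h_def X_def)
  then have "h (second_ff A geod_atlas geod_metric G p v w) (geod_J (G p) (dG p u)) = h X (geod_J (G p) (dG p u))"
    using hJ by (simp add: linear_diff[OF hl])
  also have "\<dots> = cubic p v w u"
  proof -
    have J: "npos (geod_lift (\<zeta> p) (geod_J (G p) (dG p u))) = npos (d\<zeta> p u)" "nneg (geod_lift (\<zeta> p) (geod_J (G p) (dG p u))) = - nneg (d\<zeta> p u)"
      using geod_lift_J[OF flat_T1[of p], of "dG p u"] lift_dG[of p u] flat_geod[of p] by simp_all
    have "npos (d\<zeta> p u) \<in> perp (\<zeta> p)" "nneg (d\<zeta> p u) \<in> perp (\<zeta> p)"
      using flat_perp[of p u] by (simp_all add: gen_perp_iff[OF flat_T1])
    then show ?thesis unfolding h J cubic_def X_def using cov_lift[of _ p w v] by (simp add: mink_simps)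
  qed
  finally show ?thesis by (simp add: h_def)
qed

lemma maslov_form_eq:
  "maslov_form A G p u = (\<Sum>i\<in>UNIV. \<Sum>j\<in>UNIV. matrix_inv (gram_neg (d\<zeta> p)) $ i $ j * cubic p (axis i 1) (axis j 1) u) / real CARD('n)"
proof -
  note lin = geod_lift(4)[OF flat_T1[of p]]
  have hl: "linear (\<lambda>X. geod_metric (G p) X Y)" for Y
    unfolding flat_geod[of p] geod_metric_eq[OF flat_T1]
    by (intro linearI) (simp_all add: linear_add[OF lin] linear_scale[OF lin] npos_simps mink_simps algebra_simps add_divide_distrib)
  have I: "(\<chi> i j. first_ff A geod_atlas geod_metric G p (axis i 1) (axis j 1)) = gram_neg (d\<zeta> p)"
    by (simp add: gram_neg_def first_ff_eq)
  show ?thesis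
    unfolding maslov_form_def geod_symp_def mean_curvature_def metric_trace_def I
    by (simp add: linear_scale[OF hl] linear_sum[OF hl] second_ff_cubic)
qed

section \<open>The primitive of the Maslov form\<close>

definition maslov_potential :: "'u \<Rightarrow> real" where
  "maslov_potential p = potential (d\<zeta> p)"

text \<open>Because of \<open>potential_compose\<close>, the potential can be evaluated in a fixed
  chart around a point although its definition uses pointwise chosen charts. This is what makes it
  smooth.\<close>

lemma potential_chart:
  assumes c: "c \<in> A" and y: "y \<in> snd c ` (UNIV \<inter> fst c)"
  shows "maslov_potential (chart_inv c y) = potential (frechet_derivative (\<lambda>y. \<zeta> (chart_inv c y)) (at y))"
    "immersive (\<zeta> (chart_inv c y)) (frechet_derivative (\<lambda>y. \<zeta> (chart_inv c y)) (at y))"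
proof -
  let ?q = "chart_inv c y" and ?T = "\<lambda>w. coord_field A c w (chart_inv c y)"
  have q: "?q \<in> fst c" using y chart_inv(2)[OF atlas c] by simp
  have T: "linear ?T" by (rule coord_field_inverse(3)[OF atlas c q])
  have inj: "inj ?T" using coord_field_inverse(2)[OF atlas c q] by (metis injI)
  have e: "frechet_derivative (\<lambda>y. \<zeta> (chart_inv c y)) (at y) = (\<lambda>w. d\<zeta> ?q (?T w))"
    using flat_chart(7)[OF c flat y] by auto
  show "maslov_potential ?q = potential (frechet_derivative (\<lambda>y. \<zeta> (chart_inv c y)) (at y))"
    unfolding maslov_potential_def e using potential_compose[OF immersive_dzeta T inj] by simp
  have "?T w \<noteq> 0" if "w \<noteq> 0" for w using that inj T linear_injective_0 by metis
  then show "immersive (\<zeta> ?q) (frechet_derivative (\<lambda>y. \<zeta> (chart_inv c y)) (at y))"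
    using immersive_dzeta[of ?q] linear_compose[OF T linear_dzeta[of ?q]] unfolding e immersive_def by (simp add: o_def)
qed

lemma smooth_maslov_potential: "smooth_map_on euclidean A euclidean std_atlas UNIV maslov_potential"
proof (rule smooth_map_on_to_std[OF atlas])
  fix p
  define c where "c = chart_at A p"
  have c: "c \<in> A" "p \<in> fst c" using chart_at_A by (auto simp: c_def)
  define S where "S = snd c ` (UNIV \<inter> fst c)"
  define Z where "Z y = \<zeta> (chart_inv c y)" for y
  note F = flat_chart[OF c(1) flat, folded S_def Z_def] and P = potential_chart[OF c(1), folded S_def Z_def]
  have 1: "smooth_on S (\<lambda>y. gram_neg (frechet_derivative Z (at y)) $ i $ j)"
    "smooth_on S (\<lambda>y. gram_pos (frechet_derivative Z (at y)) $ i $ j)" for i j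
    unfolding gram_neg_def gram_pos_def vec_lambda_beta by (intro smooth_intros F(1,3))+
  have "smooth_on S (\<lambda>y. potential (frechet_derivative Z (at y)))"
    unfolding potential_def
    by (intro smooth_on_divide smooth_intros smooth_on_det F(1) 1) (use immersive_det[OF P(2)] in auto)
  then have "smooth_on S (\<lambda>y. maslov_potential (chart_inv c y))" by (rule smooth_on_cong[OF _ F(1)]) (simp add: P(1))
  then show "\<exists>c\<in>A. \<exists>T. open T \<and> p \<in> fst c \<and> snd c p \<in> T \<and> T \<subseteq> snd c ` (UNIV \<inter> fst c) \<and> smooth_on T (\<lambda>y. maslov_potential (chart_inv c y))"
    using c F(1) by (intro bexI[of _ c] exI[of _ S] conjI) (simp_all add: S_def)
qed simp

text \<open>The differential of the potential traces the cubic form over its last two arguments,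
  with \<open>u\<close> in the first, the mean curvature over its first two, with \<open>u\<close>
  in the last; total symmetry makes these equal.\<close>

theorem maslov_form_exact: "maslov_form A G p u = tangent_map A std_atlas maslov_potential p u"
proof -
  define c where "c = chart_at A p"
  have c: "c \<in> A" "p \<in> fst c" using chart_at_A by (auto simp: c_def)
  define S where "S = snd c ` (UNIV \<inter> fst c)"
  define Z where "Z y = \<zeta> (chart_inv c y)" for y
  note C = chart_facts[of p, folded c_def, folded S_def Z_def]
  note P = potential_chart[OF c(1), folded S_def Z_def]
  define T where "T y = frechet_derivative Z (at y)" for y
  have T0: "T (snd c p) = d\<zeta> p" using C(4) by (auto simp: T_def)
  have "((\<lambda>y. potential (T y)) has_derivative (\<lambda>u. (\<Sum>i\<in>UNIV. \<Sum>j\<in>UNIV. matrix_inv (gram_neg (T (snd c p))) $ i $ j *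
    ((mink (nneg (hess p (axis i 1) u)) (npos (T (snd c p) (axis j 1))) - mink (npos (hess p (axis i 1) u)) (nneg (T (snd c p) (axis j 1)))) / 2)) / real CARD('n))) (at (snd c p))"
    by (rule has_derivative_potential) (use immersive_dzeta dzeta_sym C(6) in \<open>auto simp: T0 T_def[symmetric]\<close>)
  then have "((\<lambda>y. maslov_potential (chart_inv c y)) has_derivative (\<lambda>u. (\<Sum>i\<in>UNIV. \<Sum>j\<in>UNIV. matrix_inv (gram_neg (d\<zeta> p)) $ i $ j *
    cubic p u (axis i 1) (axis j 1)) / real CARD('n))) (at (snd c p))"
    unfolding T0 cubic_def by (rule has_derivative_transform_within_open[OF _ C(1,3)]) (simp add: P(1) T_def)
  then have "tangent_map A std_atlas maslov_potential p u = (\<Sum>i\<in>UNIV. \<Sum>j\<in>UNIV. matrix_inv (gram_neg (d\<zeta> p)) $ i $ j *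
    cubic p u (axis i 1) (axis j 1)) / real CARD('n)"
    unfolding tangent_map_def c_def[symmetric] by (simp add: o_def frechet_derivative_eqI)
  then show ?thesis unfolding maslov_form_eq by (simp add: cubic_cyclic[of p _ _ u])
qed

end

end

section \<open>Isometries of hyperbolic space\<close>

text \<open>The reversed Cauchy-Schwarz inequality puts the argument of \<open>arcosh\<close> in the
  range where \<open>cosh\<close> undoes it, so that equal distances mean equal Minkowski
  products.\<close>

lemma hyp_mink_le:
  assumes "x \<in> hyp" "y \<in> hyp" shows "1 \<le> - mink x y"
proof -
  define a b where "a = (\<chi> i. x $ Some i)" and "b = (\<chi> i. y $ Some i)"
  have e: "x $ None * x $ None = 1 + a \<bullet> a" "y $ None * y $ None = 1 + b \<bullet> b" "mink x y = a \<bullet> b - x $ None * y $ None"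
    "x $ None > 0" "y $ None > 0"
    using assms by (auto simp: hyp_def mink_def a_def b_def inner_vec_def)
  have "(1 + norm a * norm b)\<^sup>2 \<le> (1 + (norm a)\<^sup>2) * (1 + (norm b)\<^sup>2)"
    using sum_squares_bound[of "norm a" "norm b"] by (simp add: power2_eq_square algebra_simps)
  also have "\<dots> = (x $ None * x $ None) * (y $ None * y $ None)"
    unfolding e(1,2) power2_norm_eq_inner ..
  also have "\<dots> = (x $ None * y $ None)\<^sup>2" by (simp add: power2_eq_square)
  finally have "1 + norm a * norm b \<le> x $ None * y $ None" by (rule power2_le_imp_le) (use e(4,5) in simp)
  then show ?thesis using norm_cauchy_schwarz[of a b] e(3) by linarith
qed

lemma isometry_mink:
  assumes "hyp_dist x' y' = hyp_dist x y" "x \<in> hyp" "y \<in> hyp" "x' \<in> hyp" "y' \<in> hyp"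
  shows "mink x' y' = mink x y"
proof -
  have "cosh (arcosh (- mink x' y')) = cosh (arcosh (- mink x y))" using assms(1) by (simp add: hyp_dist_def)
  then show ?thesis using hyp_mink_le[OF assms(2,3)] hyp_mink_le[OF assms(4,5)] by simp
qed

text \<open>The points \<open>e None\<close> and \<open>h i\<close> of the hyperboloid form a basis
  of the ambient space, so their images prescribe a linear map. It preserves the form, and
  nondegeneracy then forces it to agree with \<open>f\<close> on all of \<open>hyp\<close>.\<close>

lemma isometry_linear:
  fixes f :: "'n::finite mink \<Rightarrow> 'n mink"
  assumes f: "f \<in> carrier isom_plus"
  obtains L where "linear L" "\<And>x y. mink (L x) (L y) = mink x y" "\<And>x. x \<in> hyp \<Longrightarrow> f x = L x"
proof -
  have fh: "f x \<in> hyp" if "x \<in> hyp" for x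
    using f that by (auto simp: isom_plus_def Bij_def bij_betw_def)
  have fm: "mink (f x) (f y) = mink x y" if "x \<in> hyp" "y \<in> hyp" for x y
    by (rule isometry_mink) (use f that fh in \<open>auto simp: isom_plus_def\<close>)
  define e :: "'n option option \<Rightarrow> 'n mink" where "e a = axis a 1" for a
  \<comment> \<open>The factor \<open>sqrt 2\<close> gives the vector Minkowski square -2 + 1 = -1,
    so it lies on the hyperboloid.\<close>
  define h where "h i = sqrt 2 *\<^sub>R e None + e (Some i)" for i
  have me': "mink (e a) y = (if a = None then - y $ a else y $ a)" for a y
    by (cases a) (simp_all add: mink_def e_def axis_def mult_delta_left)
  have me: "mink (e a) (e b) = (if a = b then if a = None then -1 else 1 else 0)" for a b
    unfolding me' by (auto simp: e_def axis_def)
  have hyp: "e None \<in> hyp" "h i \<in> hyp" for i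
    by (auto simp: hyp_def h_def mink_simps me real_sqrt_mult[symmetric] simp del: real_sqrt_mult) (simp_all add: e_def axis_def)
  \<comment> \<open>The images of the standard basis vectors, recovered from those of the chosen
    points by the inverse linear combination.\<close>
  define E where "E a = (case a of None \<Rightarrow> f (e None) | Some i \<Rightarrow> f (h i) - sqrt 2 *\<^sub>R f (e None))" for a
  define L where "L x = (\<Sum>a\<in>UNIV. x $ a *\<^sub>R E a)" for x
  have lin: "linear L" by (intro linearI) (simp_all add: L_def scaleR_left_distrib sum.distrib scaleR_sum_right)
  have Le: "L (e a) = E a" for a by (simp add: L_def e_def axis_def if_distrib if_distribR cong: if_cong)
  have fE: "mink (f x) (E a) = mink x (e a)" if x: "x \<in> hyp" for x a
    using fm[OF x hyp(1)] fm[OF x hyp(2)] by (cases a) (auto simp: E_def mink_simps h_def)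
  have EE: "mink (E a) (E b) = mink (e a) (e b)" for a b
    using fE[OF hyp(1), of b] fE[OF hyp(2), of _ b] by (cases a) (auto simp: E_def mink_simps h_def)
  have bl: "bilinear (\<lambda>x y. mink (L x) (L y))" "bilinear (mink :: 'n mink \<Rightarrow> _)"
    by (auto simp: bilinear_def intro!: linearI simp: linear_add[OF lin] linear_scale[OF lin] mink_simps)
  have "(\<lambda>x y. mink (L x) (L y)) = mink"
    by (rule bilinear_eq_stdbasis[OF bl]) (use EE Le in \<open>auto simp: Basis_vec_def e_def\<close>)
  then have pres: "mink (L x) (L y) = mink x y" for x y by metis
  have "inj L" unfolding linear_injective_0[OF lin]
  proof (intro allI impI)
    fix x assume "L x = 0"
    then show "x = 0" using pres[of x] by (intro mink_nondegenerate) (simp add: mink_simps)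
  qed
  then have surj: "surj L" using lin linear_injective_imp_surjective by blast
  have "f x = L x" if x: "x \<in> hyp" for x
  proof -
    have "linear (\<lambda>y. mink (f x) (L y))" "linear (mink x)"
      by (auto intro!: linearI simp: linear_add[OF lin] linear_scale[OF lin] mink_simps)
    then have "(\<lambda>y. mink (f x) (L y)) = mink x"
      by (rule linear_eq_stdbasis) (use fE[OF x] Le in \<open>auto simp: Basis_vec_def e_def\<close>)
    then have "mink (f x) (L y) = mink (L x) (L y)" for y using pres by metis
    then have "mink (f x - L x) w = 0" for w using surj by (metis mink.diff_left right_minus_eq surjD)
    then have "f x - L x = 0" by (rule mink_nondegenerate)
    then show ?thesis by simp
  qed
  with that lin pres show ?thesis by blast
qed

text \<open>The derivative within \<open>hyp\<close> is a choice off the tangent space, so it is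
  evaluated by means of a curve in \<open>hyp\<close> with velocity \<open>w\<close>.\<close>

lemma hyp_diff_linear:
  fixes f :: "'n::finite mink \<Rightarrow> 'n mink"
  assumes L: "linear L" "\<And>x. x \<in> hyp \<Longrightarrow> f x = L x" and x: "x \<in> hyp" and w: "mink x w = 0"
  shows "hyp_diff f x w = L w"
proof -
  have "(L has_derivative L) (at x within hyp)"
    using L(1) by (simp add: linear_conv_bounded_linear bounded_linear_imp_has_derivative)
  then have "(f has_derivative L) (at x within hyp)"
    by (rule has_derivative_transform[rotated 2]) (use L(2) x in auto)
  then have D: "(f has_derivative hyp_diff f x) (at x within hyp)"
    unfolding hyp_diff_def frechet_derivative_works[symmetric] by (auto simp: differentiable_def)
  define m where "m = mink w w"
  \<comment> \<open>The coefficient of \<open>x\<close> keeps the Minkowski square at -1 and has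
    derivative 0 at \<open>t = 0\<close>.\<close>
  define g where "g t = sqrt (1 + t * t * m) *\<^sub>R x + t *\<^sub>R w" for t
  define W where "W = {t. 1 + t * t * m > 0} \<inter> {t. g t $ None > 0}"
  have cg: "continuous_on UNIV g" unfolding g_def by (intro continuous_intros)
  have W: "open W" unfolding W_def
    by (intro open_Int open_Collect_less continuous_intros cg)
  have xx: "mink x x = -1" "x $ None > 0" using x by (auto simp: hyp_def)
  have 0: "0 \<in> W" "g 0 = x" using xx by (auto simp: W_def g_def)
  have gh: "g t \<in> hyp" if "t \<in> W" for t
    using that xx w mink_commute[of w x] by (auto simp: hyp_def W_def g_def mink_simps m_def[symmetric] mult.assoc[symmetric])
  have dg: "(g has_derivative (\<lambda>h. h *\<^sub>R w)) (at 0)"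
    unfolding g_def by (rule derivative_eq_intros refl | simp)+
  have "((\<lambda>t. f (g t)) has_derivative (\<lambda>h. hyp_diff f x (h *\<^sub>R w))) (at 0)"
  proof -
    have "(f has_derivative hyp_diff f x) (at (g 0) within g ` W)"
      by (rule has_derivative_subset) (use D 0 gh in auto)
    from diff_chain_within[OF has_derivative_at_withinI[OF dg] this] show ?thesis
      using at_within_open[OF 0(1) W] by (simp add: o_def)
  qed
  moreover have "((\<lambda>t. f (g t)) has_derivative (\<lambda>h. L (h *\<^sub>R w))) (at 0)"
    by (rule has_derivative_transform_within_open[OF bounded_linear.has_derivative[OF L(1)[unfolded linear_conv_bounded_linear] dg] W 0(1)])
      (use gh L(2) in simp)
  ultimately have "(\<lambda>h. hyp_diff f x (h *\<^sub>R w)) = (\<lambda>h. L (h *\<^sub>R w))" by (rule has_derivative_unique)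
  from fun_cong[OF this, of 1] show ?thesis by simp
qed

section \<open>Local inverses and deck transformations\<close>

lemma smooth_map_on_local:
  assumes A: "chart_atlas X A" and B: "chart_atlas Y B" and W: "openin X W"
    and loc: "\<And>p. p \<in> W \<Longrightarrow> \<exists>V g. p \<in> V \<and> V \<subseteq> W \<and> smooth_map_on X A Y B V g \<and> (\<forall>q\<in>V. f q = g q)"
  shows "smooth_map_on X A Y B W f"
proof (rule smooth_map_onI[OF A B W])
  fix p assume "p \<in> W"
  then obtain V g where V: "p \<in> V" "V \<subseteq> W" "smooth_map_on X A Y B V g" "\<forall>q\<in>V. f q = g q" using loc by blast
  have "p \<in> topspace X" using smooth_map_onD(1)[OF V(3)] V(1) openin_subset by blast
  note c = chart_at[OF A this] and d = chart_at[OF B smooth_map_onD(2)[OF V(3,1)]]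
  define T where "T = snd (chart_at A p) ` {q \<in> V \<inter> fst (chart_at A p). g q \<in> fst (chart_at B (g p))}"
  have T: "open T" unfolding T_def by (rule smooth_map_on_domain[OF A B c(1) d(1) V(3)])
  have in_V: "chart_inv (chart_at A p) y \<in> V" "g (chart_inv (chart_at A p) y) \<in> fst (chart_at B (g p))" if "y \<in> T" for y
    using that chart_inv(1)[OF A c(1)] by (auto simp: T_def)
  have "smooth_on T (snd (chart_at B (g p)) \<circ> f \<circ> chart_inv (chart_at A p))"
    by (rule smooth_on_cong[OF smooth_map_onD(4)[OF V(3) c(1) d(1), folded T_def] T]) (use in_V V(4) in simp)
  moreover have "\<forall>y\<in>T. f (chart_inv (chart_at A p) y) \<in> fst (chart_at B (g p))" using in_V V(4) by simp
  moreover have "snd (chart_at A p) p \<in> T" "T \<subseteq> snd (chart_at A p) ` (W \<inter> fst (chart_at A p))"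
    using V(1,2) c(2) d(2) by (auto simp: T_def)
  ultimately show "\<exists>c\<in>A. \<exists>d\<in>B. \<exists>T. open T \<and> p \<in> fst c \<and> snd c p \<in> T \<and> T \<subseteq> snd c ` (W \<inter> fst c) \<and>
       (\<forall>y\<in>T. f (chart_inv c y) \<in> fst d) \<and> smooth_on T (snd d \<circ> f \<circ> chart_inv c)"
    using c d T by blast
qed

lemma local_diffeo_inverse:
  fixes A :: "('u::topological_space, real^'n::finite) chart set" and B :: "('m::topological_space, real^'n) chart set"
  assumes A: "chart_atlas euclidean A" and B: "chart_atlas euclidean B"
    and f: "smooth_map_on euclidean A euclidean B UNIV f" and bij: "bij (tangent_map A B f p)"
  obtains N M s where "open N" "p \<in> N" "open M" "f ` N \<subseteq> M" "\<And>q. q \<in> N \<Longrightarrow> s (f q) = q"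
    "\<And>m. m \<in> M \<Longrightarrow> s m \<in> N \<and> f (s m) = m" "smooth_map_on euclidean B euclidean A M s"
proof -
  define c d where "c = chart_at A p" and "d = chart_at B (f p)"
  have c: "c \<in> A" "p \<in> fst c" and d: "d \<in> B" "f p \<in> fst d"
    using chart_at[OF A, of p] chart_at[OF B, of "f p"] by (auto simp: c_def d_def)
  define k where "k = snd d \<circ> f \<circ> chart_inv c"
  define S where "S = snd c ` {q \<in> UNIV \<inter> fst c. f q \<in> fst d}"
  have S: "open S" "snd c p \<in> S" and k: "smooth_on S k"
    using smooth_map_on_domain[OF A B c(1) d(1) f] smooth_map_onD(4)[OF f c(1) d(1)] c d by (auto simp: S_def k_def)
  have "bij (frechet_derivative k (at (snd c p)))" using bij by (simp add: tangent_map_def k_def c_def d_def)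
  from smooth_local_inverse[OF k S this] obtain U V g where U: "open U" "snd c p \<in> U" "U \<subseteq> S" "open V" "k (snd c p) \<in> V"
    and h: "homeomorphism U V k g" and g: "smooth_on V g" by blast
  have kf: "k (snd c q) = snd d (f q)" "f q \<in> fst d" if "q \<in> fst c" "snd c q \<in> S" for q
    using that chart_inv(1)[OF A c(1)] chart_atlasD(2)[OF A c(1)] by (auto simp: k_def S_def dest: inj_onD)
  define N where "N = {q \<in> fst c. snd c q \<in> U}"
  define M where "M = {m \<in> fst d. snd d m \<in> V}"
  define s where "s m = chart_inv c (g (snd d m))" for m
  have oN: "open N" and oM: "open M"
    using chart_atlasD(4)[OF A c(1) U(1)] chart_atlasD(4)[OF B d(1) U(4)] by (simp_all add: N_def M_def)
  have NM: "f q \<in> M" "s (f q) = q" if q: "q \<in> N" for q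
  proof -
    have q': "q \<in> fst c" "snd c q \<in> U" "snd c q \<in> S" using q U(3) by (auto simp: N_def)
    have "k (snd c q) \<in> V" "g (k (snd c q)) = snd c q" using h q'(2) by (auto simp: homeomorphism_def)
    then show "f q \<in> M" "s (f q) = q" using kf[OF q'(1,3)] chart_inv(1)[OF A c(1) q'(1)] by (auto simp: M_def s_def)
  qed
  have MN: "g (snd d m) \<in> U" "s m \<in> N \<and> f (s m) = m" if m: "m \<in> M" for m
  proof -
    have m': "m \<in> fst d" "snd d m \<in> V" using m by (auto simp: M_def)
    have g: "g (snd d m) \<in> U" "k (g (snd d m)) = snd d m" using h m'(2) by (auto simp: homeomorphism_def)
    then show "g (snd d m) \<in> U" by simp
    have "g (snd d m) \<in> snd c ` fst c" using g(1) U(3) by (auto simp: S_def)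
    then have s: "s m \<in> fst c" "snd c (s m) = g (snd d m)" using chart_inv(2,3)[OF A c(1)] by (auto simp: s_def)
    then have "snd d (f (s m)) = snd d m" "f (s m) \<in> fst d" using kf[OF s(1)] g U(3) by auto
    then have "f (s m) = m" using chart_atlasD(2)[OF B d(1)] m'(1) by (auto dest: inj_onD)
    then show "s m \<in> N \<and> f (s m) = m" using s g by (simp add: N_def)
  qed
  have 1: "smooth_map_on euclidean B euclidean std_atlas M (snd d)"
    by (rule smooth_map_on_subset[OF smooth_map_on_chart[OF B d(1)]]) (use oM in \<open>auto simp: M_def\<close>)
  have 2: "smooth_map_on euclidean std_atlas euclidean std_atlas V g" using U(4) g by (simp add: smooth_map_on_std_iff)
  have 3: "smooth_map_on euclidean B euclidean std_atlas M (\<lambda>m. g (snd d m))"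
    by (rule smooth_map_on_compose[OF B chart_atlas_std chart_atlas_std 1 2]) (auto simp: M_def)
  have "smooth_map_on euclidean B euclidean A M s" unfolding s_def
    by (rule smooth_map_on_compose[OF B chart_atlas_std A 3 smooth_map_on_chart_inv[OF A c(1)]])
      (use MN(1) U(3) in \<open>auto simp: S_def\<close>)
  moreover have "p \<in> N" using c U by (simp add: N_def)
  ultimately show ?thesis using that[of N M s] oN oM NM MN by blast
qed

text \<open>Near a point, a deck transformation is the covering map followed by a smooth local
  inverse of it on the sheet of the image point.\<close>

lemma deck_smooth:
  fixes A :: "('u::topological_space, real^'n::finite) chart set" and B :: "('m::topological_space, real^'n) chart set"
  assumes A: "chart_atlas euclidean A" and B: "chart_atlas euclidean B"
    and \<pi>: "smooth_map_on euclidean A euclidean B UNIV \<pi>" and bij: "\<And>p. bij (tangent_map A B \<pi> p)"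
    and \<alpha>: "continuous_on UNIV \<alpha>" "\<And>p. \<pi> (\<alpha> p) = \<pi> p"
  shows "smooth_map_on euclidean A euclidean A UNIV \<alpha>"
proof (rule smooth_map_on_local[OF A A])
  fix p
  obtain N M s where *: "open N" "\<alpha> p \<in> N" "open M" "\<pi> ` N \<subseteq> M" "\<And>q. q \<in> N \<Longrightarrow> s (\<pi> q) = q"
    "smooth_map_on euclidean B euclidean A M s"
    using local_diffeo_inverse[OF A B \<pi> bij, of "\<alpha> p"] by metis
  define V where "V = \<alpha> -` N"
  have V: "openin euclidean V" using \<alpha>(1) *(1) by (simp add: V_def continuous_on_open_vimage)
  have sub: "\<pi> ` V \<subseteq> M"
  proof
    fix m assume "m \<in> \<pi> ` V"
    then obtain q where "m = \<pi> (\<alpha> q)" "\<alpha> q \<in> N" using \<alpha>(2) by (auto simp: V_def)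
    then show "m \<in> M" using *(4) by blast
  qed
  have "smooth_map_on euclidean A euclidean A V (\<lambda>q. s (\<pi> q))"
    by (rule smooth_map_on_compose[OF A B A smooth_map_on_subset[OF \<pi> V] *(6) sub]) simp
  moreover have "\<alpha> q = s (\<pi> q)" if "q \<in> V" for q using *(5)[of "\<alpha> q"] that \<alpha>(2) by (simp add: V_def)
  ultimately show "\<exists>V g. p \<in> V \<and> V \<subseteq> UNIV \<and> smooth_map_on euclidean A euclidean A V g \<and> (\<forall>q\<in>V. \<alpha> q = g q)"
    using *(2) by (intro exI[of _ V] exI[of _ "\<lambda>q. s (\<pi> q)"]) (simp add: V_def)
qed simp

section \<open>Integration along paths\<close>

lemma path_chain_rule:
  assumes A: "chart_atlas euclidean A" and B: "chart_atlas Y B" and g: "smooth_map_on euclidean A Y B UNIV g"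
    and \<gamma>: "path \<gamma>" and diff: "(snd (chart_at A (\<gamma> t)) \<circ> \<gamma>) C1_differentiable_on ({s\<in>{0..1}. \<gamma> s \<in> fst (chart_at A (\<gamma> t))} - S)"
    and t: "t \<in> {0<..<1} - S"
  shows "((\<lambda>s. snd (chart_at B (g (\<gamma> t))) (g (\<gamma> s))) has_vector_derivative tangent_map A B g (\<gamma> t) (velocity A \<gamma> t)) (at t)"
proof -
  let ?c = "chart_at A (\<gamma> t)" and ?d = "chart_at B (g (\<gamma> t))"
  have c: "?c \<in> A" "\<gamma> t \<in> fst ?c" using chart_at[OF A, of "\<gamma> t"] by auto
  have "t \<in> {s\<in>{0..1}. \<gamma> s \<in> fst ?c} - S" using t c by auto
  then obtain D where "((snd ?c \<circ> \<gamma>) has_vector_derivative D) (at t)"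
    using diff unfolding C1_differentiable_on_def by blast
  then have v: "((snd ?c \<circ> \<gamma>) has_derivative (\<lambda>h. h *\<^sub>R velocity A \<gamma> t)) (at t)"
    unfolding velocity_def by (simp add: vector_derivative_at has_vector_derivative_def)
  have "((snd ?d \<circ> g \<circ> chart_inv ?c) has_derivative tangent_map A B g (\<gamma> t)) (at ((snd ?c \<circ> \<gamma>) t))"
    using tangent_map_has_derivative[OF A B g, of "\<gamma> t"] by simp
  from has_derivative_compose[OF v this]
  have 1: "((\<lambda>s. (snd ?d \<circ> g \<circ> chart_inv ?c) ((snd ?c \<circ> \<gamma>) s)) has_derivative (\<lambda>h. tangent_map A B g (\<gamma> t) (h *\<^sub>R velocity A \<gamma> t))) (at t)" .
  have "open (fst ?c)" using chart_atlasD(1)[OF A c(1)] by simp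
  then have O: "open ({0<..<1} \<inter> \<gamma> -` fst ?c)"
    using \<gamma> by (intro continuous_open_preimage) (auto simp: path_def intro: continuous_on_subset)
  have "((\<lambda>s. snd ?d (g (\<gamma> s))) has_derivative (\<lambda>h. tangent_map A B g (\<gamma> t) (h *\<^sub>R velocity A \<gamma> t))) (at t)"
    by (rule has_derivative_transform_within_open[OF 1 O]) (use t c chart_inv(1)[OF A c(1)] in auto)
  then show ?thesis unfolding has_vector_derivative_def
    using linear_scale[OF tangent_map_linear[OF A B g, of "\<gamma> t"]] by simp
qed

text \<open>A form on the base need not have a global primitive there; \<open>\<Psi>\<close> is one
  for its pull-back. The fundamental theorem is applied to \<open>\<Psi> \<circ> \<gamma>\<close>,
  with the finitely many bad parameters excluded.\<close>

lemma form_integral_exact: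
  assumes A: "chart_atlas euclidean A" and B: "chart_atlas euclidean B" and \<pi>: "smooth_map_on euclidean A euclidean B UNIV \<pi>"
    and \<Psi>: "smooth_map_on euclidean A euclidean std_atlas UNIV \<Psi>" and \<gamma>: "piecewise_C1_path A \<gamma>"
    and \<kappa>: "\<And>p v. \<kappa> (\<pi> p) (tangent_map A B \<pi> p v) = tangent_map A std_atlas \<Psi> p v"
  shows "form_integral B (\<pi> \<circ> \<gamma>) \<kappa> = \<Psi> (\<gamma> 1) - \<Psi> (\<gamma> 0)"
proof -
  obtain S where S: "path \<gamma>" "finite S" "\<forall>c\<in>A. (snd c \<circ> \<gamma>) C1_differentiable_on ({t\<in>{0..1}. \<gamma> t \<in> fst c} - S)"
    using \<gamma> unfolding piecewise_C1_path_def by blast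
  have diff: "(snd (chart_at A (\<gamma> t)) \<circ> \<gamma>) C1_differentiable_on ({s\<in>{0..1}. \<gamma> s \<in> fst (chart_at A (\<gamma> t))} - S)" for t
    using S(3) chart_at(1)[OF A, of "\<gamma> t"] by simp
  have d: "((\<lambda>s. \<Psi> (\<gamma> s)) has_vector_derivative \<kappa> ((\<pi> \<circ> \<gamma>) t) (velocity B (\<pi> \<circ> \<gamma>) t)) (at t)" if t: "t \<in> {0<..<1} - S" for t
  proof -
    have "velocity B (\<pi> \<circ> \<gamma>) t = tangent_map A B \<pi> (\<gamma> t) (velocity A \<gamma> t)"
      using vector_derivative_at[OF path_chain_rule[OF A B \<pi> S(1) diff t]] unfolding velocity_def[of B] by (simp add: o_def)
    then show ?thesis using path_chain_rule[OF A chart_atlas_std \<Psi> S(1) diff t] \<kappa> by simp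
  qed
  have "continuous_on UNIV \<Psi>"
    unfolding continuous_on_open_vimage[OF open_UNIV] using smooth_map_onD(3)[OF \<Psi>] by (simp add: vimage_def)
  then have "continuous_on {0..1} (\<lambda>s. \<Psi> (\<gamma> s))"
    using S(1) by (auto simp: path_def intro: continuous_on_compose2)
  then have "((\<lambda>t. \<kappa> ((\<pi> \<circ> \<gamma>) t) (velocity B (\<pi> \<circ> \<gamma>) t)) has_integral \<Psi> (\<gamma> 1) - \<Psi> (\<gamma> 0)) {0..1}"
    using fundamental_theorem_of_calculus_interior_strong[OF S(2) zero_le_one d] by simp
  then show ?thesis unfolding form_integral_def by (rule integral_unique)
qed

section \<open>The induced form on the quotient\<close>

text \<open>With a smooth local inverse \<open>s\<close> of the covering map, the form is locally
  the differential of \<open>F \<circ> s\<close>, so smoothness and closedness follow from those of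
  exact forms.\<close>

lemma closed_form_local_diffeo:
  fixes A :: "('u::topological_space, real^'n::finite) chart set" and B :: "('m::topological_space, real^'n) chart set"
  assumes A: "chart_atlas euclidean A" and B: "chart_atlas euclidean B"
    and \<pi>: "smooth_map_on euclidean A euclidean B UNIV \<pi>" and bij: "\<And>p. bij (tangent_map A B \<pi> p)" and surj: "surj \<pi>"
    and F: "smooth_map_on euclidean A euclidean std_atlas UNIV F"
    and \<theta>: "\<And>p v. \<theta> (\<pi> p) (tangent_map A B \<pi> p v) = tangent_map A std_atlas F p v"
  shows "closed_form B \<theta>"
proof -
  have local: "\<exists>M h. open M \<and> m \<in> M \<and> smooth_map_on euclidean B euclidean std_atlas M h \<and> (\<forall>m'\<in>M. \<forall>u. \<theta> m' u = tangent_map B std_atlas h m' u)" for m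
  proof -
    obtain p where p: "m = \<pi> p" using surj by (metis surjD)
    obtain N M s where *: "open N" "p \<in> N" "open M" "\<pi> ` N \<subseteq> M" "\<And>m. m \<in> M \<Longrightarrow> s m \<in> N \<and> \<pi> (s m) = m"
      "smooth_map_on euclidean B euclidean A M s"
      using local_diffeo_inverse[OF A B \<pi> bij, of p] by metis
    have "smooth_map_on euclidean B euclidean std_atlas M (\<lambda>m. F (s m))"
      by (rule smooth_map_on_compose[OF B A chart_atlas_std *(6) F]) simp
    moreover have "\<theta> m' u = tangent_map B std_atlas (\<lambda>m. F (s m)) m' u" if m': "m' \<in> M" for m' u
    proof -
      have "tangent_map B B (\<lambda>m. \<pi> (s m)) m' u = tangent_map A B \<pi> (s m') (tangent_map B A s m' u)"
        by (rule tangent_map_compose[OF B A B *(6) \<pi> m']) simp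
      moreover have "tangent_map B B (\<lambda>m. \<pi> (s m)) m' = tangent_map B B (\<lambda>m. m) m'"
        by (rule tangent_map_cong[OF B, of M]) (use *(3,5) m' in auto)
      ultimately have "tangent_map A B \<pi> (s m') (tangent_map B A s m' u) = u" using tangent_map_id[OF B] by simp
      then have "\<theta> m' u = tangent_map A std_atlas F (s m') (tangent_map B A s m' u)"
        using \<theta>[of "s m'" "tangent_map B A s m' u"] *(5)[OF m'] by simp
      also have "\<dots> = tangent_map B std_atlas (\<lambda>m. F (s m)) m' u"
        by (rule tangent_map_compose[OF B A chart_atlas_std *(6) F m', symmetric]) simp
      finally show ?thesis .
    qed
    ultimately show ?thesis using *(2,3,4) p by (intro exI[of _ M] exI[of _ "\<lambda>m. F (s m)"]) blast
  qed
  have chart: "\<exists>T h. open T \<and> y \<in> T \<and> smooth_on T h \<and> (\<forall>y'\<in>T. \<forall>w. form_coord B c \<theta> y' w = frechet_derivative h (at y') w)"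
    if c: "c \<in> B" and y: "y \<in> snd c ` fst c" for c y
  proof -
    obtain M h where M: "open M" "chart_inv c y \<in> M" "smooth_map_on euclidean B euclidean std_atlas M h"
      "\<forall>m'\<in>M. \<forall>u. \<theta> m' u = tangent_map B std_atlas h m' u" using local[of "chart_inv c y"] by blast
    let ?T = "snd c ` (M \<inter> fst c)"
    have "open ?T" by (rule chart_atlasD(3)[OF B c]) (use M in simp)
    moreover have "y \<in> ?T" using M(2) chart_inv(2,3)[OF B c y] by (metis IntI imageI)
    moreover have "smooth_on ?T (\<lambda>y. h (chart_inv c y))" by (rule smooth_map_on_std_chart[OF M(3) c])
    moreover have "form_coord B c \<theta> y' w = frechet_derivative (\<lambda>y. h (chart_inv c y)) (at y') w" if y': "y' \<in> ?T" for y' w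
    proof -
      have "chart_inv c y' \<in> M" using y' chart_inv(1)[OF B c] by auto
      then show ?thesis unfolding form_coord_def
        using M(4) tangent_map_coord_field_std[OF B c M(3) y'] by simp
    qed
    ultimately show ?thesis by (intro exI[of _ ?T] exI[of _ "\<lambda>y. h (chart_inv c y)"]) blast
  qed
  have lin: "linear (\<theta> m)" for m
  proof -
    obtain M h where M: "m \<in> M" "smooth_map_on euclidean B euclidean std_atlas M h"
      "\<forall>m'\<in>M. \<forall>u. \<theta> m' u = tangent_map B std_atlas h m' u" using local[of m] by blast
    have "\<theta> m = tangent_map B std_atlas h m" using M by auto
    then show ?thesis using tangent_map_linear[OF B chart_atlas_std M(2,1)] by simp
  qed
  have sm: "smooth_on (snd c ` fst c) (\<lambda>y. form_coord B c \<theta> y w)" if c: "c \<in> B" for c w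
  proof (rule smooth_on_local)
    fix y assume "y \<in> snd c ` fst c"
    then obtain T h where T: "open T" "y \<in> T" "smooth_on T h" "\<forall>y'\<in>T. \<forall>w. form_coord B c \<theta> y' w = frechet_derivative h (at y') w"
      using chart[OF c] by blast
    have "smooth_on T (\<lambda>y. form_coord B c \<theta> y w)"
      by (rule smooth_on_cong[OF smooth_on_frechet[OF T(3)] T(1)]) (use T(4) in simp)
    then show "\<exists>T. open T \<and> y \<in> T \<and> smooth_on T (\<lambda>y. form_coord B c \<theta> y w)" using T by blast
  qed
  have "frechet_derivative (\<lambda>y. form_coord B c \<theta> y w) (at y) u = frechet_derivative (\<lambda>y. form_coord B c \<theta> y u) (at y) w"
    if c: "c \<in> B" "y \<in> snd c ` fst c" for c y u w
  proof -
    obtain T h where T: "open T" "y \<in> T" "smooth_on T h" "\<forall>y'\<in>T. \<forall>w. form_coord B c \<theta> y' w = frechet_derivative h (at y') w"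
      using chart[OF c] by blast
    have "frechet_derivative (\<lambda>y. form_coord B c \<theta> y w) (at y) = frechet_derivative (\<lambda>y. frechet_derivative h (at y) w) (at y)" for w
      by (rule frechet_derivative_cong_open[OF T(1,2)]) (use T(4) in simp)
    then show ?thesis using symmetric_second_derivative[OF T(3,1,2)] by simp
  qed
  then show ?thesis using lin sm by (simp add: closed_form_def smooth_form_def)
qed

text \<open>Surjectivity of the covering map and of its tangent maps gives uniqueness of the
  described form; the invariance hypothesis makes its definition by arbitrary preimages
  consistent.\<close>

lemma induced_form_eq:
  fixes A :: "('u, real^'n::finite) chart set" and B :: "('m, real^'n) chart set"
  assumes surj: "surj \<pi>" and bij: "\<And>p. bij (tangent_map A B \<pi> p)"
    and inv: "\<And>p q v w. \<pi> p = \<pi> q \<Longrightarrow> tangent_map A B \<pi> p v = tangent_map A B \<pi> q w \<Longrightarrow> \<eta> p v = \<eta> q w"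
  shows "induced_form A B \<pi> \<eta> (\<pi> p) (tangent_map A B \<pi> p v) = \<eta> p v"
proof -
  define \<theta> where "\<theta> m u = \<eta> (inv_into UNIV \<pi> m) (inv_into UNIV (tangent_map A B \<pi> (inv_into UNIV \<pi> m)) u)" for m u
  have "\<theta> (\<pi> p) (tangent_map A B \<pi> p v) = \<eta> p v" for p v
    unfolding \<theta>_def by (rule inv) (use surj bij in \<open>simp_all add: surj_f_inv_f bij_is_surj\<close>)
  then have ex: "\<forall>p v. \<theta> (\<pi> p) (tangent_map A B \<pi> p v) = \<eta> p v" by blast
  have "\<theta>' = \<theta>" if "\<forall>p v. \<theta>' (\<pi> p) (tangent_map A B \<pi> p v) = \<eta> p v" for \<theta>'
  proof (intro ext)
    fix m u
    obtain p where p: "m = \<pi> p" using surj by (metis surjD)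
    obtain v where v: "u = tangent_map A B \<pi> p v" using bij[of p] by (metis bij_is_surj surjD)
    show "\<theta>' m u = \<theta> m u" unfolding p v using that ex by simp
  qed
  then have "induced_form A B \<pi> \<eta> = \<theta>" unfolding induced_form_def by (intro the_equality ex)
  then show ?thesis using ex by simp
qed

section \<open>Holonomy\<close>

definition pair_map :: "('n::finite mink \<Rightarrow> 'n mink) \<Rightarrow> 'n mink \<times> 'n mink \<Rightarrow> 'n mink \<times> 'n mink" where
  "pair_map L z = (L (fst z), L (snd z))"

lemma pair_map:
  assumes L: "linear L" "\<And>x y. mink (L x) (L y) = mink x y"
  shows "npos (pair_map L z) = L (npos z)" "nneg (pair_map L z) = L (nneg z)" "linear (pair_map L)"
    "pair_map L (flow t z) = flow t (pair_map L z)" "z \<in> T1hyp \<Longrightarrow> pair_map L z \<in> T1hyp \<Longrightarrow> \<xi> \<in> gen_perp z \<Longrightarrow> pair_map L \<xi> \<in> gen_perp (pair_map L z)"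
proof -
  show 1: "npos (pair_map L z) = L (npos z)" "nneg (pair_map L z) = L (nneg z)" for z
    by (simp_all add: pair_map_def npos_def nneg_def linear_add[OF L(1)] linear_diff[OF L(1)])
  show "linear (pair_map L)"
    by (rule linearI) (simp_all add: pair_map_def linear_add[OF L(1)] linear_scale[OF L(1)])
  show "pair_map L (flow t z) = flow t (pair_map L z)"
    by (rule null_eqI) (simp_all add: 1 linear_scale[OF L(1)])
  show "z \<in> T1hyp \<Longrightarrow> pair_map L z \<in> T1hyp \<Longrightarrow> \<xi> \<in> gen_perp z \<Longrightarrow> pair_map L \<xi> \<in> gen_perp (pair_map L z)"
    by (simp add: gen_perp_iff perp_iff 1 L(2))
qed

lemma T1_act_isometry:
  fixes f :: "'n::finite mink \<Rightarrow> 'n mink"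
  assumes f: "f \<in> carrier isom_plus"
  obtains L where "linear L" "\<And>x y. mink (L x) (L y) = mink x y"
    "\<And>z. z \<in> T1hyp \<Longrightarrow> T1_act f z = pair_map L z \<and> pair_map L z \<in> T1hyp"
    "\<And>z. z \<in> T1hyp \<Longrightarrow> geod_act f (geod z) = geod (pair_map L z)"
proof -
  obtain L where L: "linear L" "\<And>x y. mink (L x) (L y) = mink x y" "\<And>x. x \<in> hyp \<Longrightarrow> f x = L x"
    using isometry_linear[OF f] by blast
  have act: "T1_act f z = pair_map L z \<and> pair_map L z \<in> T1hyp" if z: "z \<in> T1hyp" for z
  proof -
    have x: "fst z \<in> hyp" "mink (fst z) (snd z) = 0" "mink (snd z) (snd z) = 1" using z by (auto simp: T1hyp_def)
    have "f (fst z) \<in> hyp" using f x(1) by (auto simp: isom_plus_def Bij_def bij_betw_def)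
    then show ?thesis using L(3)[OF x(1)] hyp_diff_linear[OF L(1,3) x(1,2)] x
      by (simp add: T1_act_def pair_map_def T1hyp_def L(2))
  qed
  have "geod_act f (geod z) = geod (pair_map L z)" if z: "z \<in> T1hyp" for z
  proof -
    have "T1_act f (flow t z) = flow t (pair_map L z)" for t using act[of "flow t z"] z pair_map(4)[OF L(1,2)] by simp
    then show ?thesis by (simp add: geod_act_def geod_def image_image)
  qed
  with that L act show ?thesis by blast
qed

context riemannian_lagrangian
begin

context
  fixes \<alpha> :: "'u \<Rightarrow> 'u" and L :: "'n mink \<Rightarrow> 'n mink"
  assumes smooth_\<alpha>: "smooth_map_on euclidean A euclidean A UNIV \<alpha>"
    and inj_\<alpha>: "\<And>p. inj (tangent_map A A \<alpha> p)"
    and L: "linear L" "\<And>x y. mink (L x) (L y) = mink x y"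
    and L_T1: "\<And>z. z \<in> T1hyp \<Longrightarrow> pair_map L z \<in> T1hyp"
begin

lemma linear_dalpha: "linear (tangent_map A A \<alpha> p)"
  by (rule tangent_map_linear[OF atlas atlas smooth_\<alpha>]) simp

lemma smooth_pair_map: "smooth_map_on euclidean std_atlas euclidean std_atlas UNIV (pair_map L)"
  unfolding smooth_map_on_std_iff using smooth_on_linear[OF pair_map(3)[OF L] open_UNIV smooth_on_id] by simp

lemma tangent_pair_map:
  assumes \<zeta>: "flat_on A G UNIV \<zeta>"
  shows "smooth_map_on euclidean A euclidean std_atlas UNIV (\<lambda>p. pair_map L (\<zeta> p))"
    "tangent_map A std_atlas (\<lambda>p. pair_map L (\<zeta> p)) p v = pair_map L (tangent_map A std_atlas \<zeta> p v)"
proof -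
  note f = flat_onD(1)[OF \<zeta>]
  show "smooth_map_on euclidean A euclidean std_atlas UNIV (\<lambda>p. pair_map L (\<zeta> p))"
    by (rule smooth_map_on_compose[OF atlas chart_atlas_std chart_atlas_std f smooth_pair_map]) simp
  have "tangent_map A std_atlas (\<lambda>p. pair_map L (\<zeta> p)) p v = tangent_map std_atlas std_atlas (pair_map L) (\<zeta> p) (tangent_map A std_atlas \<zeta> p v)"
    by (rule tangent_map_compose[OF atlas chart_atlas_std chart_atlas_std f smooth_pair_map]) simp_all
  also have "tangent_map std_atlas std_atlas (pair_map L) (\<zeta> p) = pair_map L"
    unfolding tangent_map_std
    by (rule frechet_derivative_eqI) (use pair_map(3)[OF L] in \<open>simp add: linear_conv_bounded_linear bounded_linear_imp_has_derivative\<close>)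
  finally show "tangent_map A std_atlas (\<lambda>p. pair_map L (\<zeta> p)) p v = pair_map L (tangent_map A std_atlas \<zeta> p v)" .
qed

lemma tangent_alpha:
  assumes \<zeta>: "flat_on A G UNIV \<zeta>"
  shows "smooth_map_on euclidean A euclidean std_atlas UNIV (\<lambda>p. \<zeta> (\<alpha> p))"
    "tangent_map A std_atlas (\<lambda>p. \<zeta> (\<alpha> p)) p v = tangent_map A std_atlas \<zeta> (\<alpha> p) (tangent_map A A \<alpha> p v)"
  by (rule smooth_map_on_compose[OF atlas atlas chart_atlas_std smooth_\<alpha> flat_onD(1)[OF \<zeta>]], simp)
    (rule tangent_map_compose[OF atlas atlas chart_atlas_std smooth_\<alpha> flat_onD(1)[OF \<zeta>]], simp_all)

text \<open>An isometry takes the flat section to a flat section over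
  \<open>G \<circ> \<alpha>\<close>, and so does precomposition with \<open>\<alpha>\<close>.
  Uniqueness up to a constant flow time, on a connected space, compares them.\<close>

lemma equivariant_flow:
  assumes \<zeta>: "flat_on A G UNIV \<zeta>" and con: "connected (UNIV :: 'u set)"
    and equiv: "\<And>p. geod (pair_map L (\<zeta> p)) = G (\<alpha> p)"
  obtains t where "\<And>p. pair_map L (\<zeta> p) = flow t (\<zeta> (\<alpha> p))"
proof -
  interpret L\<alpha>: lagrangian_map A "\<lambda>p. G (\<alpha> p)"
  proof
    show "smooth_manifold euclidean A" by (rule manifold)
    show "smooth_map_on euclidean A geod_top geod_atlas UNIV (\<lambda>p. G (\<alpha> p))"
      by (rule smooth_map_on_compose[OF atlas atlas chart_atlas_geod smooth_\<alpha> smooth_G]) simp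
    have "tangent_map A geod_atlas (\<lambda>p. G (\<alpha> p)) p v = tangent_map A geod_atlas G (\<alpha> p) (tangent_map A A \<alpha> p v)" for p v
      by (rule tangent_map_compose[OF atlas atlas chart_atlas_geod smooth_\<alpha> smooth_G]) simp_all
    then show "lagrangian A (\<lambda>p. G (\<alpha> p))" using lagrangian_G unfolding lagrangian_def by simp
  qed
  note f = flat_onD[OF \<zeta>]
  have 1: "flat_on A (\<lambda>p. G (\<alpha> p)) UNIV (\<lambda>p. \<zeta> (\<alpha> p))"
    unfolding flat_on_def using tangent_alpha[OF \<zeta>] f(2-4) by simp
  have 2: "flat_on A (\<lambda>p. G (\<alpha> p)) UNIV (\<lambda>p. pair_map L (\<zeta> p))"
    unfolding flat_on_def using tangent_pair_map[OF \<zeta>] f(2,4) equiv L_T1 pair_map(5)[OF L] by simp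
  show ?thesis using L\<alpha>.flat_unique[OF con 1 2] that by blast
qed

text \<open>The three effects on the potential are combined: the isometry leaves the Gram matrices
  unchanged, the tangent map of \<open>\<alpha>\<close> is absorbed by
  \<open>potential_compose\<close>, and the flow lowers the potential by \<open>t\<close>.\<close>

lemma potential_shift:
  assumes \<zeta>: "flat_on A G UNIV \<zeta>" and t: "\<And>p. pair_map L (\<zeta> p) = flow t (\<zeta> (\<alpha> p))"
  shows "maslov_potential \<zeta> (\<alpha> p) = maslov_potential \<zeta> p + t"
proof -
  have "smooth_map_on euclidean std_atlas euclidean std_atlas UNIV (flow t)"
    unfolding smooth_map_on_std_iff using smooth_on_linear[OF linear_flow open_UNIV smooth_on_id] by simp
  then have "tangent_map A std_atlas (\<lambda>p. flow t (\<zeta> (\<alpha> p))) p v = tangent_map std_atlas std_atlas (flow t) (\<zeta> (\<alpha> p)) (tangent_map A std_atlas (\<lambda>p. \<zeta> (\<alpha> p)) p v)" for v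
    by (rule tangent_map_compose[OF atlas chart_atlas_std chart_atlas_std tangent_alpha(1)[OF \<zeta>]]) simp_all
  moreover have "tangent_map std_atlas std_atlas (flow t) z = flow t" for z :: "'n mink \<times> 'n mink"
    unfolding tangent_map_std
    by (rule frechet_derivative_eqI[OF bounded_linear_imp_has_derivative[OF linear_flow[unfolded linear_conv_bounded_linear]]])
  ultimately have "pair_map L (tangent_map A std_atlas \<zeta> p v) = flow t (tangent_map A std_atlas \<zeta> (\<alpha> p) (tangent_map A A \<alpha> p v))" for v
    using tangent_pair_map(2)[OF \<zeta>, of p v] tangent_alpha(2)[OF \<zeta>, of p v] by (simp add: t)
  then have e: "(\<lambda>v. pair_map L (tangent_map A std_atlas \<zeta> p v)) = (\<lambda>v. flow t (tangent_map A std_atlas \<zeta> (\<alpha> p) (tangent_map A A \<alpha> p v)))"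
    by auto
  have "potential (tangent_map A std_atlas \<zeta> p) = potential (\<lambda>v. pair_map L (tangent_map A std_atlas \<zeta> p v))"
    by (simp add: potential_def gram_neg_def gram_pos_def pair_map[OF L] L(2))
  also have "\<dots> = potential (\<lambda>v. flow t (tangent_map A std_atlas \<zeta> (\<alpha> p) v))"
    unfolding e by (rule potential_compose[OF immersive_flow[OF immersive_dzeta[OF \<zeta>]] linear_dalpha inj_\<alpha>])
  also have "\<dots> = potential (tangent_map A std_atlas \<zeta> (\<alpha> p)) - t"
    by (rule potential_flow[OF immersive_dzeta[OF \<zeta>]])
  finally show ?thesis by (simp add: maslov_potential_def[OF \<zeta>])
qed

end

end

section \<open>Sums and constants, and the main result\<close>

lemma tangent_map_sum:
  fixes f g :: "'a \<Rightarrow> 'b::euclidean_space"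
  assumes A: "chart_atlas X A" and f: "smooth_map_on X A euclidean std_atlas W f" and g: "smooth_map_on X A euclidean std_atlas W g"
  shows "smooth_map_on X A euclidean std_atlas W (\<lambda>p. f p + g p)"
    "p \<in> W \<Longrightarrow> tangent_map A std_atlas (\<lambda>p. f p + g p) p v = tangent_map A std_atlas f p v + tangent_map A std_atlas g p v"
proof -
  have W: "openin X W" by (rule smooth_map_onD(1)[OF f])
  show "smooth_map_on X A euclidean std_atlas W (\<lambda>p. f p + g p)"
  proof (rule smooth_map_on_to_std[OF A W])
    fix p assume p: "p \<in> W"
    then have "p \<in> topspace X" using W openin_subset by blast
    note c = chart_at[OF A this]
    have "smooth_on (snd (chart_at A p) ` (W \<inter> fst (chart_at A p))) (\<lambda>y. f (chart_inv (chart_at A p) y) + g (chart_inv (chart_at A p) y))"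
      by (intro smooth_on_add smooth_map_on_std_chart[OF f c(1)] smooth_map_on_std_chart[OF g c(1)] chart_atlasD(3)[OF A c(1) W])
    then show "\<exists>c\<in>A. \<exists>T. open T \<and> p \<in> fst c \<and> snd c p \<in> T \<and> T \<subseteq> snd c ` (W \<inter> fst c) \<and>
       smooth_on T (\<lambda>y. f (chart_inv c y) + g (chart_inv c y))"
      using c p chart_atlasD(3)[OF A c(1) W] by blast
  qed
  assume p: "p \<in> W"
  have "((\<lambda>y. f (chart_inv (chart_at A p) y) + g (chart_inv (chart_at A p) y)) has_derivative
      (\<lambda>v. tangent_map A std_atlas f p v + tangent_map A std_atlas g p v)) (at (snd (chart_at A p) p))"
    using tangent_map_has_derivative[OF A chart_atlas_std f p] tangent_map_has_derivative[OF A chart_atlas_std g p]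
    by (intro has_derivative_add) (simp_all add: o_def)
  from frechet_derivative_eqI[OF this]
  show "tangent_map A std_atlas (\<lambda>p. f p + g p) p v = tangent_map A std_atlas f p v + tangent_map A std_atlas g p v"
    by (simp add: tangent_map_def o_def)
qed

lemma smooth_map_on_std_const:
  fixes c :: "'b::euclidean_space"
  assumes A: "chart_atlas X A"
  shows "smooth_map_on X A euclidean std_atlas (topspace X) (\<lambda>_. c)"
proof (rule smooth_map_on_to_std[OF A openin_topspace])
  fix p assume p: "p \<in> topspace X"
  show "\<exists>c'\<in>A. \<exists>T. open T \<and> p \<in> fst c' \<and> snd c' p \<in> T \<and> T \<subseteq> snd c' ` (topspace X \<inter> fst c') \<and> smooth_on T (\<lambda>y. c)"
    using chart_at[OF A p] chart_atlasD(3)[OF A chart_at(1)[OF A p] openin_topspace] p smooth_on_const by blast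
qed

lemma tangent_map_std_const [simp]: "tangent_map A std_atlas (\<lambda>_. c) p v = 0"
  by (simp add: tangent_map_def o_def frechet_derivative_const)

theorem theorem6p12:
  fixes AM :: "('m::{t2_space,second_countable_topology}, real^'n::finite) chart set"
    and AU :: "('u::{t2_space,second_countable_topology}, real^'n) chart set"
    and \<pi> :: "'u \<Rightarrow> 'm"
    and \<rho> :: "('u \<Rightarrow> 'u) \<Rightarrow> 'n mink \<Rightarrow> 'n mink"
    and G :: "'u \<Rightarrow> 'n geodesic"
  assumes "smooth_manifold euclidean AM" and "connected (UNIV :: 'm set)"
    and "smooth_manifold euclidean AU" and "universal_covering AU AM \<pi>"
    and "\<rho> \<in> hom (deck_group \<pi>) isom_plus"
    and "smooth_embedding euclidean AU geod_top geod_atlas G"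
    and "equivariant \<pi> \<rho> G" and "lagrangian AU G" and "riemannian AU G"
  shows "\<forall>\<alpha>\<in>carrier (deck_group \<pi>). \<forall>\<gamma>.
           piecewise_C1_path AU \<gamma> \<and> pathfinish \<gamma> = \<alpha> (pathstart \<gamma>) \<longrightarrow>
             holonomy AU \<rho> G \<alpha> = class_integral AM (\<pi> \<circ> \<gamma>) (maslov_class AU AM \<pi> G)"
proof -
  note A = chart_atlas_manifold[OF assms(3)] and B = chart_atlas_manifold[OF assms(1)]
  have sc: "simply_connected (UNIV :: 'u set)" and cov: "covering_space UNIV \<pi> UNIV"
    and sm: "smooth_map euclidean AU euclidean AM \<pi>" and bij: "bij (tangent_map AU AM \<pi> p)" for p
    using assms(4) by (auto simp: universal_covering_def)
  note con = simply_connected_connected[OF sc]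
  have \<pi>: "smooth_map_on euclidean AU euclidean AM UNIV \<pi>" using smooth_map_on_if_smooth_map[OF sm A] by simp
  have surj: "surj \<pi>" using covering_space_imp_surjective[OF cov] by simp
  have "smooth_map euclidean AU geod_top geod_atlas G" using assms(6) by (simp add: smooth_embedding_def)
  from smooth_map_on_if_smooth_map[OF this A]
  interpret riemannian_lagrangian AU G by unfold_locales (use assms(3,8,9) in simp_all)
  obtain \<zeta> where \<zeta>: "flat_on AU G UNIV \<zeta>" using flat_exists[OF sc] .
  note flat = flat_onD[OF \<zeta>]
  define F where "F = maslov_potential \<zeta>"
  have F: "smooth_map_on euclidean AU euclidean std_atlas UNIV F"
    unfolding F_def by (rule smooth_maslov_potential[OF \<zeta>])
  have dF: "maslov_form AU G p v = tangent_map AU std_atlas F p v" for p v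
    unfolding F_def by (rule maslov_form_exact[OF \<zeta>])
  have deck: "smooth_map_on euclidean AU euclidean AU UNIV \<alpha> \<and> (\<forall>p. \<pi> (\<alpha> p) = \<pi> p) \<and>
      (\<forall>p v. tangent_map AU AM \<pi> (\<alpha> p) (tangent_map AU AU \<alpha> p v) = tangent_map AU AM \<pi> p v)"
    if \<alpha>: "\<alpha> \<in> carrier (deck_group \<pi>)" for \<alpha>
  proof -
    have 1: "homeomorphic_map euclidean euclidean \<alpha>" "\<pi> \<circ> \<alpha> = \<pi>" using \<alpha> by (auto simp: deck_group_def)
    then have eq: "\<pi> (\<alpha> p) = \<pi> p" for p by (metis comp_apply)
    have "continuous_on UNIV \<alpha>" using homeomorphic_imp_continuous_map[OF 1(1)] by simp
    then have 2: "smooth_map_on euclidean AU euclidean AU UNIV \<alpha>" by (rule deck_smooth[OF A B \<pi> bij _ eq])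
    have "tangent_map AU AM (\<lambda>p. \<pi> (\<alpha> p)) p v = tangent_map AU AM \<pi> (\<alpha> p) (tangent_map AU AU \<alpha> p v)" for p v
      by (rule tangent_map_compose[OF A A B 2 \<pi>]) simp_all
    then show ?thesis using 2 eq by simp
  qed
  \<comment> \<open>One number governs both sides: \<open>t\<close> is the increment of the
    primitive under \<open>\<alpha>\<close> and also the translation by which
    \<open>\<alpha>\<close> acts on the trivialized bundle.\<close>
  have shift: "\<exists>t. (\<forall>p. F (\<alpha> p) = F p + t) \<and> (\<forall>p s. T1_act (\<rho> \<alpha>) (flow s (\<zeta> p)) = flow (t + s) (\<zeta> (\<alpha> p)))"
    if \<alpha>: "\<alpha> \<in> carrier (deck_group \<pi>)" for \<alpha>
  proof -
    have \<rho>: "\<rho> \<alpha> \<in> carrier isom_plus" using assms(5) \<alpha> by (rule hom_in_carrier)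
    obtain L where L: "linear L" "\<And>x y. mink (L x) (L y) = mink x y"
      "\<And>z. z \<in> T1hyp \<Longrightarrow> T1_act (\<rho> \<alpha>) z = pair_map L z \<and> pair_map L z \<in> T1hyp"
      "\<And>z. z \<in> T1hyp \<Longrightarrow> geod_act (\<rho> \<alpha>) (geod z) = geod (pair_map L z)"
      using T1_act_isometry[OF \<rho>] by metis
    have LT: "\<And>z. z \<in> T1hyp \<Longrightarrow> pair_map L z \<in> T1hyp" using L(3) by blast
    have s: "smooth_map_on euclidean AU euclidean AU UNIV \<alpha>" using deck[OF \<alpha>] by blast
    have "inj (tangent_map AU AU \<alpha> p)" for p
    proof (rule injI)
      fix v w assume "tangent_map AU AU \<alpha> p v = tangent_map AU AU \<alpha> p w"
      then have "tangent_map AU AM \<pi> p v = tangent_map AU AM \<pi> p w" using deck[OF \<alpha>] by metis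
      then show "v = w" using bij[of p] by (simp add: bij_def inj_eq)
    qed
    note i = this
    have "G (\<alpha> p) = geod_act (\<rho> \<alpha>) (G p)" for p
      using assms(7) \<alpha> unfolding equivariant_def by (metis comp_apply)
    then have "geod (pair_map L (\<zeta> p)) = G (\<alpha> p)" for p
      using L(4)[of "\<zeta> p"] flat(2,3)[of p] by simp
    then obtain t where t: "\<And>p. pair_map L (\<zeta> p) = flow t (\<zeta> (\<alpha> p))"
      using equivariant_flow[OF s i L(1,2) LT \<zeta> con] by blast
    have "F (\<alpha> p) = F p + t" for p
      unfolding F_def by (rule potential_shift[OF s i L(1,2) LT \<zeta> t])
    moreover have "T1_act (\<rho> \<alpha>) (flow s (\<zeta> p)) = flow (t + s) (\<zeta> (\<alpha> p))" for p s
    proof -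
      have "T1_act (\<rho> \<alpha>) (flow s (\<zeta> p)) = flow s (pair_map L (\<zeta> p))"
        using L(3)[of "flow s (\<zeta> p)"] flat(2)[of p] pair_map(4)[OF L(1,2)] by simp
      then show ?thesis by (simp add: t flow_flow add.commute)
    qed
    ultimately show ?thesis by blast
  qed
  define \<theta> where "\<theta> = induced_form AU AM \<pi> (maslov_form AU G)"
  have \<theta>: "\<theta> (\<pi> p) (tangent_map AU AM \<pi> p v) = tangent_map AU std_atlas F p v" for p v
    unfolding \<theta>_def dF[symmetric]
  proof (rule induced_form_eq[OF surj bij])
    fix p q v w assume pq: "\<pi> p = \<pi> q" and vw: "tangent_map AU AM \<pi> p v = tangent_map AU AM \<pi> q w"
    \<comment> \<open>Points of one fibre are related by a deck transformation, under which
      \<open>F\<close> changes by a constant only. Hence its differential has the invariance that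
      lets it descend.\<close>
    obtain \<beta> where \<beta>: "\<beta> \<in> carrier (deck_group \<pi>)" "\<beta> p = q"
      using deck_group_transitive[OF sc cov manifold_locally_path_connected[OF assms(3)] pq] by blast
    note s = deck[OF \<beta>(1)]
    have "tangent_map AU AM \<pi> q (tangent_map AU AU \<beta> p v) = tangent_map AU AM \<pi> q w"
      using s \<beta>(2) vw by metis
    then have w: "w = tangent_map AU AU \<beta> p v" using bij[of q] by (simp add: bij_def inj_eq)
    obtain t where t: "\<And>p. F (\<beta> p) = F p + t" using shift[OF \<beta>(1)] by blast
    have "tangent_map AU std_atlas (\<lambda>p. F p + t) p v = tangent_map AU std_atlas F (\<beta> p) (tangent_map AU AU \<beta> p v)"
      unfolding t[symmetric] by (rule tangent_map_compose[OF A A chart_atlas_std conjunct1[OF s] F]) simp_all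
    moreover have "tangent_map AU std_atlas (\<lambda>p. F p + t) p v = tangent_map AU std_atlas F p v + tangent_map AU std_atlas (\<lambda>_. t) p v"
      by (rule tangent_map_sum[OF A F]) (use smooth_map_on_std_const[OF A] in simp_all)
    moreover have "tangent_map AU std_atlas (\<lambda>_. t) p v = 0" by (rule tangent_map_std_const)
    ultimately show "maslov_form AU G p v = maslov_form AU G q w" unfolding dF w \<beta>(2) by simp
  qed
  have closed: "closed_form AM \<theta>" by (rule closed_form_local_diffeo[OF A B \<pi> bij surj F \<theta>])
  have K: "maslov_class AU AM \<pi> G = cohomologous AM `` {\<theta>}" by (simp add: maslov_class_def de_Rham_class_def \<theta>_def)
  \<comment> \<open>The zero function relates the form to itself, so the class is nonempty and the
    common value of its integrals is unique.\<close>
  have "(\<theta>, \<theta>) \<in> cohomologous AM"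
    unfolding cohomologous_def using closed smooth_map_if_smooth_map_on[OF smooth_map_on_std_const[OF B, of 0] B] tangent_map_std_const[of AM 0]
    by auto
  then have \<theta>K: "\<theta> \<in> maslov_class AU AM \<pi> G" by (simp add: K)
  show ?thesis
  proof (intro ballI allI impI)
    fix \<alpha> \<gamma> assume \<alpha>: "\<alpha> \<in> carrier (deck_group \<pi>)" and \<gamma>: "piecewise_C1_path AU \<gamma> \<and> pathfinish \<gamma> = \<alpha> (pathstart \<gamma>)"
    obtain t where t: "\<And>p. F (\<alpha> p) = F p + t" "\<And>p s. T1_act (\<rho> \<alpha>) (flow s (\<zeta> p)) = flow (t + s) (\<zeta> (\<alpha> p))"
      using shift[OF \<alpha>] by blast
    have \<gamma>': "piecewise_C1_path AU \<gamma>" "\<gamma> 1 = \<alpha> (\<gamma> 0)" using \<gamma> by (auto simp: pathfinish_def pathstart_def)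
    \<comment> \<open>Another representative adds the differential of some \<open>f\<close> on the
      base. Then \<open>F + f \<circ> \<pi>\<close> is a primitive upstairs, with the same
      increment, since \<open>\<pi> \<circ> \<alpha> = \<pi>\<close>.\<close>
    have int: "form_integral AM (\<pi> \<circ> \<gamma>) \<kappa> = t" if \<kappa>: "\<kappa> \<in> maslov_class AU AM \<pi> G" for \<kappa>
    proof -
      obtain f where f: "smooth_map euclidean AM euclidean std_atlas f" "\<And>p v. \<kappa> p v - \<theta> p v = tangent_map AM std_atlas f p v"
        using \<kappa> unfolding K cohomologous_def by blast
      have f': "smooth_map_on euclidean AM euclidean std_atlas UNIV f" using smooth_map_on_if_smooth_map[OF f(1) B] by simp
      have f\<pi>: "smooth_map_on euclidean AU euclidean std_atlas UNIV (\<lambda>p. f (\<pi> p))"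
        by (rule smooth_map_on_compose[OF A B chart_atlas_std \<pi> f']) simp
      have "tangent_map AU std_atlas (\<lambda>p. F p + f (\<pi> p)) p v = tangent_map AU std_atlas F p v + tangent_map AM std_atlas f (\<pi> p) (tangent_map AU AM \<pi> p v)" for p v
        using tangent_map_sum(2)[OF A F f\<pi> UNIV_I] tangent_map_compose[OF A B chart_atlas_std \<pi> f' UNIV_I UNIV_I] by metis
      then have "\<kappa> (\<pi> p) (tangent_map AU AM \<pi> p v) = tangent_map AU std_atlas (\<lambda>p. F p + f (\<pi> p)) p v" for p v
        using f(2)[of "\<pi> p" "tangent_map AU AM \<pi> p v"] \<theta>[of p v] by simp
      from form_integral_exact[OF A B \<pi> tangent_map_sum(1)[OF A F f\<pi>] \<gamma>'(1) this]
      show ?thesis using t(1) deck[OF \<alpha>] \<gamma>'(2) by simp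
    qed
    have "class_integral AM (\<pi> \<circ> \<gamma>) (maslov_class AU AM \<pi> G) = t"
      unfolding class_integral_def by (rule the_equality) (use int in blast, metis int[OF \<theta>K] \<theta>K)
    moreover have "holonomy AU \<rho> G \<alpha> = t" unfolding holonomy_def
    proof (rule the_equality)
      show "\<exists>\<zeta>. flat_section AU G \<zeta> \<and> (\<forall>p s. bundle_act \<rho> \<alpha> (bundle_triv \<zeta> (p, s)) = bundle_triv \<zeta> (\<alpha> p, t + s))"
        using \<zeta> t(2) by (intro exI[of _ \<zeta>]) (simp add: flat_section_iff bundle_act_def bundle_triv_def)
    next
      fix h assume "\<exists>\<zeta>. flat_section AU G \<zeta> \<and> (\<forall>p s. bundle_act \<rho> \<alpha> (bundle_triv \<zeta> (p, s)) = bundle_triv \<zeta> (\<alpha> p, h + s))"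
      then obtain \<zeta>' where \<zeta>': "flat_on AU G UNIV \<zeta>'"
        and act: "\<And>p s. bundle_act \<rho> \<alpha> (bundle_triv \<zeta>' (p, s)) = bundle_triv \<zeta>' (\<alpha> p, h + s)"
        unfolding flat_section_iff by blast
      \<comment> \<open>Any other flat section is a constant flow translate of the given one; the
        translations commute, so it yields the same holonomy.\<close>
      obtain k where k: "\<And>q. \<zeta>' q = flow k (\<zeta> q)" using flat_unique[OF con \<zeta> \<zeta>'] by blast
      have "T1_act (\<rho> \<alpha>) (\<zeta>' (\<gamma> 0)) = flow h (\<zeta>' (\<alpha> (\<gamma> 0)))"
        using act[of "\<gamma> 0" 0] by (simp add: bundle_act_def bundle_triv_def)
      then have "flow (t + k) (\<zeta> (\<alpha> (\<gamma> 0))) = flow (h + k) (\<zeta> (\<alpha> (\<gamma> 0)))" by (simp only: k t(2) flow_flow)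
      then show "h = t" using flow_inject[OF flat(2)[OF UNIV_I]] by simp
    qed
    ultimately show "holonomy AU \<rho> G \<alpha> = class_integral AM (\<pi> \<circ> \<gamma>) (maslov_class AU AM \<pi> G)" by simp
  qed
qed

end
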